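(* Let $R$ be a standard graded polynomial ring in $n\ge 2$ variables over a field $k$, with maximal graded ideal $\mathfrak m$. Let $M$ be a finitely generated graded $R$-module of dimension $d\ge 1$ with $\operatorname{indeg}(M)=0$. Let $l_1,\dots,l_d$ be a filter regular sequence of linear forms on $M$, let $B=\dim_k\big(M/(l_1,\dots,l_d)M\big)$ and $\overline{M}=M/H^0_{\mathfrak m}(M)$. Then for all $0\le i\le d-1$, $$|e_i(M)|\le B\cdot\big(\operatorname{reg}(\overline{M})+1\big)^i,$$ where $e_0(M),\dots,e_{d-1}(M)$ are the Hilbert coefficients of $M$.
   Context: $\operatorname{indeg}(M)=\min\{t: M_t\neq 0\}$; $\operatorname{reg}(M)=\max\{i+t : H^i_{\mathfrak m}(M)_t\neq 0\}$ is the Castelnuovo-Mumford regularity. A sequence $l_1,\dots,l_d$ of linear forms is filter regular on $M$ if for each $j=1,\dots,d$ the kernel of multiplication by $l_j$ on $M/(l_1,\dots,l_{j-1})M$ has finite length. The Hilbert coefficients $e_i(M)$ are the integers defined by writing the Hilbert polynomial of $M$ as $$P_M(t)=e_0(M)\binom{t+d-1}{d-1}-e_1(M)\binom{t+d-2}{d-2}+\cdots+(-1)^{d-1}e_{d-1}(M),$$ the binomials being read as polynomials in $t$. *)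

theory Defs
  imports
    "HOL-Algebra.Module"
    "HOL-Algebra.Ideal_Product"
    "HOL-Library.Poly_Mapping"
    "HOL-Library.Extended_Nat"
    "HOL-Computational_Algebra.Polynomial"
    "Jordan_Normal_Form.VS_Connect"
begin

section \<open>The standard graded polynomial ring\<close>

type_synonym 'k mpoly = "(nat \<Rightarrow>\<^sub>0 nat) \<Rightarrow>\<^sub>0 'k"

definition var :: "nat \<Rightarrow> 'k::field mpoly"
  where "var i = Poly_Mapping.single (Poly_Mapping.single i 1) 1"

definition const_poly :: "'k \<Rightarrow> 'k::field mpoly"
  where "const_poly c = Poly_Mapping.single 0 c"

text \<open>The variables of \<open>poly_ring n\<close> are \<open>var 0, \<dots>, var (n - 1)\<close>.\<close>

definition poly_ring :: "nat \<Rightarrow> ('k::field mpoly) ring"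
  where "poly_ring n =
    \<lparr> carrier = {p. \<forall>u \<in> Poly_Mapping.keys p. Poly_Mapping.keys u \<subseteq> {..<n}},
      mult = (*), one = 1, zero = 0, add = (+) \<rparr>"

definition mon_deg :: "(nat \<Rightarrow>\<^sub>0 nat) \<Rightarrow> nat"
  where "mon_deg u = (\<Sum>i \<in> Poly_Mapping.keys u. Poly_Mapping.lookup u i)"

definition homog :: "nat \<Rightarrow> nat \<Rightarrow> 'k::field mpoly set"
  where "homog n j = {p \<in> carrier (poly_ring n). \<forall>u \<in> Poly_Mapping.keys p. mon_deg u = j}"

definition irrelevant_ideal :: "nat \<Rightarrow> 'k::field mpoly set"
  where "irrelevant_ideal n = genideal (poly_ring n) (var ` {..<n})"


section \<open>Modules: generation, length, dimension\<close>

definition fin_gen :: "('a, 'c) ring_scheme \<Rightarrow> ('a, 'm, 'e) module_scheme \<Rightarrow> bool"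
  where "fin_gen R M \<longleftrightarrow>
    (\<exists>A. finite A \<and> A \<subseteq> carrier M \<and> module.span R M A = carrier M)"

definition ideal_smult ::
    "('a, 'c) ring_scheme \<Rightarrow> 'a set \<Rightarrow> ('a, 'm, 'e) module_scheme \<Rightarrow> 'm set"
  where "ideal_smult R L M =
    module.span R M {a \<odot>\<^bsub>M\<^esub> x | a x. a \<in> L \<and> x \<in> carrier M}"

text \<open>Both suprema below run over strictly increasing chains with \<open>r\<close> proper inclusions.\<close>

definition module_length :: "('a, 'c) ring_scheme \<Rightarrow> ('a, 'm, 'e) module_scheme \<Rightarrow> enat"
  where "module_length R M =
    Sup {enat r | r. \<exists>C :: nat \<Rightarrow> 'm set.
      (\<forall>i\<le>r. Module.submodule (C i) R M) \<and> (\<forall>i<r. C i \<subset> C (Suc i))}"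

definition finite_length :: "('a, 'c) ring_scheme \<Rightarrow> ('a, 'm, 'e) module_scheme \<Rightarrow> bool"
  where "finite_length R M \<longleftrightarrow> module_length R M \<noteq> \<infinity>"

definition annihilator :: "('a, 'c) ring_scheme \<Rightarrow> ('a, 'm, 'e) module_scheme \<Rightarrow> 'a set"
  where "annihilator R M = {a \<in> carrier R. \<forall>x \<in> carrier M. a \<odot>\<^bsub>M\<^esub> x = \<zero>\<^bsub>M\<^esub>}"

text \<open>Krull dimension of \<open>R / Ann M\<close>; the zero module gets the value \<open>0\<close>.\<close>

definition module_dim :: "('a, 'c) ring_scheme \<Rightarrow> ('a, 'm, 'e) module_scheme \<Rightarrow> enat"
  where "module_dim R M =
    Sup {enat r | r. \<exists>P :: nat \<Rightarrow> 'a set.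
      (\<forall>i\<le>r. primeideal (P i) R \<and> annihilator R M \<subseteq> P i) \<and> (\<forall>i<r. P i \<subset> P (Suc i))}"


section \<open>Graded modules over the polynomial ring\<close>

record ('a, 'm) graded_module = "('a, 'm) module" +
  grade :: "int \<Rightarrow> 'm set"

locale graded_module = module "poly_ring n" M
  for n :: nat and M :: "('k::field mpoly, 'm) graded_module" +
  assumes grade_subgroup: "subgroup (grade M t) (add_monoid M)"
    and grade_smult: "\<lbrakk>p \<in> homog n j; x \<in> grade M t\<rbrakk> \<Longrightarrow> p \<odot>\<^bsub>M\<^esub> x \<in> grade M (t + int j)"
    and grade_direct_sum: "x \<in> carrier M \<Longrightarrow>
      \<exists>!f. (\<forall>t. f t \<in> grade M t) \<and> finite {t. f t \<noteq> \<zero>\<^bsub>M\<^esub>} \<and>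
           x = finsum M f {t. f t \<noteq> \<zero>\<^bsub>M\<^esub>}"

text \<open>The ring-multiplication fields of a module record carry no meaning and are left undefined
  in the constructions below.\<close>

definition quot_module ::
    "('a, 'm) graded_module \<Rightarrow> 'm set \<Rightarrow> ('a, 'm set) graded_module"
  where "quot_module M N =
    \<lparr> carrier = a_rcosets\<^bsub>M\<^esub> N, mult = undefined, one = undefined,
      zero = N, add = set_add M,
      smult = (\<lambda>r X. \<Union>x \<in> X. N +>\<^bsub>M\<^esub> (r \<odot>\<^bsub>M\<^esub> x)),
      grade = (\<lambda>t. (\<lambda>x. N +>\<^bsub>M\<^esub> x) ` grade M t) \<rparr>"

definition restrict_scalars :: "('k::field mpoly, 'm) graded_module \<Rightarrow> ('k, 'm) module"
  where "restrict_scalars M =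
    \<lparr> carrier = carrier M, mult = mult M, one = one M, zero = zero M, add = add M,
      smult = (\<lambda>c x. const_poly c \<odot>\<^bsub>M\<^esub> x) \<rparr>"

definition k_dim :: "('k::field mpoly, 'm) graded_module \<Rightarrow> nat"
  where "k_dim M = vectorspace.dim class_ring (restrict_scalars M)"

definition indeg :: "('a, 'm) graded_module \<Rightarrow> int"
  where "indeg M = (LEAST t. grade M t \<noteq> {\<zero>\<^bsub>M\<^esub>})"

definition filter_regular ::
    "nat \<Rightarrow> ('k::field mpoly, 'm) graded_module \<Rightarrow> nat \<Rightarrow> (nat \<Rightarrow> 'k mpoly) \<Rightarrow> bool"
  where "filter_regular n M d l \<longleftrightarrow>
    (\<forall>j \<in> {1..d}.
      let Q = quot_module M (ideal_smult (poly_ring n) (l ` {1..<j}) M)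
      in finite_length (poly_ring n) (Q\<lparr>carrier := {x \<in> carrier Q. l j \<odot>\<^bsub>Q\<^esub> x = \<zero>\<^bsub>Q\<^esub>}\<rparr>))"


section \<open>Hilbert polynomial and Hilbert coefficients\<close>

definition hilbert_function :: "('k::field mpoly, 'm) graded_module \<Rightarrow> int \<Rightarrow> nat"
  where "hilbert_function M t = k_dim (M\<lparr>carrier := grade M t\<rparr>)"

definition hilbert_poly :: "('k::field mpoly, 'm) graded_module \<Rightarrow> rat poly"
  where "hilbert_poly M =
    (THE P. \<exists>t0. \<forall>t\<ge>t0. poly P (of_int t) = of_nat (hilbert_function M t))"

text \<open>An identity of polynomials over the rationals is expressed by equality of all values;
  \<open>gchoose\<close> is the binomial coefficient that is polynomial in its upper argument.\<close>

definition hilbert_coeff :: "nat \<Rightarrow> ('k::field mpoly, 'm) graded_module \<Rightarrow> nat \<Rightarrow> int"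
  where "hilbert_coeff n M =
    (let d = the_enat (module_dim (poly_ring n) M) in
     THE e. (\<forall>i\<ge>d. e i = 0) \<and>
       (\<forall>t. poly (hilbert_poly M) t =
         (\<Sum>i<d. (-1) ^ i * of_int (e i) *
           ((t + of_nat (d - 1 - i)) gchoose (d - 1 - i)))))"


section \<open>Local cohomology and regularity\<close>

text \<open>\<open>H\<^sup>0\<close> as a submodule of \<open>M\<close>: the elements killed by a power of the irrelevant ideal.\<close>

definition torsion :: "nat \<Rightarrow> ('k::field mpoly, 'm) graded_module \<Rightarrow> 'm set"
  where "torsion n M =
    {x \<in> carrier M. \<exists>r :: nat.
      \<forall>a \<in> (ideal_prod (poly_ring n) (irrelevant_ideal n) ^^ r) (carrier (poly_ring n)).
        a \<odot>\<^bsub>M\<^esub> x = \<zero>\<^bsub>M\<^esub>}"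

text \<open>\<open>H\<^sup>i\<close> with support in the irrelevant ideal is the cohomology of the Cech complex on the
  variables, whose \<open>i\<close>-th term is the product, over the \<open>i\<close>-element sets \<open>S\<close> of variables, of the
  localizations of \<open>M\<close> at the product of the variables in \<open>S\<close>. That localization is formed by
  inverting all monomials in the variables of \<open>S\<close>, so that the restriction maps are
  \<open>m/s \<mapsto> m/s\<close>. A fraction is the equivalence class of pairs that represent it.\<close>

definition monomials :: "nat set \<Rightarrow> 'k::field mpoly set"
  where "monomials S = {Poly_Mapping.single u 1 | u. Poly_Mapping.keys u \<subseteq> S}"

definition fraction ::
    "('a, 'm, 'e) module_scheme \<Rightarrow> 'a set \<Rightarrow> 'm \<Rightarrow> 'a \<Rightarrow> ('m \<times> 'a) set"
  where "fraction M W x s =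
    {(y, r). y \<in> carrier M \<and> r \<in> W \<and>
      (\<exists>w \<in> W. w \<odot>\<^bsub>M\<^esub> (r \<odot>\<^bsub>M\<^esub> x) = w \<odot>\<^bsub>M\<^esub> (s \<odot>\<^bsub>M\<^esub> y))}"

definition localization ::
    "nat \<Rightarrow> ('k::field mpoly, 'm) graded_module \<Rightarrow> nat set \<Rightarrow>
     ('k mpoly, ('m \<times> 'k mpoly) set) graded_module"
  where "localization n M S = (let W = monomials S in
    \<lparr> carrier = {fraction M W x s | x s. x \<in> carrier M \<and> s \<in> W},
      mult = undefined, one = undefined,
      zero = fraction M W \<zero>\<^bsub>M\<^esub> 1,
      add = (\<lambda>X Y. \<Union>(x, s) \<in> X. \<Union>(y, r) \<in> Y.
        fraction M W (r \<odot>\<^bsub>M\<^esub> x \<oplus>\<^bsub>M\<^esub> s \<odot>\<^bsub>M\<^esub> y) (s * r)),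
      smult = (\<lambda>a X. \<Union>(x, s) \<in> X. fraction M W (a \<odot>\<^bsub>M\<^esub> x) s),
      grade = (\<lambda>t. {fraction M W x s | x s a b.
        x \<in> grade M a \<and> s \<in> W \<inter> homog n b \<and> t = a - int b}) \<rparr>)"

definition restriction ::
    "('k::field mpoly, 'm) graded_module \<Rightarrow> nat set \<Rightarrow>
     ('m \<times> 'k mpoly) set \<Rightarrow> ('m \<times> 'k mpoly) set"
  where "restriction M S X = (\<Union>(x, s) \<in> X. fraction M (monomials S) x s)"

definition cech_index :: "nat \<Rightarrow> nat \<Rightarrow> nat set set"
  where "cech_index n i = {S. S \<subseteq> {..<n} \<and> card S = i}"

definition cech ::
    "nat \<Rightarrow> ('k::field mpoly, 'm) graded_module \<Rightarrow> nat \<Rightarrow>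
     ('k mpoly, nat set \<Rightarrow> ('m \<times> 'k mpoly) set) graded_module"
  where "cech n M i = (let I = cech_index n i; L = localization n M in
    \<lparr> carrier = (\<Pi>\<^sub>E S\<in>I. carrier (L S)),
      mult = undefined, one = undefined,
      zero = (\<lambda>S\<in>I. \<zero>\<^bsub>L S\<^esub>),
      add = (\<lambda>c c'. \<lambda>S\<in>I. c S \<oplus>\<^bsub>L S\<^esub> c' S),
      smult = (\<lambda>a c. \<lambda>S\<in>I. a \<odot>\<^bsub>L S\<^esub> c S),
      grade = (\<lambda>t. \<Pi>\<^sub>E S\<in>I. grade (L S) t) \<rparr>)"

definition cech_diff ::
    "nat \<Rightarrow> ('k::field mpoly, 'm) graded_module \<Rightarrow> nat \<Rightarrow>
     (nat set \<Rightarrow> ('m \<times> 'k mpoly) set) \<Rightarrow> (nat set \<Rightarrow> ('m \<times> 'k mpoly) set)"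
  where "cech_diff n M i c =
    (\<lambda>S\<in>cech_index n (Suc i).
      finsum (localization n M S)
        (\<lambda>j. (-1) ^ card {h \<in> S. h < j} \<odot>\<^bsub>localization n M S\<^esub> restriction M S (c (S - {j}))) S)"

definition cocycles ::
    "nat \<Rightarrow> ('k::field mpoly, 'm) graded_module \<Rightarrow> nat \<Rightarrow> (nat set \<Rightarrow> ('m \<times> 'k mpoly) set) set"
  where "cocycles n M i = {c \<in> carrier (cech n M i). cech_diff n M i c = \<zero>\<^bsub>cech n M (Suc i)\<^esub>}"

definition coboundaries ::
    "nat \<Rightarrow> ('k::field mpoly, 'm) graded_module \<Rightarrow> nat \<Rightarrow> (nat set \<Rightarrow> ('m \<times> 'k mpoly) set) set"
  where "coboundaries n M i =
    (case i of 0 \<Rightarrow> {\<zero>\<^bsub>cech n M 0\<^esub>} | Suc h \<Rightarrow> cech_diff n M h ` carrier (cech n M h))"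

definition local_cohomology ::
    "nat \<Rightarrow> ('k::field mpoly, 'm) graded_module \<Rightarrow> nat \<Rightarrow>
     ('k mpoly, (nat set \<Rightarrow> ('m \<times> 'k mpoly) set) set) graded_module"
  where "local_cohomology n M i =
    quot_module
      ((cech n M i)\<lparr>carrier := cocycles n M i,
        grade := \<lambda>t. grade (cech n M i) t \<inter> cocycles n M i\<rparr>)
      (coboundaries n M i)"

definition reg :: "nat \<Rightarrow> ('k::field mpoly, 'm) graded_module \<Rightarrow> int"
  where "reg n M =
    (GREATEST r. \<exists>i t. r = int i + t \<and>
      grade (local_cohomology n M i) t \<noteq> {\<zero>\<^bsub>local_cohomology n M i\<^esub>})"

end

theory Submission
  imports Defs "HOL-Library.Function_Algebras"
begin

text \<open>
  Choose homogeneous generators of \<open>M\<close>, so that \<open>M = F / K\<close> with \<open>F\<close> graded free, and put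
  \<open>W\<^sub>0 = K\<close>, \<open>W\<^sub>j = W\<^sub>j\<^sub>-\<^sub>1 + l\<^sub>j F\<close>, \<open>U\<^sub>j = W\<^sub>j : \<mm>\<^sup>\<infinity>\<close>, \<open>V\<^sub>j = U\<^sub>j\<^sub>-\<^sub>1 + l\<^sub>j F\<close>; then \<open>W\<^sub>j \<subseteq> V\<^sub>j \<subseteq> U\<^sub>j\<close>
  agree in high degrees and \<open>l\<^sub>j\<^sub>+\<^sub>1\<close> is regular on \<open>F / U\<^sub>j\<close>. Cutting by a regular linear form does
  not raise the regularity, so with \<open>r = reg (F / U\<^sub>0)\<close> the modules \<open>F / V\<^sub>j\<close> and \<open>F / U\<^sub>j\<close> agree above
  degree \<open>r\<close> for \<open>j \<ge> 1\<close>. If \<open>F / W\<^sub>d\<close> had infinite length, Krull's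
  construction of primes avoiding a multiplicative set, applied with the powers of
  \<open>l\<^sub>d, \<dots>, l\<^sub>1\<close> in turn, would give a chain of \<open>d + 1\<close> proper inclusions of primes over the annihilator
  of \<open>M\<close>; hence \<open>F / W\<^sub>d\<close> is finite-dimensional, of dimension \<open>B\<close>.

  Let \<open>D\<^sub>j(t)\<close> be the Hilbert function minus the Hilbert polynomial of \<open>F / U\<^sub>j\<close>. It vanishes
  for \<open>t \<ge> max r 0\<close>, and its backward difference is \<open>D\<^sub>j\<^sub>+\<^sub>1\<close> plus the defect
  \<open>dim (U\<^sub>j\<^sub>+\<^sub>1 / V\<^sub>j\<^sub>+\<^sub>1)\<close>. Solving the recursion downwards writes \<open>D\<^sub>j\<close> as a difference of two
  nonnegative iterated sums of defects over \<open>{0..r}\<close>, each bounded by \<open>B (r + 1)\<^sup>d\<^sup>-\<^sup>1\<^sup>-\<^sup>j\<close> since the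
  Hilbert function of \<open>F / W\<^sub>j\<close> is dominated by an iterated sum of that of \<open>F / W\<^sub>d\<close>. The Hilbert
  coefficient with index \<open>d - 1 - j\<close> is, up to sign, \<open>D\<^sub>j(-1)\<close>.
\<close>

section \<open>Koszul cohomology of powers of the variables\<close>

text \<open>Two obstacles shape the argument. A form of the sequence is injective on its quotient
  only up to finite length, so Hilbert functions cannot be subtracted exactly. Saturating first
  makes the form regular, and saturation affects Cech cohomology in position 0 only, so the
  regularity still passes along the chain. The price is the defects, which the regularity confines
  to degrees up to \<open>r\<close>.

  The other obstacle is that \<open>reg\<close> is the greatest element of a set that must first be
  shown bounded and nonempty. Boundedness uses no finiteness theorem for local cohomology: the last
  quotient vanishes in high degrees, and vanishing returns from the quotient by a form to the
  module, step by step. Nonemptiness, and with it \<open>0 \<le> reg\<close>, comes from the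
  numerical part: for \<open>r < 0\<close> all coefficients would be zero, so \<open>M\<close> would
  vanish in high degrees, against \<open>d \<ge> 1\<close>.

  That the power of \<open>r + 1\<close> carries no further constant depends on a balance: in degree
  \<open>t\<close> a defect is bounded by a multiple of \<open>t + 1\<close>, the sum that is added
  to it runs over \<open>r - t\<close> degrees, and the two counts add up to
  \<open>r + 1\<close>.\<close>

text \<open>\<open>F\<close> is a graded module over the scalars \<open>C\<close> and the variables \<open>x\<close>, and a graded submodule is a
  family \<open>U\<close> of subsets of its degrees. \<open>van U i t\<close> says that the degree \<open>t\<close> part of the \<open>i\<close>-th Cech
  cohomology of \<open>F / U\<close> vanishes: Cech cohomology is the colimit, over the exponent \<open>p\<close>, of the
  Koszul cohomology of the powers \<open>x j ^ p\<close>, with transition maps multiplication by \<open>xp S q\<close>. This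
  form needs no localizations.\<close>

locale koszul =
  fixes n :: nat and x :: "nat \<Rightarrow> 'a::comm_ring_1" and F :: "int \<Rightarrow> 'a set" and C :: "'a set"
  assumes F_zero: "0 \<in> F t"
    and F_add: "f \<in> F t \<Longrightarrow> g \<in> F t \<Longrightarrow> f + g \<in> F t"
    and F_C: "f \<in> F t \<Longrightarrow> c \<in> C \<Longrightarrow> c * f \<in> F t"
    and F_x: "f \<in> F t \<Longrightarrow> j < n \<Longrightarrow> x j * f \<in> F (t + 1)"
    and C_minus_one: "- 1 \<in> C"
begin

definition sub :: "(int \<Rightarrow> 'a set) \<Rightarrow> bool" where
  "sub U \<longleftrightarrow> (\<forall>t. U t \<subseteq> F t \<and> 0 \<in> U t \<and> (\<forall>f\<in>U t. \<forall>g\<in>U t. f + g \<in> U t) \<and>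
     (\<forall>f\<in>U t. \<forall>c\<in>C. c * f \<in> U t) \<and> (\<forall>f\<in>U t. \<forall>j<n. x j * f \<in> U (t + 1)))"

definition idx :: "nat \<Rightarrow> nat set set" where "idx i = {S. S \<subseteq> {..<n} \<and> card S = i}"

definition sg :: "nat set \<Rightarrow> nat \<Rightarrow> 'a" where "sg S j = (-1) ^ card {h \<in> S. h < j}"

definition dif :: "nat \<Rightarrow> (nat set \<Rightarrow> 'a) \<Rightarrow> nat set \<Rightarrow> 'a" where
  "dif p m S = (\<Sum>j\<in>S. sg S j * x j ^ p * m (S - {j}))"

definition xp :: "nat set \<Rightarrow> nat \<Rightarrow> 'a" where "xp S q = (\<Prod>j\<in>S. x j ^ q)"

text \<open>An entry \<open>m S\<close> stands for the fraction \<open>m S / xp S p\<close> of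
  degree \<open>t\<close>; this explains the shift of its degree by \<open>p\<close> for each of the
  \<open>i\<close> variables in the denominator.\<close>

definition cocyc :: "(int \<Rightarrow> 'a set) \<Rightarrow> nat \<Rightarrow> int \<Rightarrow> nat \<Rightarrow> (nat set \<Rightarrow> 'a) \<Rightarrow> bool" where
  "cocyc U i t p m \<longleftrightarrow> (\<forall>S\<in>idx i. m S \<in> F (t + int (p * i))) \<and>
     (\<forall>S\<in>idx (Suc i). dif p m S \<in> U (t + int (p * Suc i)))"

text \<open>Passing from exponent \<open>p\<close> to \<open>p + q\<close> multiplies numerators by
  \<open>xp S q\<close>. For \<open>i = 0\<close> the differential is an empty sum and the condition
  reads \<open>m {} \<in> U t\<close>.\<close>

definition cobd_by :: "(int \<Rightarrow> 'a set) \<Rightarrow> nat \<Rightarrow> int \<Rightarrow> nat \<Rightarrow> (nat set \<Rightarrow> 'a) \<Rightarrow> nat \<Rightarrow> (nat set \<Rightarrow> 'a) \<Rightarrow> bool" where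
  "cobd_by U i t p m q b \<longleftrightarrow> (\<forall>h. i = Suc h \<longrightarrow> (\<forall>S\<in>idx h. b S \<in> F (t + int ((p + q) * h)))) \<and>
     (\<forall>S\<in>idx i. xp S q * m S - dif (p + q) b S \<in> U (t + int ((p + q) * i)))"

definition cobd :: "(int \<Rightarrow> 'a set) \<Rightarrow> nat \<Rightarrow> int \<Rightarrow> nat \<Rightarrow> (nat set \<Rightarrow> 'a) \<Rightarrow> bool" where
  "cobd U i t p m \<longleftrightarrow> (\<exists>q b. cobd_by U i t p m q b)"

definition van :: "(int \<Rightarrow> 'a set) \<Rightarrow> nat \<Rightarrow> int \<Rightarrow> bool" where
  "van U i t \<longleftrightarrow> (\<forall>p m. cocyc U i t p m \<longrightarrow> cobd U i t p m)"

definition vanish_above :: "(int \<Rightarrow> 'a set) \<Rightarrow> int \<Rightarrow> bool" where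
  "vanish_above U r \<longleftrightarrow> (\<forall>i t. int i + t > r \<longrightarrow> van U i t)"

definition linear_form :: "'a \<Rightarrow> bool" where
  "linear_form l \<longleftrightarrow> (\<exists>c. (\<forall>j<n. c j \<in> C) \<and> l = (\<Sum>j<n. c j * x j))"

definition regular :: "(int \<Rightarrow> 'a set) \<Rightarrow> 'a \<Rightarrow> bool" where
  "regular U l \<longleftrightarrow> (\<forall>t. \<forall>f\<in>F t. l * f \<in> U (t + 1) \<longrightarrow> f \<in> U t)"

definition adj :: "(int \<Rightarrow> 'a set) \<Rightarrow> 'a \<Rightarrow> int \<Rightarrow> 'a set" where
  "adj U l t = {u + l * g | u g. u \<in> U t \<and> g \<in> F (t - 1)}"

text \<open>This is saturation by the irrelevant ideal: a monomial of degree above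
  \<open>n * s\<close> is divisible by some \<open>x j ^ s\<close>, so powers of single variables
  are enough to test it.\<close>

definition sat :: "(int \<Rightarrow> 'a set) \<Rightarrow> int \<Rightarrow> 'a set" where
  "sat U t = {f \<in> F t. \<exists>s. \<forall>j<n. x j ^ s * f \<in> U (t + int s)}"

lemma sub_F: "sub F"
  unfolding sub_def using F_zero F_add F_C F_x by auto

lemma sub_subset: "sub U \<Longrightarrow> f \<in> U t \<Longrightarrow> f \<in> F t"
  unfolding sub_def by blast

lemma sub_zero: "sub U \<Longrightarrow> 0 \<in> U t"
  unfolding sub_def by blast

lemma sub_add: "sub U \<Longrightarrow> f \<in> U t \<Longrightarrow> g \<in> U t \<Longrightarrow> f + g \<in> U t"
  unfolding sub_def by blast

lemma sub_C: "sub U \<Longrightarrow> f \<in> U t \<Longrightarrow> c \<in> C \<Longrightarrow> c * f \<in> U t"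
  unfolding sub_def by blast

lemma sub_x: "sub U \<Longrightarrow> f \<in> U t \<Longrightarrow> j < n \<Longrightarrow> x j * f \<in> U (t + 1)"
  unfolding sub_def by blast

lemma sub_uminus: "sub U \<Longrightarrow> f \<in> U t \<Longrightarrow> - f \<in> U t"
  using sub_C[OF _ _ C_minus_one] by fastforce

lemma sub_diff: "sub U \<Longrightarrow> f \<in> U t \<Longrightarrow> g \<in> U t \<Longrightarrow> f - g \<in> U t"
  using sub_add[of U f t "- g"] sub_uminus by auto

lemma sub_sum: "sub U \<Longrightarrow> (\<And>a. a \<in> A \<Longrightarrow> f a \<in> U t) \<Longrightarrow> sum f A \<in> U t"
  by (induction A rule: infinite_finite_induct) (auto simp: sub_zero sub_add)

lemma sub_xpow: "sub U \<Longrightarrow> f \<in> U t \<Longrightarrow> j < n \<Longrightarrow> x j ^ p * f \<in> U (t + int p)"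
proof (induction p)
  case (Suc p)
  then have "x j * (x j ^ p * f) \<in> U (t + int p + 1)"
    using sub_x by blast
  then show ?case by (simp add: mult.assoc add.commute add.left_commute)
qed auto

lemma sub_xp:
  assumes "sub U" "S \<subseteq> {..<n}" "f \<in> U t"
  shows "xp S q * f \<in> U (t + int (q * card S))"
proof -
  have "finite S" using assms(2) finite_subset by blast
  then show ?thesis using assms
  proof (induction S)
    case empty then show ?case by (simp add: xp_def)
  next
    case (insert j S)
    then have "x j ^ q * (xp S q * f) \<in> U (t + int (q * card S) + int q)"
      using sub_xpow by auto
    moreover have "t + int (q * card S) + int q = t + int (q * card (insert j S))"
      using insert by (simp add: algebra_simps)
    ultimately show ?case using insert by (simp add: xp_def mult.assoc add.assoc add.commute add.left_commute)
  qed
qed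

lemma sub_xp_idx: "sub U \<Longrightarrow> S \<in> idx i \<Longrightarrow> f \<in> U (t + int (p * i)) \<Longrightarrow> xp S q * f \<in> U (t + int ((p + q) * i))"
  using sub_xp[of U S f "t + int (p * i)" q] by (auto simp: idx_def algebra_simps)

lemma sub_sg: "sub U \<Longrightarrow> f \<in> U t \<Longrightarrow> sg S j * f \<in> U t"
  using sub_uminus[of U f t] by (cases "even (card {h \<in> S. h < j})") (auto simp: sg_def)

lemma idx_finite: "S \<in> idx i \<Longrightarrow> finite S"
  unfolding idx_def using finite_subset by blast

lemma idx_remove: "S \<in> idx (Suc i) \<Longrightarrow> j \<in> S \<Longrightarrow> S - {j} \<in> idx i"
  unfolding idx_def by (auto simp: finite_subset)

lemma idx_insert: "S \<in> idx i \<Longrightarrow> j \<notin> S \<Longrightarrow> j < n \<Longrightarrow> insert j S \<in> idx (Suc i)"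
  using finite_subset[of S "{..<n}"] unfolding idx_def by auto

lemma idx_less: "S \<in> idx i \<Longrightarrow> j \<in> S \<Longrightarrow> j < n"
  unfolding idx_def by auto

lemma idx_0: "idx 0 = {{}}"
  unfolding idx_def using finite_subset[of _ "{..<n}"] by fastforce

lemma linear_form_mult:
  assumes "sub U" "linear_form l" "f \<in> U t"
  shows "l * f \<in> U (t + 1)"
proof -
  obtain c where c: "\<forall>j<n. c j \<in> C" "l = (\<Sum>j<n. c j * x j)"
    using assms unfolding linear_form_def by blast
  have "(\<Sum>j<n. c j * (x j * f)) \<in> U (t + 1)"
    using assms c by (intro sub_sum sub_C sub_x) auto
  then show ?thesis by (simp add: c(2) sum_distrib_right mult.assoc)
qed

lemma dif_cong: "(\<And>j. j \<in> S \<Longrightarrow> m (S - {j}) = m' (S - {j})) \<Longrightarrow> dif p m S = dif p m' S"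
  unfolding dif_def by (intro sum.cong) auto

lemma dif_in:
  assumes "sub U" "S \<in> idx (Suc i)" "\<And>T. T \<in> idx i \<Longrightarrow> m T \<in> U (t + int (p * i))"
  shows "dif p m S \<in> U (t + int (p * Suc i))"
  unfolding dif_def
proof (intro sub_sum[OF assms(1)])
  fix j assume j: "j \<in> S"
  have "x j ^ p * m (S - {j}) \<in> U (t + int (p * i) + int p)"
    using assms idx_remove[OF assms(2) j] idx_less[OF assms(2) j] by (intro sub_xpow) auto
  then show "sg S j * x j ^ p * m (S - {j}) \<in> U (t + int (p * Suc i))"
    using sub_sg[OF assms(1), of _ _ S j] by (simp add: mult.assoc add.assoc add.commute add.left_commute)
qed

lemma dif_add: "dif p (\<lambda>S. a S + b S) S = dif p a S + dif p b S"
  unfolding dif_def by (simp add: algebra_simps sum.distrib)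

lemma dif_diff: "dif p (\<lambda>S. a S - b S) S = dif p a S - dif p b S"
  unfolding dif_def by (simp add: algebra_simps sum_subtractf)

lemma dif_mult: "dif p (\<lambda>S. c * a S) S = c * dif p a S"
  unfolding dif_def by (simp add: algebra_simps sum_distrib_left)

lemma xp_zero: "xp S 0 = 1"
  by (simp add: xp_def)

lemma xp_add: "xp S (p + q) = xp S p * xp S q"
  by (simp add: xp_def power_add prod.distrib)

lemma xp_remove: "finite S \<Longrightarrow> j \<in> S \<Longrightarrow> xp S q = x j ^ q * xp (S - {j}) q"
  unfolding xp_def by (simp add: prod.remove)

text \<open>Says that the transition maps of the colimit are maps of complexes; every comparison of
  cochains at different exponents rests on it.\<close>

lemma dif_xp:
  assumes "finite S"
  shows "dif (p + q) (\<lambda>T. xp T q * m T) S = xp S q * dif p m S"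
  unfolding dif_def sum_distrib_left
proof (intro sum.cong refl)
  fix j assume "j \<in> S"
  then show "sg S j * x j ^ (p + q) * (xp (S - {j}) q * m (S - {j})) = xp S q * (sg S j * x j ^ p * m (S - {j}))"
    using xp_remove[OF assms, of j q] by (simp add: power_add algebra_simps)
qed

lemma sg_remove_greater: "h < j \<Longrightarrow> sg (S - {j}) h = sg S h"
proof -
  assume "h < j"
  then have "{a \<in> S - {j}. a < h} = {a \<in> S. a < h}" by auto
  then show ?thesis by (simp add: sg_def)
qed

lemma sg_remove_less:
  assumes "h < j" "finite S" "h \<in> S"
  shows "sg (S - {h}) j = - sg S j"
proof -
  have "{a \<in> S. a < j} = insert h {a \<in> S - {h}. a < j}" using assms by auto
  then have "card {a \<in> S. a < j} = Suc (card {a \<in> S - {h}. a < j})" using assms by simp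
  then show ?thesis by (simp add: sg_def)
qed

text \<open>Removing the smaller of two indices flips the sign attached to the larger one, while
  removing the larger leaves the sign of the smaller alone; so the two orders of removal carry
  opposite signs.\<close>

lemma sg_swap:
  assumes "finite S" "h \<in> S" "j \<in> S" "h \<noteq> j"
  shows "sg S j * sg (S - {j}) h = - (sg S h * sg (S - {h}) j)"
proof (cases "h < j")
  case True
  then show ?thesis using sg_remove_greater[of h j S] sg_remove_less[of h j S] assms by (simp add: mult.commute)
next
  case False
  then have "j < h" using assms by simp
  then show ?thesis using sg_remove_greater[of j h S] sg_remove_less[of j h S] assms by (simp add: mult.commute)
qed

lemma sg_square: "sg S j * sg S j = 1"
  by (cases "even (card {h \<in> S. h < j})") (simp_all add: sg_def)

text \<open>Every pair of removed indices occurs in both orders, and the two occurrences cancel by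
  \<open>sg_swap\<close>.\<close>

lemma dif_dif:
  assumes "finite S"
  shows "dif p (dif p m) S = 0"
proof -
  define T where "T = (\<lambda>j h. sg S j * sg (S - {j}) h * (x j ^ p * x h ^ p) * m (S - {j} - {h}))"
  define A where "A = {(j, h). j \<in> S \<and> h \<in> S \<and> h < j}"
  define B where "B = {(j, h). j \<in> S \<and> h \<in> S \<and> j < h}"
  have fin: "finite A" "finite B"
    using finite_subset[of A "S \<times> S"] finite_subset[of B "S \<times> S"] assms by (auto simp: A_def B_def)
  have "dif p (dif p m) S = (\<Sum>j\<in>S. \<Sum>h\<in>S - {j}. T j h)"
    unfolding dif_def T_def by (simp add: sum_distrib_left algebra_simps)
  also have "\<dots> = (\<Sum>(j, h)\<in>(SIGMA j:S. S - {j}). T j h)"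
    using assms by (intro sum.Sigma) auto
  also have "(SIGMA j:S. S - {j}) = A \<union> B"
    unfolding A_def B_def by auto
  also have "(\<Sum>(j, h)\<in>A \<union> B. T j h) = (\<Sum>(j, h)\<in>A. T j h) + (\<Sum>(j, h)\<in>B. T j h)"
    using fin by (intro sum.union_disjoint) (auto simp: A_def B_def)
  also have "(\<Sum>(j, h)\<in>B. T j h) = (\<Sum>(j, h)\<in>A. T h j)"
    by (rule sum.reindex_bij_witness[of _ "\<lambda>(a, b). (b, a)" "\<lambda>(a, b). (b, a)"]) (auto simp: A_def B_def)
  also have "(\<Sum>(j, h)\<in>A. T h j) = (\<Sum>(j, h)\<in>A. - T j h)"
  proof (intro sum.cong refl)
    fix z assume "z \<in> A"
    then obtain j h where z: "z = (j, h)" "j \<in> S" "h \<in> S" "h < j" by (auto simp: A_def)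
    have "S - {h} - {j} = S - {j} - {h}" by auto
    moreover have sw: "sg S h * sg (S - {h}) j = - (sg S j * sg (S - {j}) h)"
      using sg_swap[OF assms, of j h] z by simp
    ultimately have "T h j = - (sg S j * sg (S - {j}) h) * (x j ^ p * x h ^ p) * m (S - {j} - {h})"
      unfolding T_def sw by (simp add: mult.commute)
    then show "(case z of (j, h) \<Rightarrow> T h j) = (case z of (j, h) \<Rightarrow> - T j h)"
      using z by (simp add: T_def)
  qed
  finally show ?thesis by (simp add: sum_negf case_prod_unfold)
qed

text \<open>The classical Koszul homotopy: contraction with the \<open>j\<close>-th basis vector shows that
  multiplication by \<open>x j ^ p\<close> is null-homotopic on the Koszul complex of the \<open>p\<close>-th powers.\<close>

lemma koszul_homotopy:
  assumes S: "finite S" and b: "b = (\<lambda>T. if j \<in> T then 0 else sg (insert j T) j * m (insert j T))"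
  shows "x j ^ p * m S - dif p b S = (if j \<in> S then 0 else sg (insert j S) j * dif p m (insert j S))"
proof (cases "j \<in> S")
  case True
  \<comment> \<open>\<open>b\<close> vanishes on sets that contain \<open>j\<close>, so only the
    summand that removes \<open>j\<close> survives.\<close>
  have "dif p b S = (\<Sum>h\<in>{j}. sg S h * x h ^ p * b (S - {h}))"
    unfolding dif_def using S True by (intro sum.mono_neutral_right) (auto simp: b)
  also have "\<dots> = x j ^ p * m S"
    using True sg_square[of S j] by (simp add: b insert_absorb algebra_simps) (metis mult.assoc mult_1)
  finally show ?thesis using True by simp
next
  case False
  let ?S = "insert j S"
  have 1: "dif p m ?S = sg ?S j * x j ^ p * m S + (\<Sum>h\<in>S. sg ?S h * x h ^ p * m (?S - {h}))"
    unfolding dif_def using S False by (simp add: insert_Diff_if)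
  have 2: "sg ?S j * (sg ?S h * x h ^ p * m (?S - {h})) = - (sg S h * x h ^ p * b (S - {h}))" if h: "h \<in> S" for h
  proof -
    have e: "insert j (S - {h}) = ?S - {h}" "?S - {j} = S" "j \<noteq> h" using False h by auto
    have "sg ?S j * sg S h = - (sg ?S h * sg (?S - {h}) j)"
      using sg_swap[of ?S h j] S h e by auto
    then have "sg ?S j * sg ?S j * sg S h = - (sg ?S j * (sg ?S h * sg (?S - {h}) j))"
      by (simp add: mult.assoc)
    then have s: "sg S h = - (sg ?S j * (sg ?S h * sg (?S - {h}) j))"
      by (simp add: sg_square)
    have "sg S h * sg (?S - {h}) j = - (sg ?S j * sg ?S h * (sg (?S - {h}) j * sg (?S - {h}) j))"
      by (subst s) (simp add: algebra_simps)
    then have s': "sg S h * sg (?S - {h}) j = - (sg ?S j * sg ?S h)" by (simp add: sg_square)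
    have "sg S h * x h ^ p * b (S - {h}) = sg S h * sg (?S - {h}) j * (x h ^ p * m (?S - {h}))"
      using False e by (simp add: b algebra_simps)
    then show ?thesis unfolding s' by (simp add: algebra_simps)
  qed
  have "sg ?S j * dif p m ?S = sg ?S j * sg ?S j * x j ^ p * m S
      + (\<Sum>h\<in>S. sg ?S j * (sg ?S h * x h ^ p * m (?S - {h})))"
    unfolding 1 by (simp add: algebra_simps sum_distrib_left)
  also have "(\<Sum>h\<in>S. sg ?S j * (sg ?S h * x h ^ p * m (?S - {h}))) = - dif p b S"
    unfolding dif_def sum_negf[symmetric] by (intro sum.cong refl 2)
  finally show ?thesis using False by (simp add: sg_square)
qed

text \<open>Lets two witnesses be moved to a common exponent, where they can be added.\<close>

lemma cobd_by_raise:
  assumes U: "sub U" and c: "cobd_by U i t p m q b"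
  shows "cobd_by U i t p m (q + q') (\<lambda>S. xp S q' * b S)"
  unfolding cobd_by_def
proof (intro conjI allI impI ballI)
  fix h S assume "i = Suc h" "S \<in> idx h"
  then show "xp S q' * b S \<in> F (t + int ((p + (q + q')) * h))"
    using c sub_xp_idx[OF sub_F, of S h "b S" t "p + q" q'] by (auto simp: cobd_by_def add.assoc)
next
  fix S assume S: "S \<in> idx i"
  have "xp S (q + q') * m S - dif (p + (q + q')) (\<lambda>S. xp S q' * b S) S
      = xp S q' * (xp S q * m S - dif (p + q) b S)"
    using dif_xp[OF idx_finite[OF S], of "p + q" q' b] by (simp add: xp_add algebra_simps)
  then show "xp S (q + q') * m S - dif (p + (q + q')) (\<lambda>S. xp S q' * b S) S \<in> U (t + int ((p + (q + q')) * i))"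
    using c S sub_xp_idx[OF U S, of _ t "p + q" q'] by (auto simp: cobd_by_def add.assoc)
qed

lemma cobd_add:
  assumes U: "sub U" and "cobd U i t p m" "cobd U i t p m'"
  shows "cobd U i t p (\<lambda>S. m S + m' S)"
proof -
  obtain q b q' b' where "cobd_by U i t p m q b" "cobd_by U i t p m' q' b'"
    using assms unfolding cobd_def by blast
  from cobd_by_raise[OF U this(1), of q'] cobd_by_raise[OF U this(2), of q]
  obtain Q c c' where c: "cobd_by U i t p m Q c" "cobd_by U i t p m' Q c'"
    by (metis add.commute)
  have "cobd_by U i t p (\<lambda>S. m S + m' S) Q (\<lambda>S. c S + c' S)"
    unfolding cobd_by_def
  proof (intro conjI allI impI ballI)
    fix h S assume "i = Suc h" "S \<in> idx h"
    then show "c S + c' S \<in> F (t + int ((p + Q) * h))"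
      using c unfolding cobd_by_def by (intro F_add) blast+
  next
    fix S assume S: "S \<in> idx i"
    have "xp S Q * (m S + m' S) - dif (p + Q) (\<lambda>S. c S + c' S) S
        = (xp S Q * m S - dif (p + Q) c S) + (xp S Q * m' S - dif (p + Q) c' S)"
      by (simp add: dif_add algebra_simps)
    then show "xp S Q * (m S + m' S) - dif (p + Q) (\<lambda>S. c S + c' S) S \<in> U (t + int ((p + Q) * i))"
      using c S by (auto simp: cobd_by_def intro!: sub_add[OF U])
  qed
  then show ?thesis unfolding cobd_def by blast
qed

lemma cobd_mult:
  assumes "\<And>U t f. sub U \<Longrightarrow> f \<in> U t \<Longrightarrow> a * f \<in> U (t + k)"
    and U: "sub U" and "cobd U i t p m"
  shows "cobd U i (t + k) p (\<lambda>S. a * m S)"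
proof -
  obtain q b where c: "cobd_by U i t p m q b"
    using assms unfolding cobd_def by blast
  have sh: "t + k + e = t + e + k" for e :: int by simp
  have "cobd_by U i (t + k) p (\<lambda>S. a * m S) q (\<lambda>S. a * b S)"
    unfolding cobd_by_def
  proof (intro conjI allI impI ballI)
    fix h S assume "i = Suc h" "S \<in> idx h"
    then show "a * b S \<in> F (t + k + int ((p + q) * h))"
      using c assms(1)[OF sub_F] unfolding cobd_by_def sh by blast
  next
    fix S assume S: "S \<in> idx i"
    have "xp S q * (a * m S) - dif (p + q) (\<lambda>S. a * b S) S = a * (xp S q * m S - dif (p + q) b S)"
      by (simp add: dif_mult algebra_simps)
    then show "xp S q * (a * m S) - dif (p + q) (\<lambda>S. a * b S) S \<in> U (t + k + int ((p + q) * i))"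
      using c S by (auto simp: cobd_by_def sh intro!: assms(1)[OF U])
  qed
  then show ?thesis unfolding cobd_def by blast
qed

lemma cobd_zero: "sub U \<Longrightarrow> cobd U i t p (\<lambda>S. 0)"
  unfolding cobd_def cobd_by_def
  by (intro exI[of _ 0] exI[of _ "\<lambda>S. 0"]) (auto simp: dif_def sub_zero F_zero)

lemma cobd_sum:
  "sub U \<Longrightarrow> (\<And>a. a \<in> A \<Longrightarrow> cobd U i t p (m a)) \<Longrightarrow> cobd U i t p (\<lambda>S. \<Sum>a\<in>A. m a S)"
  by (induction A rule: infinite_finite_induct) (auto simp: cobd_zero cobd_add)

text \<open>The contraction from \<open>koszul_homotopy\<close> is the witness, at the same
  exponent: its error term is, up to sign, the differential of \<open>m\<close>, which lies in
  \<open>U\<close> because \<open>m\<close> is a cocycle.\<close>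

lemma cobd_xpow:
  assumes U: "sub U" and m: "cocyc U i t p m" and j: "j < n"
  shows "cobd U i (t + int p) p (\<lambda>S. x j ^ p * m S)"
proof -
  define b where "b = (\<lambda>T. if j \<in> T then 0 else sg (insert j T) j * m (insert j T))"
  have "cobd_by U i (t + int p) p (\<lambda>S. x j ^ p * m S) 0 b"
    unfolding cobd_by_def
  proof (intro conjI allI impI ballI)
    fix h S assume h: "i = Suc h" and S: "S \<in> idx h"
    show "b S \<in> F (t + int p + int ((p + 0) * h))"
    proof (cases "j \<in> S")
      case False
      then have "m (insert j S) \<in> F (t + int (p * i))"
        using m idx_insert[OF S _ j] h unfolding cocyc_def by blast
      then show ?thesis using False sub_sg[OF sub_F] by (simp add: b_def h algebra_simps)
    qed (simp add: b_def F_zero)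
  next
    fix S assume S: "S \<in> idx i"
    have e: "t + int p + int ((p + 0) * i) = t + int (p * Suc i)" by simp
    show "xp S 0 * (x j ^ p * m S) - dif (p + 0) b S \<in> U (t + int p + int ((p + 0) * i))"
      unfolding e using koszul_homotopy[OF idx_finite[OF S] b_def, of p] m idx_insert[OF S _ j]
        sub_sg[OF U] sub_zero[OF U]
      by (auto simp: xp_zero cocyc_def)
  qed
  then show ?thesis unfolding cobd_def by blast
qed

section \<open>Cohomology of the quotient by a linear form\<close>

lemma sub_adj:
  assumes U: "sub U" and l: "linear_form l"
  shows "sub (adj U l)"
  unfolding sub_def
proof (intro allI conjI ballI impI subsetI)
  fix t f assume "f \<in> adj U l t"
  then obtain u g where "f = u + l * g" "u \<in> U t" "g \<in> F (t - 1)" unfolding adj_def by blast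
  then show "f \<in> F t" using linear_form_mult[OF sub_F l, of g "t - 1"] sub_subset[OF U] F_add by auto
next
  fix t show "0 \<in> adj U l t"
    unfolding adj_def using sub_zero[OF U] F_zero by force
next
  fix t f f' assume "f \<in> adj U l t" "f' \<in> adj U l t"
  then obtain u g u' g' where fg: "f = u + l * g" "u \<in> U t" "g \<in> F (t - 1)" "f' = u' + l * g'" "u' \<in> U t" "g' \<in> F (t - 1)"
    unfolding adj_def by blast
  have "f + f' = (u + u') + l * (g + g')" using fg by (simp add: algebra_simps)
  then show "f + f' \<in> adj U l t" unfolding adj_def using fg sub_add[OF U] F_add by blast
next
  fix t f c assume "f \<in> adj U l t" and c: "c \<in> C"
  then obtain u g where fg: "f = u + l * g" "u \<in> U t" "g \<in> F (t - 1)" unfolding adj_def by blast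
  have "c * f = c * u + l * (c * g)" using fg by (simp add: algebra_simps)
  then show "c * f \<in> adj U l t" unfolding adj_def using fg sub_C[OF U] F_C c by blast
next
  fix t f j assume "f \<in> adj U l t" and j: "j < n"
  then obtain u g where fg: "f = u + l * g" "u \<in> U t" "g \<in> F (t - 1)" unfolding adj_def by blast
  have "x j * f = x j * u + l * (x j * g)" using fg by (simp add: algebra_simps)
  moreover have "x j * g \<in> F (t + 1 - 1)" using F_x[OF fg(3) j] by simp
  ultimately show "x j * f \<in> adj U l (t + 1)" unfolding adj_def using fg sub_x[OF U] j by blast
qed

lemma adj_supset: "f \<in> U t \<Longrightarrow> f \<in> adj U l t"
  unfolding adj_def using F_zero by force

lemma adj_mono: "(\<And>t. U t \<subseteq> U' t) \<Longrightarrow> adj U l t \<subseteq> adj U' l t"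
  unfolding adj_def by blast

text \<open>A chase in the long exact sequence of
  \<open>0 -> (F/U)(-1) -> F/U -> F/(U + l F) -> 0\<close>, carried out on representatives: the
  cohomology of the quotient in position \<open>i\<close> sits between that of \<open>F/U\<close> in
  position \<open>i\<close> and degree \<open>t\<close> and that in position \<open>i + 1\<close>
  and degree \<open>t - 1\<close>.\<close>

lemma van_adj:
  assumes U: "sub U" and l: "linear_form l" and reg: "regular U l"
    and v: "van U i t" "van U (Suc i) (t - 1)"
  shows "van (adj U l) i t"
  unfolding van_def
proof (intro allI impI)
  fix p m assume m: "cocyc (adj U l) i t p m"
  have sh: "t + e - 1 = t - 1 + e" for e :: int by simp
  have "\<forall>S\<in>idx (Suc i). \<exists>u g. dif p m S = u + l * g \<and> u \<in> U (t + int (p * Suc i)) \<and> g \<in> F (t - 1 + int (p * Suc i))"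
    using m by (auto simp only: cocyc_def adj_def sh mem_Collect_eq)
  then obtain u g where ug: "\<And>S. S \<in> idx (Suc i) \<Longrightarrow> dif p m S = u S + l * g S"
      "\<And>S. S \<in> idx (Suc i) \<Longrightarrow> u S \<in> U (t + int (p * Suc i))"
      "\<And>S. S \<in> idx (Suc i) \<Longrightarrow> g S \<in> F (t - 1 + int (p * Suc i))"
    by metis
  \<comment> \<open>\<open>g\<close> represents the image of \<open>m\<close> under the connecting
    homomorphism. Since \<open>dif\<close> squares to zero, \<open>l\<close> times the differential
    of \<open>g\<close> lies in \<open>U\<close>, and regularity of \<open>l\<close> cancels the
    factor.\<close>
  have "cocyc U (Suc i) (t - 1) p g"
    unfolding cocyc_def
  proof (intro conjI ballI)
    fix S assume S: "S \<in> idx (Suc (Suc i))"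
    have "0 = dif p (dif p m) S" using dif_dif idx_finite[OF S] by simp
    also have "\<dots> = dif p (\<lambda>S. u S + l * g S) S"
      using ug(1) idx_remove[OF S] by (intro dif_cong) auto
    also have "\<dots> = dif p u S + l * dif p g S" by (simp add: dif_add dif_mult)
    finally have "l * dif p g S = - dif p u S" by (simp add: eq_neg_iff_add_eq_0 add.commute)
    moreover have "dif p u S \<in> U (t + int (p * Suc (Suc i)))"
      using dif_in[OF U S] ug(2) by blast
    ultimately have "l * dif p g S \<in> U (t - 1 + int (p * Suc (Suc i)) + 1)"
      using sub_uminus[OF U] by (simp add: algebra_simps)
    moreover have "dif p g S \<in> F (t - 1 + int (p * Suc (Suc i)))"
      using dif_in[OF sub_F S] ug(3) by blast
    ultimately show "dif p g S \<in> U (t - 1 + int (p * Suc (Suc i)))"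
      using reg unfolding regular_def by blast
  qed (use ug in blast)
  then obtain q b where "cobd_by U (Suc i) (t - 1) p g q b"
    using v(2) unfolding van_def cobd_def by blast
  then have b: "\<And>S. S \<in> idx i \<Longrightarrow> b S \<in> F (t - 1 + int ((p + q) * i))"
      "\<And>S. S \<in> idx (Suc i) \<Longrightarrow> xp S q * g S - dif (p + q) b S \<in> U (t - 1 + int ((p + q) * Suc i))"
    unfolding cobd_by_def by auto
  \<comment> \<open>Subtracting \<open>l * b\<close> turns \<open>m\<close>, at the raised exponent,
    into a genuine cocycle of \<open>F/U\<close>; the correction is invisible modulo
    \<open>l F\<close>.\<close>
  define m' where "m' = (\<lambda>S. xp S q * m S - l * b S)"
  have "cocyc U i t (p + q) m'"
    unfolding cocyc_def
  proof (intro conjI ballI)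
    fix S assume S: "S \<in> idx i"
    have "xp S q * m S \<in> F (t + int ((p + q) * i))"
      using sub_xp_idx[OF sub_F S] m S unfolding cocyc_def by blast
    moreover have "l * b S \<in> F (t + int ((p + q) * i))"
      using linear_form_mult[OF sub_F l b(1)[OF S]] by (simp add: algebra_simps)
    ultimately show "m' S \<in> F (t + int ((p + q) * i))"
      unfolding m'_def using sub_diff[OF sub_F] by blast
  next
    fix S assume S: "S \<in> idx (Suc i)"
    have "dif (p + q) m' S = xp S q * dif p m S - l * dif (p + q) b S"
      unfolding m'_def dif_diff dif_mult by (simp add: dif_xp[OF idx_finite[OF S]])
    also have "\<dots> = xp S q * u S + l * (xp S q * g S - dif (p + q) b S)"
      using ug(1)[OF S] by (simp add: algebra_simps)
    finally have "dif (p + q) m' S = xp S q * u S + l * (xp S q * g S - dif (p + q) b S)" .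
    moreover have "xp S q * u S \<in> U (t + int ((p + q) * Suc i))"
      using sub_xp_idx[OF U S] ug(2)[OF S] by blast
    moreover have "l * (xp S q * g S - dif (p + q) b S) \<in> U (t + int ((p + q) * Suc i))"
      using linear_form_mult[OF U l b(2)[OF S]] by (simp add: algebra_simps)
    ultimately show "dif (p + q) m' S \<in> U (t + int ((p + q) * Suc i))"
      using sub_add[OF U] by simp
  qed
  then obtain q' b' where b': "cobd_by U i t (p + q) m' q' b'"
    using v(1) unfolding van_def cobd_def by blast
  have "cobd_by (adj U l) i t p m (q + q') b'"
    unfolding cobd_by_def
  proof (intro conjI allI impI ballI)
    fix h S assume "i = Suc h" "S \<in> idx h"
    then show "b' S \<in> F (t + int ((p + (q + q')) * h))"
      using b' by (simp add: cobd_by_def add.assoc)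
  next
    fix S assume S: "S \<in> idx i"
    have "xp S q' * m' S - dif (p + q + q') b' S \<in> U (t + int ((p + q + q') * i))"
      using b' S unfolding cobd_by_def by blast
    moreover have "xp S (q + q') * m S - dif (p + (q + q')) b' S
        = (xp S q' * m' S - dif (p + q + q') b' S) + l * (xp S q' * b S)"
      by (simp add: m'_def xp_add algebra_simps)
    moreover have "xp S q' * b S \<in> F (t + int ((p + q + q') * i) - 1)"
      using sub_xp_idx[OF sub_F S b(1)[OF S], of q'] by (simp add: algebra_simps)
    ultimately show "xp S (q + q') * m S - dif (p + (q + q')) b' S \<in> adj U l (t + int ((p + (q + q')) * i))"
      unfolding adj_def add.assoc[of p] by blast
  qed
  then show "cobd (adj U l) i t p m" unfolding cobd_def by blast
qed

text \<open>Injectivity of multiplication by \<open>l\<close> on cohomology, read off from the same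
  exact sequence: the kernel in position \<open>i\<close> is the image of the cohomology of
  \<open>F/(U + l F)\<close> in position \<open>i - 1\<close> and degree \<open>t + 1\<close>. In
  position 0 it is regularity itself.\<close>

lemma cobd_of_linear_form_mult:
  assumes U: "sub U" and l: "linear_form l" and reg: "regular U l"
    and v: "\<And>h. i = Suc h \<Longrightarrow> van (adj U l) h (t + 1)"
    and m: "\<And>S. S \<in> idx i \<Longrightarrow> m S \<in> F (t + int (p * i))"
    and lm: "cobd U i (t + 1) p (\<lambda>S. l * m S)"
  shows "cobd U i t p m"
proof -
  obtain q b where "cobd_by U i (t + 1) p (\<lambda>S. l * m S) q b"
    using lm unfolding cobd_def by blast
  then have b: "\<And>h S. i = Suc h \<Longrightarrow> S \<in> idx h \<Longrightarrow> b S \<in> F (t + 1 + int ((p + q) * h))"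
      "\<And>S. S \<in> idx i \<Longrightarrow> xp S q * (l * m S) - dif (p + q) b S \<in> U (t + 1 + int ((p + q) * i))"
    unfolding cobd_by_def by auto
  have regD: "f \<in> U s" if "f \<in> F s" "l * f \<in> U (s + 1)" for f s
    using reg that unfolding regular_def by blast
  have xm: "xp S q * m S \<in> F (t + int ((p + q) * i))" if "S \<in> idx i" for S q
    using sub_xp_idx[OF sub_F that m[OF that]] .
  show ?thesis
  proof (cases i)
    case 0
    have "m {} \<in> U t"
      using b(2)[of "{}"] m[of "{}"] regD[of "m {}" t] by (simp add: 0 idx_0 xp_def dif_def)
    then have "cobd_by U i t p m 0 b"
      unfolding cobd_by_def by (simp add: 0 idx_0 xp_def dif_def)
    then show ?thesis unfolding cobd_def by blast
  next
    case (Suc h)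
    have "cocyc (adj U l) h (t + 1) (p + q) b"
      unfolding cocyc_def
    proof (intro conjI ballI)
      fix S assume S: "S \<in> idx (Suc h)"
      have "dif (p + q) b S = - (xp S q * (l * m S) - dif (p + q) b S) + l * (xp S q * m S)"
        by (simp add: algebra_simps)
      moreover have "- (xp S q * (l * m S) - dif (p + q) b S) \<in> U (t + 1 + int ((p + q) * Suc h))"
        using sub_uminus[OF U b(2)] S Suc by blast
      moreover have "xp S q * m S \<in> F (t + 1 + int ((p + q) * Suc h) - 1)"
        using xm[of S q] S Suc by (simp add: algebra_simps)
      ultimately show "dif (p + q) b S \<in> adj U l (t + 1 + int ((p + q) * Suc h))"
        unfolding adj_def by blast
    qed (use b(1) Suc in blast)
    then obtain q' b' where "cobd_by (adj U l) h (t + 1) (p + q) b q' b'"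
      using v[OF Suc] unfolding van_def cobd_def by blast
    moreover have sh: "t + 1 + e - 1 = t + e" for e :: int by simp
    ultimately have "\<forall>S\<in>idx h. \<exists>u g. xp S q' * b S - dif (p + q + q') b' S = u + l * g
        \<and> u \<in> U (t + 1 + int ((p + q + q') * h)) \<and> g \<in> F (t + int ((p + q + q') * h))"
      by (auto simp only: cobd_by_def adj_def sh mem_Collect_eq)
    then obtain u g where ug': "\<And>S. S \<in> idx h \<Longrightarrow> xp S q' * b S - dif (p + q + q') b' S = u S + l * g S"
        "\<And>S. S \<in> idx h \<Longrightarrow> u S \<in> U (t + 1 + int ((p + q + q') * h))"
        "\<And>S. S \<in> idx h \<Longrightarrow> g S \<in> F (t + int ((p + q + q') * h))"
      by metis
    have ug: "xp S q' * b S = dif (p + q + q') b' S + u S + l * g S" if "S \<in> idx h" for S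
      using ug'(1)[OF that] by (simp add: algebra_simps)
    let ?P = "p + q + q'"
    \<comment> \<open>Up to a coboundary and an element of \<open>U\<close>, the primitive
      \<open>b\<close> of \<open>l * m\<close> equals \<open>l * g\<close>; cancelling
      \<open>l\<close> makes \<open>g\<close> a primitive of \<open>m\<close>.\<close>
    have "cobd_by U i t p m (q + q') g"
      unfolding cobd_by_def
    proof (intro conjI allI impI ballI)
      fix h' S assume "i = Suc h'" "S \<in> idx h'"
      then show "g S \<in> F (t + int ((p + (q + q')) * h'))"
        using ug'(3) Suc by (simp add: add.assoc)
    next
      fix S assume S: "S \<in> idx i"
      let ?y = "xp S (q + q') * m S - dif ?P g S"
      define e where "e = xp S q * (l * m S) - dif (p + q) b S"
      have e: "e \<in> U (t + 1 + int ((p + q) * i))" unfolding e_def using b(2)[OF S] .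
      have "dif ?P (\<lambda>S. xp S q' * b S) S = dif ?P (\<lambda>S. dif ?P b' S + u S + l * g S) S"
        using ug idx_remove S Suc by (intro dif_cong) auto
      also have "\<dots> = dif ?P u S + l * dif ?P g S"
        using dif_dif[OF idx_finite[OF S]] by (simp add: dif_add dif_mult)
      finally have d: "xp S q' * dif (p + q) b S = dif ?P u S + l * dif ?P g S"
        using dif_xp[OF idx_finite[OF S], of "p + q" q' b] by simp
      have "l * ?y = xp S q' * e + (xp S q' * dif (p + q) b S - l * dif ?P g S)"
        by (simp add: e_def xp_add algebra_simps)
      also have "\<dots> = xp S q' * e + dif ?P u S" unfolding d by simp
      finally have ly: "l * ?y = xp S q' * e + dif ?P u S" .
      have "xp S q' * e \<in> U (t + 1 + int (?P * i))"
        using sub_xp_idx[OF U S e] .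
      moreover have "dif ?P u S \<in> U (t + 1 + int (?P * i))"
        using dif_in[OF U, of S h u "t + 1" ?P] ug'(2) S Suc by blast
      ultimately have "l * ?y \<in> U (t + int (?P * i) + 1)"
        unfolding ly using sub_add[OF U] by (simp add: algebra_simps)
      moreover have "?y \<in> F (t + int (?P * i))"
        using xm[OF S, of "q + q'"] dif_in[OF sub_F, of S h g t ?P] ug'(3) S Suc
        by (intro sub_diff[OF sub_F]) (auto simp: add.assoc)
      ultimately have "?y \<in> U (t + int (?P * i))" by (rule regD[rotated])
      then show "xp S (q + q') * m S - dif (p + (q + q')) g S \<in> U (t + int ((p + (q + q')) * i))"
        by (simp add: add.assoc)
    qed
    then show ?thesis unfolding cobd_def by blast
  qed
qed

text \<open>Monomials are lists of variable indices here, so that the inductions below can add or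
  remove a single variable.\<close>

lemma prod_list_x_split:
  "p \<le> count_list js j \<Longrightarrow>
   \<exists>js'. prod_list (map x js) = x j ^ p * prod_list (map x js') \<and> length js = p + length js' \<and> set js' \<subseteq> set js"
proof (induction p arbitrary: js)
  case 0
  then show ?case by auto
next
  case (Suc p)
  then have "j \<in> set js" by (metis count_list_0_iff not_less_eq_eq zero_le)
  then obtain as bs where js: "js = as @ j # bs" by (meson split_list)
  then have "p \<le> count_list (as @ bs) j" using Suc by simp
  from Suc.IH[OF this] obtain js' where js': "prod_list (map x (as @ bs)) = x j ^ p * prod_list (map x js')"
    "length (as @ bs) = p + length js'" "set js' \<subseteq> set (as @ bs)" by blast
  have "prod_list (map x js) = x j * prod_list (map x (as @ bs))" by (simp add: js algebra_simps)
  then have "prod_list (map x js) = x j ^ Suc p * prod_list (map x js')" using js'(1) by (simp add: mult.assoc)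
  then show ?case using js' js by (intro exI[of _ js']) auto
qed

lemma sub_prod_list_x:
  "sub U \<Longrightarrow> set js \<subseteq> {..<n} \<Longrightarrow> f \<in> U t \<Longrightarrow> prod_list (map x js) * f \<in> U (t + int (length js))"
proof (induction js)
  case (Cons j js)
  then have "x j * (prod_list (map x js) * f) \<in> U (t + int (length js) + 1)"
    by (intro sub_x) auto
  then show ?case by (simp add: algebra_simps)
qed auto

lemma pigeonhole_list:
  assumes "set js \<subseteq> {..<n}" "length js > n * p"
  shows "\<exists>j<n. p \<le> count_list js j"
proof (rule ccontr)
  assume "\<not> ?thesis"
  then have "\<And>j. j < n \<Longrightarrow> count_list js j \<le> p" by force
  then have "(\<Sum>j<n. count_list js j) \<le> (\<Sum>j<n. p)" by (intro sum_mono) auto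
  moreover have "(\<Sum>j<n. count_list js j) = (\<Sum>j\<in>set js. count_list js j)"
    using assms(1) by (intro sum.mono_neutral_right) (auto simp: count_list_0_iff)
  moreover have "\<dots> = length js" by (simp add: sum_count_set)
  ultimately show False using assms(2) by simp
qed

text \<open>High powers of the maximal ideal kill a cocycle class; a linear form that is injective on
  cohomology in the relevant degrees lets one remove the variables again one at a time.\<close>

lemma vanish_above_of_adj:
  assumes U: "sub U" and l: "linear_form l" and reg: "regular U l"
    and v: "vanish_above (adj U l) r"
  shows "vanish_above U r"
  unfolding vanish_above_def van_def
proof (intro allI impI)
  fix i t p m assume it: "int i + t > r" and m: "cocyc U i t p m"
  obtain c where c: "\<forall>j<n. c j \<in> C" "l = (\<Sum>j<n. c j * x j)"
    using l unfolding linear_form_def by blast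
  define X where "X = (\<lambda>js. prod_list (map x js))"
  let ?P = "\<lambda>k. \<forall>js. set js \<subseteq> {..<n} \<longrightarrow> length js = k \<longrightarrow> cobd U i (t + int k) p (\<lambda>S. X js * m S)"
  \<comment> \<open>By the pigeonhole principle a monomial of this degree contains some
    \<open>x j ^ p\<close>, and \<open>cobd_xpow\<close> makes it kill the class.\<close>
  have top: "?P (Suc (n * p))"
  proof (intro allI impI)
    fix js assume js: "set js \<subseteq> {..<n}" "length js = Suc (n * p)"
    obtain j where j: "j < n" "p \<le> count_list js j" using pigeonhole_list[OF js(1), of p] js(2) by auto
    obtain js' where js': "X js = x j ^ p * X js'" "length js = p + length js'" "set js' \<subseteq> set js"
      using prod_list_x_split[OF j(2)] unfolding X_def by blast
    have "cobd U i (t + int p + int (length js')) p (\<lambda>S. X js' * (x j ^ p * m S))"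
      using sub_prod_list_x js js' unfolding X_def
      by (intro cobd_mult[OF _ U cobd_xpow[OF U m j(1)]]) auto
    moreover have "t + int p + int (length js') = t + int (Suc (n * p))" using js js' by (metis add.assoc of_nat_add)
    ultimately show "cobd U i (t + int (Suc (n * p))) p (\<lambda>S. X js * m S)"
      by (simp add: js'(1) mult.assoc mult.left_commute)
  qed
  \<comment> \<open>If all monomials of degree \<open>Suc k\<close> kill the class, so does
    \<open>l\<close> times any monomial of degree \<open>k\<close>, because \<open>l\<close> is a
    combination of variables. Injectivity of \<open>l\<close> then removes it; the degrees never
    fall below \<open>t\<close>, so the vanishing above \<open>r\<close> applies.\<close>
  have step: "?P k" if P: "?P (Suc k)" for k
  proof (intro allI impI)
    fix js assume js: "set js \<subseteq> {..<n}" "length js = k"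
    have "cobd U i (t + int k + 1) p (\<lambda>S. c j * (X (j # js) * m S))" if "j < n" for j
    proof -
      have "cobd U i (t + int (Suc k)) p (\<lambda>S. X (j # js) * m S)" using P that js by simp
      then have "cobd U i (t + int (Suc k) + 0) p (\<lambda>S. c j * (X (j # js) * m S))"
        using cobd_mult[of "c j" 0, OF _ U] c that sub_C by auto
      then show ?thesis by (simp add: algebra_simps)
    qed
    then have "cobd U i (t + int k + 1) p (\<lambda>S. \<Sum>j<n. c j * (X (j # js) * m S))"
      by (intro cobd_sum[OF U]) auto
    then have "cobd U i (t + int k + 1) p (\<lambda>S. l * (X js * m S))"
      by (simp add: c(2) X_def sum_distrib_right sum_distrib_left mult.assoc)
    then show "cobd U i (t + int k) p (\<lambda>S. X js * m S)"
    proof (rule cobd_of_linear_form_mult[OF U l reg, rotated 2])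
      fix h assume "i = Suc h"
      then show "van (adj U l) h (t + int k + 1)"
        using v it unfolding vanish_above_def by auto
    next
      fix S assume "S \<in> idx i"
      then have "X js * m S \<in> F (t + int (p * i) + int (length js))"
        unfolding X_def using m js by (intro sub_prod_list_x[OF sub_F]) (auto simp: cocyc_def)
      then show "X js * m S \<in> F (t + int k + int (p * i))" using js by (simp add: algebra_simps)
    qed
  qed
  have "?P 0"
    using top step by (rule inc_induct[of 0 "Suc (n * p)" ?P, rotated 1]) auto
  then show "cobd U i t p m" by (auto simp: X_def dest: spec[of _ "[]"])
qed

lemma vanish_above_adj:
  "sub U \<Longrightarrow> linear_form l \<Longrightarrow> regular U l \<Longrightarrow> vanish_above U r \<Longrightarrow> vanish_above (adj U l) r"
  unfolding vanish_above_def by (auto intro!: van_adj)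

section \<open>Saturation and its effect on cohomology\<close>

lemma sub_sat:
  assumes U: "sub U"
  shows "sub (sat U)"
proof -
  have raise: "x j ^ s' * f \<in> U (t + int s')" if "x j ^ s * f \<in> U (t + int s)" "j < n" "s \<le> s'" for j s s' f t
  proof -
    have "x j ^ (s' - s) * (x j ^ s * f) \<in> U (t + int s + int (s' - s))"
      using sub_xpow[OF U] that by blast
    moreover have "x j ^ (s' - s) * (x j ^ s * f) = x j ^ s' * f" using that
      by (metis le_add_diff_inverse2 mult.assoc power_add)
    ultimately show ?thesis using that by simp
  qed
  show ?thesis
    unfolding sub_def
  proof (intro allI conjI ballI impI subsetI)
    fix t f g assume f: "f \<in> sat U t" and g: "g \<in> sat U t"
    obtain s where s: "\<forall>j<n. x j ^ s * f \<in> U (t + int s)" using f unfolding sat_def by blast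
    obtain s' where s': "\<forall>j<n. x j ^ s' * g \<in> U (t + int s')" using g unfolding sat_def by blast
    have "\<forall>j<n. x j ^ (s + s') * f + x j ^ (s + s') * g \<in> U (t + int (s + s'))"
      using raise[of _ s f t "s + s'"] raise[of _ s' g t "s + s'"] s s' by (auto intro!: sub_add[OF U])
    then show "f + g \<in> sat U t"
      unfolding sat_def using f g F_add by (auto simp: sat_def distrib_left intro!: exI[of _ "s + s'"])
  next
    fix t f c assume f: "f \<in> sat U t" and c: "c \<in> C"
    obtain s where s: "\<forall>j<n. x j ^ s * f \<in> U (t + int s)" using f unfolding sat_def by blast
    have "\<forall>j<n. x j ^ s * (c * f) \<in> U (t + int s)"
      using s sub_C[OF U _ c] by (auto simp: mult.left_commute)
    then show "c * f \<in> sat U t" unfolding sat_def using f F_C c by (auto simp: sat_def)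
  next
    fix t f i assume f: "f \<in> sat U t" and i: "i < n"
    obtain s where s: "\<forall>j<n. x j ^ s * f \<in> U (t + int s)" using f unfolding sat_def by blast
    have "\<forall>j<n. x j ^ s * (x i * f) \<in> U (t + 1 + int s)"
    proof (intro allI impI)
      fix j assume "j < n"
      then have "x i * (x j ^ s * f) \<in> U (t + int s + 1)" using s sub_x[OF U _ i] by blast
      then show "x j ^ s * (x i * f) \<in> U (t + 1 + int s)" by (simp add: algebra_simps)
    qed
    then show "x i * f \<in> sat U (t + 1)" unfolding sat_def using f F_x i by (auto simp: sat_def)
  qed (use F_zero sub_zero[OF U] in \<open>auto simp: sat_def\<close>)
qed

lemma sat_supset: "sub U \<Longrightarrow> f \<in> U t \<Longrightarrow> f \<in> sat U t"
  unfolding sat_def using sub_subset by (auto intro!: exI[of _ 0])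

lemma sat_mono: "(\<And>t. U t \<subseteq> U' t) \<Longrightarrow> sat U t \<subseteq> sat U' t"
  unfolding sat_def by blast

lemma sat_pow_ge:
  assumes U: "sub U" and f: "f \<in> sat U t"
  shows "\<exists>s. \<forall>s'\<ge>s. \<forall>j<n. x j ^ s' * f \<in> U (t + int s')"
proof -
  obtain s where s: "\<forall>j<n. x j ^ s * f \<in> U (t + int s)" using f unfolding sat_def by blast
  have "x j ^ s' * f \<in> U (t + int s')" if "j < n" "s \<le> s'" for s' j
  proof -
    have "x j ^ (s' - s) * (x j ^ s * f) \<in> U (t + int s + int (s' - s))"
      using sub_xpow[OF U] that s by blast
    moreover have "x j ^ (s' - s) * (x j ^ s * f) = x j ^ s' * f" using that
      by (metis le_add_diff_inverse2 mult.assoc power_add)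
    ultimately show ?thesis using that by simp
  qed
  then show ?thesis by blast
qed

lemma sat_sat:
  assumes U: "sub U"
  shows "sat (sat U) t \<subseteq> sat U t"
proof
  fix f assume f: "f \<in> sat (sat U) t"
  then obtain s where s: "\<forall>j<n. x j ^ s * f \<in> sat U (t + int s)" unfolding sat_def by blast
  have "\<forall>j\<in>{..<n}. \<exists>e. \<forall>s'\<ge>e. x j ^ s' * (x j ^ s * f) \<in> U (t + int s + int s')"
    using sat_pow_ge[OF U] s by (meson lessThan_iff)
  then obtain e where e: "\<And>j s'. j < n \<Longrightarrow> e j \<le> s' \<Longrightarrow> x j ^ s' * (x j ^ s * f) \<in> U (t + int s + int s')"
    by (metis lessThan_iff)
  define E where "E = (\<Sum>j<n. e j)"
  have "x j ^ (s + E) * f \<in> U (t + int (s + E))" if "j < n" for j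
    using e[OF that, of E] that member_le_sum[of j "{..<n}" e]
    by (simp add: E_def power_add algebra_simps)
  then show "f \<in> sat U t" using f unfolding sat_def by blast
qed

text \<open>A cocycle in position 0 is a single element that a power of each variable multiplies
  into \<open>U\<close>, and it is trivial exactly when it lies in \<open>U\<close>; so the
  cohomology is \<open>sat U / U\<close>.\<close>

lemma van_0_iff:
  assumes U: "sub U"
  shows "van U 0 t \<longleftrightarrow> sat U t \<subseteq> U t"
proof -
  have coc: "cocyc U 0 t p m \<longleftrightarrow> m {} \<in> F t \<and> (\<forall>j<n. x j ^ p * m {} \<in> U (t + int p))" for p m
  proof -
    have "idx (Suc 0) = (\<lambda>j. {j}) ` {..<n}" unfolding idx_def by (auto simp: card_Suc_eq)
    moreover have "dif p m {j} = x j ^ p * m {}" for j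
    proof -
      have "{h \<in> {j}. h < j} = {}" by auto
      then have "sg {j} j = 1" unfolding sg_def by (metis card.empty power_0)
      then show ?thesis by (simp add: dif_def)
    qed
    ultimately show ?thesis by (auto simp: cocyc_def idx_0)
  qed
  have cob: "cobd U 0 t p m \<longleftrightarrow> m {} \<in> U t" for p m
    unfolding cobd_def cobd_by_def by (simp add: idx_0 dif_def xp_def)
  show ?thesis
    unfolding van_def coc cob sat_def by (auto dest: spec[of _ "\<lambda>_. _"])
qed

text \<open>\<open>U / V\<close> is torsion and dies as soon as one variable is inverted. Only the
  term of the complex with the empty denominator can see it, so in positive positions the two
  quotients have the same cohomology.\<close>

lemma van_sat_closed:
  assumes U: "sub U" and V: "sub V" and VU: "\<And>t. V t \<subseteq> U t" and UV: "\<And>t. U t \<subseteq> sat V t"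
    and i: "i \<noteq> 0"
  shows "van V i t \<longleftrightarrow> van U i t"
proof -
  \<comment> \<open>A nonempty \<open>S\<close> contains a variable, a high power of which carries
    the given element of \<open>U\<close> into \<open>V\<close>; one exponent works for the finitely
    many \<open>S\<close>.\<close>
  have ev: "\<exists>q0. \<forall>q\<ge>q0. \<forall>S\<in>idx i. xp S q * f S \<in> V (t + int (q * i))"
    if f: "\<And>S. S \<in> idx i \<Longrightarrow> f S \<in> U t" and i: "i \<noteq> 0" for f i t
  proof -
    have "\<exists>e. \<forall>q\<ge>e. xp S q * f S \<in> V (t + int (q * i))" if S: "S \<in> idx i" for S
    proof -
      obtain j where j: "j \<in> S" using S i unfolding idx_def by (metis (mono_tags) card.empty ex_in_conv mem_Collect_eq)
      have "f S \<in> sat V t" using f[OF S] UV by blast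
      from sat_pow_ge[OF V this] obtain e where e: "\<forall>q\<ge>e. \<forall>j<n. x j ^ q * f S \<in> V (t + int q)" by blast
      have "xp S q * f S \<in> V (t + int (q * i))" if "q \<ge> e" for q
      proof -
        have "x j ^ q * f S \<in> V (t + int q)" using e that idx_less[OF S j] by blast
        then have "xp (S - {j}) q * (x j ^ q * f S) \<in> V (t + int q + int (q * card (S - {j})))"
          using S by (intro sub_xp[OF V]) (auto simp: idx_def)
        moreover have "card S = i" "card (S - {j}) = i - 1" "finite S" using S j idx_finite[OF S] by (auto simp: idx_def)
        then have "t + int q + int (q * card (S - {j})) = t + int (q * i)"
          using i by (cases i) (auto simp: algebra_simps)
        ultimately show ?thesis using xp_remove[of S j q] j idx_finite[OF S] by (simp add: algebra_simps)
      qed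
      then show ?thesis by blast
    qed
    then obtain e where e: "\<And>S q. S \<in> idx i \<Longrightarrow> q \<ge> e S \<Longrightarrow> xp S q * f S \<in> V (t + int (q * i))" by metis
    have fin: "finite (idx i)" unfolding idx_def by simp
    show ?thesis
      using e member_le_sum[of _ "idx i" e, OF _ _ fin] by (intro exI[of _ "sum e (idx i)"]) (meson order_trans zero_le)
  qed
  show ?thesis
  proof
    assume v: "van V i t"
    show "van U i t" unfolding van_def
    proof (intro allI impI)
      fix p m assume m: "cocyc U i t p m"
      then obtain q where q: "\<forall>S\<in>idx (Suc i). xp S q * dif p m S \<in> V (t + int (p * Suc i) + int (q * Suc i))"
        using ev[of "Suc i" "dif p m" "t + int (p * Suc i)"] unfolding cocyc_def by auto
      have "cocyc V i t (p + q) (\<lambda>S. xp S q * m S)"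
        unfolding cocyc_def
      proof (intro conjI ballI)
        fix S assume S: "S \<in> idx i"
        then show "xp S q * m S \<in> F (t + int ((p + q) * i))"
          using sub_xp_idx[OF sub_F S] m unfolding cocyc_def by blast
      next
        fix S assume S: "S \<in> idx (Suc i)"
        have "t + int (p * Suc i) + int (q * Suc i) = t + int ((p + q) * Suc i)" by (simp add: algebra_simps)
        then show "dif (p + q) (\<lambda>S. xp S q * m S) S \<in> V (t + int ((p + q) * Suc i))"
          using q S dif_xp[OF idx_finite[OF S]] by metis
      qed
      then obtain q' b where b: "cobd_by V i t (p + q) (\<lambda>S. xp S q * m S) q' b"
        using v unfolding van_def cobd_def by blast
      have "cobd_by U i t p m (q + q') b"
        using b VU by (auto simp: cobd_by_def xp_add add.assoc algebra_simps subset_iff)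
      then show "cobd U i t p m" unfolding cobd_def by blast
    qed
  next
    assume v: "van U i t"
    show "van V i t" unfolding van_def
    proof (intro allI impI)
      fix p m assume m: "cocyc V i t p m"
      then have "cocyc U i t p m" using VU unfolding cocyc_def by blast
      then obtain q b where b: "cobd_by U i t p m q b" using v unfolding van_def cobd_def by blast
      then obtain q' where q': "\<forall>S\<in>idx i. xp S q' * (xp S q * m S - dif (p + q) b S) \<in> V (t + int ((p + q) * i) + int (q' * i))"
        using ev[of i "\<lambda>S. xp S q * m S - dif (p + q) b S" "t + int ((p + q) * i)"] i unfolding cobd_by_def by auto
      have "cobd_by V i t p m (q + q') (\<lambda>S. xp S q' * b S)"
        unfolding cobd_by_def
      proof (intro conjI allI impI ballI)
        fix h S assume "i = Suc h" "S \<in> idx h"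
        then show "xp S q' * b S \<in> F (t + int ((p + (q + q')) * h))"
          using b sub_xp_idx[OF sub_F, of S h "b S" t "p + q" q'] by (auto simp: cobd_by_def add.assoc)
      next
        fix S assume S: "S \<in> idx i"
        have "xp S (q + q') * m S - dif (p + (q + q')) (\<lambda>S. xp S q' * b S) S
            = xp S q' * (xp S q * m S - dif (p + q) b S)"
          using dif_xp[OF idx_finite[OF S], of "p + q" q' b] by (simp add: xp_add algebra_simps)
        moreover have "t + int ((p + q) * i) + int (q' * i) = t + int ((p + (q + q')) * i)" by (simp add: algebra_simps)
        ultimately show "xp S (q + q') * m S - dif (p + (q + q')) (\<lambda>S. xp S q' * b S) S \<in> V (t + int ((p + (q + q')) * i))"
          using q' S by metis
      qed
      then show "cobd V i t p m" unfolding cobd_def by blast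
    qed
  qed
qed

lemma vanish_above_if_full:
  assumes V: "sub V" and full: "\<And>t. t > r \<Longrightarrow> V t = F t"
  shows "vanish_above V r"
  unfolding vanish_above_def van_def
proof (intro allI impI)
  fix i t p m assume it: "r < int i + t" and m: "cocyc V i t p m"
  \<comment> \<open>Chosen so that \<open>t + q\<close> exceeds \<open>r\<close>: for positive
    \<open>i\<close> the numerators at exponent \<open>p + q\<close> then lie in degrees where
    \<open>V\<close> is everything.\<close>
  define q where "q = nat (r - t) + 1"
  have "cobd_by V i t p m q (\<lambda>S. 0)"
    unfolding cobd_by_def
  proof (intro conjI allI impI ballI)
    fix S assume S: "S \<in> idx i"
    have "xp S q * m S \<in> F (t + int ((p + q) * i))"
      using sub_xp_idx[OF sub_F S] m S unfolding cocyc_def by blast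
    moreover have "t + int ((p + q) * i) > r"
    proof (cases i)
      case (Suc h)
      have "int ((p + q) * i) \<ge> int q" unfolding Suc by simp
      then show ?thesis unfolding q_def by linarith
    qed (use it in simp)
    ultimately show "xp S q * m S - dif (p + q) (\<lambda>S. 0) S \<in> V (t + int ((p + q) * i))"
      using full by (simp add: dif_def)
  qed (simp add: F_zero)
  then show "cobd V i t p m" unfolding cobd_def by blast
qed

end

context koszul begin

text \<open>The descent of \<open>vanish_above_of_adj\<close> for elements instead of classes.
  Degrees only rise on the way, so injectivity of \<open>l\<close> from degree \<open>t\<close> on
  suffices, which is what a filter regular form offers in high degrees.\<close>

lemma sat_descent:
  assumes U: "sub U" and l: "linear_form l"
    and reg: "\<And>t' f. t' \<ge> t \<Longrightarrow> f \<in> F t' \<Longrightarrow> l * f \<in> U (t' + 1) \<Longrightarrow> f \<in> U t'"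
    and f: "f \<in> sat U t"
  shows "f \<in> U t"
proof -
  obtain c where c: "\<forall>j<n. c j \<in> C" "l = (\<Sum>j<n. c j * x j)"
    using l unfolding linear_form_def by blast
  obtain s where s: "\<forall>j<n. x j ^ s * f \<in> U (t + int s)" and fF: "f \<in> F t" using f unfolding sat_def by blast
  define X where "X = (\<lambda>js. prod_list (map x js))"
  let ?P = "\<lambda>k. \<forall>js. set js \<subseteq> {..<n} \<longrightarrow> length js = k \<longrightarrow> X js * f \<in> U (t + int k)"
  have top: "?P (Suc (n * s))"
  proof (intro allI impI)
    fix js assume js: "set js \<subseteq> {..<n}" "length js = Suc (n * s)"
    obtain j where j: "j < n" "s \<le> count_list js j" using pigeonhole_list[OF js(1), of s] js(2) by auto
    obtain js' where js': "X js = x j ^ s * X js'" "length js = s + length js'" "set js' \<subseteq> set js"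
      using prod_list_x_split[OF j(2)] unfolding X_def by blast
    have "X js' * (x j ^ s * f) \<in> U (t + int s + int (length js'))"
      unfolding X_def using s j js js' by (intro sub_prod_list_x[OF U]) auto
    moreover have "t + int s + int (length js') = t + int (Suc (n * s))"
      using js js' by (metis add.assoc of_nat_add)
    ultimately show "X js * f \<in> U (t + int (Suc (n * s)))"
      by (simp add: js'(1) mult.assoc mult.left_commute)
  qed
  have step: "?P k" if P: "?P (Suc k)" for k
  proof (intro allI impI)
    fix js assume js: "set js \<subseteq> {..<n}" "length js = k"
    have "X (j # js) * f \<in> U (t + int (Suc k))" if "j < n" for j using P js that by simp
    then have "c j * (X (j # js) * f) \<in> U (t + int (Suc k))" if "j < n" for j
      using sub_C[OF U] c that by blast
    then have "(\<Sum>j<n. c j * (X (j # js) * f)) \<in> U (t + int (Suc k))"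
      by (intro sub_sum[OF U]) auto
    then have "l * (X js * f) \<in> U (t + int k + 1)"
      by (simp add: c(2) X_def sum_distrib_right sum_distrib_left algebra_simps)
    moreover have "X js * f \<in> F (t + int k)"
      unfolding X_def using sub_prod_list_x[OF sub_F js(1) fF] js(2) by simp
    ultimately show "X js * f \<in> U (t + int k)" using reg[of "t + int k"] by simp
  qed
  have "?P 0"
    using top step by (rule inc_induct[of 0 "Suc (n * s)" ?P, rotated 1]) auto
  then show ?thesis by (auto simp: X_def dest: spec[of _ "[]"])
qed

end

section \<open>Filter regular sequences and their saturated quotients\<close>

locale filter_regular_chain = koszul +
  fixes W :: "nat \<Rightarrow> int \<Rightarrow> 'a set" and l :: "nat \<Rightarrow> 'a" and d :: nat
  assumes sub_W0: "sub (W 0)"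
    and linear: "j < d \<Longrightarrow> linear_form (l (Suc j))"
    and W_Suc: "j < d \<Longrightarrow> W (Suc j) = adj (W j) (l (Suc j))"
    and filter_regular: "j < d \<Longrightarrow> \<exists>t0. \<forall>t\<ge>t0. \<forall>f\<in>F t. l (Suc j) * f \<in> W j (t + 1) \<longrightarrow> f \<in> W j t"
    and W_full: "\<exists>t0. \<forall>t\<ge>t0. W d t = F t"
begin

definition Usat :: "nat \<Rightarrow> int \<Rightarrow> 'a set" where "Usat j = sat (W j)"

definition V :: "nat \<Rightarrow> int \<Rightarrow> 'a set" where "V j = (case j of 0 \<Rightarrow> W 0 | Suc h \<Rightarrow> adj (Usat h) (l (Suc h)))"

lemma sub_W: "j \<le> d \<Longrightarrow> sub (W j)"
  by (induction j) (auto simp: sub_W0 W_Suc linear intro: sub_adj)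

lemma sub_Usat: "j \<le> d \<Longrightarrow> sub (Usat j)"
  unfolding Usat_def by (intro sub_sat sub_W)

lemma sub_V: "j \<le> d \<Longrightarrow> sub (V j)"
  unfolding V_def by (cases j) (auto simp: sub_W0 intro!: sub_adj sub_Usat linear)

lemma W_subset_Usat: "j \<le> d \<Longrightarrow> W j t \<subseteq> Usat j t"
  unfolding Usat_def using sat_supset[OF sub_W] by blast

lemma W_subset_V: "j \<le> d \<Longrightarrow> W j t \<subseteq> V j t"
proof (cases j)
  case (Suc h)
  assume "j \<le> d"
  then have "\<And>t. W h t \<subseteq> Usat h t" using W_subset_Usat Suc by simp
  then show ?thesis using \<open>j \<le> d\<close> adj_mono by (simp add: Suc V_def W_Suc)
qed (simp add: V_def)

lemma V_subset_Usat:
  assumes "j \<le> d"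
  shows "V j t \<subseteq> Usat j t"
proof (cases j)
  case (Suc h)
  then have h: "h < d" using assms by simp
  show ?thesis
  proof
    fix f assume "f \<in> V j t"
    then obtain u g where f: "f = u + l j * g" "u \<in> Usat h t" "g \<in> F (t - 1)"
      by (auto simp: Suc V_def adj_def)
    have "W h s \<subseteq> W j s" for s using W_Suc[OF h] adj_supset by (auto simp: Suc)
    then have "u \<in> Usat j t" using f(2) sat_mono[of "W h" "W j"] unfolding Usat_def by blast
    moreover have "0 \<in> W h t" using sub_zero[OF sub_W[of h]] h by simp
    then have "0 + l j * g \<in> W j t"
      unfolding Suc W_Suc[OF h] adj_def using f(3) Suc by blast
    then have "l j * g \<in> Usat j t" using W_subset_Usat[OF assms] by auto
    ultimately show "f \<in> Usat j t" using f(1) sub_add[OF sub_Usat[OF assms]] by blast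
  qed
qed (use assms W_subset_Usat in \<open>auto simp: V_def\<close>)

lemma Usat_subset_sat_V: "j \<le> d \<Longrightarrow> Usat j t \<subseteq> sat (V j) t"
  unfolding Usat_def by (intro sat_mono W_subset_V)

text \<open>For \<open>j < d\<close> the next form of the sequence drives
  \<open>sat_descent\<close>; at \<open>j = d\<close> there is no next form, and fullness of
  \<open>W d\<close> in high degrees takes its place.\<close>

lemma Usat_eventually:
  assumes "j \<le> d"
  shows "\<exists>t0. \<forall>t\<ge>t0. Usat j t = W j t"
proof (cases "j = d")
  case True
  obtain t0 where "\<forall>t\<ge>t0. W d t = F t" using W_full by blast
  then have "\<forall>t\<ge>t0. Usat j t = W j t"
    using W_subset_Usat[OF assms] sub_subset[OF sub_Usat[OF assms]] True by blast
  then show ?thesis by blast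
next
  case False
  then have j: "j < d" using assms by simp
  obtain t0 where t0: "\<forall>t\<ge>t0. \<forall>f\<in>F t. l (Suc j) * f \<in> W j (t + 1) \<longrightarrow> f \<in> W j t"
    using filter_regular[OF j] by blast
  have "Usat j t \<subseteq> W j t" if "t \<ge> t0" for t
    using sat_descent[OF sub_W[OF assms] linear[OF j], of t] t0 that unfolding Usat_def by auto
  then show ?thesis using W_subset_Usat[OF assms] by blast
qed

text \<open>High powers of the variables move the problem into degrees where the form is injective
  modulo \<open>W j\<close>; the saturation absorbs those powers.\<close>

lemma Usat_regular:
  assumes j: "j < d"
  shows "regular (Usat j) (l (Suc j))"
  unfolding regular_def
proof (intro allI ballI impI)
  fix t f assume f: "f \<in> F t" and lf: "l (Suc j) * f \<in> Usat j (t + 1)"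
  obtain t0 where t0: "\<forall>t\<ge>t0. \<forall>f\<in>F t. l (Suc j) * f \<in> W j (t + 1) \<longrightarrow> f \<in> W j t"
    using filter_regular[OF j] by blast
  obtain s where s: "\<forall>s'\<ge>s. \<forall>i<n. x i ^ s' * (l (Suc j) * f) \<in> W j (t + 1 + int s')"
    using sat_pow_ge[OF sub_W, of j "l (Suc j) * f" "t + 1"] lf j unfolding Usat_def by auto
  define s' where "s' = s + nat (t0 - t)"
  have "x i ^ s' * f \<in> W j (t + int s')" if i: "i < n" for i
  proof -
    have "l (Suc j) * (x i ^ s' * f) \<in> W j (t + int s' + 1)"
    proof -
      have "s' \<ge> s" by (simp add: s'_def)
      then have "x i ^ s' * (l (Suc j) * f) \<in> W j (t + 1 + int s')" using s i by blast
      then show ?thesis by (simp add: algebra_simps)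
    qed
    moreover have "x i ^ s' * f \<in> F (t + int s')" using sub_xpow[OF sub_F f i] .
    moreover have "t + int s' \<ge> t0" by (simp add: s'_def)
    ultimately show ?thesis using t0 by blast
  qed
  then show "f \<in> Usat j t" unfolding Usat_def sat_def using f by blast
qed

text \<open>Saturating \<open>V (Suc j)\<close> removes the cohomology in position 0 altogether and
  leaves the other positions unchanged by \<open>van_sat_closed\<close>; so the bound
  survives.\<close>

lemma vanish_above_Suc:
  assumes j: "j < d" and v: "vanish_above (Usat j) r"
  shows "vanish_above (V (Suc j)) r" "vanish_above (Usat (Suc j)) r"
proof -
  have j': "j \<le> d" "Suc j \<le> d" using j by auto
  show V: "vanish_above (V (Suc j)) r"
    using vanish_above_adj[OF sub_Usat[OF j'(1)] linear[OF j] Usat_regular[OF j] v] by (simp add: V_def)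
  show "vanish_above (Usat (Suc j)) r"
    unfolding vanish_above_def
  proof (intro allI impI)
    fix i t assume it: "r < int i + t"
    show "van (Usat (Suc j)) i t"
    proof (cases "i = 0")
      case True
      then show ?thesis
        using van_0_iff[OF sub_Usat[OF j'(2)]] sat_sat[OF sub_W[OF j'(2)]] by (simp add: Usat_def)
    next
      case False
      then show ?thesis
        using van_sat_closed[OF sub_Usat[OF j'(2)] sub_V[OF j'(2)] V_subset_Usat[OF j'(2)] Usat_subset_sat_V[OF j'(2)]]
          V it unfolding vanish_above_def by blast
    qed
  qed
qed

lemma vanish_above_Usat: "j \<le> d \<Longrightarrow> vanish_above (Usat 0) r \<Longrightarrow> vanish_above (Usat j) r"
  by (induction j) (auto intro: vanish_above_Suc)

text \<open>The torsion of \<open>F / V j\<close> is its cohomology in position 0, so it is bounded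
  by the regularity of the saturated quotient one step before. For \<open>j = 0\<close> there is no
  such step, and the torsion of the module itself is not controlled.\<close>

lemma Usat_eq_V:
  assumes "vanish_above (Usat 0) r" "1 \<le> j" "j \<le> d" "t > r"
  shows "Usat j t = V j t"
proof -
  obtain h where h: "j = Suc h" "h < d" using assms by (cases j) auto
  have "vanish_above (V j) r"
    using vanish_above_Suc(1)[OF h(2)] vanish_above_Usat[of h] assms(1) h by simp
  then have "van (V j) 0 t" using assms(4) unfolding vanish_above_def by simp
  then have "sat (V j) t \<subseteq> V j t" using van_0_iff[OF sub_V[OF assms(3)]] by blast
  then show ?thesis using Usat_subset_sat_V[OF assms(3)] V_subset_Usat[OF assms(3)] by blast
qed

text \<open>Descending induction from the end of the chain, where \<open>Usat d\<close> is
  everything in high degrees; \<open>vanish_above_of_adj\<close> leads from the quotient by a form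
  back to the module.\<close>

lemma vanish_above_exists: "\<exists>r. vanish_above (Usat 0) r"
proof -
  have "\<exists>r. vanish_above (Usat j) r" if "j \<le> d" for j
    using that
  proof (induction j rule: inc_induct)
    case base
    obtain t0 where t0: "\<forall>t\<ge>t0. Usat d t = W d t" using Usat_eventually[of d] by blast
    obtain t1 where t1: "\<forall>t\<ge>t1. W d t = F t" using W_full by blast
    have "vanish_above (Usat d) (max t0 t1)"
      using t0 t1 by (intro vanish_above_if_full sub_Usat) auto
    then show ?case by blast
  next
    case (step j)
    then have j: "j \<le> d" "Suc j \<le> d" by auto
    obtain r where r: "vanish_above (Usat (Suc j)) r" using step by blast
    obtain t0 where t0: "\<forall>t\<ge>t0. Usat (Suc j) t = W (Suc j) t" using Usat_eventually[OF j(2)] by blast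
    \<comment> \<open>The bound may have to grow: \<open>r\<close> handles the positive positions,
      while in position 0 the torsion modulo \<open>V (Suc j)\<close> is only known to vanish from
      \<open>t0\<close> on.\<close>
    have "vanish_above (V (Suc j)) (max r t0)"
      unfolding vanish_above_def
    proof (intro allI impI)
      fix i t assume it: "max r t0 < int i + t"
      show "van (V (Suc j)) i t"
      proof (cases "i = 0")
        case True
        have "sat (V (Suc j)) t \<subseteq> sat (Usat (Suc j)) t"
          using V_subset_Usat[OF j(2)] by (intro sat_mono)
        also have "\<dots> \<subseteq> Usat (Suc j) t" using sat_sat[OF sub_W[OF j(2)]] by (simp add: Usat_def)
        also have "\<dots> \<subseteq> V (Suc j) t" using t0 it True W_subset_V[OF j(2)] by auto
        finally show ?thesis using van_0_iff[OF sub_V[OF j(2)]] True by blast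
      next
        case False
        then show ?thesis
          using van_sat_closed[OF sub_Usat[OF j(2)] sub_V[OF j(2)] V_subset_Usat[OF j(2)] Usat_subset_sat_V[OF j(2)]]
            r it unfolding vanish_above_def by auto
      qed
    qed
    then have "vanish_above (adj (Usat j) (l (Suc j))) (max r t0)" by (simp add: V_def)
    then show ?case
      using vanish_above_of_adj[OF sub_Usat[OF j(1)] linear Usat_regular] step by blast
  qed
  then show ?thesis by blast
qed

end

section \<open>Bounds for the coefficients of a Hilbert polynomial\<close>

text \<open>A Hilbert polynomial without the alternating signs of its coefficients. In this basis
  the backward difference drops the last coefficient and keeps the others, so a single sequence
  \<open>e\<close> serves all modules of the chain.\<close>

definition newton :: "(nat \<Rightarrow> int) \<Rightarrow> nat \<Rightarrow> rat \<Rightarrow> rat" where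
  "newton e k t = (\<Sum>i<k. of_int (e i) * ((t + of_nat (k - 1 - i)) gchoose (k - 1 - i)))"

lemma gchoose_backward_difference:
  fixes t :: rat
  shows "((t + of_nat (Suc m)) gchoose Suc m) - ((t - 1 + of_nat (Suc m)) gchoose Suc m) = (t + of_nat m) gchoose m"
proof -
  have "((t + of_nat m + 1) gchoose Suc m) = ((t + of_nat m) gchoose m) + ((t + of_nat m) gchoose Suc m)"
    by (rule gbinomial_Suc_Suc)
  moreover have "t + of_nat (Suc m) = t + of_nat m + 1" "t - 1 + of_nat (Suc m) = t + of_nat m" by auto
  ultimately show ?thesis by (metis add_diff_cancel_right')
qed

lemma newton_difference: "newton e (Suc k) t - newton e (Suc k) (t - 1) = newton e k t"
proof -
  have "newton e (Suc k) t - newton e (Suc k) (t - 1) = (\<Sum>i<k. of_int (e i) *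
      (((t + of_nat (k - i)) gchoose (k - i)) - ((t - 1 + of_nat (k - i)) gchoose (k - i))))"
    unfolding newton_def by (simp add: right_diff_distrib sum_subtractf)
  also have "\<dots> = newton e k t"
    unfolding newton_def
  proof (intro sum.cong refl)
    fix i assume "i \<in> {..<k}"
    then have k: "k - i = Suc (k - 1 - i)" by auto
    show "of_int (e i) * (((t + of_nat (k - i)) gchoose (k - i)) - ((t - 1 + of_nat (k - i)) gchoose (k - i)))
        = of_int (e i) * ((t + of_nat (k - 1 - i)) gchoose (k - 1 - i))"
      unfolding k gchoose_backward_difference ..
  qed
  finally show ?thesis .
qed

text \<open>All binomials with positive lower index vanish at -1, which isolates the last
  coefficient. Since the Hilbert functions vanish in that degree, a coefficient is, up to sign, the
  gap between function and polynomial there.\<close>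

lemma newton_minus_one: "newton e (Suc k) (- 1) = of_int (e k)"
proof -
  have "(- 1 + of_nat (k - i) :: rat) gchoose (k - i) = 0" if "i < k" for i
  proof -
    have k: "k - i = Suc (k - 1 - i)" using that by auto
    have "(- 1 + of_nat (k - i) :: rat) = of_nat (k - 1 - i)" unfolding k by simp
    then show ?thesis unfolding k by (metis binomial_gbinomial binomial_eq_0 lessI of_nat_0)
  qed
  then show ?thesis unfolding newton_def by simp
qed

lemma newton_cong: "(\<And>i. i < k \<Longrightarrow> e i = e' i) \<Longrightarrow> newton e k t = newton e' k t"
  unfolding newton_def by simp

lemma newton_inj:
  assumes "\<And>t. newton e k t = newton e' k t" "i < k"
  shows "e i = e' i"
  using assms
proof (induction k)
  case (Suc k)
  have "newton e k t = newton e' k t" for t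
    using newton_difference[of e k t] newton_difference[of e' k t] Suc.prems(1) by simp
  moreover have "e k = e' k" using newton_minus_one[of e k] newton_minus_one[of e' k] Suc.prems(1) by simp
  ultimately show ?case using Suc by (cases "i = k") auto
qed simp

text \<open>Numerical data of a filter regular sequence: \<open>h\<close>, \<open>hb\<close>, \<open>w\<close> stand for the Hilbert functions
  of \<open>F / V j\<close>, \<open>F / Usat j\<close> and \<open>F / W j\<close>.\<close>

locale hilbert_data =
  fixes d :: nat and r :: int and B :: int and hb h w :: "nat \<Rightarrow> int \<Rightarrow> int"
  assumes difference: "j < d \<Longrightarrow> hb j t - hb j (t - 1) = h (Suc j) t"
    and hb_le_h: "j \<le> d \<Longrightarrow> hb j t \<le> h j t"
    and hb_eq_h: "1 \<le> j \<Longrightarrow> j \<le> d \<Longrightarrow> t > r \<Longrightarrow> hb j t = h j t"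
    and hb_last: "hb d t = 0"
    and hb_neg: "j \<le> d \<Longrightarrow> t < 0 \<Longrightarrow> hb j t = 0"
    and hb_nonneg: "j \<le> d \<Longrightarrow> 0 \<le> hb j t"
    and h_le_w: "j \<le> d \<Longrightarrow> h j t \<le> w j t"
    and w_difference: "j < d \<Longrightarrow> w j t - w j (t - 1) \<le> w (Suc j) t"
    and w_neg: "j \<le> d \<Longrightarrow> t < 0 \<Longrightarrow> w j t = 0"
    and w_sum: "(\<Sum>s\<in>{0..T}. w d s) \<le> B"
begin

lemma w_nonneg: "j \<le> d \<Longrightarrow> 0 \<le> w j t"
  using hb_nonneg hb_le_h h_le_w order_trans by meson

lemma B_nonneg: "0 \<le> B"
  using w_sum[of "- 1"] by simp

text \<open>The Hilbert functions become polynomial by repeated summation from the end of the chain.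
  Integrality comes with it, each new coefficient being a constant of summation.\<close>

lemma ex_newton:
  assumes "k \<le> d"
  shows "\<exists>e. \<forall>k'\<le>k. \<forall>t\<ge>max r 0. of_int (hb (d - k') t) = newton e k' (of_int t)"
  using assms
proof (induction k)
  case 0
  then show ?case by (auto simp: newton_def hb_last)
next
  case (Suc k)
  then obtain e where e: "\<And>k' t. k' \<le> k \<Longrightarrow> t \<ge> max r 0 \<Longrightarrow> of_int (hb (d - k') t) = newton e k' (of_int t)"
    by auto
  define r' where "r' = max r 0"
  \<comment> \<open>The constant of summation: its binomial factor is 1, so matching the value in
    degree \<open>r'\<close> determines it as an integer.\<close>
  define v where "v = hb (d - Suc k) r' - (\<Sum>i<k. e i * int (nat (r' + int (k - i)) choose (k - i)))"
  define e' where "e' = e(k := v)"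
  have le: "newton e' k' t = newton e k' t" if "k' \<le> k" for k' t
    using that by (intro newton_cong) (auto simp: e'_def)
  have c: "(of_int r' + of_nat m :: rat) gchoose m = of_int (int (nat (r' + int m) choose m))" for m
  proof -
    have "(of_int r' + of_nat m :: rat) = of_nat (nat (r' + int m))"
      by (simp add: r'_def of_nat_nat)
    then show ?thesis by (metis binomial_gbinomial of_int_of_nat_eq)
  qed
  have at: "newton e' (Suc k) (of_int r') = of_int (hb (d - Suc k) r')"
    unfolding newton_def by (simp add: c e'_def v_def del: of_nat_diff of_nat_add)
  \<comment> \<open>Above \<open>r\<close> the values of \<open>h\<close> and \<open>hb\<close> for
    the next module agree, so both sides have the same difference.\<close>
  have all: "of_int (hb (d - Suc k) t) = newton e' (Suc k) (of_int t)" if "t \<ge> r'" for t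
    using that
  proof (induction t rule: int_ge_induct)
    case base
    then show ?case using at by simp
  next
    case (step t)
    have "newton e' (Suc k) (of_int (t + 1)) = newton e' (Suc k) (of_int t) + newton e k (of_int (t + 1))"
      using newton_difference[of e' k "of_int (t + 1)"] le[of k] by simp
    also have "\<dots> = of_int (hb (d - Suc k) t) + of_int (hb (d - k) (t + 1))"
      using step e[of k "t + 1"] by (simp add: r'_def)
    also have "hb (d - k) (t + 1) = h (Suc (d - Suc k)) (t + 1)"
      using hb_eq_h[of "d - k" "t + 1"] step Suc.prems by (simp add: Suc_diff_Suc r'_def)
    also have "\<dots> = hb (d - Suc k) (t + 1) - hb (d - Suc k) t"
      using difference[of "d - Suc k" "t + 1"] Suc.prems by simp
    finally show ?case by simp
  qed
  show ?case
  proof (intro exI[of _ e'] allI impI)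
    fix k' t assume "k' \<le> Suc k" "t \<ge> max r 0"
    then show "of_int (hb (d - k') t) = newton e' k' (of_int t)"
      using all[of t] e[of k' t] le[of k'] by (cases "k' = Suc k") (auto simp: r'_def)
  qed
qed

text \<open>Each summation from degree 0 to \<open>t\<close> costs a factor \<open>t + 1\<close>,
  except the first one, which \<open>w_sum\<close> bounds by \<open>B\<close> in total; hence the
  exponent \<open>k - 1\<close>.\<close>

lemma w_bound: "1 \<le> k \<Longrightarrow> k \<le> d \<Longrightarrow> 0 \<le> t \<Longrightarrow> w (d - k) t \<le> B * (t + 1) ^ (k - 1)"
proof (induction k arbitrary: t rule: nat_induct_at_least)
  case base
  have "w (d - 1) t \<le> (\<Sum>s\<in>{0..t}. w d s)" if "0 \<le> t" for t
    using that
  proof (induction t rule: int_ge_induct)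
    case base
    then show ?case using w_difference[of "d - 1" 0] w_neg[of "d - 1" "-1"] \<open>1 \<le> d\<close> by simp
  next
    case (step t)
    have "{0..t + 1} = insert (t + 1) {0..t}" using step by auto
    then show ?case using w_difference[of "d - 1" "t + 1"] step \<open>1 \<le> d\<close> by simp
  qed
  then show ?case using w_sum[of t] base by force
next
  case (Suc k)
  \<comment> \<open>Induction on \<open>s\<close> with the factor for the final degree
    \<open>t\<close> held fixed, so that every step adds the same amount.\<close>
  have "w (d - Suc k) s \<le> (s + 1) * (B * (t + 1) ^ (k - 1))" if "0 \<le> s" "s \<le> t" for s
    using that
  proof (induction s rule: int_ge_induct)
    case base
    have "w (d - Suc k) 0 \<le> w (d - k) 0"
      using w_difference[of "d - Suc k" 0] w_neg[of "d - Suc k" "-1"] Suc.prems by (simp add: Suc_diff_Suc)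
    also have "\<dots> \<le> B" using Suc.IH[of 0] Suc.prems by simp
    also have "\<dots> \<le> B * (t + 1) ^ (k - 1)"
      using B_nonneg Suc.prems one_le_power[of "t + 1" "k - 1"] mult_left_mono[of 1 "(t + 1) ^ (k - 1)" B] by simp
    finally show ?case by simp
  next
    case (step s)
    have "w (d - Suc k) (s + 1) \<le> w (d - Suc k) s + w (d - k) (s + 1)"
      using w_difference[of "d - Suc k" "s + 1"] Suc.prems by (simp add: Suc_diff_Suc)
    also have "w (d - k) (s + 1) \<le> B * (s + 1 + 1) ^ (k - 1)"
      using Suc.IH[of "s + 1"] Suc.prems step by simp
    also have "\<dots> \<le> B * (t + 1) ^ (k - 1)"
      using step B_nonneg by (intro mult_left_mono power_mono) auto
    finally have "w (d - Suc k) (s + 1) \<le> w (d - Suc k) s + B * (t + 1) ^ (k - 1)" by simp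
    then show ?case using step by (simp add: algebra_simps)
  qed
  from this[of t] show ?case
    using Suc by (cases k) (auto simp: algebra_simps)
qed

text \<open>\<open>k\<close> counts from the end of the chain. For \<open>k < d\<close> this defect
  vanishes above \<open>r\<close>, which is why the sums below may stop at \<open>r\<close>.\<close>

definition A :: "nat \<Rightarrow> int \<Rightarrow> int" where "A k t = h (d - k) t - hb (d - k) t"

text \<open>\<open>hb (d - k)\<close> minus its polynomial is \<open>Ev k - Od k\<close>; \<open>A\<close> enters
  \<open>Od\<close> only, so that each step back in the chain exchanges the two.\<close>

fun Od Ev :: "nat \<Rightarrow> int \<Rightarrow> int" where
  "Od 0 t = 0"
| "Ev 0 t = 0"
| "Od (Suc k) t = (\<Sum>s\<in>{t + 1..r}. A k s + Ev k s)"
| "Ev (Suc k) t = (\<Sum>s\<in>{t + 1..r}. Od k s)"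

lemma A_nonneg: "k \<le> d \<Longrightarrow> 0 \<le> A k t"
  unfolding A_def using hb_le_h[of "d - k" t] by simp

lemma Od_Ev_nonneg: "k \<le> d \<Longrightarrow> 0 \<le> Od k t \<and> 0 \<le> Ev k t"
proof (induction k arbitrary: t)
  case (Suc k)
  then show ?case using A_nonneg[of k] by (auto intro!: sum_nonneg add_nonneg_nonneg simp: sum.distrib)
qed simp

lemma A_le_w: "k \<le> d \<Longrightarrow> A k t \<le> w (d - k) t"
  unfolding A_def using hb_nonneg[of "d - k" t] h_le_w[of "d - k" t] by simp

text \<open>The absolute value of a difference of nonnegative numbers is at most the larger one, so
  bounding \<open>Od\<close> and \<open>Ev\<close> separately loses nothing to the triangle
  inequality. The third conjunct, on the summand of the next \<open>Od\<close>, keeps the induction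
  going.\<close>

lemma A_Od_Ev_bound:
  assumes r: "0 \<le> r"
  shows "1 \<le> k \<Longrightarrow> k \<le> d \<Longrightarrow> - 1 \<le> t \<Longrightarrow> Od k t \<le> B * (r + 1) ^ (k - 1) \<and> Ev k t \<le> B * (r + 1) ^ (k - 1)
    \<and> (k < d \<longrightarrow> 0 \<le> t \<longrightarrow> A k t + Ev k t \<le> B * (r + 1) ^ (k - 1))"
proof (induction k arbitrary: t rule: nat_induct_at_least)
  case base
  have "Od (Suc 0) t \<le> (\<Sum>s\<in>{t + 1..r}. w d s)"
    using A_le_w[of 0] by (auto intro!: sum_mono)
  also have "\<dots> \<le> (\<Sum>s\<in>{0..r}. w d s)"
    using base w_nonneg by (intro sum_mono2) auto
  also have "\<dots> \<le> B" by (rule w_sum)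
  finally have "Od (Suc 0) t \<le> B" .
  then show ?case using B_nonneg A_le_w[of 1 t] w_bound[of 1 t] base by auto
next
  case (Suc k)
  define P where "P = B * (r + 1) ^ (k - 1)"
  have P0: "0 \<le> P" unfolding P_def using B_nonneg r by simp
  have P: "B * (r + 1) ^ (Suc k - 1) = (r + 1) * P"
    unfolding P_def using Suc.hyps by (cases k) auto
  have c: "int (card {t + 1..r}) \<le> r + 1" using Suc.prems r by auto
  have "(\<Sum>s\<in>{t + 1..r}. A k s + Ev k s) \<le> (\<Sum>s\<in>{t + 1..r}. P)"
    unfolding P_def using Suc.IH Suc.prems by (intro sum_mono) auto
  also have "\<dots> \<le> (r + 1) * P" using mult_right_mono[OF c P0] by simp
  finally have 1: "Od (Suc k) t \<le> (r + 1) * P" by simp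
  have "(\<Sum>s\<in>{t + 1..r}. Od k s) \<le> (\<Sum>s\<in>{t + 1..r}. P)"
    unfolding P_def using Suc.IH Suc.prems by (intro sum_mono) auto
  also have "(\<Sum>s\<in>{t + 1..r}. P) = int (nat (r - t)) * P" by simp
  finally have 2: "Ev (Suc k) t \<le> int (nat (r - t)) * P" by simp
  have 3: "int (nat (r - t)) * P \<le> (r + 1) * P"
    using Suc.prems r by (intro mult_right_mono P0) auto
  \<comment> \<open>The balance that avoids a factor 2: in degree \<open>t\<close> the defect is at
    most \<open>(t + 1) * P\<close>, while \<open>Ev\<close> sums only the \<open>r - t\<close>
    degrees above \<open>t\<close>, so together they are at most \<open>(r + 1) * P\<close>.\<close>
  have 4: "A (Suc k) t + Ev (Suc k) t \<le> (r + 1) * P" if k: "Suc k < d" and t: "0 \<le> t"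
  proof (cases "t > r")
    case True
    have "A (Suc k) t = 0" unfolding A_def using hb_eq_h[of "d - Suc k" t] k True by simp
    moreover have "Ev (Suc k) t \<le> 0" using True by simp
    moreover have "0 \<le> (r + 1) * P" using r P0 by simp
    ultimately show ?thesis by linarith
  next
    case False
    have "A (Suc k) t \<le> B * (t + 1) ^ k"
      using A_le_w[of "Suc k" t] w_bound[of "Suc k" t] k t by simp
    also have "\<dots> = (t + 1) * (B * (t + 1) ^ (k - 1))" using Suc.hyps by (cases k) auto
    also have "\<dots> \<le> (t + 1) * P"
      unfolding P_def using False t B_nonneg by (intro mult_left_mono power_mono) auto
    finally have "A (Suc k) t \<le> (t + 1) * P" .
    moreover have "Ev (Suc k) t \<le> (r - t) * P" using 2 False by simp
    ultimately show ?thesis by (simp add: algebra_simps)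
  qed
  show ?case unfolding P using 1 2 3 4 by auto
qed

text \<open>Both sides vanish from degree \<open>r\<close> on and have the same backward difference:
  the polynomial passes to that of the next module of the chain, and \<open>A\<close> is the gap
  between \<open>h\<close> and \<open>hb\<close> there.\<close>

lemma defect:
  assumes e: "\<And>k t. k \<le> d \<Longrightarrow> t \<ge> max r 0 \<Longrightarrow> of_int (hb (d - k) t) = newton e k (of_int t)"
  shows "k \<le> d \<Longrightarrow> of_int (hb (d - k) t) - newton e k (of_int t) = of_int (Ev k t - Od k t)"
proof (induction k arbitrary: t)
  case 0
  then show ?case by (simp add: newton_def hb_last)
next
  case (Suc k)
  define D where "D = (\<lambda>t. of_int (hb (d - Suc k) t) - newton e (Suc k) (of_int t))"
  have step: "D t - D (t - 1) = of_int (A k t + Ev k t - Od k t)" for t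
  proof -
    have "hb (d - Suc k) t - hb (d - Suc k) (t - 1) = h (d - k) t"
      using difference[of "d - Suc k" t] Suc.prems by (simp add: Suc_diff_Suc)
    then have "D t - D (t - 1) = of_int (h (d - k) t) - newton e k (of_int t)"
      unfolding D_def using newton_difference[of e k "of_int t"] by (simp flip: \<open>hb (d - Suc k) t - _ = _\<close>)
    also have "\<dots> = of_int (A k t) + (of_int (hb (d - k) t) - newton e k (of_int t))"
      by (simp add: A_def)
    also have "\<dots> = of_int (A k t + Ev k t - Od k t)" using Suc.IH[of t] Suc.prems by simp
    finally show ?thesis .
  qed
  have zero: "A k t + Ev k t - Od k t = 0" if "t > r" for t
  proof -
    have "A k t = 0" unfolding A_def using hb_eq_h[of "d - k" t] that Suc.prems by simp
    moreover have "Ev k t = 0" "Od k t = 0" using that by (cases k; simp)+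
    ultimately show ?thesis by simp
  qed
  \<comment> \<open>The hypothesis gives agreement only from \<open>max r 0\<close> on. For negative
    \<open>r\<close> it extends down to \<open>r\<close> because the backward difference is zero
    above \<open>r\<close>.\<close>
  have top: "D t = 0" if "t \<ge> r" for t
  proof -
    have "D (t + int m) = D t" for m
    proof (induction m)
      case (Suc m)
      have "D (t + int m + 1) - D (t + int m) = 0"
        using step[of "t + int m + 1"] zero[of "t + int m + 1"] that by simp
      then show ?case using Suc by (simp add: algebra_simps)
    qed simp
    moreover have "D (t + int (nat (max r 0 - t))) = 0"
    proof -
      have "t + int (nat (max r 0 - t)) \<ge> max r 0" by linarith
      from e[OF Suc.prems this] show ?thesis unfolding D_def by simp
    qed
    ultimately show ?thesis by metis
  qed
  have "D t = of_int (Ev (Suc k) t - Od (Suc k) t)"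
  proof (cases "t \<ge> r")
    case True
    then show ?thesis using top by simp
  next
    case False
    then have "t \<le> r" by simp
    then show ?thesis
    proof (induction t rule: int_le_induct)
      case base
      then show ?case using top by simp
    next
      case (step t)
      have s: "{t - 1 + 1..r} = insert t {t + 1..r}" using step by auto
      have "D (t - 1) = D t - of_int (A k t + Ev k t - Od k t)" using \<open>\<And>t. D t - D (t - 1) = _\<close>[of t] by simp
      also have "\<dots> = of_int (Ev (Suc k) (t - 1) - Od (Suc k) (t - 1))"
        unfolding Ev.simps Od.simps s using step by simp
      finally show ?case .
    qed
  qed
  then show ?case unfolding D_def .
qed

text \<open>The defect is evaluated in degree -1, where \<open>hb\<close> is zero and the polynomial
  takes the coefficient as its value. For negative \<open>r\<close> the sums defining
  \<open>Od\<close> and \<open>Ev\<close> are empty there.\<close>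

lemma coefficient_bound:
  assumes e: "\<And>k t. k \<le> d \<Longrightarrow> t \<ge> max r 0 \<Longrightarrow> of_int (hb (d - k) t) = newton e k (of_int t)"
    and i: "i < d"
  shows "0 \<le> r \<Longrightarrow> \<bar>e i\<bar> \<le> B * (r + 1) ^ i" "r < 0 \<Longrightarrow> e i = 0"
proof -
  have "of_int (hb (d - Suc i) (- 1)) - newton e (Suc i) (of_int (- 1)) = of_int (Ev (Suc i) (- 1) - Od (Suc i) (- 1))"
    using i by (intro defect[OF e]) auto
  then have "of_int (- e i) = (of_int (Ev (Suc i) (- 1) - Od (Suc i) (- 1)) :: rat)"
    using hb_neg[of "d - Suc i" "- 1"] i by (simp add: newton_minus_one)
  then have *: "- e i = Ev (Suc i) (- 1) - Od (Suc i) (- 1)" by (simp only: of_int_eq_iff)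
  show "r < 0 \<Longrightarrow> e i = 0" using * by simp
  show "0 \<le> r \<Longrightarrow> \<bar>e i\<bar> \<le> B * (r + 1) ^ i"
    using A_Od_Ev_bound[of "Suc i" "- 1"] Od_Ev_nonneg[of "Suc i" "- 1"] * i by auto
qed

end

section \<open>Dimensions of images and quotients\<close>

context vector_space begin

lemma finite_basis_extend:
  assumes "S \<subseteq> V" "independent S" "V \<subseteq> span X" "finite X"
  obtains B where "S \<subseteq> B" "B \<subseteq> V" "independent B" "V \<subseteq> span B" "finite B" "card B = dim V"
proof -
  obtain B where B: "S \<subseteq> B" "B \<subseteq> V" "independent B" "V \<subseteq> span B"
    using maximal_independent_subset_extend[OF assms(1,2)] by blast
  have "finite B" using independent_span_bound[OF assms(4) B(3)] B(2) assms(3) by blast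
  then show ?thesis using that B basis_card_eq_dim by blast
qed

lemma dim_mono_finite:
  assumes "U \<subseteq> V" "V \<subseteq> span X" "finite X"
  shows "dim U \<le> dim V"
proof -
  obtain S where S: "S \<subseteq> U" "independent S" "U \<subseteq> span S" "card S = dim U" by (rule basis_exists)
  then obtain B where "S \<subseteq> B" "finite B" "card B = dim V"
    using finite_basis_extend[OF _ S(2) assms(2,3)] assms(1) by (metis dual_order.trans)
  then show ?thesis using S(4) card_mono by metis
qed

text \<open>Rank and nullity for the map induced by \<open>L\<close> from \<open>V\<close> to the
  quotient by \<open>U\<close>, without forming the quotient: a basis of the kernel is extended to
  \<open>V\<close>, and the images of the new vectors join a basis of \<open>U\<close>.\<close>

lemma dim_add_image:
  assumes U: "subspace U" "U \<subseteq> span Y" "finite Y" and V: "subspace V" "V \<subseteq> span X" "finite X"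
    and L: "Vector_Spaces.linear scale scale L"
  shows "dim {u + L v | u v. u \<in> U \<and> v \<in> V} + dim {v \<in> V. L v \<in> U} = dim U + dim V"
proof -
  interpret L: Vector_Spaces.linear scale scale L by (rule L)
  define K where "K = {v \<in> V. L v \<in> U}"
  have K: "subspace K" unfolding K_def
    using U(1) V(1) by (auto simp: subspace_def L.add L.scale L.zero)
  have "K \<subseteq> V" by (auto simp: K_def)
  obtain BU where BU: "BU \<subseteq> U" "independent BU" "U \<subseteq> span BU" "finite BU" "card BU = dim U"
    using finite_basis_extend[of "{}" U Y] U by (auto simp: independent_empty)
  obtain BK where BK: "BK \<subseteq> K" "independent BK" "K \<subseteq> span BK" "finite BK" "card BK = dim K"
    using finite_basis_extend[of "{}" K X] V \<open>K \<subseteq> V\<close> by (auto simp: independent_empty)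
  obtain BV where BV: "BK \<subseteq> BV" "BV \<subseteq> V" "independent BV" "V \<subseteq> span BV" "finite BV" "card BV = dim V"
    using finite_basis_extend[of BK V X] V \<open>K \<subseteq> V\<close> BK by (metis dual_order.trans)
  have sU: "span BU = U" using span_minimal[OF BU(1) U(1)] BU(3) by blast
  have Z: "independent (BU \<union> L ` Z) \<and> card (BU \<union> L ` Z) = card BU + card Z" if "finite Z" "Z \<subseteq> BV - BK" for Z
    using that
  proof (induction Z)
    case empty
    then show ?case using BU by simp
  next
    case (insert z Z)
    have zV: "z \<in> V" "Z \<subseteq> V" using insert BV by auto
    have "L z \<notin> span (BU \<union> L ` Z)"
    proof
      assume "L z \<in> span (BU \<union> L ` Z)"
      then obtain u y where uy: "L z = u + y" "u \<in> span BU" "y \<in> span (L ` Z)"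
        unfolding span_Un by blast
      then obtain y' where y': "y = L y'" "y' \<in> span Z" using L.span_image by blast
      have "y' \<in> V" using y' span_minimal[OF zV(2) V(1)] by blast
      then have "z - y' \<in> K" unfolding K_def
        using zV uy y' sU subspace_diff[OF V(1)] by (simp add: L.diff)
      then have "z - y' \<in> span (BV - {z})"
        using BK(3) span_mono[of BK "BV - {z}"] BV(1) insert.prems by blast
      moreover have "y' \<in> span (BV - {z})"
        using y'(2) span_mono[of Z "BV - {z}"] insert.prems insert.hyps by blast
      ultimately have "z \<in> span (BV - {z})" using span_add[of "z - y'" _ y'] by simp
      then show False using BV(3) insert.prems unfolding dependent_def by blast
    qed
    moreover have "L z \<notin> BU \<union> L ` Z" using calculation span_base[of "L z" "BU \<union> L ` Z"] by blast
    ultimately show ?case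
      using insert BU(4) by (simp add: independent_insertI)
  qed
  have fin: "finite (BV - BK)" using BV by simp
  let ?B = "BU \<union> L ` (BV - BK)"
  have "dim {u + L v | u v. u \<in> U \<and> v \<in> V} = card ?B"
  proof (rule basis_card_eq_dim[symmetric])
    show "?B \<subseteq> {u + L v | u v. u \<in> U \<and> v \<in> V}"
    proof
      fix y assume "y \<in> ?B"
      then consider "y \<in> U" | v where "y = L v" "v \<in> V" using BU(1) BV(2) by blast
      then show "y \<in> {u + L v | u v. u \<in> U \<and> v \<in> V}"
      proof cases
        case 1
        then have "y = y + L 0 \<and> y \<in> U \<and> 0 \<in> V" using subspace_0[OF V(1)] by (simp add: L.zero)
        then show ?thesis by blast
      next
        case (2 v)
        then have "y = 0 + L v \<and> 0 \<in> U \<and> v \<in> V" using subspace_0[OF U(1)] by simp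
        then show ?thesis by blast
      qed
    qed
    show "{u + L v | u v. u \<in> U \<and> v \<in> V} \<subseteq> span ?B"
    proof clarify
      fix u v assume u: "u \<in> U" and v: "v \<in> V"
      have "v \<in> span (BK \<union> (BV - BK))" using v BV(1,4) by (metis Diff_partition subsetD)
      then obtain k y where ky: "v = k + y" "k \<in> span BK" "y \<in> span (BV - BK)" unfolding span_Un by blast
      then have "k \<in> K" using span_minimal[OF BK(1) K] by blast
      then have "u + L k \<in> span BU" using u U(1) sU by (simp add: K_def subspace_add)
      moreover have "L y \<in> span (L ` (BV - BK))" using ky(3) L.span_image by blast
      ultimately have "(u + L k) + L y \<in> span ?B" unfolding span_Un by blast
      then show "u + L v \<in> span ?B" by (simp add: ky(1) L.add add.assoc)
    qed
    show "independent ?B" using Z[OF fin] by blast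
  qed
  then have "dim {u + L v | u v. u \<in> U \<and> v \<in> V} = card BU + card (BV - BK)" using Z[OF fin] by simp
  moreover have "card (BV - BK) + card BK = card BV"
    using BV BK by (metis card_Diff_subset card_mono le_add_diff_inverse2)
  ultimately show ?thesis using BU(5) BK(5) BV(6) by (simp add: K_def)
qed

end

text \<open>\<open>k_dim\<close> refers to vector spaces given by records, while dimensions are
  computed for subspaces of a type. The record \<open>N\<close> is known only as an image; its
  vector space laws are transported along \<open>\<psi>\<close> before the dimensions are
  compared.\<close>

lemma vector_space_k_dim:
  fixes scale :: "'k::field \<Rightarrow> 'b::ab_group_add \<Rightarrow> 'b" and N :: "('k mpoly, 'n) graded_module"
  assumes vs: "vector_space scale"
    and V: "Modules.module.subspace scale V" "V \<subseteq> Modules.module.span scale X" "finite X"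
    and add: "\<And>f g. f \<in> V \<Longrightarrow> g \<in> V \<Longrightarrow> \<psi> (f + g) = \<psi> f \<oplus>\<^bsub>N\<^esub> \<psi> g"
    and sm: "\<And>c f. f \<in> V \<Longrightarrow> \<psi> (scale c f) = const_poly c \<odot>\<^bsub>N\<^esub> \<psi> f"
    and zero: "\<psi> 0 = \<zero>\<^bsub>N\<^esub>" and car: "carrier N = \<psi> ` V"
  shows "k_dim N = vector_space.dim scale V - vector_space.dim scale {f \<in> V. \<psi> f = \<zero>\<^bsub>N\<^esub>}"
proof -
  interpret S: vector_space scale by (rule vs)
  let ?R = "restrict_scalars N"
  have V0: "0 \<in> V" and Vadd: "\<And>f g. f \<in> V \<Longrightarrow> g \<in> V \<Longrightarrow> f + g \<in> V" and Vsc: "\<And>c f. f \<in> V \<Longrightarrow> scale c f \<in> V"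
    and Vneg: "\<And>f. f \<in> V \<Longrightarrow> - f \<in> V"
    using V(1) S.subspace_neg by (auto simp: S.subspace_def)
  have sel: "carrier ?R = \<psi> ` V" "add ?R = add N" "zero ?R = zero N" "smult ?R = (\<lambda>c y. const_poly c \<odot>\<^bsub>N\<^esub> y)"
    by (simp_all add: restrict_scalars_def car)
  have ag: "abelian_group ?R"
  proof (rule abelian_groupI)
    fix y assume "y \<in> carrier ?R"
    then obtain f where f: "f \<in> V" "y = \<psi> f" by (auto simp: sel)
    have "\<psi> (- f) \<oplus>\<^bsub>N\<^esub> \<psi> f = \<zero>\<^bsub>N\<^esub>" using add[OF Vneg[OF f(1)] f(1)] zero by simp
    then show "\<exists>z\<in>carrier ?R. z \<oplus>\<^bsub>?R\<^esub> y = \<zero>\<^bsub>?R\<^esub>" using f Vneg by (auto simp: sel)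
    show "\<zero>\<^bsub>?R\<^esub> \<oplus>\<^bsub>?R\<^esub> y = y" using add[OF V0 f(1)] f(2) zero by (simp add: sel)
  next
    show "\<zero>\<^bsub>?R\<^esub> \<in> carrier ?R" using V0 by (simp add: sel flip: zero)
  next
    fix y z assume "y \<in> carrier ?R" "z \<in> carrier ?R"
    then obtain f g where fg: "f \<in> V" "y = \<psi> f" "g \<in> V" "z = \<psi> g" by (auto simp: sel)
    show "y \<oplus>\<^bsub>?R\<^esub> z \<in> carrier ?R" using fg Vadd by (auto simp: sel add[symmetric])
    show "y \<oplus>\<^bsub>?R\<^esub> z = z \<oplus>\<^bsub>?R\<^esub> y" using fg add[OF fg(1,3)] add[OF fg(3,1)] by (simp add: sel add.commute)
    fix u assume "u \<in> carrier ?R"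
    then obtain h where h: "h \<in> V" "u = \<psi> h" by (auto simp: sel)
    show "y \<oplus>\<^bsub>?R\<^esub> z \<oplus>\<^bsub>?R\<^esub> u = y \<oplus>\<^bsub>?R\<^esub> (z \<oplus>\<^bsub>?R\<^esub> u)"
    proof -
      have "y \<oplus>\<^bsub>?R\<^esub> z \<oplus>\<^bsub>?R\<^esub> u = \<psi> (f + g + h)" using fg h add Vadd by (simp add: sel)
      moreover have "y \<oplus>\<^bsub>?R\<^esub> (z \<oplus>\<^bsub>?R\<^esub> u) = \<psi> (f + (g + h))" using fg h add Vadd by (simp add: sel)
      ultimately show ?thesis by (simp add: add.assoc)
    qed
  qed
  have cp: "const_poly (a + b) \<odot>\<^bsub>N\<^esub> y = const_poly a \<odot>\<^bsub>N\<^esub> y \<oplus>\<^bsub>N\<^esub> const_poly b \<odot>\<^bsub>N\<^esub> y" if "y \<in> \<psi> ` V" for a b y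
    using that by (auto simp: sm[symmetric] Vsc add[symmetric] S.scale_left_distrib)
  have mod: "module class_ring ?R"
  proof (rule moduleI)
    show "cring (class_ring :: 'k ring)" by (rule class_cring.cring_axioms)
    show "abelian_group ?R" by (rule ag)
  qed (auto simp: sel sm[symmetric] add[symmetric] Vsc Vadd cp S.scale_right_distrib)
  interpret vectorspace class_ring ?R
    using mod class_field.field_axioms by (simp add: vectorspace_def)
  have fs: "finsum ?R (\<lambda>z. a z \<odot>\<^bsub>?R\<^esub> \<psi> z) T = \<psi> (\<Sum>z\<in>T. scale (a z) z)" if "finite T" "T \<subseteq> V" for a T
    using that
  proof (induction T)
    case empty
    then show ?case using zero by (simp add: sel)
  next
    case (insert z T)
    have "finsum ?R (\<lambda>z. a z \<odot>\<^bsub>?R\<^esub> \<psi> z) (insert z T) = a z \<odot>\<^bsub>?R\<^esub> \<psi> z \<oplus>\<^bsub>?R\<^esub> finsum ?R (\<lambda>z. a z \<odot>\<^bsub>?R\<^esub> \<psi> z) T"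
      using insert by (intro finsum_insert) (auto simp: sel sm[symmetric] Vsc)
    also have "\<dots> = \<psi> (scale (a z) z) \<oplus>\<^bsub>N\<^esub> \<psi> (\<Sum>z\<in>T. scale (a z) z)"
      using insert sm by (simp add: sel)
    also have "\<dots> = \<psi> (scale (a z) z + (\<Sum>z\<in>T. scale (a z) z))"
      using insert Vsc by (intro add[symmetric] S.subspace_sum[OF V(1)]) auto
    finally show ?case using insert by simp
  qed
  define K where "K = {f \<in> V. \<psi> f = \<zero>\<^bsub>N\<^esub>}"
  have zN: "\<zero>\<^bsub>N\<^esub> \<oplus>\<^bsub>N\<^esub> \<zero>\<^bsub>N\<^esub> = \<zero>\<^bsub>N\<^esub>" using add[OF V0 V0] zero by simp
  have cz: "const_poly c \<odot>\<^bsub>N\<^esub> \<zero>\<^bsub>N\<^esub> = \<zero>\<^bsub>N\<^esub>" for c using sm[OF V0, of c] zero by simp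
  have K: "S.subspace K" unfolding K_def S.subspace_def
    using V0 zero Vadd Vsc by (auto simp: add sm zN cz)
  have "K \<subseteq> V" by (auto simp: K_def)
  obtain BK where BK: "BK \<subseteq> K" "S.independent BK" "K \<subseteq> S.span BK" "finite BK" "card BK = S.dim K"
    using S.finite_basis_extend[of "{}" K X] V \<open>K \<subseteq> V\<close> by (auto simp: S.independent_empty)
  obtain BV where BV: "BK \<subseteq> BV" "BV \<subseteq> V" "S.independent BV" "V \<subseteq> S.span BV" "finite BV" "card BV = S.dim V"
    using S.finite_basis_extend[of BK V X] V \<open>K \<subseteq> V\<close> BK by (metis dual_order.trans)
  \<comment> \<open>Basis vectors of \<open>V\<close> that complete a basis of the kernel; their
    images are going to be a basis of \<open>N\<close>.\<close>
  define Z where "Z = BV - BK"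
  have Zfin: "finite Z" and ZV: "Z \<subseteq> V" using BV by (auto simp: Z_def)
  have ind: "a z = 0" if "T \<subseteq> Z" "z \<in> T" "(\<Sum>z\<in>T. scale (a z) z) \<in> K" for a T z
  proof (rule ccontr)
    assume az: "a z \<noteq> 0"
    have fT: "finite T" using that Zfin finite_subset by blast
    have "(\<Sum>z\<in>T. scale (a z) z) = scale (a z) z + (\<Sum>z\<in>T - {z}. scale (a z) z)"
      using that(2) fT by (simp add: sum.remove)
    then have e: "scale (a z) z = (\<Sum>z\<in>T. scale (a z) z) - (\<Sum>z\<in>T - {z}. scale (a z) z)" by simp
    have "(\<Sum>z\<in>T. scale (a z) z) \<in> S.span (BV - {z})"
      using that BK(3) S.span_mono[of BK "BV - {z}"] BV(1) by (auto simp: Z_def)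
    moreover have "(\<Sum>z\<in>T - {z}. scale (a z) z) \<in> S.span (BV - {z})"
      using that(1) by (intro S.span_sum S.span_scale S.span_base) (auto simp: Z_def)
    ultimately have "scale (a z) z \<in> S.span (BV - {z})" unfolding e by (rule S.span_diff)
    from S.span_scale[OF this, of "inverse (a z)"] have "z \<in> S.span (BV - {z})" using az by simp
    then show False using BV(3) that unfolding S.dependent_def Z_def by blast
  qed
  have Kiff: "f \<in> K \<longleftrightarrow> \<psi> f = \<zero>\<^bsub>N\<^esub>" if "f \<in> V" for f using that by (simp add: K_def)
  have inj: "inj_on \<psi> Z"
  proof (rule inj_onI, rule ccontr)
    fix y z assume yz: "y \<in> Z" "z \<in> Z" "\<psi> y = \<psi> z" "y \<noteq> z"
    define a where "a = (\<lambda>u. if u = y then 1 else -1 :: 'k)"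
    have "(\<Sum>u\<in>{y, z}. scale (a u) u) = y - z" using yz by (simp add: a_def)
    moreover have "\<psi> (y - z) = \<zero>\<^bsub>N\<^esub>"
    proof -
      have "\<psi> (y - z) = \<psi> y \<oplus>\<^bsub>N\<^esub> \<psi> (- z)" using add[of y "- z"] yz ZV Vneg by auto
      also have "\<dots> = \<psi> (z + - z)" using add[of z "- z"] yz ZV Vneg by auto
      finally show ?thesis using zero by simp
    qed
    ultimately have "(\<Sum>u\<in>{y, z}. scale (a u) u) \<in> K"
      using Kiff[of "y - z"] yz ZV S.subspace_diff[OF V(1)] by auto
    from ind[OF _ _ this, of y] show False using yz by (simp add: a_def)
  qed
  have lc: "lincomb a (\<psi> ` T) = \<psi> (\<Sum>z\<in>T. scale (a (\<psi> z)) z)" if T: "T \<subseteq> Z" for a T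
  proof -
    have fT: "finite T" and TV: "T \<subseteq> V" using T Zfin ZV finite_subset by auto
    have "lincomb a (\<psi> ` T) = finsum ?R (\<lambda>z. a (\<psi> z) \<odot>\<^bsub>?R\<^esub> \<psi> z) T"
      unfolding lincomb_def using inj_on_subset[OF inj T] TV
      by (intro finsum_reindex) (auto simp: sel sm[symmetric] Vsc)
    then show ?thesis using fs[OF fT TV, of "\<lambda>z. a (\<psi> z)"] by simp
  qed
  have sub: "\<psi> ` Z \<subseteq> carrier ?R" using ZV by (auto simp: sel)
  have "basis (\<psi> ` Z)"
    unfolding basis_def
  proof (intro conjI)
    show "\<not> lin_dep (\<psi> ` Z)"
      unfolding lin_dep_def
    proof clarify
      fix A a v assume A: "A \<subseteq> \<psi> ` Z" "lincomb a A = \<zero>\<^bsub>?R\<^esub>" "v \<in> A" "a v \<noteq> \<zero>\<^bsub>class_ring\<^esub>"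
      obtain T where T: "T \<subseteq> Z" "A = \<psi> ` T" using A(1) by (meson subset_imageE)
      obtain z where z: "z \<in> T" "v = \<psi> z" using A(3) T by blast
      have "(\<Sum>z\<in>T. scale (a (\<psi> z)) z) \<in> V"
        using T ZV Vsc by (intro S.subspace_sum[OF V(1)]) auto
      then have "(\<Sum>z\<in>T. scale (a (\<psi> z)) z) \<in> K"
        using Kiff lc[OF T(1), of a] A(2) T(2) by (simp add: sel)
      from ind[OF T(1) z(1) this] show False using A(4) z by simp
    qed
    show "span (\<psi> ` Z) = carrier ?R"
    proof
      show "span (\<psi> ` Z) \<subseteq> carrier ?R" using span_is_subset2[OF sub] .
      show "carrier ?R \<subseteq> span (\<psi> ` Z)"
      proof
        fix y assume "y \<in> carrier ?R"
        then obtain f where f: "f \<in> V" "y = \<psi> f" by (auto simp: sel)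
        have "f \<in> S.span (BK \<union> Z)" using f BV(1,4) unfolding Z_def by (metis Diff_partition subsetD)
        then obtain k g where kg: "f = k + g" "k \<in> S.span BK" "g \<in> S.span Z" unfolding S.span_Un by blast
        have k: "k \<in> K" using kg S.span_minimal[OF BK(1) K] by blast
        obtain u where u: "g = (\<Sum>z\<in>Z. scale (u z) z)" using kg(3) S.span_finite[OF Zfin] by auto
        have g: "g \<in> V" using kg(3) S.span_minimal[OF ZV V(1)] by blast
        have "y = \<psi> k \<oplus>\<^bsub>N\<^esub> \<psi> g" using f kg add[of k g] k g by (simp add: K_def)
        also have "\<dots> = \<psi> g" using k add[OF V0 g] zero by (simp add: K_def)
        also have "\<dots> = lincomb (\<lambda>v. u (the_inv_into Z \<psi> v)) (\<psi> ` Z)"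
          using lc[of Z "\<lambda>v. u (the_inv_into Z \<psi> v)"] the_inv_into_f_f[OF inj] by (simp add: u)
        finally show "y \<in> span (\<psi> ` Z)" unfolding span_def using Zfin by fastforce
      qed
    qed
  qed (rule sub)
  then have "dim = card (\<psi> ` Z)" using dim_basis Zfin by blast
  also have "\<dots> = card Z" using card_image[OF inj] .
  also have "\<dots> = S.dim V - S.dim K"
    using BV BK card_Diff_subset[OF BK(4) BV(1)] by (simp add: Z_def)
  finally show ?thesis unfolding k_dim_def K_def .
qed

section \<open>Graded free modules\<close>

lemma poly_ring_simps [simp]:
  "mult (poly_ring n) = (*)" "one (poly_ring n) = 1" "zero (poly_ring n) = 0" "add (poly_ring n) = (+)"
  by (simp_all add: poly_ring_def)

lemma in_poly_ring: "p \<in> carrier (poly_ring n) \<longleftrightarrow> (\<forall>u\<in>Poly_Mapping.keys p. Poly_Mapping.keys u \<subseteq> {..<n})"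
  by (simp add: poly_ring_def)

lemma poly_ring_zero: "0 \<in> carrier (poly_ring n)"
  by (simp add: in_poly_ring)

lemma poly_ring_single: "Poly_Mapping.keys u \<subseteq> {..<n} \<Longrightarrow> Poly_Mapping.single u c \<in> carrier (poly_ring n)"
  by (auto simp: in_poly_ring split: if_splits)

lemma poly_ring_const: "const_poly c \<in> carrier (poly_ring n)"
  unfolding const_poly_def by (rule poly_ring_single) simp

lemma poly_ring_one: "1 \<in> carrier (poly_ring n)"
  using poly_ring_const[of 1] by (simp add: const_poly_def single_one)

lemma poly_ring_var: "j < n \<Longrightarrow> var j \<in> carrier (poly_ring n)"
  unfolding var_def by (rule poly_ring_single) simp

lemma poly_ring_add: "p \<in> carrier (poly_ring n) \<Longrightarrow> q \<in> carrier (poly_ring n) \<Longrightarrow> p + q \<in> carrier (poly_ring n)"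
  unfolding in_poly_ring using Poly_Mapping.keys_add[of p q] by blast

lemma poly_ring_uminus: "p \<in> carrier (poly_ring n) \<Longrightarrow> - p \<in> carrier (poly_ring n)"
  unfolding in_poly_ring by simp

lemma poly_ring_mult:
  assumes "p \<in> carrier (poly_ring n)" "q \<in> carrier (poly_ring n)"
  shows "p * q \<in> carrier (poly_ring n)"
  unfolding in_poly_ring
proof
  fix u assume "u \<in> Poly_Mapping.keys (p * q)"
  then obtain a b where "u = a + b" "a \<in> Poly_Mapping.keys p" "b \<in> Poly_Mapping.keys q"
    using keys_mult by blast
  then show "Poly_Mapping.keys u \<subseteq> {..<n}"
    using assms Poly_Mapping.keys_add[of a b] unfolding in_poly_ring by blast
qed

lemma poly_ring_power: "p \<in> carrier (poly_ring n) \<Longrightarrow> p ^ k \<in> carrier (poly_ring n)"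
  by (induction k) (auto simp: poly_ring_one poly_ring_mult)

lemma cring_poly_ring: "cring (poly_ring n)"
proof (rule cringI)
  show "abelian_group (poly_ring n)"
  proof (rule abelian_groupI)
    fix p assume "p \<in> carrier (poly_ring n)"
    then show "\<exists>q\<in>carrier (poly_ring n). q \<oplus>\<^bsub>poly_ring n\<^esub> p = \<zero>\<^bsub>poly_ring n\<^esub>"
      using poly_ring_uminus[of p n] by (intro bexI[of _ "- p"]) auto
  qed (auto simp: poly_ring_add poly_ring_zero algebra_simps)
  show "Group.comm_monoid (poly_ring n)"
    by (rule comm_monoidI) (auto simp: poly_ring_mult poly_ring_one algebra_simps)
qed (auto simp: algebra_simps)

lemma mon_deg_eq: "finite A \<Longrightarrow> Poly_Mapping.keys u \<subseteq> A \<Longrightarrow> mon_deg u = (\<Sum>i\<in>A. Poly_Mapping.lookup u i)"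
  unfolding mon_deg_def by (rule sum.mono_neutral_left) (auto simp: in_keys_iff)

lemma mon_deg_add: "mon_deg (u + v) = mon_deg u + mon_deg v"
proof -
  let ?A = "Poly_Mapping.keys u \<union> Poly_Mapping.keys v"
  show ?thesis
    using mon_deg_eq[of ?A u] mon_deg_eq[of ?A v] mon_deg_eq[of ?A "u + v"] Poly_Mapping.keys_add[of u v]
    by (simp add: lookup_add sum.distrib)
qed

lemma mon_deg_single [simp]: "mon_deg (Poly_Mapping.single i k) = k"
  by (simp add: mon_deg_def)

lemma mon_deg_0 [simp]: "mon_deg 0 = 0"
  by (simp add: mon_deg_def)

lemma mon_deg_0_iff: "mon_deg u = 0 \<longleftrightarrow> u = 0"
  by (auto simp: mon_deg_def in_keys_iff intro!: poly_mapping_eqI)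

lemma homog_carrier: "p \<in> homog n j \<Longrightarrow> p \<in> carrier (poly_ring n)"
  by (simp add: homog_def)

lemma homog_zero: "0 \<in> homog n j"
  by (simp add: homog_def poly_ring_zero)

lemma homog_add: "p \<in> homog n j \<Longrightarrow> q \<in> homog n j \<Longrightarrow> p + q \<in> homog n j"
  unfolding homog_def using poly_ring_add[of p n q] Poly_Mapping.keys_add[of p q] by blast

lemma homog_mult:
  assumes "p \<in> homog n i" "q \<in> homog n j"
  shows "p * q \<in> homog n (i + j)"
proof -
  have "mon_deg u = i + j" if u: "u \<in> Poly_Mapping.keys (p * q)" for u
  proof -
    obtain a b where "u = a + b" "a \<in> Poly_Mapping.keys p" "b \<in> Poly_Mapping.keys q"
      using u keys_mult[of p q] by blast
    then show ?thesis using assms by (simp add: homog_def mon_deg_add)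
  qed
  then show ?thesis using assms poly_ring_mult by (auto simp: homog_def)
qed

lemma homog_single: "Poly_Mapping.keys u \<subseteq> {..<n} \<Longrightarrow> Poly_Mapping.single u c \<in> homog n (mon_deg u)"
  by (auto simp: homog_def poly_ring_single split: if_splits)

lemma homog_const: "const_poly c \<in> homog n 0"
  using homog_single[of 0 n c] by (simp add: const_poly_def)

lemma homog_var: "j < n \<Longrightarrow> var j \<in> homog n 1"
  using homog_single[of "Poly_Mapping.single j 1" n 1] by (simp add: var_def)

lemma const_poly_simps:
  "const_poly 0 = 0" "const_poly 1 = 1" "const_poly (a + b) = const_poly a + const_poly b"
  "const_poly (a * b) = const_poly a * const_poly b" "const_poly (- a) = - const_poly a"
  by (simp_all add: const_poly_def single_one single_add mult_single single_uminus)

lemma poly_mapping_sum_monomials: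
  "p = (\<Sum>u\<in>Poly_Mapping.keys p. Poly_Mapping.single u (Poly_Mapping.lookup p u))"
proof (rule poly_mapping_eqI)
  fix v
  show "Poly_Mapping.lookup p v = Poly_Mapping.lookup (\<Sum>u\<in>Poly_Mapping.keys p. Poly_Mapping.single u (Poly_Mapping.lookup p u)) v"
    by (simp add: lookup_sum lookup_single when_def in_keys_iff)
qed

section \<open>Homogeneous components of polynomials\<close>

definition hcomp :: "nat \<Rightarrow> 'k::field mpoly \<Rightarrow> 'k mpoly" where
  "hcomp j p = (\<Sum>u\<in>{u \<in> Poly_Mapping.keys p. mon_deg u = j}. Poly_Mapping.single u (Poly_Mapping.lookup p u))"

lemma lookup_hcomp: "Poly_Mapping.lookup (hcomp j p) u = (if mon_deg u = j then Poly_Mapping.lookup p u else 0)"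
proof -
  have "Poly_Mapping.lookup (hcomp j p) u = (\<Sum>v\<in>{v \<in> Poly_Mapping.keys p. mon_deg v = j}. if v = u then Poly_Mapping.lookup p v else 0)"
    by (simp add: hcomp_def lookup_sum lookup_single when_def)
  also have "\<dots> = (if mon_deg u = j then Poly_Mapping.lookup p u else 0)"
    by (subst sum.delta) (auto simp: in_keys_iff)
  finally show ?thesis .
qed

lemma hcomp_add: "hcomp j (p + q) = hcomp j p + hcomp j q"
  by (rule poly_mapping_eqI) (simp add: lookup_hcomp lookup_add)

lemma hcomp_zero [simp]: "hcomp j 0 = 0"
  by (rule poly_mapping_eqI) (simp add: lookup_hcomp)

lemma hcomp_homog: "p \<in> homog n i \<Longrightarrow> hcomp j p = (if i = j then p else 0)"
  by (rule poly_mapping_eqI) (auto simp: lookup_hcomp homog_def in_keys_iff)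

lemma hcomp_in_homog: "p \<in> carrier (poly_ring n) \<Longrightarrow> hcomp j p \<in> homog n j"
  by (auto simp: homog_def in_poly_ring in_keys_iff lookup_hcomp split: if_splits)

lemma hcomp_finite: "finite {j. hcomp j p \<noteq> 0}"
proof (rule finite_subset)
  show "{j. hcomp j p \<noteq> 0} \<subseteq> mon_deg ` Poly_Mapping.keys p"
  proof clarify
    fix j assume "hcomp j p \<noteq> 0"
    then obtain u where "Poly_Mapping.lookup (hcomp j p) u \<noteq> 0" by (metis poly_mapping_eqI lookup_zero)
    then show "j \<in> mon_deg ` Poly_Mapping.keys p" by (auto simp: lookup_hcomp in_keys_iff split: if_splits)
  qed
qed simp

lemma hcomp_sum: "finite T \<Longrightarrow> {j. hcomp j p \<noteq> 0} \<subseteq> T \<Longrightarrow> p = (\<Sum>j\<in>T. hcomp j p)"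
proof (rule poly_mapping_eqI)
  fix u assume T: "finite T" "{j. hcomp j p \<noteq> 0} \<subseteq> T"
  have "Poly_Mapping.lookup (\<Sum>j\<in>T. hcomp j p) u = (\<Sum>j\<in>T. if mon_deg u = j then Poly_Mapping.lookup p u else 0)"
    by (simp add: lookup_sum lookup_hcomp)
  also have "\<dots> = (if mon_deg u \<in> T then Poly_Mapping.lookup p u else 0)"
    using T by simp
  also have "\<dots> = Poly_Mapping.lookup p u"
  proof (cases "Poly_Mapping.lookup p u = 0")
    case False
    then have "Poly_Mapping.lookup (hcomp (mon_deg u) p) u \<noteq> 0" by (simp add: lookup_hcomp)
    then have "hcomp (mon_deg u) p \<noteq> 0" by (metis lookup_zero)
    then show ?thesis using T by auto
  qed simp
  finally show "Poly_Mapping.lookup p u = Poly_Mapping.lookup (\<Sum>j\<in>T. hcomp j p) u" by simp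
qed

lemma hcomp_sum_fun: "hcomp j (\<Sum>a\<in>A. f a) = (\<Sum>a\<in>A. hcomp j (f a))"
  by (induction A rule: infinite_finite_induct) (auto simp: hcomp_add)

lemma hcomp_mult_homog:
  assumes a: "a \<in> homog n i" and p: "p \<in> carrier (poly_ring n)"
  shows "hcomp j (a * p) = (if i \<le> j then a * hcomp (j - i) p else 0)"
proof -
  let ?T = "insert (j - i) {j. hcomp j p \<noteq> 0}"
  have T: "finite ?T" using hcomp_finite by simp
  have "a * p = (\<Sum>m\<in>?T. a * hcomp m p)"
    using hcomp_sum[OF T, of p] by (simp add: sum_distrib_left[symmetric] subset_insertI)
  then have "hcomp j (a * p) = (\<Sum>m\<in>?T. hcomp j (a * hcomp m p))" by (simp only: hcomp_sum_fun)
  also have "\<dots> = (\<Sum>m\<in>?T. if m = j - i then (if i \<le> j then a * hcomp m p else 0) else 0)"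
    using hcomp_homog[OF homog_mult[OF a hcomp_in_homog[OF p]]] by (intro sum.cong) auto
  also have "\<dots> = (if i \<le> j then a * hcomp (j - i) p else 0)" using T by (subst sum.delta) auto
  finally show ?thesis .
qed

text \<open>The coefficient at a generator \<open>g\<close> of an element of degree \<open>t\<close>
  has degree \<open>t - deg g\<close>, which may be negative; hence integer degrees.\<close>

definition hz :: "nat \<Rightarrow> int \<Rightarrow> 'k::field mpoly set" where
  "hz n z = (if z < 0 then {0} else homog n (nat z))"

definition hcz :: "int \<Rightarrow> 'k::field mpoly \<Rightarrow> 'k mpoly" where
  "hcz z p = (if z < 0 then 0 else hcomp (nat z) p)"

lemma hz_simps: "0 \<in> hz n z" "p \<in> hz n z \<Longrightarrow> q \<in> hz n z \<Longrightarrow> p + q \<in> hz n z"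
  "p \<in> hz n z \<Longrightarrow> p \<in> carrier (poly_ring n)"
  by (auto simp: hz_def homog_zero homog_add homog_carrier poly_ring_zero split: if_splits)

lemma hz_mult: "a \<in> homog n i \<Longrightarrow> p \<in> hz n z \<Longrightarrow> a * p \<in> hz n (z + int i)"
  using homog_mult[of a n i p "nat z"]
  by (auto simp: hz_def homog_zero nat_add_distrib add.commute split: if_splits)

lemma hcz_simps: "hcz z (p + q) = hcz z p + hcz z q" "hcz z 0 = 0"
  by (simp_all add: hcz_def hcomp_add)

lemma hcz_in: "p \<in> carrier (poly_ring n) \<Longrightarrow> hcz z p \<in> hz n z"
  by (simp add: hcz_def hz_def hcomp_in_homog)

lemma hcz_hz: "p \<in> hz n y \<Longrightarrow> hcz z p = (if y = z then p else 0)"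
  by (auto simp: hcz_def hz_def hcomp_homog eq_nat_nat_iff split: if_splits)

lemma hcz_mult: "a \<in> homog n i \<Longrightarrow> p \<in> carrier (poly_ring n) \<Longrightarrow> hcz (z + int i) (a * p) = a * hcz z p"
  using hcomp_mult_homog[of a n i p "nat (z + int i)"]
  by (auto simp: hcz_def nat_add_distrib nat_le_iff split: if_splits)

lemma hcz_finite: "finite {z. hcz z p \<noteq> 0}"
proof (rule finite_subset)
  show "{z. hcz z p \<noteq> 0} \<subseteq> int ` {j. hcomp j p \<noteq> 0}"
    by (auto simp: hcz_def image_iff split: if_splits) (metis nat_0_le not_less)
qed (simp add: hcomp_finite)

lemma hcz_sum: "finite T \<Longrightarrow> {z. hcz z p \<noteq> 0} \<subseteq> T \<Longrightarrow> p = (\<Sum>z\<in>T. hcz z p)"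
proof -
  assume T: "finite T" "{z. hcz z p \<noteq> 0} \<subseteq> T"
  have "p = (\<Sum>j\<in>{j. hcomp j p \<noteq> 0}. hcomp j p)" by (rule hcomp_sum) (auto simp: hcomp_finite)
  also have "\<dots> = (\<Sum>z\<in>int ` {j. hcomp j p \<noteq> 0}. hcz z p)"
    by (simp add: sum.reindex hcz_def)
  also have "\<dots> = (\<Sum>z\<in>T. hcz z p)"
  proof (rule sum.mono_neutral_left)
    show "int ` {j. hcomp j p \<noteq> 0} \<subseteq> T" using T by (auto simp: hcz_def)
    show "\<forall>z\<in>T - int ` {j. hcomp j p \<noteq> 0}. hcz z p = 0"
      by (auto simp: hcz_def image_iff) (metis nat_0_le not_less)
  qed (use T in simp)
  finally show ?thesis .
qed

text \<open>Elements of the free module are functions on the generators, which form a ring under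
  pointwise multiplication. Constant functions give scalars of the same type, as the locale
  \<open>koszul\<close> requires.\<close>

definition emb :: "'k::field mpoly \<Rightarrow> 'g \<Rightarrow> 'k mpoly" where "emb p = (\<lambda>_. p)"

lemma emb_simps: "emb (p + q) = emb p + emb q" "emb (p * q) = emb p * emb q" "emb 0 = 0" "emb 1 = 1"
  "emb (- p) = - emb p" "emb (p ^ k) = emb p ^ k"
proof -
  show *: "emb (p * q) = emb p * emb q" "emb 1 = 1" for p q by (auto simp: emb_def fun_eq_iff)
  show "emb (p ^ k) = emb p ^ k" by (induction k) (simp_all add: *)
qed (auto simp: emb_def fun_eq_iff)

lemma emb_sum: "emb (\<Sum>a\<in>A. f a) = (\<Sum>a\<in>A. emb (f a))"
  by (induction A rule: infinite_finite_induct) (auto simp: emb_simps)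

lemma emb_prod: "emb (\<Prod>a\<in>A. f a) = (\<Prod>a\<in>A. emb (f a))"
  by (induction A rule: infinite_finite_induct) (auto simp: emb_simps)

lemma emb_app [simp]: "emb p g = p"
  by (simp add: emb_def)

definition fscale :: "'k::field \<Rightarrow> ('g \<Rightarrow> 'k mpoly) \<Rightarrow> 'g \<Rightarrow> 'k mpoly" where
  "fscale c f = emb (const_poly c) * f"

lemma vector_space_fscale: "vector_space fscale"
  by unfold_locales (simp_all add: fscale_def const_poly_simps emb_simps algebra_simps)

section \<open>Graded submodules of a graded free module\<close>

locale free_graded =
  fixes n :: nat and G :: "'g set" and deg :: "'g \<Rightarrow> int" and ty :: "'k::field itself"
  assumes finite_G: "finite G"
begin

definition FF :: "('g \<Rightarrow> 'k mpoly) set" where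
  "FF = {f. \<forall>g. if g \<in> G then f g \<in> carrier (poly_ring n) else f g = 0}"

definition Fg :: "int \<Rightarrow> ('g \<Rightarrow> 'k mpoly) set" where
  "Fg t = {f. \<forall>g. if g \<in> G then f g \<in> hz n (t - deg g) else f g = 0}"

definition hc :: "int \<Rightarrow> ('g \<Rightarrow> 'k mpoly) \<Rightarrow> 'g \<Rightarrow> 'k mpoly" where
  "hc t f = (\<lambda>g. hcz (t - deg g) (f g))"

lemma Fg_homog: "a \<in> homog n i \<Longrightarrow> f \<in> Fg t \<Longrightarrow> emb a * f \<in> Fg (t + int i)"
  unfolding Fg_def
proof (intro CollectI allI)
  fix g assume a: "a \<in> homog n i" and f: "f \<in> {f. \<forall>g. if g \<in> G then f g \<in> hz n (t - deg g) else f g = 0}"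
  have e: "t + int i - deg g = t - deg g + int i" by simp
  show "if g \<in> G then (emb a * f) g \<in> hz n (t + int i - deg g) else (emb a * f) g = 0"
    unfolding e using f hz_mult[OF a, of "f g" "t - deg g"] by (auto split: if_splits)
qed

sublocale koszul n "\<lambda>j. emb (var j)" Fg "range (\<lambda>c. emb (const_poly c))"
proof
  fix t and f g :: "'g \<Rightarrow> 'k mpoly"
  show "0 \<in> Fg t" by (auto simp: Fg_def hz_simps)
  assume f: "f \<in> Fg t"
  show "g \<in> Fg t \<Longrightarrow> f + g \<in> Fg t" using f by (auto simp: Fg_def hz_simps split: if_splits)
  fix c :: "'g \<Rightarrow> 'k mpoly" assume "c \<in> range (\<lambda>c. emb (const_poly c))"
  then show "c * f \<in> Fg t" using Fg_homog[OF homog_const f] by auto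
next
  fix t and f :: "'g \<Rightarrow> 'k mpoly" and j assume "f \<in> Fg t" "j < n"
  then show "emb (var j) * f \<in> Fg (t + 1)" using Fg_homog[OF homog_var] by fastforce
next
  have "emb (const_poly (- 1)) = (- 1 :: 'g \<Rightarrow> 'k mpoly)" by (simp add: const_poly_simps emb_simps)
  then show "(- 1 :: 'g \<Rightarrow> 'k mpoly) \<in> range (\<lambda>c. emb (const_poly c))" by (metis rangeI)
qed

lemma Fg_subset_FF: "f \<in> Fg t \<Longrightarrow> f \<in> FF"
  by (auto simp: Fg_def FF_def intro: hz_simps(3) split: if_splits)

lemma FF_add: "f \<in> FF \<Longrightarrow> g \<in> FF \<Longrightarrow> f + g \<in> FF"
  by (auto simp: FF_def poly_ring_add split: if_splits)

lemma FF_zero: "0 \<in> FF"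
  by (auto simp: FF_def poly_ring_zero)

lemma FF_emb: "p \<in> carrier (poly_ring n) \<Longrightarrow> f \<in> FF \<Longrightarrow> emb p * f \<in> FF"
  by (auto simp: FF_def poly_ring_mult split: if_splits)

lemma FF_uminus: "f \<in> FF \<Longrightarrow> - f \<in> FF"
  by (auto simp: FF_def poly_ring_uminus split: if_splits)

lemma FF_diff: "f \<in> FF \<Longrightarrow> g \<in> FF \<Longrightarrow> f - g \<in> FF"
  using FF_add[of f "- g"] FF_uminus by simp

lemma FF_sum: "(\<And>a. a \<in> A \<Longrightarrow> f a \<in> FF) \<Longrightarrow> sum f A \<in> FF"
  by (induction A rule: infinite_finite_induct) (auto simp: FF_zero FF_add)

lemma hc_in: "f \<in> FF \<Longrightarrow> hc t f \<in> Fg t"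
  by (auto simp: Fg_def FF_def hc_def hcz_in hcz_simps split: if_splits)

lemma hc_add: "hc t (f + g) = hc t f + hc t g"
  by (auto simp: hc_def hcz_simps)

lemma hc_zero: "hc t 0 = 0"
  by (auto simp: hc_def hcz_simps)

lemma hc_sum: "hc t (\<Sum>a\<in>A. f a) = (\<Sum>a\<in>A. hc t (f a))"
  using sum_comp_morphism[of "hc t" f A] by (simp add: hc_zero hc_add comp_def)

lemma hc_uminus: "hc t (- f) = - hc t f"
  using hc_add[of t f "- f"] by (simp add: hc_zero eq_neg_iff_add_eq_0 add.commute)

lemma hc_diff: "hc t (f - g) = hc t f - hc t g"
  using hc_add[of t f "- g"] hc_uminus by simp

lemma hc_Fg: "f \<in> Fg s \<Longrightarrow> hc t f = (if s = t then f else 0)"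
proof
  fix g assume f: "f \<in> Fg s"
  show "hc t f g = (if s = t then f else 0) g"
    using f hcz_hz[of "f g" n "s - deg g" "t - deg g"]
    by (cases "g \<in> G") (auto simp: Fg_def hc_def hcz_simps split: if_splits)
qed

lemma hc_homog:
  assumes "a \<in> homog n i" "f \<in> FF"
  shows "hc (t + int i) (emb a * f) = emb a * hc t f"
proof
  fix g
  have e: "t + int i - deg g = t - deg g + int i" by simp
  show "hc (t + int i) (emb a * f) g = (emb a * hc t f) g"
    unfolding hc_def e using hcz_mult[OF assms(1), of "f g" "t - deg g"] assms(2)
    by (cases "g \<in> G") (auto simp: FF_def hcz_simps split: if_splits)
qed

lemma hc_finite: "f \<in> FF \<Longrightarrow> finite {t. hc t f \<noteq> 0}"
proof (rule finite_subset)
  assume f: "f \<in> FF"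
  show "{t. hc t f \<noteq> 0} \<subseteq> (\<Union>g\<in>G. (\<lambda>z. z + deg g) ` {z. hcz z (f g) \<noteq> 0})"
  proof clarify
    fix t assume "hc t f \<noteq> 0"
    then obtain g where g: "hcz (t - deg g) (f g) \<noteq> 0" by (auto simp: hc_def fun_eq_iff)
    then have "g \<in> G" using f by (auto simp: FF_def hcz_simps split: if_splits)
    then show "t \<in> (\<Union>g\<in>G. (\<lambda>z. z + deg g) ` {z. hcz z (f g) \<noteq> 0})"
      using g by (intro UN_I[of g] image_eqI[of _ _ "t - deg g"]) auto
  qed
qed (use finite_G hcz_finite in auto)

lemma fun_sum_apply: "(\<Sum>a\<in>A. f a) g = (\<Sum>a\<in>A. f a g)"
  by (induction A rule: infinite_finite_induct) auto

lemma hc_decompose: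
  assumes T: "finite T" "{t. hc t f \<noteq> 0} \<subseteq> T"
  shows "f = (\<Sum>t\<in>T. hc t f)"
proof
  fix g
  have "f g = (\<Sum>z\<in>(\<lambda>t. t - deg g) ` T. hcz z (f g))"
  proof (rule hcz_sum)
    show "{z. hcz z (f g) \<noteq> 0} \<subseteq> (\<lambda>t. t - deg g) ` T"
    proof clarify
      fix z assume "hcz z (f g) \<noteq> 0"
      then have "hc (z + deg g) f g \<noteq> 0" by (simp add: hc_def)
      then have "hc (z + deg g) f \<noteq> 0" by (metis zero_fun_apply)
      then show "z \<in> (\<lambda>t. t - deg g) ` T" using T by (intro image_eqI[of _ _ "z + deg g"]) auto
    qed
  qed (use T in simp)
  also have "\<dots> = (\<Sum>t\<in>T. hc t f g)" by (simp add: sum.reindex inj_on_def hc_def)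
  finally show "f g = (\<Sum>t\<in>T. hc t f) g" by (simp add: fun_sum_apply)
qed

lemma sub_monomial:
  assumes U: "sub U" and f: "f \<in> U t" and u: "Poly_Mapping.keys u \<subseteq> {..<n}"
  shows "emb (Poly_Mapping.single u c) * f \<in> U (t + int (mon_deg u))"
  using f u
proof (induction "mon_deg u" arbitrary: u)
  case 0
  then have "u = 0" using mon_deg_0_iff by simp
  then show ?case using sub_C[OF U 0(2), of "emb (const_poly c)"] by (metis const_poly_def mon_deg_0 of_nat_0 add_0_right rangeI)
next
  case (Suc k)
  then have "u \<noteq> 0" using mon_deg_0_iff by auto
  then obtain i where i: "i \<in> Poly_Mapping.keys u" by (metis keys_eq_empty ex_in_conv)
  define v where "v = u - Poly_Mapping.single i 1"
  have uv: "u = Poly_Mapping.single i 1 + v"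
  proof (rule poly_mapping_eqI)
    fix j show "Poly_Mapping.lookup u j = Poly_Mapping.lookup (Poly_Mapping.single i 1 + v) j"
      using i by (auto simp: v_def lookup_add lookup_minus lookup_single when_def in_keys_iff)
  qed
  have "Poly_Mapping.keys v \<subseteq> Poly_Mapping.keys u" by (auto simp: v_def in_keys_iff lookup_minus)
  moreover have "k = mon_deg v" using Suc(2) mon_deg_add[of "Poly_Mapping.single i 1" v] uv by simp
  ultimately have "emb (Poly_Mapping.single v c) * f \<in> U (t + int (mon_deg v))" using Suc by auto
  then have "emb (var i) * (emb (Poly_Mapping.single v c) * f) \<in> U (t + int (mon_deg v) + 1)"
    using i Suc by (intro sub_x[OF U]) auto
  moreover have "emb (var i) * (emb (Poly_Mapping.single v c) * f) = emb (Poly_Mapping.single u c) * f"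
  proof -
    have "var i * Poly_Mapping.single v c = Poly_Mapping.single u c"
      using uv by (simp add: var_def mult_single)
    then show ?thesis by (metis emb_simps(2) mult.assoc)
  qed
  moreover have "t + int (mon_deg v) + 1 = t + int (mon_deg u)" using \<open>k = mon_deg v\<close> Suc(2) by simp
  ultimately show ?case by simp
qed

lemma sub_homog:
  assumes U: "sub U" and f: "f \<in> U t" and a: "a \<in> homog n i"
  shows "emb a * f \<in> U (t + int i)"
proof -
  have "emb a * f = (\<Sum>u\<in>Poly_Mapping.keys a. emb (Poly_Mapping.single u (Poly_Mapping.lookup a u)) * f)"
    by (subst poly_mapping_sum_monomials[of a]) (simp add: emb_sum sum_distrib_right)
  also have "\<dots> \<in> U (t + int i)"
    using a by (intro sub_sum[OF U]) (auto simp: homog_def in_poly_ring dest!: sub_monomial[OF U f])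
  finally show ?thesis .
qed

text \<open>The submodule of the ungraded free module that corresponds to a graded family;
  annihilators, kernels and fractions are ungraded notions and are expressed through it.\<close>

definition tot :: "(int \<Rightarrow> ('g \<Rightarrow> 'k mpoly) set) \<Rightarrow> ('g \<Rightarrow> 'k mpoly) set" where
  "tot U = {f \<in> FF. \<forall>t. hc t f \<in> U t}"

lemma tot_add: "sub U \<Longrightarrow> f \<in> tot U \<Longrightarrow> g \<in> tot U \<Longrightarrow> f + g \<in> tot U"
  by (auto simp: tot_def FF_add hc_add sub_add)

lemma tot_zero: "sub U \<Longrightarrow> 0 \<in> tot U"
  by (auto simp: tot_def FF_zero hc_zero sub_zero)

lemma tot_sum: "sub U \<Longrightarrow> (\<And>a. a \<in> A \<Longrightarrow> f a \<in> tot U) \<Longrightarrow> sum f A \<in> tot U"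
  by (induction A rule: infinite_finite_induct) (auto simp: tot_zero tot_add)

lemma tot_homog:
  assumes U: "sub U" and f: "f \<in> tot U" and a: "a \<in> homog n i"
  shows "emb a * f \<in> tot U"
proof -
  have "hc t (emb a * f) \<in> U t" for t
  proof -
    have "hc (t - int i + int i) (emb a * f) = emb a * hc (t - int i) f"
      using f a by (intro hc_homog) (auto simp: tot_def)
    then show ?thesis using sub_homog[OF U _ a, of "hc (t - int i) f" "t - int i"] f by (simp add: tot_def)
  qed
  then show ?thesis using f FF_emb[OF homog_carrier[OF a]] by (simp add: tot_def)
qed

lemma tot_emb:
  assumes U: "sub U" and f: "f \<in> tot U" and p: "p \<in> carrier (poly_ring n)"
  shows "emb p * f \<in> tot U"
proof -
  have "p = (\<Sum>j\<in>{j. hcomp j p \<noteq> 0}. hcomp j p)" by (rule hcomp_sum) (auto simp: hcomp_finite)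
  then have "emb p * f = (\<Sum>j\<in>{j. hcomp j p \<noteq> 0}. emb (hcomp j p) * f)"
    by (metis emb_sum sum_distrib_right)
  also have "\<dots> \<in> tot U" using tot_homog[OF U f hcomp_in_homog[OF p]] by (intro tot_sum[OF U])
  finally show ?thesis .
qed

lemma tot_uminus: "sub U \<Longrightarrow> f \<in> tot U \<Longrightarrow> - f \<in> tot U"
  by (auto simp: tot_def FF_uminus hc_uminus sub_uminus)

lemma tot_diff: "sub U \<Longrightarrow> f \<in> tot U \<Longrightarrow> g \<in> tot U \<Longrightarrow> f - g \<in> tot U"
  using tot_add[of U f "- g"] tot_uminus by simp

lemma tot_Fg: "sub U \<Longrightarrow> f \<in> Fg t \<Longrightarrow> f \<in> tot U \<longleftrightarrow> f \<in> U t"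
  using Fg_subset_FF by (auto simp: tot_def hc_Fg sub_zero dest: spec[of _ t])

text \<open>A monomial of degree 1 is a single variable, so the hypothesis on the forms of the
  sequence matches the notion used in \<open>koszul\<close>.\<close>

lemma linear_form_homog:
  assumes a: "a \<in> homog n 1"
  shows "linear_form (emb a)"
proof -
  let ?s = "\<lambda>j::nat. Poly_Mapping.single j (1::nat)"
  define cf where "cf = (\<lambda>j. Poly_Mapping.lookup a (?s j))"
  have keys: "Poly_Mapping.keys a \<subseteq> ?s ` {..<n}"
  proof
    fix u assume "u \<in> Poly_Mapping.keys a"
    then have u: "mon_deg u = 1" "Poly_Mapping.keys u \<subseteq> {..<n}" using a by (auto simp: homog_def in_poly_ring)
    then have "u \<noteq> 0" by auto
    then obtain i where i: "i \<in> Poly_Mapping.keys u" by (metis keys_eq_empty ex_in_conv)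
    have "(\<Sum>j\<in>Poly_Mapping.keys u - {i}. Poly_Mapping.lookup u j) + Poly_Mapping.lookup u i = 1"
      using u(1) i unfolding mon_deg_def by (subst (asm) sum.remove[of _ i]) auto
    moreover have "Poly_Mapping.lookup u i \<noteq> 0" using i by (simp add: in_keys_iff)
    ultimately have "Poly_Mapping.lookup u i = 1" "(\<Sum>j\<in>Poly_Mapping.keys u - {i}. Poly_Mapping.lookup u j) = 0"
      by linarith+
    then have "Poly_Mapping.lookup u j = (if j = i then 1 else 0)" for j
      by (auto simp: in_keys_iff)
    then have "u = ?s i" by (intro poly_mapping_eqI) (simp add: lookup_single when_def)
    then show "u \<in> ?s ` {..<n}" using i u(2) by auto
  qed
  have inj: "inj_on ?s {..<n}"
  proof (rule inj_onI)
    fix i j assume "?s i = ?s j"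
    then have "Poly_Mapping.lookup (?s i) i = Poly_Mapping.lookup (?s j) i" by simp
    then show "i = j" by (simp add: lookup_single when_def split: if_splits)
  qed
  have "a = (\<Sum>u\<in>?s ` {..<n}. Poly_Mapping.single u (Poly_Mapping.lookup a u))"
  proof -
    have "(\<Sum>u\<in>Poly_Mapping.keys a. Poly_Mapping.single u (Poly_Mapping.lookup a u))
        = (\<Sum>u\<in>?s ` {..<n}. Poly_Mapping.single u (Poly_Mapping.lookup a u))"
      using keys by (intro sum.mono_neutral_left) (auto simp: in_keys_iff)
    then show ?thesis using poly_mapping_sum_monomials[of a] by argo
  qed
  also have "\<dots> = (\<Sum>j<n. const_poly (cf j) * var j)"
    using inj by (simp add: sum.reindex const_poly_def var_def mult_single cf_def)
  finally have a_eq: "a = (\<Sum>j<n. const_poly (cf j) * var j)" .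
  have "emb a = (\<Sum>j<n. emb (const_poly (cf j)) * (emb (var j) :: 'g \<Rightarrow> 'k mpoly))"
    by (subst a_eq) (simp only: emb_sum emb_simps)
  then show ?thesis unfolding linear_form_def
    by (intro exI[of _ "\<lambda>j. emb (const_poly (cf j))"]) blast
qed

text \<open>A spanning set consists of the finitely many monomials of the right degree, each placed
  at one generator.\<close>

lemma Fg_finite_dim: "\<exists>X. finite X \<and> Fg t \<subseteq> Modules.module.span fscale X"
proof -
  interpret S: vector_space fscale by (rule vector_space_fscale)
  define Mn where "Mn = (\<lambda>j. {u. Poly_Mapping.keys u \<subseteq> {..<n} \<and> mon_deg u = j})"
  have fin: "finite (Mn j)" for j
  proof -
    have "inj_on (\<lambda>u. restrict (Poly_Mapping.lookup u) {..<n}) (Mn j)"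
    proof (rule inj_onI)
      fix u v assume uv: "u \<in> Mn j" "v \<in> Mn j" "restrict (Poly_Mapping.lookup u) {..<n} = restrict (Poly_Mapping.lookup v) {..<n}"
      show "u = v"
      proof (rule poly_mapping_eqI)
        fix i
        have "i \<notin> Poly_Mapping.keys u \<and> i \<notin> Poly_Mapping.keys v" if "\<not> i < n"
          using uv(1,2) that unfolding Mn_def by blast
        then show "Poly_Mapping.lookup u i = Poly_Mapping.lookup v i"
          using fun_cong[OF uv(3), of i] by (cases "i < n") (simp_all add: in_keys_iff)
      qed
    qed
    moreover have "(\<lambda>u. restrict (Poly_Mapping.lookup u) {..<n}) ` Mn j \<subseteq> {..<n} \<rightarrow>\<^sub>E {..j}"
    proof clarify
      fix u assume u: "u \<in> Mn j"
      have "Poly_Mapping.lookup u i \<le> j" if "i < n" for i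
        using u member_le_sum[of i "{..<n}" "Poly_Mapping.lookup u"] that mon_deg_eq[of "{..<n}" u] by (simp add: Mn_def)
      then show "restrict (Poly_Mapping.lookup u) {..<n} \<in> {..<n} \<rightarrow>\<^sub>E {..j}" by auto
    qed
    moreover have "finite ({..<n} \<rightarrow>\<^sub>E {..j})" by (simp add: finite_PiE)
    ultimately show ?thesis by (rule inj_on_finite)
  qed
  define e where "e = (\<lambda>(g::'g, u::nat \<Rightarrow>\<^sub>0 nat). \<lambda>h. if h = g then Poly_Mapping.single u (1::'k) else 0)"
  define X where "X = e ` (SIGMA g:G. Mn (nat (t - deg g)))"
  have "Fg t \<subseteq> S.span X"
  proof
    fix f assume f: "f \<in> Fg t"
    define f' where "f' = (\<Sum>g\<in>G. \<Sum>u\<in>Poly_Mapping.keys (f g). fscale (Poly_Mapping.lookup (f g) u) (e (g, u)))"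
    have "f = f'"
    proof
      fix h
      have "f' h = (\<Sum>g\<in>G. if g = h then (\<Sum>u\<in>Poly_Mapping.keys (f g). Poly_Mapping.single u (Poly_Mapping.lookup (f g) u)) else 0)"
        unfolding f'_def fun_sum_apply
        by (intro sum.cong refl) (auto simp: fscale_def e_def const_poly_def mult_single)
      also have "\<dots> = f h"
        using finite_G f by (auto simp: Fg_def poly_mapping_sum_monomials[symmetric] split: if_splits)
      finally show "f h = f' h" ..
    qed
    moreover have "fscale c (e (g, u)) \<in> S.span X" if gu: "g \<in> G" "u \<in> Poly_Mapping.keys (f g)" for c g u
    proof -
      from f have "\<forall>g. if g \<in> G then f g \<in> hz n (t - deg g) else f g = 0" unfolding Fg_def by (rule CollectD)
      from spec[OF this, of g] have "f g \<in> hz n (t - deg g)" using gu(1) by (simp only: if_True)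
      then have "f g \<in> homog n (nat (t - deg g))"
        using gu(2) by (auto simp: hz_def split: if_splits)
      then have "u \<in> Mn (nat (t - deg g))" using gu(2) by (auto simp: Mn_def homog_def in_poly_ring)
      then have "e (g, u) \<in> X" using gu(1) by (auto simp: X_def)
      then show ?thesis by (rule S.span_scale[OF S.span_base])
    qed
    then have "f' \<in> S.span X" unfolding f'_def by (simp only: S.span_sum)
    ultimately show "f \<in> S.span X" by simp
  qed
  moreover have "finite X" unfolding X_def by (intro finite_imageI finite_SigmaI finite_G fin)
  ultimately show ?thesis by blast
qed

end

interpretation fs: vector_space "fscale :: 'k::field \<Rightarrow> ('g \<Rightarrow> 'k mpoly) \<Rightarrow> _"
  by (rule vector_space_fscale)

lemma linear_emb_mult: "Vector_Spaces.linear fscale fscale (\<lambda>f. emb a * f)"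
  by unfold_locales (simp_all add: fscale_def distrib_left mult.left_commute)

section \<open>Hilbert functions of quotients of the free module\<close>

context free_graded begin

text \<open>The Hilbert function of \<open>F / U\<close>, as an integer so that its differences can
  be formed without truncation.\<close>

definition codim :: "(int \<Rightarrow> ('g \<Rightarrow> 'k mpoly) set) \<Rightarrow> int \<Rightarrow> int" where
  "codim U t = int (fs.dim (Fg t)) - int (fs.dim (U t))"

lemma sub_subspace: "sub U \<Longrightarrow> fs.subspace (U t)"
  by (auto simp: fs.subspace_def fscale_def sub_zero sub_add sub_C)

lemma sub_finite_dim: "sub U \<Longrightarrow> \<exists>X. finite X \<and> U t \<subseteq> fs.span X"
  using Fg_finite_dim[of t] sub_subset by blast

lemma dim_mono: "U \<subseteq> U' \<Longrightarrow> U' \<subseteq> Fg t \<Longrightarrow> fs.dim U \<le> fs.dim U'"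
  using Fg_finite_dim[of t] fs.dim_mono_finite by (meson order_trans)

lemma codim_nonneg: "sub U \<Longrightarrow> 0 \<le> codim U t"
  unfolding codim_def using dim_mono[of "U t" "Fg t" t] sub_subset by auto

lemma codim_mono: "sub U' \<Longrightarrow> U t \<subseteq> U' t \<Longrightarrow> codim U' t \<le> codim U t"
  unfolding codim_def using dim_mono[of "U t" "U' t" t] sub_subset by auto

lemma codim_cong: "U t = U' t \<Longrightarrow> codim U t = codim U' t"
  by (simp add: codim_def)

lemma codim_full: "U t = Fg t \<Longrightarrow> codim U t = 0"
  by (simp add: codim_def)

text \<open>An instance of \<open>dim_add_image\<close> for multiplication by \<open>a\<close> from
  degree \<open>t - 1\<close> to the quotient in degree \<open>t\<close>; the subtracted term is the
  rank of this map.\<close>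

lemma codim_adj:
  assumes U: "sub U"
  shows "codim (adj U (emb a)) t = codim U t - (int (fs.dim (Fg (t - 1))) - int (fs.dim {f \<in> Fg (t - 1). emb a * f \<in> U t}))"
proof -
  obtain Y where Y: "finite Y" "U t \<subseteq> fs.span Y" using sub_finite_dim[OF U] by blast
  obtain X where X: "finite X" "Fg (t - 1) \<subseteq> fs.span X" using Fg_finite_dim by blast
  have "adj U (emb a) t = {u + emb a * v | u v. u \<in> U t \<and> v \<in> Fg (t - 1)}"
    unfolding adj_def ..
  then have "fs.dim (adj U (emb a) t) + fs.dim {f \<in> Fg (t - 1). emb a * f \<in> U t} = fs.dim (U t) + fs.dim (Fg (t - 1))"
    using fs.dim_add_image[OF sub_subspace[OF U] Y(2,1) sub_subspace[OF sub_F] X(2,1) linear_emb_mult, of a]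
    by (simp only:)
  then show ?thesis unfolding codim_def by linarith
qed

lemma codim_adj_regular:
  assumes U: "sub U" and a: "linear_form (emb a)" and reg: "regular U (emb a)"
  shows "codim U t - codim U (t - 1) = codim (adj U (emb a)) t"
proof -
  have "f \<in> U (t - 1)" if "f \<in> Fg (t - 1)" "emb a * f \<in> U t" for f
    using reg that unfolding regular_def by (metis diff_add_cancel)
  moreover have "emb a * f \<in> U t" if "f \<in> U (t - 1)" for f
    using linear_form_mult[OF U a that] by simp
  ultimately have "{f \<in> Fg (t - 1). emb a * f \<in> U t} = U (t - 1)"
    using sub_subset[OF U] by blast
  then show ?thesis unfolding codim_adj[OF U] codim_def[of U "t - 1"] by (simp only:)
qed

text \<open>Without regularity the preimage of \<open>U t\<close> may be larger than
  \<open>U (t - 1)\<close>; this lowers the rank and leaves an inequality.\<close>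

lemma codim_adj_ge:
  assumes U: "sub U" and a: "linear_form (emb a)"
  shows "codim U t - codim U (t - 1) \<le> codim (adj U (emb a)) t"
proof -
  have "U (t - 1) \<subseteq> {f \<in> Fg (t - 1). emb a * f \<in> U t}"
  proof
    fix f assume f: "f \<in> U (t - 1)"
    then show "f \<in> {f \<in> Fg (t - 1). emb a * f \<in> U t}"
      using linear_form_mult[OF U a f] sub_subset[OF U f] by simp
  qed
  from dim_mono[OF this, of "t - 1"]
  have "fs.dim (U (t - 1)) \<le> fs.dim {f \<in> Fg (t - 1). emb a * f \<in> U t}" by blast
  then show ?thesis unfolding codim_adj[OF U] codim_def[of U "t - 1"] by linarith
qed

text \<open>A part of \<open>tot U\<close> that is large enough to compute the dimension of a
  quotient vanishing from degree \<open>k\<close> on. It is finite-dimensional when the generators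
  have nonnegative degrees, since the free module is then zero in negative degrees.\<close>

definition tot_below :: "(int \<Rightarrow> ('g \<Rightarrow> 'k mpoly) set) \<Rightarrow> nat \<Rightarrow> ('g \<Rightarrow> 'k mpoly) set" where
  "tot_below U k = {f \<in> tot U. \<forall>t. hc t f \<noteq> 0 \<longrightarrow> t < int k}"

lemma Fg_neg:
  assumes "\<And>g. g \<in> G \<Longrightarrow> 0 \<le> deg g" "t < 0"
  shows "Fg t = {0}"
proof -
  have "f = 0" if f: "f \<in> Fg t" for f
  proof
    fix g
    show "f g = 0 g"
    proof (cases "g \<in> G")
      case True
      then have "t - deg g < 0" using assms(1)[of g] assms(2) by simp
      moreover have "f g \<in> hz n (t - deg g)" using f True by (auto simp: Fg_def dest: spec[of _ g])
      ultimately show ?thesis by (simp add: hz_def)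
    qed (use f in \<open>auto simp: Fg_def dest: spec[of _ g]\<close>)
  qed
  then show ?thesis using F_zero by blast
qed

lemma tot_below_subspace: "sub U \<Longrightarrow> fs.subspace (tot_below U k)"
proof -
  assume U: "sub U"
  have "hc t (fscale c f) = fscale c (hc t f)" if "f \<in> tot U" for t c f
    using hc_homog[OF homog_const, of f t c] that by (simp add: fscale_def tot_def)
  note sc = this
  show ?thesis unfolding fs.subspace_def
  proof (intro conjI ballI allI)
    show "0 \<in> tot_below U k" using tot_zero[OF U] by (simp add: tot_below_def hc_zero)
  next
    fix f g assume "f \<in> tot_below U k" "g \<in> tot_below U k"
    moreover have "hc t f \<noteq> 0 \<or> hc t g \<noteq> 0" if "hc t (f + g) \<noteq> 0" for t
      using that by (metis add_0 hc_add)
    ultimately show "f + g \<in> tot_below U k" unfolding tot_below_def using tot_add[OF U] by blast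
  next
    fix c f assume f: "f \<in> tot_below U k"
    then have "hc t f \<noteq> 0" if "hc t (fscale c f) \<noteq> 0" for t
      using that sc[of f t c] by (auto simp: tot_below_def fscale_def)
    moreover have "fscale c f \<in> tot U" using f tot_emb[OF U _ poly_ring_const] by (simp add: fscale_def tot_below_def)
    ultimately show "fscale c f \<in> tot_below U k" using f unfolding tot_below_def by blast
  qed
qed

lemma tot_below_dim:
  assumes deg: "\<And>g. g \<in> G \<Longrightarrow> 0 \<le> deg g" and U: "sub U"
  shows "fs.dim (tot_below U k) = (\<Sum>t<k. fs.dim (U (int t))) \<and> (\<exists>X. finite X \<and> tot_below U k \<subseteq> fs.span X)"
proof (induction k)
  case 0
  have "f = 0" if f: "f \<in> tot_below U 0" for f
  proof -
    have FF: "f \<in> FF" using f by (simp add: tot_below_def tot_def)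
    have "hc t f = 0" for t
    proof (cases "t < 0")
      case True
      then show ?thesis using hc_in[OF FF, of t] Fg_neg[OF deg True] by simp
    next
      case False
      then show ?thesis using f by (auto simp: tot_below_def)
    qed
    then show ?thesis using hc_decompose[of "{}" f] by simp
  qed
  then have "tot_below U 0 \<subseteq> {0}" by blast
  then have "tot_below U 0 \<subseteq> fs.span {}" by simp
  then have "fs.dim (tot_below U 0) = 0" using fs.dim_le_card[of "tot_below U 0" "{}"] by simp
  then show ?case using \<open>tot_below U 0 \<subseteq> fs.span {}\<close> by (intro conjI exI[of _ "{}"]) auto
next
  case (Suc k)
  then obtain X where X: "finite X" "tot_below U k \<subseteq> fs.span X" by blast
  obtain Y where Y: "finite Y" "U (int k) \<subseteq> fs.span Y" using sub_finite_dim[OF U] by blast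
  \<comment> \<open>The component of degree \<open>k\<close> is split off; \<open>emb 1\<close>
    gives the sum the shape that \<open>dim_add_image\<close> expects.\<close>
  have eq: "tot_below U (Suc k) = {u + emb 1 * v | u v. u \<in> tot_below U k \<and> v \<in> U (int k)}"
  proof (intro equalityI subsetI)
    fix f assume f: "f \<in> tot_below U (Suc k)"
    define v where "v = hc (int k) f"
    have FF: "f \<in> FF" using f by (simp add: tot_below_def tot_def)
    have v: "v \<in> U (int k)" using f by (simp add: v_def tot_below_def tot_def)
    have vF: "v \<in> Fg (int k)" using v sub_subset[OF U] by blast
    have "f - v \<in> tot U" using f v tot_Fg[OF U vF] by (intro tot_diff[OF U]) (auto simp: tot_below_def)
    moreover have "t < int k" if "hc t (f - v) \<noteq> 0" for t
    proof -
      have "hc t (f - v) = (if t = int k then 0 else hc t f)"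
        using hc_Fg[OF vF, of t] by (auto simp: hc_diff v_def)
      then have "t \<noteq> int k" "hc t f \<noteq> 0" using that by (auto split: if_splits)
      then show ?thesis using f by (auto simp: tot_below_def)
    qed
    ultimately have "f - v \<in> tot_below U k" by (simp add: tot_below_def)
    moreover have "f = (f - v) + emb 1 * v" by (simp add: emb_simps)
    ultimately show "f \<in> {u + emb 1 * v | u v. u \<in> tot_below U k \<and> v \<in> U (int k)}" using v by blast
  next
    fix f assume "f \<in> {u + emb 1 * v | u v. u \<in> tot_below U k \<and> v \<in> U (int k)}"
    then obtain u v where uv: "f = u + v" "u \<in> tot_below U k" "v \<in> U (int k)" by (auto simp: emb_simps)
    have vF: "v \<in> Fg (int k)" using uv sub_subset[OF U] by blast
    have "f \<in> tot U" using uv tot_Fg[OF U vF] tot_add[OF U] by (auto simp: tot_below_def)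
    moreover have "t < int (Suc k)" if "hc t f \<noteq> 0" for t
    proof (cases "t = int k")
      case False
      then have "hc t u \<noteq> 0" using that uv(1) hc_Fg[OF vF, of t] by (auto simp: hc_add)
      then show ?thesis using uv(2) by (auto simp: tot_below_def)
    qed simp
    ultimately show "f \<in> tot_below U (Suc k)" by (simp add: tot_below_def)
  qed
  have K: "{v \<in> U (int k). emb 1 * v \<in> tot_below U k} \<subseteq> {0}"
  proof
    fix v assume "v \<in> {v \<in> U (int k). emb 1 * v \<in> tot_below U k}"
    then have v: "v \<in> U (int k)" "v \<in> tot_below U k" by (auto simp: emb_simps)
    then have "hc (int k) v = v" using hc_Fg[of v "int k" "int k"] sub_subset[OF U] by simp
    then show "v \<in> {0}" using v(2) by (auto simp: tot_below_def dest: spec[of _ "int k"])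
  qed
  then have "fs.dim {v \<in> U (int k). emb 1 * v \<in> tot_below U k} = 0"
    using fs.dim_le_card[of "{v \<in> U (int k). emb 1 * v \<in> tot_below U k}" "{}"] by simp
  then have "fs.dim (tot_below U (Suc k)) = fs.dim (tot_below U k) + fs.dim (U (int k))"
    unfolding eq using fs.dim_add_image[OF tot_below_subspace[OF U] X(2,1) sub_subspace[OF U] Y(2,1) linear_emb_mult, of 1]
    by linarith
  moreover have "tot_below U (Suc k) \<subseteq> fs.span (X \<union> Y)"
    unfolding eq fs.span_Un emb_simps mult_1 using X(2) Y(2) by blast
  moreover have "finite (X \<union> Y)" using X Y by simp
  ultimately show ?case using Suc by (metis sum.lessThan_Suc)
qed

end

locale free_chain = free_graded n G deg ty
  for n :: nat and G :: "'g set" and deg and ty :: "'k::field itself" +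
  fixes W :: "nat \<Rightarrow> int \<Rightarrow> ('g \<Rightarrow> 'k mpoly) set" and a :: "nat \<Rightarrow> 'k mpoly" and d :: nat
  assumes deg_nonneg: "g \<in> G \<Longrightarrow> 0 \<le> deg g"
    and sub_W0: "sub (W 0)"
    and a_homog: "j < d \<Longrightarrow> a (Suc j) \<in> homog n 1"
    and W_Suc: "j < d \<Longrightarrow> W (Suc j) = adj (W j) (emb (a (Suc j)))"
    and filter_reg: "j < d \<Longrightarrow> \<exists>t0. \<forall>t\<ge>t0. \<forall>f\<in>Fg t. emb (a (Suc j)) * f \<in> W j (t + 1) \<longrightarrow> f \<in> W j t"
    and W_full: "\<exists>t0. \<forall>t\<ge>t0. W d t = Fg t"
begin

sublocale filter_regular_chain n "\<lambda>j. emb (var j)" Fg "range (\<lambda>c. emb (const_poly c))" W "\<lambda>j. emb (a j)" d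
  using sub_W0 W_Suc filter_reg W_full linear_form_homog[OF a_homog]
  by unfold_locales auto

text \<open>High powers of the variables carry any element into the degrees where \<open>W d\<close>
  is everything.\<close>

lemma Usat_last: "Usat d t = Fg t"
proof
  show "Usat d t \<subseteq> Fg t" using sub_subset[OF sub_Usat] by blast
  show "Fg t \<subseteq> Usat d t"
  proof
    fix f assume f: "f \<in> Fg t"
    obtain t0 where t0: "\<forall>t\<ge>t0. W d t = Fg t" using W_full by blast
    have "emb (var j) ^ nat (t0 - t) * f \<in> W d (t + int (nat (t0 - t)))" if "j < n" for j
    proof -
      have "t + int (nat (t0 - t)) \<ge> t0" by linarith
      then show ?thesis using sub_xpow[OF sub_F f that, of "nat (t0 - t)"] t0 by blast
    qed
    then show "f \<in> Usat d t" unfolding Usat_def sat_def using f by blast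
  qed
qed

lemma hilbert_data:
  assumes v: "vanish_above (Usat 0) r" and B: "\<And>k. (\<Sum>t<k. codim (W d) (int t)) \<le> B"
  shows "hilbert_data d r B (\<lambda>j. codim (Usat j)) (\<lambda>j. codim (V j)) (\<lambda>j. codim (W j))"
proof
  fix j t assume j: "j < d"
  show "codim (Usat j) t - codim (Usat j) (t - 1) = codim (V (Suc j)) t"
    using codim_adj_regular[OF sub_Usat linear_form_homog[OF a_homog[OF j]] Usat_regular[OF j]] j
    by (simp add: V_def)
  show "codim (W j) t - codim (W j) (t - 1) \<le> codim (W (Suc j)) t"
    unfolding W_Suc[OF j] using j by (intro codim_adj_ge sub_W linear_form_homog a_homog) auto
next
  fix j t assume j: "j \<le> d"
  show "codim (Usat j) t \<le> codim (V j) t" by (intro codim_mono sub_Usat V_subset_Usat j)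
  show "0 \<le> codim (Usat j) t" by (intro codim_nonneg sub_Usat j)
  show "codim (V j) t \<le> codim (W j) t" by (intro codim_mono sub_V W_subset_V j)
  assume t: "t < 0"
  have "Fg t = {0}" using Fg_neg[OF deg_nonneg t] .
  then show "codim (Usat j) t = 0" "codim (W j) t = 0"
    using sub_subset[OF sub_Usat[OF j], of _ t] sub_zero[OF sub_Usat[OF j], of t]
      sub_subset[OF sub_W[OF j], of _ t] sub_zero[OF sub_W[OF j], of t]
    by (auto intro!: codim_full)
next
  fix j t assume "1 \<le> j" "j \<le> d" "r < t"
  then show "codim (Usat j) t = codim (V j) t" by (intro codim_cong Usat_eq_V[OF v])
next
  fix t show "codim (Usat d) t = 0" by (intro codim_full Usat_last)
next
  fix T :: int
  have "{0..T} = int ` {..<nat (T + 1)}"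
  proof (intro equalityI subsetI)
    fix s assume "s \<in> {0..T}"
    then show "s \<in> int ` {..<nat (T + 1)}" by (intro image_eqI[of _ _ "nat s"]) auto
  qed auto
  then have "(\<Sum>s\<in>{0..T}. codim (W d) s) = (\<Sum>t<nat (T + 1). codim (W d) (int t))"
    by (simp add: sum.reindex)
  then show "(\<Sum>s\<in>{0..T}. codim (W d) s) \<le> B" using B by simp
qed

end

section \<open>The Cech complex of a presented module\<close>

lemma monomials_one: "1 \<in> monomials S"
  unfolding monomials_def by (rule CollectI, rule exI[of _ 0]) (simp add: single_one)

lemma monomials_mult:
  assumes "s \<in> monomials S" "r \<in> monomials S"
  shows "s * r \<in> monomials S"
proof -
  obtain u v where uv: "s = Poly_Mapping.single u 1" "Poly_Mapping.keys u \<subseteq> S"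
    "r = Poly_Mapping.single v 1" "Poly_Mapping.keys v \<subseteq> S"
    using assms unfolding monomials_def by blast
  have "s * r = Poly_Mapping.single (u + v) 1" using uv by (simp add: mult_single)
  moreover have "Poly_Mapping.keys (u + v) \<subseteq> S" using uv Poly_Mapping.keys_add[of u v] by blast
  ultimately show ?thesis unfolding monomials_def by blast
qed

lemma monomials_mono: "S \<subseteq> T \<Longrightarrow> s \<in> monomials S \<Longrightarrow> s \<in> monomials T"
  unfolding monomials_def by blast

lemma monomials_carrier: "S \<subseteq> {..<n} \<Longrightarrow> s \<in> monomials S \<Longrightarrow> s \<in> carrier (poly_ring n)"
  unfolding monomials_def by (auto intro!: poly_ring_single)

definition vp :: "nat set \<Rightarrow> nat \<Rightarrow> 'k::field mpoly" where "vp S p = (\<Prod>j\<in>S. var j ^ p)"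

lemma vp_eq_single: "finite S \<Longrightarrow> vp S p = Poly_Mapping.single (\<Sum>j\<in>S. Poly_Mapping.single j p) 1"
proof (induction S rule: finite_induct)
  case empty
  then show ?case by (simp add: vp_def single_one)
next
  case (insert j S)
  have "var j ^ p = Poly_Mapping.single (Poly_Mapping.single j p) (1::'a)"
    by (induction p) (simp_all add: var_def mult_single single_one flip: single_add)
  then show ?case using insert by (simp add: vp_def mult_single)
qed

lemma vp_exponent_lookup:
  "finite S \<Longrightarrow> Poly_Mapping.lookup (\<Sum>j\<in>S. Poly_Mapping.single j p) i = (if i \<in> S then p else (0::nat))"
  by (simp add: lookup_sum lookup_single when_def)

lemma vp_exponent_keys:
  assumes "finite S" shows "Poly_Mapping.keys (\<Sum>j\<in>S. Poly_Mapping.single j (p::nat)) \<subseteq> S"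
proof
  fix i assume "i \<in> Poly_Mapping.keys (\<Sum>j\<in>S. Poly_Mapping.single j p)"
  then show "i \<in> S" using vp_exponent_lookup[OF assms, of p i] by (simp add: in_keys_iff split: if_splits)
qed

lemma vp_monomials: "finite S \<Longrightarrow> vp S p \<in> monomials S"
  unfolding monomials_def using vp_eq_single[of S p] vp_exponent_keys[of S p] by blast

lemma vp_exponent_deg: "finite S \<Longrightarrow> mon_deg (\<Sum>j\<in>S. Poly_Mapping.single j p) = p * card S"
  using mon_deg_eq[OF _ vp_exponent_keys, of S p] by (simp add: vp_exponent_lookup)

text \<open>Fractions can therefore be rewritten with the denominator \<open>vp S q\<close> for
  every large \<open>q\<close>. The form with \<open>eventually\<close> allows finitely many such
  choices to be made at one exponent.\<close>

lemma monomials_divide_vp: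
  assumes S: "finite S" "S \<subseteq> {..<n}" and s: "s \<in> monomials S"
  shows "\<forall>\<^sub>F q in sequentially. \<exists>s'\<in>monomials S. s * s' = vp S q \<and>
    (\<forall>b. s \<in> homog n b \<longrightarrow> s' \<in> homog n (q * card S - b) \<and> b \<le> q * card S)"
proof -
  obtain u where u: "s = Poly_Mapping.single u 1" "Poly_Mapping.keys u \<subseteq> S" using s unfolding monomials_def by blast
  show ?thesis
    using eventually_ge_at_top[of "mon_deg u"]
  proof (rule eventually_mono)
    fix q assume q: "mon_deg u \<le> q"
    let ?e = "\<Sum>j\<in>S. Poly_Mapping.single j q"
    define v where "v = ?e - u"
    have le: "Poly_Mapping.lookup u i \<le> (if i \<in> S then q else 0)" for i
    proof (cases "i \<in> S")
      case True
      then have "Poly_Mapping.lookup u i \<le> mon_deg u"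
        unfolding mon_deg_eq[OF S(1) u(2)] by (intro member_le_sum S(1)) auto
      then show ?thesis using q True by simp
    next
      case False
      then show ?thesis using u(2) by (auto simp: in_keys_iff)
    qed
    have uv: "u + v = ?e"
    proof (rule poly_mapping_eqI)
      fix i show "Poly_Mapping.lookup (u + v) i = Poly_Mapping.lookup ?e i"
        using le[of i] unfolding v_def lookup_add lookup_minus vp_exponent_lookup[OF S(1)] by simp
    qed
    have kv: "Poly_Mapping.keys v \<subseteq> S"
    proof
      fix i assume "i \<in> Poly_Mapping.keys v"
      then show "i \<in> S"
        unfolding in_keys_iff v_def lookup_minus vp_exponent_lookup[OF S(1)] by (simp split: if_splits)
    qed
    have deg: "mon_deg u + mon_deg v = q * card S" using vp_exponent_deg[OF S(1), of q] by (simp flip: uv add: mon_deg_add)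
    have "s * Poly_Mapping.single v 1 = vp S q"
      unfolding vp_eq_single[OF S(1)] uv[symmetric] u(1) by (simp add: mult_single)
    moreover have "Poly_Mapping.single v 1 \<in> homog n (q * card S - b) \<and> b \<le> q * card S" if "s \<in> homog n b" for b
    proof -
      have "b = mon_deg u" using that unfolding u(1) homog_def by simp
      then show ?thesis using deg homog_single[of v n 1] kv S(2) by (metis add_diff_cancel_left' le_add1 subset_trans)
    qed
    ultimately show "\<exists>s'\<in>monomials S. s * s' = vp S q \<and>
        (\<forall>b. s \<in> homog n b \<longrightarrow> s' \<in> homog n (q * card S - b) \<and> b \<le> q * card S)"
      using kv unfolding monomials_def by blast
  qed
qed

lemma UN_constant2:
  assumes "(a, b) \<in> X" "(c, e) \<in> Y" "\<And>a b c e. (a, b) \<in> X \<Longrightarrow> (c, e) \<in> Y \<Longrightarrow> h a b c e = Z"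
  shows "(\<Union>(a, b)\<in>X. \<Union>(c, e)\<in>Y. h a b c e) = Z"
  using assms by blast

lemma UN_constant1:
  assumes "(a, b) \<in> X" "\<And>a b. (a, b) \<in> X \<Longrightarrow> h a b = Z"
  shows "(\<Union>(a, b)\<in>X. h a b) = Z"
  using assms by blast

text \<open>Cross-multiplication identities behind the calculus of fractions, stated over an
  abstract ring. All but the last write the quantity to be tested through quantities that are known
  to lie in the kernel.\<close>

context
  fixes f g h w w' q r s r' s' f' g' a :: "'a::comm_ring_1"
begin

lemma frac_sym_id: "w * (r * f - s * g) = - (w * (s * g - r * f))"
  by (simp add: algebra_simps)

lemma frac_trans_id: "(w * w' * r) * (q * f - s * h) = (w' * q) * (w * (r * f - s * g)) + (w * s) * (w' * (q * g - r * h))"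
  by (simp add: algebra_simps)

lemma frac_add_id: "(w * w') * ((s' * r') * (r * f + s * g) - (s * r) * (r' * f' + s' * g'))
    = (w' * (r * r')) * (w * (s' * f - s * f')) + (w * (s * s')) * (w' * (r' * g - r * g'))"
  by (simp add: algebra_simps)

lemma frac_smult_id: "w * (r * (a * f) - s * (a * g)) = a * (w * (r * f - s * g))"
  by (simp add: algebra_simps)

lemma frac_common_id: "w * (s * g - s * h) = (w * s) * (g - h)"
  by (simp add: algebra_simps)

lemma frac_assoc_id:
  "(q * (r * f + s * g) + (s * r) * h) = ((r * q) * f + s * (q * g + r * h))"
  by (simp add: algebra_simps)

end

text \<open>\<open>Q\<close> is known only as the image of a free module, with kernel
  \<open>tot U\<close>. Quotient records thus fit in without being shown to be modules first; the
  laws used later are transported along \<open>\<psi>\<close>.\<close>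

locale presentation = free_graded n G deg ty
  for n :: nat and G :: "'g set" and deg and ty :: "'k::field itself" +
  fixes Q :: "('k mpoly, 'q) graded_module" and \<psi> :: "('g \<Rightarrow> 'k mpoly) \<Rightarrow> 'q" and U :: "int \<Rightarrow> ('g \<Rightarrow> 'k mpoly) set"
  assumes sub_U: "sub U"
    and psi_add: "f \<in> FF \<Longrightarrow> g \<in> FF \<Longrightarrow> \<psi> (f + g) = \<psi> f \<oplus>\<^bsub>Q\<^esub> \<psi> g"
    and psi_smult: "p \<in> carrier (poly_ring n) \<Longrightarrow> f \<in> FF \<Longrightarrow> \<psi> (emb p * f) = p \<odot>\<^bsub>Q\<^esub> \<psi> f"
    and psi_zero: "\<psi> 0 = \<zero>\<^bsub>Q\<^esub>"
    and carrier_Q: "carrier Q = \<psi> ` FF"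
    and grade_Q: "grade Q t = \<psi> ` Fg t"
    and kernel: "f \<in> FF \<Longrightarrow> \<psi> f = \<zero>\<^bsub>Q\<^esub> \<longleftrightarrow> f \<in> tot U"
begin

lemma psi_eq:
  assumes f: "f \<in> FF" and g: "g \<in> FF"
  shows "\<psi> f = \<psi> g \<longleftrightarrow> f - g \<in> tot U"
proof -
  have e: "\<psi> f = \<psi> (f - g) \<oplus>\<^bsub>Q\<^esub> \<psi> g" using psi_add[OF FF_diff[OF f g] g] by simp
  have e': "\<psi> (f - g) = \<psi> f \<oplus>\<^bsub>Q\<^esub> \<psi> (- g)" using psi_add[OF f FF_uminus[OF g]] by simp
  have z: "\<zero>\<^bsub>Q\<^esub> \<oplus>\<^bsub>Q\<^esub> \<psi> g = \<psi> g" using psi_add[OF FF_zero g] psi_zero by simp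
  have z': "\<psi> g \<oplus>\<^bsub>Q\<^esub> \<psi> (- g) = \<zero>\<^bsub>Q\<^esub>" using psi_add[OF g FF_uminus[OF g]] psi_zero by simp
  show ?thesis unfolding kernel[OF FF_diff[OF f g], symmetric] using e e' z z' by metis
qed

text \<open>Equality of the fractions \<open>f / s\<close> and \<open>g / r\<close> over
  \<open>Q\<close>, tested on numerators in the free module.\<close>

definition rel where
  "rel S f s g r \<longleftrightarrow> (\<exists>w\<in>monomials S. emb w * (emb r * f - emb s * g) \<in> tot U)"

definition fr :: "nat set \<Rightarrow> ('g \<Rightarrow> 'k mpoly) \<Rightarrow> 'k mpoly \<Rightarrow> ('q \<times> 'k mpoly) set" where
  "fr S f s = fraction Q (monomials S) (\<psi> f) s"

context
  fixes S :: "nat set" assumes S: "S \<subseteq> {..<n}"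
begin

lemmas mon_car = monomials_carrier[OF S]

lemma tot_mon: "s \<in> monomials S \<Longrightarrow> f \<in> tot U \<Longrightarrow> emb s * f \<in> tot U"
  using tot_emb[OF sub_U _ mon_car] .

lemma FF_mon: "s \<in> monomials S \<Longrightarrow> f \<in> FF \<Longrightarrow> emb s * f \<in> FF"
  using FF_emb[OF mon_car] .

lemma rel_sym: "rel S f s g r \<Longrightarrow> rel S g r f s"
proof -
  assume "rel S f s g r"
  then obtain w where w: "w \<in> monomials S" "emb w * (emb r * f - emb s * g) \<in> tot U" unfolding rel_def by blast
  then have "emb w * (emb s * g - emb r * f) \<in> tot U"
    using tot_uminus[OF sub_U w(2)] frac_sym_id[of "emb w" "emb s" g "emb r" f] by simp
  then show ?thesis using w unfolding rel_def by blast
qed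

lemma rel_trans:
  assumes "rel S f s g r" "rel S g r h q" "s \<in> monomials S" "r \<in> monomials S" "q \<in> monomials S"
  shows "rel S f s h q"
proof -
  obtain w where w: "w \<in> monomials S" "emb w * (emb r * f - emb s * g) \<in> tot U" using assms unfolding rel_def by blast
  obtain w' where w': "w' \<in> monomials S" "emb w' * (emb q * g - emb r * h) \<in> tot U" using assms unfolding rel_def by blast
  have "emb (w * w' * r) * (emb q * f - emb s * h) \<in> tot U"
    unfolding emb_simps frac_trans_id[of "emb w" "emb w'" "emb r" "emb q" f "emb s" h g]
    unfolding emb_simps(2)[symmetric]
    by (rule tot_add[OF sub_U tot_mon[OF _ w(2)] tot_mon[OF _ w'(2)]]) (intro monomials_mult assms w w')+
  then show ?thesis using assms w w' monomials_mult unfolding rel_def by blast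
qed

lemma rel_scale:
  assumes "a \<in> monomials S" "f \<in> FF"
  shows "rel S f s (emb a * f) (s * a)"
proof -
  have "emb (s * a) * f - emb s * (emb a * f) = 0" by (simp add: emb_simps mult.assoc)
  then have "emb 1 * (emb (s * a) * f - emb s * (emb a * f)) \<in> tot U" using tot_zero[OF sub_U] by simp
  then show ?thesis using monomials_one unfolding rel_def by blast
qed

lemma rel_psi:
  assumes f: "f \<in> FF" and g: "g \<in> FF" and e: "\<psi> f = \<psi> g" and s: "s \<in> monomials S"
  shows "rel S f s g s"
proof -
  have "emb s * (f - g) \<in> tot U" using psi_eq[OF f g] e tot_mon[OF s] by blast
  then have "emb 1 * (emb s * f - emb s * g) \<in> tot U" by (simp add: emb_simps right_diff_distrib)
  then show ?thesis using monomials_one unfolding rel_def by blast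
qed

lemma fr_iff:
  assumes f: "f \<in> FF" and s: "s \<in> monomials S"
  shows "(y, r) \<in> fr S f s \<longleftrightarrow> (\<exists>g\<in>FF. y = \<psi> g \<and> r \<in> monomials S \<and> rel S f s g r)"
proof -
  have "w \<odot>\<^bsub>Q\<^esub> (r \<odot>\<^bsub>Q\<^esub> \<psi> f) = w \<odot>\<^bsub>Q\<^esub> (s \<odot>\<^bsub>Q\<^esub> \<psi> g) \<longleftrightarrow> emb w * (emb r * f - emb s * g) \<in> tot U"
    if "w \<in> monomials S" "r \<in> monomials S" "g \<in> FF" for w r g
  proof -
    have "w \<odot>\<^bsub>Q\<^esub> (r \<odot>\<^bsub>Q\<^esub> \<psi> f) = \<psi> (emb w * (emb r * f))" "w \<odot>\<^bsub>Q\<^esub> (s \<odot>\<^bsub>Q\<^esub> \<psi> g) = \<psi> (emb w * (emb s * g))"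
      using psi_smult[OF mon_car FF_mon] psi_smult[OF mon_car] that f s by presburger+
    then show ?thesis
      using psi_eq[of "emb w * (emb r * f)" "emb w * (emb s * g)"] FF_mon that f s by (simp add: right_diff_distrib)
  qed
  then show ?thesis unfolding fr_def fraction_def rel_def carrier_Q by blast
qed

lemma fr_self: "f \<in> FF \<Longrightarrow> s \<in> monomials S \<Longrightarrow> (\<psi> f, s) \<in> fr S f s"
  using fr_iff rel_psi by blast

lemma fr_eq:
  assumes f: "f \<in> FF" and g: "g \<in> FF" and s: "s \<in> monomials S" and r: "r \<in> monomials S"
  shows "fr S f s = fr S g r \<longleftrightarrow> rel S f s g r"
proof
  assume "fr S f s = fr S g r"
  then have "(\<psi> g, r) \<in> fr S f s" using fr_self[OF g r] by simp
  then obtain g' where "g' \<in> FF" "\<psi> g = \<psi> g'" "rel S f s g' r" using fr_iff[OF f s] by blast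
  then show "rel S f s g r" using rel_trans[OF _ rel_psi[of g' g r] s r r] g r by metis
next
  assume "rel S f s g r"
  then have "rel S f s h q \<longleftrightarrow> rel S g r h q" if "q \<in> monomials S" for h q
    using rel_trans rel_sym s r that by metis
  then have "(y, q) \<in> fr S f s \<longleftrightarrow> (y, q) \<in> fr S g r" for y q
    unfolding fr_iff[OF f s] fr_iff[OF g r] by blast
  then show "fr S f s = fr S g r" by auto
qed

lemma fr_scale: "f \<in> FF \<Longrightarrow> s \<in> monomials S \<Longrightarrow> a \<in> monomials S \<Longrightarrow> fr S (emb a * f) (s * a) = fr S f s"
  using fr_eq[of f "emb a * f" s "s * a"] rel_scale FF_mon monomials_mult by metis

abbreviation L where "L \<equiv> localization n Q S"

lemma loc_carrier: "carrier L = {fr S f s | f s. f \<in> FF \<and> s \<in> monomials S}"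
  unfolding localization_def Let_def fr_def carrier_Q by auto

lemma loc_zero: "\<zero>\<^bsub>L\<^esub> = fr S 0 1"
  unfolding localization_def Let_def fr_def psi_zero by simp

lemma loc_grade: "grade L t = {fr S f s | f s a b. f \<in> Fg a \<and> s \<in> monomials S \<inter> homog n b \<and> t = a - int b}"
  unfolding localization_def Let_def fr_def grade_Q by auto

text \<open>The sum in \<open>localization\<close> is a union over all pairs of representatives; it
  collapses to one fraction once all pairs are shown to give the same class.\<close>

lemma loc_add:
  assumes f: "f \<in> FF" and g: "g \<in> FF" and s: "s \<in> monomials S" and r: "r \<in> monomials S"
  shows "fr S f s \<oplus>\<^bsub>L\<^esub> fr S g r = fr S (emb r * f + emb s * g) (s * r)"
proof -
  have "fr S f s \<oplus>\<^bsub>L\<^esub> fr S g r = (\<Union>(y, s')\<in>fr S f s. \<Union>(z, r')\<in>fr S g r.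
      fraction Q (monomials S) (r' \<odot>\<^bsub>Q\<^esub> y \<oplus>\<^bsub>Q\<^esub> s' \<odot>\<^bsub>Q\<^esub> z) (s' * r'))"
    unfolding localization_def Let_def by simp
  also have "\<dots> = fr S (emb r * f + emb s * g) (s * r)"
  proof (rule UN_constant2[OF fr_self[OF f s] fr_self[OF g r]])
    fix y s' z r' assume "(y, s') \<in> fr S f s" "(z, r') \<in> fr S g r"
    then obtain f' g' where f': "f' \<in> FF" "y = \<psi> f'" "s' \<in> monomials S" "rel S f s f' s'"
      and g': "g' \<in> FF" "z = \<psi> g'" "r' \<in> monomials S" "rel S g r g' r'"
      unfolding fr_iff[OF f s] fr_iff[OF g r] by blast
    obtain w where w: "w \<in> monomials S" "emb w * (emb s' * f - emb s * f') \<in> tot U"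
      using f'(4) unfolding rel_def by blast
    obtain w' where w': "w' \<in> monomials S" "emb w' * (emb r' * g - emb r * g') \<in> tot U"
      using g'(4) unfolding rel_def by blast
    have "emb (w * w') * (emb (s' * r') * (emb r * f + emb s * g) - emb (s * r) * (emb r' * f' + emb s' * g')) \<in> tot U"
      unfolding emb_simps frac_add_id[of "emb w" "emb w'" "emb s'" "emb r'" "emb r" f "emb s" g f' g']
      unfolding emb_simps(2)[symmetric]
      by (rule tot_add[OF sub_U tot_mon[OF _ w(2)] tot_mon[OF _ w'(2)]]) (intro monomials_mult s r f' g' w w')+
    then have "rel S (emb r * f + emb s * g) (s * r) (emb r' * f' + emb s' * g') (s' * r')"
      using w w' monomials_mult unfolding rel_def by blast
    moreover have "r' \<odot>\<^bsub>Q\<^esub> y \<oplus>\<^bsub>Q\<^esub> s' \<odot>\<^bsub>Q\<^esub> z = \<psi> (emb r' * f' + emb s' * g')"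
      unfolding psi_add[OF FF_mon[OF g'(3) f'(1)] FF_mon[OF f'(3) g'(1)]]
        psi_smult[OF mon_car[OF g'(3)] f'(1)] psi_smult[OF mon_car[OF f'(3)] g'(1)] f'(2) g'(2) ..
    ultimately show "fraction Q (monomials S) (r' \<odot>\<^bsub>Q\<^esub> y \<oplus>\<^bsub>Q\<^esub> s' \<odot>\<^bsub>Q\<^esub> z) (s' * r') = fr S (emb r * f + emb s * g) (s * r)"
      using fr_eq[of "emb r * f + emb s * g" "emb r' * f' + emb s' * g'" "s * r" "s' * r'"]
        monomials_mult[OF s r] monomials_mult[OF f'(3) g'(3)] f g s r f' g' unfolding fr_def by (simp add: FF_add FF_mon)
  qed
  finally show ?thesis .
qed

lemma loc_smult:
  assumes f: "f \<in> FF" and s: "s \<in> monomials S" and a: "a \<in> carrier (poly_ring n)"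
  shows "a \<odot>\<^bsub>L\<^esub> fr S f s = fr S (emb a * f) s"
proof -
  have "a \<odot>\<^bsub>L\<^esub> fr S f s = (\<Union>(y, s')\<in>fr S f s. fraction Q (monomials S) (a \<odot>\<^bsub>Q\<^esub> y) s')"
    unfolding localization_def Let_def by simp
  also have "\<dots> = fr S (emb a * f) s"
  proof (rule UN_constant1[OF fr_self[OF f s]])
    fix y s' assume "(y, s') \<in> fr S f s"
    then obtain f' where f': "f' \<in> FF" "y = \<psi> f'" "s' \<in> monomials S" "rel S f s f' s'"
      unfolding fr_iff[OF f s] by blast
    obtain w where w: "w \<in> monomials S" "emb w * (emb s' * f - emb s * f') \<in> tot U"
      using f'(4) unfolding rel_def by blast
    have "emb w * (emb s' * (emb a * f) - emb s * (emb a * f')) \<in> tot U"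
      unfolding frac_smult_id using tot_emb[OF sub_U w(2) a] .
    then have "rel S (emb a * f) s (emb a * f') s'" using w unfolding rel_def by blast
    then show "fraction Q (monomials S) (a \<odot>\<^bsub>Q\<^esub> y) s' = fr S (emb a * f) s"
      using fr_eq[of "emb a * f" "emb a * f'" s s'] FF_emb[OF a] f s f' psi_smult[OF a] unfolding fr_def by simp
  qed
  finally show ?thesis .
qed

end

lemma restriction_fr:
  assumes S: "S \<subseteq> {..<n}" and T: "T \<subseteq> S" and f: "f \<in> FF" and s: "s \<in> monomials T"
  shows "restriction Q S (fr T f s) = fr S f s"
proof -
  have T': "T \<subseteq> {..<n}" using S T by blast
  show ?thesis unfolding restriction_def
  proof (rule UN_constant1[OF fr_self[OF T' f s]])
    fix y s' assume "(y, s') \<in> fr T f s"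
    then obtain f' where f': "f' \<in> FF" "y = \<psi> f'" "s' \<in> monomials T" "rel T f s f' s'"
      unfolding fr_iff[OF T' f s] by blast
    then have "rel S f s f' s'" using monomials_mono[OF T] unfolding rel_def by blast
    then show "fraction Q (monomials S) y s' = fr S f s"
      using fr_eq[OF S f f'(1) monomials_mono[OF T s] monomials_mono[OF T f'(3)]] f'(2) unfolding fr_def by simp
  qed
qed

lemma fr_zero: "S \<subseteq> {..<n} \<Longrightarrow> s \<in> monomials S \<Longrightarrow> fr S 0 s = fr S 0 1"
  using fr_scale[of S 0 1 s] FF_zero monomials_one[of S] by simp

lemma fr_add:
  assumes S: "S \<subseteq> {..<n}" and f: "f \<in> FF" and g: "g \<in> FF" and s: "s \<in> monomials S"
  shows "fr S f s \<oplus>\<^bsub>localization n Q S\<^esub> fr S g s = fr S (f + g) s"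
  using loc_add[OF S f g s s] fr_scale[OF S FF_add[OF f g] s s] by (simp add: distrib_left)

text \<open>The abelian monoid laws are what finite sums in a record depend on, and
  \<open>cech_diff\<close> is such a sum.\<close>

lemma loc_monoid:
  assumes S: "S \<subseteq> {..<n}"
  shows "abelian_monoid (localization n Q S)"
proof (rule abelian_monoidI)
  let ?L = "localization n Q S"
  note [simp] = FF_mon[OF S] FF_add monomials_mult
  show "\<zero>\<^bsub>?L\<^esub> \<in> carrier ?L" unfolding loc_carrier[OF S] loc_zero[OF S] using FF_zero monomials_one by blast
  fix x assume "x \<in> carrier ?L"
  then obtain f s where f: "x = fr S f s" "f \<in> FF" "s \<in> monomials S" unfolding loc_carrier[OF S] by blast
  have "\<zero>\<^bsub>?L\<^esub> = fr S 0 s" unfolding loc_zero[OF S] using fr_zero[OF S f(3)] by simp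
  then show "\<zero>\<^bsub>?L\<^esub> \<oplus>\<^bsub>?L\<^esub> x = x" using fr_add[OF S FF_zero f(2,3)] f(1) by simp
  fix y assume "y \<in> carrier ?L"
  then obtain g r where g: "y = fr S g r" "g \<in> FF" "r \<in> monomials S" unfolding loc_carrier[OF S] by blast
  show "x \<oplus>\<^bsub>?L\<^esub> y \<in> carrier ?L"
    unfolding f(1) g(1) loc_add[OF S f(2) g(2) f(3) g(3)] loc_carrier[OF S] using f g by fastforce
  show "x \<oplus>\<^bsub>?L\<^esub> y = y \<oplus>\<^bsub>?L\<^esub> x"
    unfolding f(1) g(1) loc_add[OF S f(2) g(2) f(3) g(3)] loc_add[OF S g(2) f(2) g(3) f(3)]
    by (simp add: add.commute mult.commute)
  fix z assume "z \<in> carrier ?L"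
  then obtain h q where h: "z = fr S h q" "h \<in> FF" "q \<in> monomials S" unfolding loc_carrier[OF S] by blast
  show "x \<oplus>\<^bsub>?L\<^esub> y \<oplus>\<^bsub>?L\<^esub> z = x \<oplus>\<^bsub>?L\<^esub> (y \<oplus>\<^bsub>?L\<^esub> z)"
    unfolding f(1) g(1) h(1) using f g h
    by (simp add: loc_add[OF S] emb_simps mult.assoc flip: frac_assoc_id) (simp add: algebra_simps)
qed

lemma finsum_fr:
  assumes S: "S \<subseteq> {..<n}" and s: "s \<in> monomials S" and "finite A" "\<And>j. j \<in> A \<Longrightarrow> f j \<in> FF"
  shows "finsum (localization n Q S) (\<lambda>j. fr S (f j) s) A = fr S (\<Sum>j\<in>A. f j) s"
  using assms(3,4)
proof (induction A rule: finite_induct)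
  case empty
  show ?case unfolding sum.empty abelian_monoid.finsum_empty[OF loc_monoid[OF S]] loc_zero[OF S] fr_zero[OF S s] ..
next
  case (insert j A)
  have "(\<lambda>j. fr S (f j) s) \<in> A \<rightarrow> carrier (localization n Q S)" "fr S (f j) s \<in> carrier (localization n Q S)"
    unfolding loc_carrier[OF S] using insert.prems s by blast+
  then have "finsum (localization n Q S) (\<lambda>j. fr S (f j) s) (insert j A)
      = fr S (f j) s \<oplus>\<^bsub>localization n Q S\<^esub> fr S (\<Sum>j\<in>A. f j) s"
    using abelian_monoid.finsum_insert[OF loc_monoid[OF S] insert.hyps] insert.IH insert.prems by simp
  also have "\<dots> = fr S (f j + (\<Sum>j\<in>A. f j)) s"
    using insert.prems by (intro fr_add[OF S _ FF_sum s]) auto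
  also have "f j + (\<Sum>j\<in>A. f j) = (\<Sum>j\<in>insert j A. f j)" using insert.hyps by (rule sum.insert[symmetric])
  finally show ?case .
qed

lemma emb_vp: "emb (vp S p) = xp S p"
  unfolding vp_def xp_def emb_prod emb_simps ..

text \<open>The multiplier in the equality of fractions divides every large power
  \<open>xp S q\<close> and can be replaced by any of these; the resulting condition combines over
  finitely many \<open>S\<close>.\<close>

lemma fr_eq_common:
  assumes S: "S \<subseteq> {..<n}" and g: "g \<in> FF" and h: "h \<in> FF" and s: "s \<in> monomials S"
  shows "fr S g s = fr S h s \<longleftrightarrow> (\<forall>\<^sub>F q in sequentially. xp S q * (g - h) \<in> tot U)"
proof -
  have fS: "finite S" using S finite_subset by blast
  show ?thesis unfolding fr_eq[OF S g h s s]
  proof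
    assume "rel S g s h s"
    then obtain w where w: "w \<in> monomials S" "emb w * (emb s * g - emb s * h) \<in> tot U" unfolding rel_def by blast
    then have w2: "emb (w * s) * (g - h) \<in> tot U" by (simp add: frac_common_id emb_simps)
    show "\<forall>\<^sub>F q in sequentially. xp S q * (g - h) \<in> tot U"
      using monomials_divide_vp[OF fS S monomials_mult[OF w(1) s]]
    proof (rule eventually_mono)
      fix q assume "\<exists>s'\<in>monomials S. w * s * s' = vp S q \<and> (\<forall>b. w * s \<in> homog n b \<longrightarrow> s' \<in> homog n (q * card S - b) \<and> b \<le> q * card S)"
      then obtain s' where s': "s' \<in> monomials S" "w * s * s' = vp S q" by blast
      have "emb s' * (emb (w * s) * (g - h)) \<in> tot U" using tot_mon[OF S s'(1) w2] .
      then show "xp S q * (g - h) \<in> tot U"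
        unfolding emb_vp[symmetric] s'(2)[symmetric] by (simp add: emb_simps mult.assoc mult.left_commute)
    qed
  next
    assume "\<forall>\<^sub>F q in sequentially. xp S q * (g - h) \<in> tot U"
    then obtain q where "xp S q * (g - h) \<in> tot U"
      using eventually_happens[of _ sequentially] by (auto simp: trivial_limit_sequentially)
    then have "emb s * (emb (vp S q) * (g - h)) \<in> tot U" unfolding emb_vp by (rule tot_mon[OF S s])
    then have "emb (vp S q) * (emb s * g - emb s * h) \<in> tot U" by (simp add: frac_common_id mult.assoc mult.left_commute)
    then show "rel S g s h s" using vp_monomials[OF fS] unfolding rel_def by blast
  qed
qed

lemma loc_rep:
  assumes S: "S \<subseteq> {..<n}" and c: "c \<in> carrier (localization n Q S)"
  shows "\<forall>\<^sub>F p in sequentially. \<exists>f\<in>FF. c = fr S f (vp S p)"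
proof -
  obtain f s where f: "c = fr S f s" "f \<in> FF" "s \<in> monomials S" using c unfolding loc_carrier[OF S] by blast
  show ?thesis
    using monomials_divide_vp[OF finite_subset[OF S finite_lessThan] S f(3)]
  proof (rule eventually_mono)
    fix p assume "\<exists>s'\<in>monomials S. s * s' = vp S p \<and> (\<forall>b. s \<in> homog n b \<longrightarrow> s' \<in> homog n (p * card S - b) \<and> b \<le> p * card S)"
    then obtain s' where s': "s' \<in> monomials S" "s * s' = vp S p" by blast
    have "c = fr S (emb s' * f) (vp S p)" unfolding f(1) s'(2)[symmetric] using fr_scale[OF S f(2,3) s'(1)] by simp
    then show "\<exists>f\<in>FF. c = fr S f (vp S p)" using FF_mon[OF S s'(1) f(2)] by blast
  qed
qed

lemma loc_rep_graded:
  assumes S: "S \<subseteq> {..<n}" and c: "c \<in> grade (localization n Q S) t"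
  shows "\<forall>\<^sub>F p in sequentially. \<exists>f\<in>Fg (t + int (p * card S)). c = fr S f (vp S p)"
proof -
  obtain f s a b where f: "c = fr S f s" "f \<in> Fg a" "s \<in> monomials S" "s \<in> homog n b" "t = a - int b"
    using c unfolding loc_grade[OF S] by blast
  show ?thesis
    using monomials_divide_vp[OF finite_subset[OF S finite_lessThan] S f(3)]
  proof (rule eventually_mono)
    fix p assume "\<exists>s'\<in>monomials S. s * s' = vp S p \<and> (\<forall>b. s \<in> homog n b \<longrightarrow> s' \<in> homog n (p * card S - b) \<and> b \<le> p * card S)"
    then obtain s' where s': "s' \<in> monomials S" "s * s' = vp S p" "s' \<in> homog n (p * card S - b)" "b \<le> p * card S"
      using f(4) by blast
    have "c = fr S (emb s' * f) (vp S p)"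
      unfolding f(1) s'(2)[symmetric] using fr_scale[OF S Fg_subset_FF[OF f(2)] f(3) s'(1)] by simp
    moreover have "a + int (p * card S - b) = t + int (p * card S)" using s'(4) f(5) by (simp add: of_nat_diff)
    then have "emb s' * f \<in> Fg (t + int (p * card S))" using Fg_homog[OF s'(3) f(2)] by simp
    ultimately show "\<exists>f\<in>Fg (t + int (p * card S)). c = fr S f (vp S p)" by blast
  qed
qed

end

section \<open>Cech cochains with a common denominator\<close>

context presentation begin

lemma idx_cech: "cech_index n i = idx i"
  by (simp add: cech_index_def idx_def)

lemma idx_sub: "S \<in> idx i \<Longrightarrow> S \<subseteq> {..<n}"
  by (simp add: idx_def)

lemma finite_idx: "finite (idx i)"
  by (simp add: idx_def)

lemma vp_mon: "S \<in> idx i \<Longrightarrow> vp S p \<in> monomials S"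
  using vp_monomials idx_finite by blast

text \<open>The bridge between the two complexes: since there are finitely many \<open>S\<close>,
  each Cech cochain has this form for all large \<open>p\<close>, and \<open>m\<close> is then a
  cochain of the Koszul complex of the \<open>p\<close>-th powers.\<close>

definition coch :: "nat \<Rightarrow> nat \<Rightarrow> (nat set \<Rightarrow> 'g \<Rightarrow> 'k mpoly) \<Rightarrow> nat set \<Rightarrow> ('q \<times> 'k mpoly) set" where
  "coch i p m = (\<lambda>S\<in>idx i. fr S (m S) (vp S p))"

lemma cech_sel:
  "carrier (cech n Q i) = (\<Pi>\<^sub>E S\<in>idx i. carrier (localization n Q S))"
  "\<zero>\<^bsub>cech n Q i\<^esub> = (\<lambda>S\<in>idx i. \<zero>\<^bsub>localization n Q S\<^esub>)"
  "c \<oplus>\<^bsub>cech n Q i\<^esub> c' = (\<lambda>S\<in>idx i. c S \<oplus>\<^bsub>localization n Q S\<^esub> c' S)"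
  "grade (cech n Q i) t = (\<Pi>\<^sub>E S\<in>idx i. grade (localization n Q S) t)"
  by (simp_all add: cech_def Let_def idx_cech)

lemma coch_cong: "(\<And>S. S \<in> idx i \<Longrightarrow> fr S (m S) (vp S p) = fr S (m' S) (vp S p')) \<Longrightarrow> coch i p m = coch i p' m'"
  unfolding coch_def by (rule restrict_ext)

lemma coch_carrier: "(\<And>S. S \<in> idx i \<Longrightarrow> m S \<in> FF) \<Longrightarrow> coch i p m \<in> carrier (cech n Q i)"
  unfolding coch_def cech_sel using loc_carrier[OF idx_sub] vp_mon by (intro restrict_PiE_iff[THEN iffD2]) blast

lemma coch_grade:
  assumes "\<And>S. S \<in> idx i \<Longrightarrow> m S \<in> Fg (t + int (p * i))"
  shows "coch i p m \<in> grade (cech n Q i) t"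
  unfolding coch_def cech_sel
proof (intro restrict_PiE_iff[THEN iffD2] ballI)
  fix S assume S: "S \<in> idx i"
  have fS: "finite S" and cS: "card S = i" using idx_finite[OF S] S by (auto simp: idx_def)
  have "vp S p \<in> homog n (p * i)"
    using homog_single[of "\<Sum>j\<in>S. Poly_Mapping.single j p" n 1] vp_exponent_keys[OF fS, of p] idx_sub[OF S]
      vp_exponent_deg[OF fS, of p] vp_eq_single[OF fS, of p] cS by (metis order_trans)
  then have "vp S p \<in> monomials S \<inter> homog n (p * i)" using vp_mon[OF S] by blast
  moreover have "t = (t + int (p * i)) - int (p * i)" by simp
  ultimately show "fr S (m S) (vp S p) \<in> grade (localization n Q S) t"
    unfolding loc_grade[OF idx_sub[OF S]] using assms[OF S] by blast
qed

lemma coch_zero: "\<zero>\<^bsub>cech n Q i\<^esub> = coch i p (\<lambda>S. 0)"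
  unfolding coch_def cech_sel
  using loc_zero[OF idx_sub] fr_zero[OF idx_sub vp_mon] by (intro restrict_ext) metis

lemma coch_add:
  assumes "\<And>S. S \<in> idx i \<Longrightarrow> m S \<in> FF" "\<And>S. S \<in> idx i \<Longrightarrow> m' S \<in> FF"
  shows "coch i p m \<oplus>\<^bsub>cech n Q i\<^esub> coch i p m' = coch i p (\<lambda>S. m S + m' S)"
  unfolding cech_sel(3) coch_def
proof (rule restrict_ext)
  fix S assume S: "S \<in> idx i"
  show "restrict (\<lambda>S. fr S (m S) (vp S p)) (idx i) S \<oplus>\<^bsub>localization n Q S\<^esub> restrict (\<lambda>S. fr S (m' S) (vp S p)) (idx i) S = fr S (m S + m' S) (vp S p)"
    using fr_add[OF idx_sub[OF S] assms(1)[OF S] assms(2)[OF S] vp_mon[OF S]] S by simp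
qed

lemma vp_add: "vp S (p + q) = vp S p * vp S q"
  by (simp add: vp_def power_add prod.distrib)

lemma coch_raise:
  assumes "\<And>S. S \<in> idx i \<Longrightarrow> m S \<in> FF"
  shows "coch i (p + q) (\<lambda>S. xp S q * m S) = coch i p m"
proof (rule coch_cong)
  fix S assume S: "S \<in> idx i"
  show "fr S (xp S q * m S) (vp S (p + q)) = fr S (m S) (vp S p)"
    using fr_scale[OF idx_sub[OF S] assms[OF S] vp_mon[OF S] vp_mon[OF S], of q p] unfolding vp_add emb_vp .
qed

lemma sg_emb: "sg S j = emb ((-1) ^ card {h \<in> S. h < j})"
  unfolding sg_def by (simp only: emb_simps)

lemma sg_carrier: "(-1) ^ k \<in> carrier (poly_ring n)"
  by (intro poly_ring_power poly_ring_uminus poly_ring_one)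

lemma FF_dif_term:
  assumes "S \<in> idx (Suc i)" "j \<in> S" "m (S - {j}) \<in> FF"
  shows "sg S j * emb (var j) ^ p * m (S - {j}) \<in> FF"
  unfolding sg_emb emb_simps(6)[symmetric] emb_simps(2)[symmetric]
  using assms idx_less[OF assms(1,2)] by (intro FF_emb poly_ring_mult sg_carrier poly_ring_power poly_ring_var)

lemma FF_dif:
  assumes "S \<in> idx (Suc i)" "\<And>T. T \<in> idx i \<Longrightarrow> m T \<in> FF"
  shows "dif p m S \<in> FF"
  unfolding dif_def using FF_dif_term[OF assms(1)] assms(2) idx_remove[OF assms(1)] by (intro FF_sum) blast

lemma FF_xp: "S \<subseteq> {..<n} \<Longrightarrow> f \<in> FF \<Longrightarrow> xp S q * f \<in> FF"
  unfolding emb_vp[symmetric] using FF_mon[OF _ vp_monomials] finite_subset by blast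

lemma tot_xp: "S \<subseteq> {..<n} \<Longrightarrow> f \<in> tot U \<Longrightarrow> xp S q * f \<in> tot U"
  unfolding emb_vp[symmetric] using tot_mon[OF _ vp_monomials] finite_subset by blast

text \<open>Bringing the fraction at \<open>S - {j}\<close> to the denominator \<open>vp S p\<close>
  multiplies its numerator by \<open>var j ^ p\<close>, which is, up to sign, the coefficient in the
  Koszul differential.\<close>

lemma cech_diff_coch:
  assumes m: "\<And>S. S \<in> idx i \<Longrightarrow> m S \<in> FF"
  shows "cech_diff n Q i (coch i p m) = coch (Suc i) p (dif p m)"
  unfolding cech_diff_def idx_cech coch_def[of "Suc i"]
proof (rule restrict_ext)
  fix S assume S: "S \<in> idx (Suc i)"
  let ?L = "localization n Q S"
  have Sn: "S \<subseteq> {..<n}" and fS: "finite S" using idx_sub[OF S] idx_finite[OF S] by auto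
  have t: "(-1) ^ card {h \<in> S. h < j} \<odot>\<^bsub>?L\<^esub> restriction Q S (coch i p m (S - {j}))
      = fr S (sg S j * emb (var j) ^ p * m (S - {j})) (vp S p)" if j: "j \<in> S" for j
  proof -
    note T = idx_remove[OF S j]
    have jm: "var j ^ p \<in> monomials S" using monomials_mono[OF _ vp_monomials[of "{j}" p], of S] j by (simp add: vp_def)
    have f: "emb (var j ^ p) * m (S - {j}) \<in> FF" using FF_mon[OF Sn jm m[OF T]] .
    have vpS: "vp S p = vp (S - {j}) p * var j ^ p"
      using fS j by (simp add: vp_def prod.remove mult.commute)
    have "restriction Q S (coch i p m (S - {j})) = fr S (m (S - {j})) (vp (S - {j}) p)"
      unfolding coch_def using T restriction_fr[OF Sn _ m[OF T] vp_mon[OF T], of p] by simp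
    also have "\<dots> = fr S (emb (var j ^ p) * m (S - {j})) (vp S p)"
      unfolding vpS using fr_scale[OF Sn m[OF T] monomials_mono[OF _ vp_mon[OF T]] jm, of p] by simp
    finally show ?thesis
      using loc_smult[OF Sn f vp_mon[OF S] sg_carrier] by (simp add: sg_emb emb_simps(6) mult.assoc)
  qed
  have mon: "abelian_monoid ?L" using loc_monoid[OF Sn] .
  have FFt: "sg S j * emb (var j) ^ p * m (S - {j}) \<in> FF" if "j \<in> S" for j
    using FF_dif_term[of S i j m p] S that m[OF idx_remove[OF S that]] by blast
  have "finsum ?L (\<lambda>j. (-1) ^ card {h \<in> S. h < j} \<odot>\<^bsub>?L\<^esub> restriction Q S (coch i p m (S - {j}))) S
      = finsum ?L (\<lambda>j. fr S (sg S j * emb (var j) ^ p * m (S - {j})) (vp S p)) S"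
  proof (rule abelian_monoid.finsum_cong'[OF mon refl])
    show "(\<lambda>j. fr S (sg S j * emb (var j) ^ p * m (S - {j})) (vp S p)) \<in> S \<rightarrow> carrier ?L"
      unfolding loc_carrier[OF Sn] using FFt vp_mon[OF S] by blast
  qed (rule t)
  also have "\<dots> = fr S (dif p m S) (vp S p)"
    unfolding dif_def using FFt by (intro finsum_fr[OF Sn vp_mon[OF S] fS])
  finally show "finsum ?L (\<lambda>j. (-1) ^ card {h \<in> S. h < j} \<odot>\<^bsub>?L\<^esub> restriction Q S (coch i p m (S - {j}))) S
      = fr S (dif p m S) (vp S p)" .
qed

lemma coch_eq:
  assumes "\<And>S. S \<in> idx i \<Longrightarrow> m S \<in> FF" "\<And>S. S \<in> idx i \<Longrightarrow> m' S \<in> FF"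
  shows "coch i p m = coch i p m' \<longleftrightarrow> (\<forall>\<^sub>F q in sequentially. \<forall>S\<in>idx i. xp S q * (m S - m' S) \<in> tot U)"
proof -
  have "coch i p m = coch i p m' \<longleftrightarrow> (\<forall>S\<in>idx i. fr S (m S) (vp S p) = fr S (m' S) (vp S p))"
  proof
    assume e: "coch i p m = coch i p m'"
    show "\<forall>S\<in>idx i. fr S (m S) (vp S p) = fr S (m' S) (vp S p)"
    proof
      fix S assume "S \<in> idx i"
      then show "fr S (m S) (vp S p) = fr S (m' S) (vp S p)" using fun_cong[OF e, of S] by (simp add: coch_def)
    qed
  qed (blast intro: coch_cong)
  also have "\<dots> \<longleftrightarrow> (\<forall>S\<in>idx i. \<forall>\<^sub>F q in sequentially. xp S q * (m S - m' S) \<in> tot U)"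
    using fr_eq_common[OF idx_sub assms vp_mon] by blast
  also have "\<dots> \<longleftrightarrow> (\<forall>\<^sub>F q in sequentially. \<forall>S\<in>idx i. xp S q * (m S - m' S) \<in> tot U)"
    by (rule eventually_ball_finite_distrib[OF finite_idx, symmetric])
  finally show ?thesis .
qed

lemma coch_eqI:
  assumes "\<And>S. S \<in> idx i \<Longrightarrow> m S \<in> FF" "\<And>S. S \<in> idx i \<Longrightarrow> m' S \<in> FF" "\<And>S. S \<in> idx i \<Longrightarrow> m S - m' S \<in> tot U"
  shows "coch i p m = coch i p m'"
proof (rule coch_eq[THEN iffD2])
  have "\<forall>S\<in>idx i. xp S q * (m S - m' S) \<in> tot U" for q using tot_xp[OF idx_sub] assms(3) by blast
  then show "\<forall>\<^sub>F q in sequentially. \<forall>S\<in>idx i. xp S q * (m S - m' S) \<in> tot U" by (intro always_eventually) blast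
qed (use assms in blast)+

lemma coch_rep_aux:
  assumes "\<And>S. S \<in> idx i \<Longrightarrow> \<forall>\<^sub>F p in sequentially. \<exists>f\<in>X p. c S = fr S f (vp S p)"
    and "c \<in> extensional (idx i)"
  shows "\<forall>\<^sub>F p in sequentially. \<exists>m. (\<forall>S\<in>idx i. m S \<in> X p) \<and> c = coch i p m"
proof -
  have "\<forall>\<^sub>F p in sequentially. \<forall>S\<in>idx i. \<exists>f\<in>X p. c S = fr S f (vp S p)"
    using assms(1) by (intro eventually_ball_finite[OF finite_idx]) blast
  then show ?thesis
  proof (rule eventually_mono)
    fix p assume "\<forall>S\<in>idx i. \<exists>f\<in>X p. c S = fr S f (vp S p)"
    then obtain m where m: "\<forall>S\<in>idx i. m S \<in> X p \<and> c S = fr S (m S) (vp S p)" by metis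
    then have "c = coch i p m" unfolding coch_def using assms(2) by (intro extensionalityI[of _ "idx i"]) auto
    then show "\<exists>m. (\<forall>S\<in>idx i. m S \<in> X p) \<and> c = coch i p m" using m by blast
  qed
qed

lemma coch_rep:
  "c \<in> carrier (cech n Q i) \<Longrightarrow> \<forall>\<^sub>F p in sequentially. \<exists>m. (\<forall>S\<in>idx i. m S \<in> FF) \<and> c = coch i p m"
  unfolding cech_sel by (rule coch_rep_aux[of i "\<lambda>_. FF"]) (auto simp: PiE_def intro!: loc_rep idx_sub)

lemma coch_rep_graded:
  assumes "c \<in> grade (cech n Q i) t"
  shows "\<forall>\<^sub>F p in sequentially. \<exists>m. (\<forall>S\<in>idx i. m S \<in> Fg (t + int (p * i))) \<and> c = coch i p m"
proof (rule coch_rep_aux[of i "\<lambda>p. Fg (t + int (p * i))"])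
  fix S assume S: "S \<in> idx i"
  then have "c S \<in> grade (localization n Q S) t" using assms unfolding cech_sel by (rule PiE_mem[rotated])
  moreover have "card S = i" using S by (simp add: idx_def)
  ultimately show "\<forall>\<^sub>F p in sequentially. \<exists>f\<in>Fg (t + int (p * i)). c S = fr S f (vp S p)"
    using loc_rep_graded[OF idx_sub[OF S]] by blast
qed (use assms in \<open>auto simp: cech_sel PiE_def\<close>)

lemma eventually_obtain:
  assumes "\<forall>\<^sub>F p in sequentially. P (p::nat)"
  obtains p where "P p" "p \<ge> k"
  using eventually_happens[OF eventually_conj[OF assms eventually_ge_at_top[of k]]]
  by (auto simp: trivial_limit_sequentially)

lemma coch_rep_ex:
  assumes "c \<in> carrier (cech n Q i)"
  shows "\<exists>p m. p \<ge> k \<and> (\<forall>S\<in>idx i. m S \<in> FF) \<and> c = coch i p m"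
  using eventually_obtain[OF coch_rep[OF assms], of k] by metis

lemma coch_cocycle:
  assumes m: "\<And>S. S \<in> idx i \<Longrightarrow> m S \<in> FF"
  shows "coch i p m \<in> cocycles n Q i \<longleftrightarrow> (\<forall>\<^sub>F q in sequentially. \<forall>S\<in>idx (Suc i). xp S q * dif p m S \<in> tot U)"
proof -
  have "coch i p m \<in> cocycles n Q i \<longleftrightarrow> coch (Suc i) p (dif p m) = coch (Suc i) p (\<lambda>S. 0)"
    unfolding cocycles_def using coch_carrier[of i m p, OF m] cech_diff_coch[of i m p, OF m] coch_zero[of "Suc i" p] by simp
  also have "\<dots> \<longleftrightarrow> (\<forall>\<^sub>F q in sequentially. \<forall>S\<in>idx (Suc i). xp S q * (dif p m S - 0) \<in> tot U)"
  proof (rule coch_eq)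
    show "dif p m S \<in> FF" if "S \<in> idx (Suc i)" for S using FF_dif[of S i m p, OF that m] .
  qed (rule FF_zero)
  finally show ?thesis unfolding diff_zero .
qed

lemma hc_dif:
  assumes S: "S \<in> idx (Suc i)" and m: "\<And>T. T \<in> idx i \<Longrightarrow> m T \<in> FF"
  shows "hc (e + int P) (dif P m S) = dif P (\<lambda>T. hc e (m T)) S"
  unfolding dif_def hc_sum
proof (rule sum.cong[OF refl])
  fix j assume j: "j \<in> S"
  have v: "(var j ^ P :: 'k mpoly) \<in> homog n P"
  proof -
    have "(var j ^ P :: 'k mpoly) = vp {j} P" by (simp add: vp_def)
    also have "\<dots> \<in> homog n P"
      unfolding vp_eq_single[OF finite.insertI[OF finite.emptyI]]
      using homog_single[of "Poly_Mapping.single j P" n 1] idx_less[OF S j] by (cases "P = 0") auto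
    finally show ?thesis .
  qed
  have o: "((-1) ^ k :: 'k mpoly) \<in> homog n 0" for k
  proof -
    have "(-1 :: 'k mpoly) ^ k = const_poly ((-1) ^ k)" by (induction k) (simp_all add: const_poly_simps)
    then show ?thesis using homog_const by simp
  qed
  have "(-1 :: 'k mpoly) ^ card {h \<in> S. h < j} * var j ^ P \<in> homog n P" using homog_mult[OF o v] by simp
  from hc_homog[OF this m[OF idx_remove[OF S j]], of e]
  show "hc (e + int P) (sg S j * emb (var j) ^ P * m (S - {j})) = sg S j * emb (var j) ^ P * hc e (m (S - {j}))"
    unfolding sg_emb emb_simps .
qed

lemma coch_coboundary:
  assumes m: "\<And>S. S \<in> idx i \<Longrightarrow> m S \<in> Fg (t + int (p * i))"
  shows "coch i p m \<in> coboundaries n Q i \<longleftrightarrow> cobd U i t p m"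
proof (cases i)
  case 0
  have m0: "m {} \<in> Fg t" using m[of "{}"] by (simp add: 0 idx_0)
  have FFm: "\<And>S. S \<in> idx 0 \<Longrightarrow> m S \<in> FF" using Fg_subset_FF[OF m0] by (simp add: idx_0)
  have "coch i p m \<in> coboundaries n Q i \<longleftrightarrow> coch 0 p m = coch 0 p (\<lambda>S. 0)"
    using coch_zero[of 0 p] by (simp add: coboundaries_def 0)
  also have "\<dots> \<longleftrightarrow> (\<forall>\<^sub>F q in sequentially. \<forall>S\<in>idx 0. xp S q * (m S - 0) \<in> tot U)"
    using FFm FF_zero by (intro coch_eq)
  also have "\<dots> \<longleftrightarrow> m {} \<in> tot U" by (simp add: idx_0 xp_def)
  also have "\<dots> \<longleftrightarrow> m {} \<in> U t" by (rule tot_Fg[OF sub_U m0])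
  also have "\<dots> \<longleftrightarrow> cobd U i t p m" by (simp add: cobd_def cobd_by_def 0 idx_0 dif_def xp_def)
  finally show ?thesis .
next
  case (Suc h)
  have FFm: "\<And>S. S \<in> idx i \<Longrightarrow> m S \<in> FF" using Fg_subset_FF[OF m] .
  show ?thesis
  proof
    assume "coch i p m \<in> coboundaries n Q i"
    then obtain c where c: "c \<in> carrier (cech n Q h)" "coch i p m = cech_diff n Q h c"
      by (auto simp: coboundaries_def Suc)
    obtain P b where P: "P \<ge> p" and b: "\<And>S. S \<in> idx h \<Longrightarrow> b S \<in> FF" and cb: "c = coch h P b"
      using coch_rep_ex[OF c(1), of p] by blast
    define z where "z = P - p"
    have Pz: "P = p + z" using P by (simp add: z_def)
    have d: "dif P b S \<in> FF" if "S \<in> idx i" for S using FF_dif[of S h b P] b that Suc by blast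
    have "coch i P (\<lambda>S. xp S z * m S) = coch i P (dif P b)"
      using c(2) cb cech_diff_coch[of h b P, OF b] coch_raise[of i m p z, OF FFm] unfolding Pz Suc by simp
    then have "\<forall>\<^sub>F q in sequentially. \<forall>S\<in>idx i. xp S q * (xp S z * m S - dif P b S) \<in> tot U"
      using coch_eq[of i "\<lambda>S. xp S z * m S" "dif P b" P] FF_xp[OF idx_sub FFm] d by blast
    then obtain q where q: "\<And>S. S \<in> idx i \<Longrightarrow> xp S q * (xp S z * m S - dif P b S) \<in> tot U"
      by (rule eventually_obtain[where k = 0]) blast
    define b' where "b' = (\<lambda>S. xp S q * b S)"
    have b'FF: "b' S \<in> FF" if "S \<in> idx h" for S unfolding b'_def using FF_xp[OF idx_sub[OF that] b[OF that]] .
    \<comment> \<open>The primitive comes from the ungraded complex and need not be homogeneous. Its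
      component of degree \<open>e\<close> still bounds the homogeneous cochain, because
      \<open>dif\<close> commutes with taking components up to the shift in
      \<open>hc_dif\<close>.\<close>
    define e where "e = t + int ((P + q) * h)"
    have pe: "p + (z + q) = P + q" using Pz by simp
    have "cobd_by U i t p m (z + q) (\<lambda>S. hc e (b' S))"
      unfolding cobd_by_def pe
    proof (intro conjI allI impI ballI)
      fix h' S assume "i = Suc h'" and S: "S \<in> idx h'"
      then have "h' = h" using Suc by simp
      then show "hc e (b' S) \<in> Fg (t + int ((P + q) * h'))" using hc_in[OF b'FF] S unfolding e_def by blast
    next
      fix S assume S: "S \<in> idx i"
      have S': "S \<in> idx (Suc h)" using S Suc by simp
      have ei: "t + int ((P + q) * i) = e + int (P + q)" unfolding e_def Suc by simp
      have "dif (P + q) b' S = xp S q * dif P b S" unfolding b'_def by (rule dif_xp[OF idx_finite[OF S]])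
      then have E: "xp S q * (xp S z * m S - dif P b S) = xp S (z + q) * m S - dif (P + q) b' S"
        by (simp add: xp_add algebra_simps)
      have x: "xp S (z + q) * m S \<in> Fg (t + int ((P + q) * i))"
        using sub_xp_idx[OF sub_F S m[OF S], of "z + q"] unfolding pe .
      have "hc (t + int ((P + q) * i)) (xp S (z + q) * m S - dif (P + q) b' S) \<in> U (t + int ((P + q) * i))"
        using q[OF S] unfolding E tot_def by blast
      moreover have "hc (t + int ((P + q) * i)) (xp S (z + q) * m S - dif (P + q) b' S)
          = xp S (z + q) * m S - dif (P + q) (\<lambda>S. hc e (b' S)) S"
        unfolding hc_diff using hc_Fg[OF x, of "t + int ((P + q) * i)"] hc_dif[of S h b' e "P + q", OF S' b'FF] ei by simp
      ultimately show "xp S (z + q) * m S - dif (P + q) (\<lambda>S. hc e (b' S)) S \<in> U (t + int ((P + q) * i))" by simp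
    qed
    then show "cobd U i t p m" unfolding cobd_def by blast
  next
    assume "cobd U i t p m"
    then obtain q b where qb: "cobd_by U i t p m q b" unfolding cobd_def by blast
    have b: "b S \<in> FF" if "S \<in> idx h" for S
      using qb that Suc Fg_subset_FF unfolding cobd_by_def by blast
    have d: "dif (p + q) b S \<in> FF" if "S \<in> idx i" for S using FF_dif[of S h b "p + q"] b that Suc by blast
    have x: "xp S q * m S \<in> FF" if "S \<in> idx i" for S using FF_xp[OF idx_sub FFm] that by blast
    have "coch i p m = coch i (p + q) (\<lambda>S. xp S q * m S)" using coch_raise[of i m p q, OF FFm] by simp
    also have "\<dots> = coch i (p + q) (dif (p + q) b)"
    proof (rule coch_eqI)
      fix S assume S: "S \<in> idx i"
      then have u: "xp S q * m S - dif (p + q) b S \<in> U (t + int ((p + q) * i))" using qb unfolding cobd_by_def by blast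
      show "xp S q * m S - dif (p + q) b S \<in> tot U" using tot_Fg[OF sub_U sub_subset[OF sub_U u]] u by blast
    qed (use x d in blast)+
    also have "\<dots> = cech_diff n Q h (coch h (p + q) b)" using cech_diff_coch[of h b "p + q", OF b] Suc by simp
    finally show "coch i p m \<in> coboundaries n Q i"
      using coch_carrier[of h b "p + q", OF b] by (simp add: coboundaries_def Suc)
  qed
qed

text \<open>These closure properties make the coset of a coboundary equal to the subgroup itself.
  Both elements are first written at a common exponent, where differences can be formed on
  numerators.\<close>

lemma coboundaries_rep2:
  assumes c: "c \<in> coboundaries n Q i" and c': "c' \<in> coboundaries n Q i"
  shows "c \<oplus>\<^bsub>cech n Q i\<^esub> c' \<in> coboundaries n Q i \<and> (\<exists>c''\<in>coboundaries n Q i. c = c'' \<oplus>\<^bsub>cech n Q i\<^esub> c')"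
proof (cases i)
  case 0
  have "c = coch 0 0 (\<lambda>S. 0)" "c' = coch 0 0 (\<lambda>S. 0)" using c c' coch_zero[of 0 0] by (simp_all add: 0 coboundaries_def)
  moreover have "coch 0 0 (\<lambda>S. 0) \<oplus>\<^bsub>cech n Q 0\<^esub> coch 0 0 (\<lambda>S. 0) = coch 0 0 (\<lambda>S. 0)"
    using coch_add[of 0 "\<lambda>S. 0" "\<lambda>S. 0" 0] FF_zero by simp
  ultimately show ?thesis using c 0 by metis
next
  case (Suc h)
  obtain b b' where b: "b \<in> carrier (cech n Q h)" "c = cech_diff n Q h b"
    and b': "b' \<in> carrier (cech n Q h)" "c' = cech_diff n Q h b'"
    using c c' by (auto simp: coboundaries_def Suc)
  obtain P where "\<exists>m. (\<forall>S\<in>idx h. m S \<in> FF) \<and> b = coch h P m" "\<exists>m. (\<forall>S\<in>idx h. m S \<in> FF) \<and> b' = coch h P m"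
    using eventually_obtain[OF eventually_conj[OF coch_rep[OF b(1)] coch_rep[OF b'(1)]], of 0] by metis
  then obtain m m' where m: "\<And>S. S \<in> idx h \<Longrightarrow> m S \<in> FF" "b = coch h P m"
    and m': "\<And>S. S \<in> idx h \<Longrightarrow> m' S \<in> FF" "b' = coch h P m'" by blast
  have ce: "c = coch i P (dif P m)" "c' = coch i P (dif P m')"
    using b b' m m' cech_diff_coch[of h m P, OF m(1)] cech_diff_coch[of h m' P, OF m'(1)] Suc by simp_all
  have cob: "coch i P (dif P y) \<in> coboundaries n Q i" if "\<And>S. S \<in> idx h \<Longrightarrow> y S \<in> FF" for y
    unfolding coboundaries_def Suc nat.case
    using coch_carrier[of h y P, OF that] cech_diff_coch[of h y P, OF that] by (metis image_eqI)
  have FFd: "dif P y S \<in> FF" if "\<And>S. S \<in> idx h \<Longrightarrow> y S \<in> FF" "S \<in> idx i" for y S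
    using FF_dif[of S h y P] that Suc by blast
  have add: "coch i P (dif P y) \<oplus>\<^bsub>cech n Q i\<^esub> coch i P (dif P y') = coch i P (dif P (\<lambda>S. y S + y' S))"
    if y: "\<And>S. S \<in> idx h \<Longrightarrow> y S \<in> FF" "\<And>S. S \<in> idx h \<Longrightarrow> y' S \<in> FF" for y y'
    using coch_add[of i "dif P y" "dif P y'" P, OF FFd[of y, OF y(1)] FFd[of y', OF y(2)]] unfolding dif_add .
  have s: "(\<lambda>S. m S - m' S + m' S) = m" by (rule ext) (rule diff_add_cancel)
  have mm: "m S - m' S \<in> FF" if "S \<in> idx h" for S using FF_diff[OF m(1)[OF that] m'(1)[OF that]] .
  have mp: "m S + m' S \<in> FF" if "S \<in> idx h" for S using FF_add[OF m(1)[OF that] m'(1)[OF that]] .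
  have "c = coch i P (dif P (\<lambda>S. m S - m' S)) \<oplus>\<^bsub>cech n Q i\<^esub> c'"
    using add[of "\<lambda>S. m S - m' S" m', OF mm m'(1)] ce unfolding s by simp
  moreover have "c \<oplus>\<^bsub>cech n Q i\<^esub> c' \<in> coboundaries n Q i"
    using add[of m m', OF m(1) m'(1)] cob[of "\<lambda>S. m S + m' S", OF mp] ce by simp
  ultimately show ?thesis using cob[of "\<lambda>S. m S - m' S", OF mm] by blast
qed

lemma zero_coboundary: "\<zero>\<^bsub>cech n Q i\<^esub> \<in> coboundaries n Q i"
  using coch_coboundary[of i "\<lambda>S. 0" 0 0] coch_zero[of i 0] cobd_zero[OF sub_U] F_zero by simp

text \<open>For a Cech cocycle the Koszul differential of the numerators lies in \<open>U\<close>
  only after multiplication by some \<open>xp S q\<close>; raising the exponent by \<open>q\<close>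
  absorbs this factor. That is where the colimit over the exponents enters.\<close>

theorem local_cohomology_zero_iff:
  "grade (local_cohomology n Q i) t = {\<zero>\<^bsub>local_cohomology n Q i\<^esub>} \<longleftrightarrow> van U i t"
proof -
  define H where "H = coboundaries n Q i"
  define C where "C = cech n Q i"
  define X where "X = grade C t \<inter> cocycles n Q i"
  have g: "grade (local_cohomology n Q i) t = (\<lambda>c. {h \<oplus>\<^bsub>C\<^esub> c | h. h \<in> H}) ` X"
    by (auto simp: local_cohomology_def quot_module_def a_r_coset_def r_coset_def H_def C_def X_def)
  have z: "\<zero>\<^bsub>local_cohomology n Q i\<^esub> = H" by (simp add: local_cohomology_def quot_module_def H_def)
  have zero_add: "\<zero>\<^bsub>C\<^esub> \<oplus>\<^bsub>C\<^esub> c = c" if "c \<in> carrier C" for c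
  proof -
    have "c \<in> carrier (cech n Q i)" using that unfolding C_def .
    then obtain P m where m: "\<And>S. S \<in> idx i \<Longrightarrow> m S \<in> FF" "c = coch i P m"
      using coch_rep_ex[of c i 0] by blast
    show ?thesis unfolding C_def m(2) coch_zero[of i P] using coch_add[of i "\<lambda>S. 0" m P] FF_zero m(1) by simp
  qed
  have coset: "{h \<oplus>\<^bsub>C\<^esub> c | h. h \<in> H} = H \<longleftrightarrow> c \<in> H" if "c \<in> carrier C" for c
  proof
    assume "{h \<oplus>\<^bsub>C\<^esub> c | h. h \<in> H} = H"
    moreover have "\<zero>\<^bsub>C\<^esub> \<oplus>\<^bsub>C\<^esub> c \<in> {h \<oplus>\<^bsub>C\<^esub> c | h. h \<in> H}" using zero_coboundary[of i] unfolding C_def H_def by blast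
    ultimately show "c \<in> H" using zero_add[OF that] by simp
  next
    assume "c \<in> H"
    then show "{h \<oplus>\<^bsub>C\<^esub> c | h. h \<in> H} = H" using coboundaries_rep2[of _ i c] unfolding C_def H_def by blast
  qed
  have XC: "X \<subseteq> carrier C" by (auto simp: X_def cocycles_def C_def)
  \<comment> \<open>Without an element of \<open>X\<close> the image would be empty rather than the
    singleton of \<open>H\<close>.\<close>
  have Xne: "coch i 0 (\<lambda>S. 0) \<in> X"
  proof -
    have d0: "dif 0 (\<lambda>S. 0) S = 0" for S by (simp add: dif_def)
    have "coch i 0 (\<lambda>S. 0) \<in> cocycles n Q i"
      using FF_zero tot_zero[OF sub_U] by (subst coch_cocycle) (simp_all add: d0)
    then show ?thesis unfolding X_def C_def using coch_grade[of i "\<lambda>S. 0" t 0] F_zero by simp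
  qed
  have "grade (local_cohomology n Q i) t = {\<zero>\<^bsub>local_cohomology n Q i\<^esub>} \<longleftrightarrow> (\<forall>c\<in>X. {h \<oplus>\<^bsub>C\<^esub> c | h. h \<in> H} = H)"
  proof -
    have "f ` X = {H} \<longleftrightarrow> (\<forall>c\<in>X. f c = H)" for f using Xne by auto
    then show ?thesis unfolding g z .
  qed
  also have "\<dots> \<longleftrightarrow> (\<forall>c\<in>X. c \<in> H)" by (intro ball_cong refl coset subsetD[OF XC])
  also have "\<dots> \<longleftrightarrow> van U i t"
  proof
    assume X: "\<forall>c\<in>X. c \<in> H"
    show "van U i t" unfolding van_def
    proof (intro allI impI)
      fix p m assume m: "cocyc U i t p m"
      have mF: "\<And>S. S \<in> idx i \<Longrightarrow> m S \<in> Fg (t + int (p * i))" using m unfolding cocyc_def by blast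
      have "xp S q * dif p m S \<in> tot U" if S: "S \<in> idx (Suc i)" for q S
      proof -
        have u: "dif p m S \<in> U (t + int (p * Suc i))" using m S unfolding cocyc_def by blast
        then have "dif p m S \<in> tot U" using tot_Fg[OF sub_U sub_subset[OF sub_U u]] by blast
        then show ?thesis by (rule tot_xp[OF idx_sub[OF S]])
      qed
      then have "coch i p m \<in> cocycles n Q i"
        using coch_cocycle[of i m p, OF Fg_subset_FF[OF mF]] by (simp add: always_eventually)
      then have "coch i p m \<in> X" unfolding X_def C_def using coch_grade[of i m t p, OF mF] by blast
      then show "cobd U i t p m" using X coch_coboundary[of i m t p, OF mF] unfolding H_def by blast
    qed
  next
    assume v: "van U i t"
    show "\<forall>c\<in>X. c \<in> H"
    proof
      fix c assume c: "c \<in> X"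
      then have "c \<in> grade (cech n Q i) t" unfolding X_def C_def by blast
      from eventually_obtain[OF coch_rep_graded[OF this], of 0]
      obtain p m where m: "\<And>S. S \<in> idx i \<Longrightarrow> m S \<in> Fg (t + int (p * i))" "c = coch i p m" by metis
      have FFm: "\<And>S. S \<in> idx i \<Longrightarrow> m S \<in> FF" using Fg_subset_FF[OF m(1)] .
      have "\<forall>\<^sub>F q in sequentially. \<forall>S\<in>idx (Suc i). xp S q * dif p m S \<in> tot U"
        using c coch_cocycle[of i m p, OF FFm] m(2) unfolding X_def by blast
      then obtain q where q: "\<And>S. S \<in> idx (Suc i) \<Longrightarrow> xp S q * dif p m S \<in> tot U"
        by (rule eventually_obtain[where k = 0]) blast
      let ?m = "\<lambda>S. xp S q * m S"
      have mF: "?m S \<in> Fg (t + int ((p + q) * i))" if S: "S \<in> idx i" for S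
        using sub_xp_idx[OF sub_F S m(1)[OF S]] .
      have "cocyc U i t (p + q) ?m"
        unfolding cocyc_def
      proof (intro conjI ballI)
        fix S assume S: "S \<in> idx (Suc i)"
        have "dif (p + q) ?m S \<in> tot U" unfolding dif_xp[OF idx_finite[OF S]] using q[OF S] .
        moreover have "dif (p + q) ?m S \<in> Fg (t + int ((p + q) * Suc i))" using dif_in[of Fg S i ?m, OF sub_F S mF] .
        ultimately show "dif (p + q) ?m S \<in> U (t + int ((p + q) * Suc i))" using tot_Fg[OF sub_U] by blast
      qed (rule mF)
      then have "cobd U i t (p + q) ?m" using v unfolding van_def by blast
      then have "coch i (p + q) ?m \<in> H" unfolding H_def using coch_coboundary[of i ?m t "p + q", OF mF] by blast
      then show "c \<in> H" using coch_raise[of i m p q, OF FFm] m(2) by simp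
    qed
  qed
  finally show ?thesis .
qed

end

section \<open>Presentations by homogeneous generators\<close>

locale generated_module = free_graded n G deg ty + M: graded_module n M
  for n :: nat and G :: "'m set" and deg and ty :: "'k::field itself" and M :: "('k mpoly, 'm) graded_module" +
  assumes G_grade: "g \<in> G \<Longrightarrow> g \<in> grade M (deg g)"
    and G_gen: "y \<in> carrier M \<Longrightarrow> \<exists>f. f \<in> G \<rightarrow> carrier (poly_ring n) \<and> y = finsum M (\<lambda>g. f g \<odot>\<^bsub>M\<^esub> g) G"
begin

lemma grade_carrier: "y \<in> grade M t \<Longrightarrow> y \<in> carrier M"
  using subgroup.subset[OF M.grade_subgroup[of t]] by auto

lemma grade_zero: "\<zero>\<^bsub>M\<^esub> \<in> grade M t"
  using subgroup.one_closed[OF M.grade_subgroup[of t]] by simp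

lemma grade_add: "y \<in> grade M t \<Longrightarrow> z \<in> grade M t \<Longrightarrow> y \<oplus>\<^bsub>M\<^esub> z \<in> grade M t"
  using subgroup.m_closed[OF M.grade_subgroup[of t]] by simp

lemma grade_finsum: "finite A \<Longrightarrow> (\<And>a. a \<in> A \<Longrightarrow> h a \<in> grade M t) \<Longrightarrow> finsum M h A \<in> grade M t"
proof (induction A rule: finite_induct)
  case empty
  then show ?case using grade_zero by simp
next
  case (insert a A)
  then have "finsum M h (insert a A) = h a \<oplus>\<^bsub>M\<^esub> finsum M h A"
    using grade_carrier by (intro M.finsum_insert) auto
  then show ?case using insert grade_add by simp
qed

lemma G_carrier: "g \<in> G \<Longrightarrow> g \<in> carrier M"
  using G_grade grade_carrier by blast

definition \<phi> :: "('m \<Rightarrow> 'k mpoly) \<Rightarrow> 'm" where "\<phi> f = finsum M (\<lambda>g. f g \<odot>\<^bsub>M\<^esub> g) G"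

lemma FF_app: "f \<in> FF \<Longrightarrow> f g \<in> carrier (poly_ring n)"
  using poly_ring_zero[of n] by (cases "g \<in> G") (auto simp: FF_def dest!: spec[of _ g])

lemma term_closed: "f \<in> FF \<Longrightarrow> (\<lambda>g. f g \<odot>\<^bsub>M\<^esub> g) \<in> G \<rightarrow> carrier M"
  using FF_app G_carrier by blast

lemma phi_closed: "f \<in> FF \<Longrightarrow> \<phi> f \<in> carrier M"
  unfolding \<phi>_def using term_closed by (intro M.finsum_closed)

lemma phi_add:
  assumes "f \<in> FF" "g \<in> FF"
  shows "\<phi> (f + g) = \<phi> f \<oplus>\<^bsub>M\<^esub> \<phi> g"
proof -
  have "\<phi> (f + g) = finsum M (\<lambda>y. f y \<odot>\<^bsub>M\<^esub> y \<oplus>\<^bsub>M\<^esub> g y \<odot>\<^bsub>M\<^esub> y) G"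
    unfolding \<phi>_def
  proof (rule M.finsum_cong'[OF refl])
    show "(\<lambda>y. f y \<odot>\<^bsub>M\<^esub> y \<oplus>\<^bsub>M\<^esub> g y \<odot>\<^bsub>M\<^esub> y) \<in> G \<rightarrow> carrier M"
      using term_closed[OF assms(1)] term_closed[OF assms(2)] by (auto intro!: M.add.m_closed)
    fix y assume "y \<in> G"
    then show "(f + g) y \<odot>\<^bsub>M\<^esub> y = f y \<odot>\<^bsub>M\<^esub> y \<oplus>\<^bsub>M\<^esub> g y \<odot>\<^bsub>M\<^esub> y"
      using M.smult_l_distr[OF FF_app[OF assms(1), of y] FF_app[OF assms(2), of y] G_carrier] by simp
  qed
  then show ?thesis unfolding \<phi>_def using M.finsum_addf[OF term_closed[OF assms(1)] term_closed[OF assms(2)]] by simp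
qed

lemma phi_smult:
  assumes p: "p \<in> carrier (poly_ring n)" and f: "f \<in> FF"
  shows "\<phi> (emb p * f) = p \<odot>\<^bsub>M\<^esub> \<phi> f"
proof -
  have "p \<odot>\<^bsub>M\<^esub> \<phi> f = finsum M (\<lambda>y. p \<odot>\<^bsub>M\<^esub> (f y \<odot>\<^bsub>M\<^esub> y)) G"
    unfolding \<phi>_def by (rule M.finsum_smult_ldistr[OF finite_G p term_closed[OF f]])
  also have "\<dots> = \<phi> (emb p * f)"
    unfolding \<phi>_def
  proof (rule M.finsum_cong'[OF refl])
    show "(\<lambda>g. (emb p * f) g \<odot>\<^bsub>M\<^esub> g) \<in> G \<rightarrow> carrier M" by (rule term_closed[OF FF_emb[OF p f]])
    fix y assume "y \<in> G"
    then show "p \<odot>\<^bsub>M\<^esub> (f y \<odot>\<^bsub>M\<^esub> y) = (emb p * f) y \<odot>\<^bsub>M\<^esub> y"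
      using M.smult_assoc1[OF p FF_app[OF f, of y] G_carrier] by simp
  qed
  finally show ?thesis ..
qed

lemma phi_zero: "\<phi> 0 = \<zero>\<^bsub>M\<^esub>"
proof -
  have "\<phi> 0 = 0 \<odot>\<^bsub>M\<^esub> \<phi> 0" using phi_smult[OF poly_ring_zero FF_zero] by (simp add: emb_simps)
  also have "\<dots> = \<zero>\<^bsub>M\<^esub>" using M.smult_l_null[OF phi_closed[OF FF_zero]] by simp
  finally show ?thesis .
qed

lemma phi_surj: "carrier M = \<phi> ` FF"
proof
  show "carrier M \<subseteq> \<phi> ` FF"
  proof
    fix y assume "y \<in> carrier M"
    then obtain f where f: "f \<in> G \<rightarrow> carrier (poly_ring n)" "y = finsum M (\<lambda>g. f g \<odot>\<^bsub>M\<^esub> g) G" using G_gen by blast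
    define f' where "f' = (\<lambda>g. if g \<in> G then f g else 0)"
    have FF: "f' \<in> FF" using f(1) by (auto simp: FF_def f'_def)
    have "y = \<phi> f'" unfolding \<phi>_def f(2)
      by (rule M.finsum_cong'[OF refl term_closed[OF FF]]) (simp add: f'_def)
    then show "y \<in> \<phi> ` FF" using FF by blast
  qed
qed (use phi_closed in blast)

lemma phi_sum:
  assumes "finite A" "\<And>a. a \<in> A \<Longrightarrow> h a \<in> FF"
  shows "\<phi> (\<Sum>a\<in>A. h a) = finsum M (\<lambda>a. \<phi> (h a)) A"
  using assms
proof (induction A rule: finite_induct)
  case empty
  show ?case unfolding sum.empty M.finsum_empty by (rule phi_zero)
next
  case (insert a A)
  have "\<phi> (\<Sum>a\<in>insert a A. h a) = \<phi> (h a + (\<Sum>a\<in>A. h a))" unfolding sum.insert[OF insert.hyps] ..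
  also have "\<dots> = \<phi> (h a) \<oplus>\<^bsub>M\<^esub> finsum M (\<lambda>a. \<phi> (h a)) A"
    using phi_add[OF insert.prems[OF insertI1] FF_sum[of A h]] insert by simp
  also have "\<dots> = finsum M (\<lambda>a. \<phi> (h a)) (insert a A)"
    using insert phi_closed by (intro M.finsum_insert[symmetric]) auto
  finally show ?case .
qed

lemma phi_grade:
  assumes f: "f \<in> Fg t"
  shows "\<phi> f \<in> grade M t"
  unfolding \<phi>_def
proof (rule grade_finsum[OF finite_G])
  fix g assume g: "g \<in> G"
  then have fg: "f g \<in> hz n (t - deg g)" using f by (auto simp: Fg_def dest: spec[of _ g])
  show "f g \<odot>\<^bsub>M\<^esub> g \<in> grade M t"
  proof (cases "t - deg g < 0")
    case True
    then have "f g = 0" using fg by (simp add: hz_def)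
    then show ?thesis using M.smult_l_null[OF G_carrier[OF g]] grade_zero by simp
  next
    case False
    then have "f g \<in> homog n (nat (t - deg g))" using fg by (simp add: hz_def)
    from M.grade_smult[OF this G_grade[OF g]] show ?thesis using False by simp
  qed
qed

text \<open>Uniqueness of the decomposition into degrees forces the components of
  \<open>\<phi> f\<close> to be the images of those of \<open>f\<close>.\<close>

lemma phi_components:
  assumes f: "f \<in> FF" and e: "\<forall>t. e t \<in> grade M t" "finite {t. e t \<noteq> \<zero>\<^bsub>M\<^esub>}" "\<phi> f = finsum M e {t. e t \<noteq> \<zero>\<^bsub>M\<^esub>}"
  shows "e t = \<phi> (hc t f)"
proof -
  define e' where "e' = (\<lambda>t. \<phi> (hc t f))"
  let ?T = "{t. hc t f \<noteq> 0}"
  have T: "finite ?T" using hc_finite[OF f] .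
  have sub: "{t. e' t \<noteq> \<zero>\<^bsub>M\<^esub>} \<subseteq> ?T" using phi_zero by (auto simp: e'_def)
  have gr: "e' t \<in> grade M t" for t unfolding e'_def using phi_grade[OF hc_in[OF f]] .
  have "\<phi> f = \<phi> (\<Sum>t\<in>?T. hc t f)" using hc_decompose[OF T, of f] by simp
  also have "\<dots> = finsum M e' ?T" unfolding e'_def using Fg_subset_FF[OF hc_in[OF f]] by (intro phi_sum T)
  also have "\<dots> = finsum M e' {t. e' t \<noteq> \<zero>\<^bsub>M\<^esub>}"
    using T sub gr grade_carrier by (intro M.add.finprod_mono_neutral_cong_right) auto
  finally have "\<phi> f = finsum M e' {t. e' t \<noteq> \<zero>\<^bsub>M\<^esub>}" .
  then have "(\<forall>t. e' t \<in> grade M t) \<and> finite {t. e' t \<noteq> \<zero>\<^bsub>M\<^esub>} \<and> \<phi> f = finsum M e' {t. e' t \<noteq> \<zero>\<^bsub>M\<^esub>}"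
    using gr finite_subset[OF sub T] by blast
  then have "e = e'" using M.grade_direct_sum[OF phi_closed[OF f]] e by blast
  then show ?thesis by (simp add: e'_def)
qed

lemma grade_image: "grade M t = \<phi> ` Fg t"
proof
  show "grade M t \<subseteq> \<phi> ` Fg t"
  proof
    fix y assume y: "y \<in> grade M t"
    then obtain f where f: "f \<in> FF" "y = \<phi> f" using grade_carrier phi_surj by blast
    \<comment> \<open>The decomposition of \<open>y\<close> has \<open>y\<close> as its component of
      degree \<open>t\<close> and zero elsewhere; comparison by \<open>phi_components\<close>
      replaces an arbitrary preimage by a homogeneous one.\<close>
    define e where "e = (\<lambda>s. if s = t then y else \<zero>\<^bsub>M\<^esub>)"
    have s: "{s. e s \<noteq> \<zero>\<^bsub>M\<^esub>} = (if y = \<zero>\<^bsub>M\<^esub> then {} else {t})" by (auto simp: e_def)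
    have "\<phi> f = finsum M e {s. e s \<noteq> \<zero>\<^bsub>M\<^esub>}"
      unfolding s using f(2) M.finsum_insert[of "{}" t e] y grade_carrier by (auto simp: e_def)
    then have "e t = \<phi> (hc t f)"
      using y grade_zero by (intro phi_components[OF f(1)]) (auto simp: e_def s)
    then show "y \<in> \<phi> ` Fg t" using hc_in[OF f(1)] by (simp add: e_def)
  qed
qed (use phi_grade in blast)

definition K :: "int \<Rightarrow> ('m \<Rightarrow> 'k mpoly) set" where "K t = {f \<in> Fg t. \<phi> f = \<zero>\<^bsub>M\<^esub>}"

lemma sub_K: "sub K"
  unfolding sub_def
proof (intro allI conjI ballI impI)
  fix t show "K t \<subseteq> Fg t" "0 \<in> K t" using F_zero phi_zero by (auto simp: K_def)
next
  fix t f g assume "f \<in> K t" "g \<in> K t"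
  then show "f + g \<in> K t" using F_add[of f t g] phi_add[OF Fg_subset_FF[of f t] Fg_subset_FF[of g t]] M.l_zero[OF M.zero_closed]
    by (simp add: K_def)
next
  fix t f and c :: "'m \<Rightarrow> 'k mpoly" assume f: "f \<in> K t" and "c \<in> range (\<lambda>c. emb (const_poly c))"
  then obtain b :: 'k where c: "c = emb (const_poly b)" by blast
  have fF: "f \<in> Fg t" using f by (simp add: K_def)
  have "\<phi> (emb (const_poly b) * f) = \<zero>\<^bsub>M\<^esub>"
    using f phi_smult[OF poly_ring_const Fg_subset_FF[OF fF]] M.smult_r_null[OF poly_ring_const] by (simp add: K_def)
  then show "c * f \<in> K t" unfolding c K_def using F_C[OF fF, of "emb (const_poly b)"] by simp
next
  fix t f j assume f: "f \<in> K t" and j: "j < n"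
  have fF: "f \<in> Fg t" using f by (simp add: K_def)
  have "\<phi> (emb (var j) * f) = \<zero>\<^bsub>M\<^esub>"
    using f phi_smult[OF poly_ring_var[OF j] Fg_subset_FF[OF fF]] M.smult_r_null[OF poly_ring_var[OF j]] by (simp add: K_def)
  then show "emb (var j) * f \<in> K (t + 1)" unfolding K_def using F_x[OF fF j] by simp
qed

lemma phi_kernel:
  assumes f: "f \<in> FF"
  shows "\<phi> f = \<zero>\<^bsub>M\<^esub> \<longleftrightarrow> f \<in> tot K"
proof
  assume "\<phi> f = \<zero>\<^bsub>M\<^esub>"
  then have "\<zero>\<^bsub>M\<^esub> = \<phi> (hc t f)" for t
    using grade_zero by (intro phi_components[OF f, of "\<lambda>_. \<zero>\<^bsub>M\<^esub>"]) auto
  then show "f \<in> tot K" unfolding tot_def K_def using f hc_in[OF f] by auto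
next
  assume t: "f \<in> tot K"
  have T: "finite {t. hc t f \<noteq> 0}" using hc_finite[OF f] .
  have "\<phi> f = \<phi> (\<Sum>t\<in>{t. hc t f \<noteq> 0}. hc t f)" using hc_decompose[OF T, of f] by simp
  also have "\<dots> = finsum M (\<lambda>t. \<phi> (hc t f)) {t. hc t f \<noteq> 0}"
    using Fg_subset_FF[OF hc_in[OF f]] by (intro phi_sum T)
  also have "\<dots> = finsum M (\<lambda>t. \<zero>\<^bsub>M\<^esub>) {t. hc t f \<noteq> 0}"
    using t by (intro M.finsum_cong') (auto simp: tot_def K_def)
  finally show "\<phi> f = \<zero>\<^bsub>M\<^esub>" by simp
qed

sublocale M: presentation n G deg ty M \<phi> K
  using sub_K phi_add phi_smult phi_zero phi_surj grade_image phi_kernel by unfold_locales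

lemma quot_presentation:
  assumes U: "sub U" and N: "Module.submodule N (poly_ring n) M"
    and iff: "\<And>f. f \<in> FF \<Longrightarrow> \<phi> f \<in> N \<longleftrightarrow> f \<in> tot U"
  shows "presentation n G deg (quot_module M N) (\<lambda>f. N +>\<^bsub>M\<^esub> \<phi> f) U"
proof -
  have NM: "N \<subseteq> carrier M" using M.submoduleE(1)[OF N] .
  interpret N: abelian_subgroup N M
    using submodule.axioms(1)[OF N] M.abelian_group_axioms
    by (intro abelian_subgroupI3) (auto simp: additive_subgroup_def)
  have mem: "N +>\<^bsub>M\<^esub> y = N \<longleftrightarrow> y \<in> N" if "y \<in> carrier M" for y
    using M.a_coset_join1[of N y] M.a_coset_join2[of y N] that N.a_subgroup by blast
  show ?thesis
  proof
    show "sub U" by (rule U)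
    fix f assume f: "f \<in> FF"
    note y = phi_closed[OF f]
    show "N +>\<^bsub>M\<^esub> \<phi> f = \<zero>\<^bsub>quot_module M N\<^esub> \<longleftrightarrow> f \<in> tot U"
      using mem[OF y] iff[OF f] by (simp add: quot_module_def)
    show "N +>\<^bsub>M\<^esub> \<phi> (f + g) = (N +>\<^bsub>M\<^esub> \<phi> f) \<oplus>\<^bsub>quot_module M N\<^esub> (N +>\<^bsub>M\<^esub> \<phi> g)" if g: "g \<in> FF" for g
      using N.a_rcos_sum[OF y phi_closed[OF g]] phi_add[OF f g] by (simp add: quot_module_def)
    fix p :: "'k mpoly" assume p: "p \<in> carrier (poly_ring n)"
    have "(\<Union>z\<in>N +>\<^bsub>M\<^esub> \<phi> f. N +>\<^bsub>M\<^esub> (p \<odot>\<^bsub>M\<^esub> z)) = N +>\<^bsub>M\<^esub> (p \<odot>\<^bsub>M\<^esub> \<phi> f)"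
    proof (rule UN_constant_eq[OF _ ballI])
      show "\<phi> f \<in> N +>\<^bsub>M\<^esub> \<phi> f" by (rule N.a_rcos_self[OF y])
      fix z assume "z \<in> N +>\<^bsub>M\<^esub> \<phi> f"
      then obtain k where k: "k \<in> N" "z = k \<oplus>\<^bsub>M\<^esub> \<phi> f" unfolding a_r_coset_def r_coset_def by auto
      have kM: "k \<in> carrier M" using k NM by blast
      have "p \<odot>\<^bsub>M\<^esub> z = p \<odot>\<^bsub>M\<^esub> k \<oplus>\<^bsub>M\<^esub> p \<odot>\<^bsub>M\<^esub> \<phi> f" using M.smult_r_distr[OF p kM y] k by simp
      moreover have "p \<odot>\<^bsub>M\<^esub> k \<in> N" using M.submoduleE(4)[OF N p k(1)] .
      ultimately have "p \<odot>\<^bsub>M\<^esub> z \<in> N +>\<^bsub>M\<^esub> (p \<odot>\<^bsub>M\<^esub> \<phi> f)" unfolding a_r_coset_def r_coset_def by auto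
      then show "N +>\<^bsub>M\<^esub> (p \<odot>\<^bsub>M\<^esub> z) = N +>\<^bsub>M\<^esub> (p \<odot>\<^bsub>M\<^esub> \<phi> f)"
        using N.a_repr_independence'[of "p \<odot>\<^bsub>M\<^esub> z" "p \<odot>\<^bsub>M\<^esub> \<phi> f"] M.smult_closed[OF p y] by simp
    qed
    then show "N +>\<^bsub>M\<^esub> \<phi> (emb p * f) = p \<odot>\<^bsub>quot_module M N\<^esub> (N +>\<^bsub>M\<^esub> \<phi> f)"
      using phi_smult[OF p f] by (simp add: quot_module_def)
  next
    show "N +>\<^bsub>M\<^esub> \<phi> 0 = \<zero>\<^bsub>quot_module M N\<^esub>"
      using mem[OF phi_closed[OF FF_zero]] phi_zero subgroup.one_closed[OF N.a_subgroup] by (simp add: quot_module_def)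
    show "carrier (quot_module M N) = (\<lambda>f. N +>\<^bsub>M\<^esub> \<phi> f) ` FF"
      by (auto simp: quot_module_def A_RCOSETS_def' phi_surj)
    show "grade (quot_module M N) t = (\<lambda>f. N +>\<^bsub>M\<^esub> \<phi> f) ` Fg t" for t
      by (auto simp: quot_module_def grade_image)
  qed
qed

text \<open>As the kernel lies in \<open>U\<close>, membership of \<open>\<phi> f\<close> in the
  image does not depend on the chosen preimage.\<close>

lemma image_submodule:
  assumes U: "sub U" and KU: "\<And>t. K t \<subseteq> U t" and N: "N = \<phi> ` tot U"
  shows "Module.submodule N (poly_ring n) M" "\<And>f. f \<in> FF \<Longrightarrow> \<phi> f \<in> N \<longleftrightarrow> f \<in> tot U"
proof -
  have tF: "f \<in> FF" if "f \<in> tot U" for f using that by (simp add: tot_def)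
  show "Module.submodule N (poly_ring n) M"
  proof (rule M.submoduleI)
    show "N \<subseteq> carrier M" unfolding N using phi_closed[OF tF] by blast
    show "\<zero>\<^bsub>M\<^esub> \<in> N" unfolding N phi_zero[symmetric] by (rule imageI[OF tot_zero[OF U]])
    fix y assume "y \<in> N"
    then obtain f where f: "f \<in> tot U" "y = \<phi> f" unfolding N by blast
    note fF = tF[OF f(1)]
    show "y \<oplus>\<^bsub>M\<^esub> z \<in> N" if z: "z \<in> N" for z
    proof -
      obtain g where g: "g \<in> tot U" "z = \<phi> g" using z unfolding N by blast
      show ?thesis unfolding N f(2) g(2) phi_add[OF fF tF[OF g(1)], symmetric] by (rule imageI[OF tot_add[OF U f(1) g(1)]])
    qed
    show "p \<odot>\<^bsub>M\<^esub> y \<in> N" if "p \<in> carrier (poly_ring n)" for p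
      unfolding N f(2) phi_smult[OF that fF, symmetric] by (rule imageI[OF tot_emb[OF U f(1) that]])
    have "\<phi> (- f) \<oplus>\<^bsub>M\<^esub> y = \<zero>\<^bsub>M\<^esub>" using phi_add[OF FF_uminus[OF fF] fF] f(2) phi_zero by simp
    then have "\<ominus>\<^bsub>M\<^esub> y = \<phi> (- f)"
      using M.minus_equality[of "\<phi> (- f)" y] phi_closed[OF FF_uminus[OF fF]] phi_closed[OF fF] f(2) by simp
    then show "\<ominus>\<^bsub>M\<^esub> y \<in> N" unfolding N using imageI[OF tot_uminus[OF U f(1)], of \<phi>] by simp
  qed
  fix f assume f: "f \<in> FF"
  show "\<phi> f \<in> N \<longleftrightarrow> f \<in> tot U"
  proof
    assume "\<phi> f \<in> N"
    then obtain g where g: "g \<in> tot U" "\<phi> f = \<phi> g" unfolding N by blast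
    have "f - g \<in> tot K" using M.psi_eq[OF f tF[OF g(1)]] g(2) by blast
    then have "f - g \<in> tot U" using KU unfolding tot_def by blast
    then show "f \<in> tot U" using tot_add[OF U _ g(1), of "f - g"] by simp
  qed (simp add: N)
qed

end

section \<open>Prime ideals and Krull dimension\<close>

lemma poly_idealI:
  fixes I :: "'a::field mpoly set"
  assumes "I \<subseteq> carrier (poly_ring n)" "0 \<in> I" "\<And>p q. p \<in> I \<Longrightarrow> q \<in> I \<Longrightarrow> p + q \<in> I"
    "\<And>p q. p \<in> carrier (poly_ring n) \<Longrightarrow> q \<in> I \<Longrightarrow> p * q \<in> I"
  shows "ideal I (poly_ring n)"
proof (rule idealI)
  interpret cring "poly_ring n" by (rule cring_poly_ring)
  show "ring (poly_ring n)" by (rule ring_axioms)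
  show "subgroup I (add_monoid (poly_ring n))"
  proof (rule group.subgroupI[OF a_group])
    fix a assume a: "a \<in> I"
    have "\<ominus>\<^bsub>poly_ring n\<^esub> a = - a"
      using assms(1) a poly_ring_uminus by (intro minus_equality) auto
    moreover have "- a \<in> I" using assms(4)[OF poly_ring_uminus[OF poly_ring_one] a] by simp
    ultimately show "inv\<^bsub>add_monoid (poly_ring n)\<^esub> a \<in> I" by (simp add: a_inv_def)
  qed (use assms in auto)
  fix a p :: "'a mpoly" assume "a \<in> I" "p \<in> carrier (poly_ring n)"
  then show "p \<otimes>\<^bsub>poly_ring n\<^esub> a \<in> I" "a \<otimes>\<^bsub>poly_ring n\<^esub> p \<in> I"
    using assms(4)[of p a] by (simp_all add: mult.commute)
qed

lemma poly_ideal_props: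
  assumes "ideal I (poly_ring n)"
  shows "I \<subseteq> carrier (poly_ring n)" "0 \<in> I" "p \<in> I \<Longrightarrow> q \<in> I \<Longrightarrow> p + q \<in> I"
    "p \<in> carrier (poly_ring n) \<Longrightarrow> q \<in> I \<Longrightarrow> p * q \<in> I"
proof -
  interpret ideal I "poly_ring n" by (rule assms)
  show "I \<subseteq> carrier (poly_ring n)" using a_subset .
  show "0 \<in> I" using additive_subgroup.zero_closed[OF is_additive_subgroup] by simp
  show "p \<in> I \<Longrightarrow> q \<in> I \<Longrightarrow> p + q \<in> I" using additive_subgroup.a_closed[OF is_additive_subgroup] by simp
  show "p \<in> carrier (poly_ring n) \<Longrightarrow> q \<in> I \<Longrightarrow> p * q \<in> I" using I_l_closed by simp
qed

text \<open>An ideal that is maximal among those containing \<open>I\<close> and disjoint from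
  \<open>S\<close> is prime.\<close>

lemma exists_prime_avoiding:
  fixes I S :: "'a::field mpoly set"
  assumes I: "ideal I (poly_ring n)" and one: "1 \<in> S" and mult: "\<And>a b. a \<in> S \<Longrightarrow> b \<in> S \<Longrightarrow> a * b \<in> S"
    and disj: "I \<inter> S = {}"
  shows "\<exists>P. primeideal P (poly_ring n) \<and> I \<subseteq> P \<and> P \<inter> S = {}"
proof -
  let ?A = "{J. ideal J (poly_ring n) \<and> I \<subseteq> J \<and> J \<inter> S = {}}"
  have "\<exists>P\<in>?A. \<forall>J\<in>?A. P \<subseteq> J \<longrightarrow> J = P"
  proof (rule subset_Zorn_nonempty)
    show "?A \<noteq> {}" using I disj by blast
    fix C assume C: "C \<noteq> {}" "subset.chain ?A C"
    then have CA: "\<And>J. J \<in> C \<Longrightarrow> J \<in> ?A" and ch: "\<And>J J'. J \<in> C \<Longrightarrow> J' \<in> C \<Longrightarrow> J \<subseteq> J' \<or> J' \<subseteq> J"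
      by (auto simp: subset_chain_def)
    have CI: "\<And>J. J \<in> C \<Longrightarrow> ideal J (poly_ring n)" using CA by blast
    have "ideal (\<Union>C) (poly_ring n)"
    proof (rule poly_idealI)
      show "\<Union>C \<subseteq> carrier (poly_ring n)" using poly_ideal_props(1)[OF CI] by blast
      show "0 \<in> \<Union>C" using C(1) poly_ideal_props(2)[OF CI] by blast
      show "p + q \<in> \<Union>C" if pq: "p \<in> \<Union>C" "q \<in> \<Union>C" for p q
      proof -
        obtain J1 J2 where J12: "J1 \<in> C" "p \<in> J1" "J2 \<in> C" "q \<in> J2" using pq by blast
        then obtain J where J: "J \<in> C" "p \<in> J" "q \<in> J" using ch[OF J12(1,3)] by blast
        then have "p + q \<in> J" using poly_ideal_props(3)[OF CI[OF J(1)] J(2,3)] by blast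
        then show ?thesis using J by blast
      qed
      show "p * q \<in> \<Union>C" if pq: "p \<in> carrier (poly_ring n)" "q \<in> \<Union>C" for p q
      proof -
        obtain J where J: "J \<in> C" "q \<in> J" using pq by blast
        then show ?thesis using poly_ideal_props(4)[OF CI[OF J(1)] pq(1) J(2)] by blast
      qed
    qed
    then show "\<Union>C \<in> ?A" using C(1) CA by blast
  qed
  then obtain P where PA: "P \<in> ?A" and m: "\<forall>J\<in>?A. P \<subseteq> J \<longrightarrow> J = P" by (rule bexE)
  then have P: "ideal P (poly_ring n)" "I \<subseteq> P" "P \<inter> S = {}" by simp_all
  have max: "J = P" if "ideal J (poly_ring n)" "J \<inter> S = {}" "P \<subseteq> J" for J
    using m that P(2) by auto
  note PI = poly_ideal_props[OF P(1)]
  \<comment> \<open>By maximality, adjoining an element outside \<open>P\<close> produces an ideal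
    that meets \<open>S\<close>. If two such elements had their product in \<open>P\<close>,
    multiplying the two elements of \<open>S\<close> so obtained would give an element of
    \<open>P\<close> in \<open>S\<close>.\<close>
  have ext: "\<exists>s\<in>S. \<exists>q\<in>P. \<exists>r\<in>carrier (poly_ring n). s = q + r * a" if a: "a \<in> carrier (poly_ring n)" "a \<notin> P" for a :: "'a mpoly"
  proof -
    let ?J = "{q + r * a | q r. q \<in> P \<and> r \<in> carrier (poly_ring n)}"
    have J: "ideal ?J (poly_ring n)"
    proof (rule poly_idealI)
      show "?J \<subseteq> carrier (poly_ring n)" 
      proof clarify
        fix q r :: "'a mpoly" assume "q \<in> P" "r \<in> carrier (poly_ring n)"
        then show "q + r * a \<in> carrier (poly_ring n)" using PI(1) a(1) by (intro poly_ring_add poly_ring_mult) auto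
      qed
      have "0 = 0 + 0 * a" by simp
      then show "0 \<in> ?J" using PI(2) poly_ring_zero by blast
    next
      fix p p' assume "p \<in> ?J" "p' \<in> ?J"
      then obtain q r q' r' where e: "p = q + r * a" "q \<in> P" "r \<in> carrier (poly_ring n)" "p' = q' + r' * a" "q' \<in> P" "r' \<in> carrier (poly_ring n)"
        by blast
      have "p + p' = (q + q') + (r + r') * a" using e by (simp add: algebra_simps)
      then show "p + p' \<in> ?J" using PI(3)[OF e(2,5)] poly_ring_add[OF e(3,6)] by blast
    next
      fix c p :: "'a mpoly" assume c: "c \<in> carrier (poly_ring n)" and "p \<in> ?J"
      then obtain q r where e: "p = q + r * a" "q \<in> P" "r \<in> carrier (poly_ring n)" by blast
      have "c * p = c * q + (c * r) * a" using e by (simp add: algebra_simps)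
      then show "c * p \<in> ?J" using PI(4)[OF c e(2)] poly_ring_mult[OF c e(3)] by blast
    qed
    have PJ: "P \<subseteq> ?J"
    proof
      fix q assume "q \<in> P"
      moreover have "q = q + 0 * a" by simp
      ultimately show "q \<in> ?J" using poly_ring_zero by blast
    qed
    have "a = 0 + 1 * a" by simp
    then have "a \<in> ?J" using PI(2) poly_ring_one by blast
    then have "?J \<noteq> P" using a(2) by blast
    then have "?J \<inter> S \<noteq> {}" using max[OF J _ PJ] by blast
    then show ?thesis by blast
  qed
  have "primeideal P (poly_ring n)"
  proof (rule primeidealI[OF P(1) cring_poly_ring])
    show "carrier (poly_ring n) \<noteq> P" using one P(3) poly_ring_one[of n] by blast
    fix a b :: "'a mpoly" assume a: "a \<in> carrier (poly_ring n)" and b: "b \<in> carrier (poly_ring n)" and "a \<otimes>\<^bsub>poly_ring n\<^esub> b \<in> P"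
    then have ab: "a * b \<in> P" by simp
    show "a \<in> P \<or> b \<in> P"
    proof (rule ccontr)
      assume nab: "\<not> (a \<in> P \<or> b \<in> P)"
      obtain s q r where s: "s \<in> S" "q \<in> P" "r \<in> carrier (poly_ring n)" "s = q + r * a" using ext[OF a] nab by blast
      obtain s' q' r' where s': "s' \<in> S" "q' \<in> P" "r' \<in> carrier (poly_ring n)" "s' = q' + r' * b" using ext[OF b] nab by blast
      have q'c: "q' \<in> carrier (poly_ring n)" using PI(1) s'(2) by blast
      have "s * s' = (q' + r' * b) * q + ((r * a) * q' + (r * r') * (a * b))" unfolding s(4) s'(4) by (simp add: algebra_simps)
      also have "\<dots> \<in> P"
        by (intro PI(3) PI(4) poly_ring_add poly_ring_mult s s' ab a b q'c)
      finally show False using mult[OF s(1) s'(1)] P(3) by blast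
    qed
  qed
  then show ?thesis using P by blast
qed

text \<open>Exponents cannot cancel, so only the two constant terms contribute to the constant term
  of a product; this makes \<open>max_ideal\<close> prime.\<close>

lemma lookup_mult_0: "Poly_Mapping.lookup (p * q) 0 = Poly_Mapping.lookup p 0 * Poly_Mapping.lookup (q :: 'k::field mpoly) 0"
proof -
  let ?s = "\<lambda>p u. Poly_Mapping.single u (Poly_Mapping.lookup p u)"
  have z: "u + v = 0 \<longleftrightarrow> u = 0 \<and> v = 0" for u v :: "nat \<Rightarrow>\<^sub>0 nat"
    using mon_deg_0_iff[of "u + v"] mon_deg_0_iff[of u] mon_deg_0_iff[of v] by (auto simp: mon_deg_add)
  have "p * q = (\<Sum>u\<in>Poly_Mapping.keys p. \<Sum>v\<in>Poly_Mapping.keys q. ?s p u * ?s q v)"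
    unfolding sum_product[symmetric] poly_mapping_sum_monomials[symmetric] ..
  then have "Poly_Mapping.lookup (p * q) 0 = (\<Sum>u\<in>Poly_Mapping.keys p. \<Sum>v\<in>Poly_Mapping.keys q. Poly_Mapping.lookup (?s p u * ?s q v) 0)"
    by (simp only: lookup_sum)
  also have "\<dots> = (\<Sum>u\<in>Poly_Mapping.keys p. \<Sum>v\<in>Poly_Mapping.keys q.
      (if u = 0 then Poly_Mapping.lookup p u else 0) * (if v = 0 then Poly_Mapping.lookup q v else 0))"
    by (intro sum.cong refl) (auto simp: mult_single lookup_single when_def z)
  also have "\<dots> = (\<Sum>u\<in>Poly_Mapping.keys p. if u = 0 then Poly_Mapping.lookup p u else 0) *
      (\<Sum>v\<in>Poly_Mapping.keys q. if v = 0 then Poly_Mapping.lookup q v else 0)"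
    by (rule sum_product[symmetric])
  also have "\<dots> = Poly_Mapping.lookup p 0 * Poly_Mapping.lookup q 0" by (simp add: in_keys_iff)
  finally show ?thesis .
qed

definition max_ideal :: "nat \<Rightarrow> 'k::field mpoly set" where
  "max_ideal n = {p \<in> carrier (poly_ring n). Poly_Mapping.lookup p 0 = 0}"

lemma max_ideal_prime: "primeideal (max_ideal n :: 'a::field mpoly set) (poly_ring n)"
proof (rule primeidealI[OF poly_idealI cring_poly_ring])
  have "(1 :: 'a mpoly) \<notin> max_ideal n" by (simp add: max_ideal_def lookup_one)
  then show "carrier (poly_ring n) \<noteq> (max_ideal n :: 'a mpoly set)" using poly_ring_one[of n] by blast
qed (auto simp: max_ideal_def poly_ring_zero poly_ring_add poly_ring_mult lookup_add lookup_mult_0)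

lemma monomial_split:
  assumes u: "Poly_Mapping.keys u \<subseteq> {..<n}" and deg: "mon_deg u > n * s"
  shows "\<exists>j<n. \<exists>v. Poly_Mapping.keys v \<subseteq> {..<n} \<and> (\<forall>c. Poly_Mapping.single u c = Poly_Mapping.single v c * (var j :: 'k::field mpoly) ^ s)"
proof -
  have "\<exists>j<n. s \<le> Poly_Mapping.lookup u j"
  proof (rule ccontr)
    assume "\<not> ?thesis"
    then have "(\<Sum>j<n. Poly_Mapping.lookup u j) \<le> (\<Sum>j<n. s)" by (intro sum_mono) force
    then show False using deg mon_deg_eq[OF _ u] by simp
  qed
  then obtain j where j: "j < n" "s \<le> Poly_Mapping.lookup u j" by blast
  define v where "v = u - Poly_Mapping.single j s"
  have "u = v + Poly_Mapping.single j s"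
    by (rule poly_mapping_eqI) (use j in \<open>auto simp: v_def lookup_add lookup_minus lookup_single when_def\<close>)
  moreover have "(var j :: 'k mpoly) ^ s = Poly_Mapping.single (Poly_Mapping.single j s) 1"
    using vp_eq_single[of "{j}" s] by (simp add: vp_def)
  ultimately have "\<forall>c. Poly_Mapping.single u c = Poly_Mapping.single v c * (var j :: 'k mpoly) ^ s"
    by (simp add: mult_single)
  moreover have "Poly_Mapping.keys v \<subseteq> {..<n}" 
  proof
    fix i assume "i \<in> Poly_Mapping.keys v"
    then have "i \<in> Poly_Mapping.keys u" by (auto simp: v_def in_keys_iff lookup_minus)
    then show "i \<in> {..<n}" using u by blast
  qed
  ultimately show ?thesis using j by blast
qed

text \<open>Together with \<open>var_power_irrelevant\<close> this compares powers of the irrelevant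
  ideal, used by \<open>torsion\<close>, with powers of the variables, used by
  \<open>sat\<close>.\<close>

lemma irrelevant_power_degree:
  "p \<in> (ideal_prod (poly_ring n) (irrelevant_ideal n) ^^ r) (carrier (poly_ring n)) \<Longrightarrow>
   p \<in> carrier (poly_ring n) \<and> (\<forall>u\<in>Poly_Mapping.keys p. r \<le> mon_deg u)"
proof (induction r arbitrary: p)
  case 0
  then show ?case by simp
next
  case (Suc r)
  define D where "D = (\<lambda>r. {p :: 'a mpoly. p \<in> carrier (poly_ring n) \<and> (\<forall>u\<in>Poly_Mapping.keys p. r \<le> mon_deg u)})"
  have D_add: "p + q \<in> D r" if "p \<in> D r" "q \<in> D r" for p q r
    using that poly_ring_add Poly_Mapping.keys_add[of p q] by (auto simp: D_def)
  have D_mult: "p * q \<in> D (r + s)" if pq: "p \<in> D r" "q \<in> D s" for p q r s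
  proof -
    have "r + s \<le> mon_deg u" if u: "u \<in> Poly_Mapping.keys (p * q)" for u
    proof -
      obtain a b where "u = a + b" "a \<in> Poly_Mapping.keys p" "b \<in> Poly_Mapping.keys q"
        using u keys_mult[of p q] by blast
      then show ?thesis using pq by (auto simp: D_def mon_deg_add intro: add_mono)
    qed
    then show ?thesis using pq poly_ring_mult by (auto simp: D_def)
  qed
  have D0: "D 0 = carrier (poly_ring n)" by (auto simp: D_def)
  have "irrelevant_ideal n \<subseteq> D 1"
    unfolding irrelevant_ideal_def
  proof (rule ring.genideal_minimal[OF cring.axioms(1)[OF cring_poly_ring]])
    show "ideal (D 1) (poly_ring n)"
    proof (rule poly_idealI)
      show "0 \<in> D 1" by (simp add: D_def poly_ring_zero)
      show "p * q \<in> D 1" if "p \<in> carrier (poly_ring n)" "q \<in> D 1" for p q using D_mult[of p 0 q 1] that D0 by simp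
      show "p + q \<in> D 1" if "p \<in> D 1" "q \<in> D 1" for p q using D_add that .
    qed (auto simp: D_def)
    show "var ` {..<n} \<subseteq> D 1" using poly_ring_var by (auto simp: D_def var_def)
  qed
  moreover have "p \<in> ideal_prod (poly_ring n) (irrelevant_ideal n) ((ideal_prod (poly_ring n) (irrelevant_ideal n) ^^ r) (carrier (poly_ring n)))"
    using Suc.prems by simp
  then have "p \<in> D (Suc r)"
  proof (induction rule: ideal_prod.induct)
    case (prod i j)
    then show ?case using D_mult[of i 1 j r] Suc.IH[of j] calculation by (auto simp: D_def)
  next
    case (sum s1 s2)
    then show ?case using D_add by simp
  qed
  then show ?case by (simp add: D_def)
qed

lemma var_power_irrelevant:
  "j < n \<Longrightarrow> var j ^ r \<in> (ideal_prod (poly_ring n) (irrelevant_ideal n) ^^ r) (carrier (poly_ring n))"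
proof (induction r)
  case 0
  then show ?case by (simp add: poly_ring_one)
next
  case (Suc r)
  have "var ` {..<n} \<subseteq> (irrelevant_ideal n :: 'a mpoly set)"
    unfolding irrelevant_ideal_def
    by (rule ring.genideal_self[OF cring.axioms(1)[OF cring_poly_ring]]) (use poly_ring_var in blast)
  then have "var j \<in> (irrelevant_ideal n :: 'a mpoly set)" using Suc.prems by blast
  from ideal_prod.prod[OF this Suc.IH[OF Suc.prems], of "poly_ring n"] show ?case by simp
qed

lemma homog_var_power:
  assumes "j < n"
  shows "(var j :: 'a::field mpoly) ^ s \<in> homog n s"
proof -
  have "(var j :: 'a mpoly) ^ s = Poly_Mapping.single (Poly_Mapping.single j s) 1"
    using vp_eq_single[of "{j}" s, where ?'a = 'a] by (simp add: vp_def)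
  then show ?thesis using homog_single[of "Poly_Mapping.single j s" n "1 :: 'a"] assms by (cases "s = 0") auto
qed

section \<open>Torsion, kernels of finite length and multiples by linear forms\<close>

context free_graded begin

lemma tot_high:
  assumes U: "sub U" and var: "\<And>j. j < n \<Longrightarrow> emb (var j ^ s) * f \<in> tot U"
    and p: "p \<in> carrier (poly_ring n)" "\<forall>u\<in>Poly_Mapping.keys p. n * s < mon_deg u"
  shows "emb p * f \<in> tot U"
proof -
  have "emb p * f = emb (\<Sum>u\<in>Poly_Mapping.keys p. Poly_Mapping.single u (Poly_Mapping.lookup p u)) * f"
    by (simp only: poly_mapping_sum_monomials[symmetric])
  also have "\<dots> = (\<Sum>u\<in>Poly_Mapping.keys p. emb (Poly_Mapping.single u (Poly_Mapping.lookup p u)) * f)"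
    by (simp only: emb_sum sum_distrib_right)
  also have "\<dots> \<in> tot U"
  proof (rule tot_sum[OF U])
    fix u assume u: "u \<in> Poly_Mapping.keys p"
    have "Poly_Mapping.keys u \<subseteq> {..<n}" "n * s < mon_deg u" using p u by (auto simp: in_poly_ring)
    from monomial_split[OF this, where ?'k = 'k] obtain j v where j: "j < n" "Poly_Mapping.keys v \<subseteq> {..<n}"
      "\<And>c :: 'k. Poly_Mapping.single u c = Poly_Mapping.single v c * var j ^ s" by blast
    show "emb (Poly_Mapping.single u (Poly_Mapping.lookup p u)) * f \<in> tot U"
      unfolding j(3) emb_simps(2) mult.assoc by (rule tot_emb[OF U var[OF j(1)] poly_ring_single[OF j(2)]])
  qed
  finally show ?thesis .
qed

lemma tot_mono: "(\<And>t. U t \<subseteq> U' t) \<Longrightarrow> tot U \<subseteq> tot U'"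
  unfolding tot_def by blast

end

context presentation begin

lemma psi_image_submodule:
  assumes Z: "sub Z" and A: "tot Z \<subseteq> A" "A \<subseteq> FF"
  shows "Module.submodule (\<psi> ` tot Z) (poly_ring n) (Q\<lparr>carrier := \<psi> ` A\<rparr>)"
proof (intro Module.submodule.intro subgroup.intro submodule_axioms.intro)
  let ?Q = "Q\<lparr>carrier := \<psi> ` A\<rparr>"
  have tF: "f \<in> FF" if "f \<in> tot Z" for f using that by (simp add: tot_def)
  show "\<psi> ` tot Z \<subseteq> carrier (add_monoid ?Q)" using A(1) by auto
  show "\<one>\<^bsub>add_monoid ?Q\<^esub> \<in> \<psi> ` tot Z" using tot_zero[OF Z] psi_zero by force
  fix y assume "y \<in> \<psi> ` tot Z"
  then obtain f where f: "f \<in> tot Z" "y = \<psi> f" by blast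
  note fF = tF[OF f(1)]
  show "y \<otimes>\<^bsub>add_monoid ?Q\<^esub> z \<in> \<psi> ` tot Z" if z: "z \<in> \<psi> ` tot Z" for z
  proof -
    obtain g where g: "g \<in> tot Z" "z = \<psi> g" using z by blast
    have "y \<oplus>\<^bsub>Q\<^esub> z = \<psi> (f + g)" using psi_add[OF fF tF[OF g(1)]] f g by simp
    then show ?thesis using tot_add[OF Z f(1) g(1)] by simp
  qed
  show "p \<odot>\<^bsub>?Q\<^esub> y \<in> \<psi> ` tot Z" if p: "p \<in> carrier (poly_ring n)" for p
  proof -
    have "p \<odot>\<^bsub>Q\<^esub> y = \<psi> (emb p * f)" using psi_smult[OF p fF] f by simp
    then show ?thesis using tot_emb[OF Z f(1) p] by simp
  qed
  have mF: "- f \<in> FF" using FF_uminus[OF fF] .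
  have 1: "y \<oplus>\<^bsub>Q\<^esub> \<psi> (- f) = \<zero>\<^bsub>Q\<^esub>" "\<psi> (- f) \<oplus>\<^bsub>Q\<^esub> y = \<zero>\<^bsub>Q\<^esub>"
    using psi_add[OF fF mF] psi_add[OF mF fF] f(2) psi_zero by simp_all
  have "inv\<^bsub>add_monoid ?Q\<^esub> y = \<psi> (- f)"
    unfolding m_inv_def
  proof (rule the_equality)
    show "\<psi> (- f) \<in> carrier (add_monoid ?Q) \<and> y \<otimes>\<^bsub>add_monoid ?Q\<^esub> \<psi> (- f) = \<one>\<^bsub>add_monoid ?Q\<^esub> \<and> \<psi> (- f) \<otimes>\<^bsub>add_monoid ?Q\<^esub> y = \<one>\<^bsub>add_monoid ?Q\<^esub>"
      using 1 A(1) tot_uminus[OF Z f(1)] by auto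
    fix z assume z: "z \<in> carrier (add_monoid ?Q) \<and> y \<otimes>\<^bsub>add_monoid ?Q\<^esub> z = \<one>\<^bsub>add_monoid ?Q\<^esub> \<and> z \<otimes>\<^bsub>add_monoid ?Q\<^esub> y = \<one>\<^bsub>add_monoid ?Q\<^esub>"
    then obtain g where g: "g \<in> FF" "z = \<psi> g" using A(2) by auto
    have "\<psi> (g + f) = \<zero>\<^bsub>Q\<^esub>" using z g f(2) psi_add[OF g(1) fF] by simp
    then have "g - (- f) \<in> tot U" using kernel[OF FF_add[OF g(1) fF]] by simp
    then show "z = \<psi> (- f)" using psi_eq[OF g(1) mF] g(2) by blast
  qed
  then show "inv\<^bsub>add_monoid ?Q\<^esub> y \<in> \<psi> ` tot Z" using tot_uminus[OF Z f(1)] by simp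
qed

text \<open>If the kernel of \<open>a\<close> were nonzero in arbitrarily high degrees, its
  truncations from degree \<open>T\<close> on would shrink strictly infinitely often, giving chains
  of submodules of any length.\<close>

lemma finite_length_kernel:
  assumes a: "a \<in> homog n 1"
    and fl: "finite_length (poly_ring n) (Q\<lparr>carrier := {y \<in> carrier Q. a \<odot>\<^bsub>Q\<^esub> y = \<zero>\<^bsub>Q\<^esub>}\<rparr>)"
  shows "\<exists>t0. \<forall>t\<ge>t0. \<forall>f\<in>Fg t. emb a * f \<in> U (t + 1) \<longrightarrow> f \<in> U t"
proof (rule ccontr)
  assume "\<not> ?thesis"
  then have bad: "\<exists>t\<ge>t0. \<exists>f\<in>Fg t. emb a * f \<in> U (t + 1) \<and> f \<notin> U t" for t0 by blast
  define A where "A = (\<lambda>t. {f \<in> Fg t. emb a * f \<in> U (t + 1)})"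
  define Z where "Z = (\<lambda>T t. {f \<in> A t. t < T \<longrightarrow> f \<in> U t})"
  have lin: "linear_form (emb a)" by (rule linear_form_homog[OF a])
  have sZ: "sub (Z T)" for T
    unfolding sub_def
  proof (intro allI conjI ballI impI)
    fix t show "Z T t \<subseteq> Fg t" "0 \<in> Z T t" using F_zero sub_zero[OF sub_U] by (auto simp: Z_def A_def)
  next
    fix t f g assume f: "f \<in> Z T t" and g: "g \<in> Z T t"
    have "emb a * f + emb a * g \<in> U (t + 1)" using f g sub_add[OF sub_U] by (simp add: Z_def A_def)
    then show "f + g \<in> Z T t"
      using f g F_add[of f t g] sub_add[OF sub_U, of f t g] by (simp add: Z_def A_def distrib_left)
  next
    fix t f and c :: "'g \<Rightarrow> 'k mpoly" assume f: "f \<in> Z T t" and c: "c \<in> range (\<lambda>c. emb (const_poly c))"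
    have "c * (emb a * f) \<in> U (t + 1)" using f sub_C[OF sub_U _ c] by (simp add: Z_def A_def)
    then show "c * f \<in> Z T t"
      using f F_C[OF _ c, of f t] sub_C[OF sub_U _ c, of f t] by (simp add: Z_def A_def mult.left_commute)
  next
    fix t f j assume f: "f \<in> Z T t" and j: "j < n"
    have "emb a * f \<in> U (t + 1)" using f by (simp add: Z_def A_def)
    from sub_x[OF sub_U this j] have "emb (var j) * (emb a * f) \<in> U (t + 1 + 1)" .
    then have 1: "emb a * (emb (var j) * f) \<in> U (t + 1 + 1)" by (simp add: mult.left_commute)
    show "emb (var j) * f \<in> Z T (t + 1)"
      using f 1 F_x[OF _ j, of f t] sub_x[OF sub_U _ j, of f t] by (auto simp: Z_def A_def)
  qed
  define KK where "KK = {f \<in> FF. emb a * f \<in> tot U}"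
  have ker: "{y \<in> carrier Q. a \<odot>\<^bsub>Q\<^esub> y = \<zero>\<^bsub>Q\<^esub>} = \<psi> ` KK"
  proof -
    have "a \<odot>\<^bsub>Q\<^esub> \<psi> f = \<zero>\<^bsub>Q\<^esub> \<longleftrightarrow> emb a * f \<in> tot U" if "f \<in> FF" for f
      using psi_smult[OF homog_carrier[OF a] that] kernel[OF FF_emb[OF homog_carrier[OF a] that]] by simp
    then show ?thesis unfolding carrier_Q KK_def by blast
  qed
  have ZK: "tot (Z T) \<subseteq> KK" for T
  proof
    fix f assume f: "f \<in> tot (Z T)"
    then have FF: "f \<in> FF" by (simp add: tot_def)
    have "hc t (emb a * f) \<in> U t" for t
    proof -
      have "hc (t - 1 + int 1) (emb a * f) = emb a * hc (t - 1) f" by (rule hc_homog[OF a FF])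
      moreover have "hc (t - 1) f \<in> Z T (t - 1)" using f unfolding tot_def by blast
      then have "emb a * hc (t - 1) f \<in> U (t - 1 + 1)" unfolding Z_def A_def by blast
      ultimately show ?thesis by simp
    qed
    then show "f \<in> KK" unfolding KK_def tot_def using FF FF_emb[OF homog_carrier[OF a] FF] by blast
  qed
  \<comment> \<open>A strictly increasing sequence of degrees in which the kernel is
    nonzero.\<close>
  define T where "T = rec_nat (SOME t. \<exists>f\<in>Fg t. emb a * f \<in> U (t + 1) \<and> f \<notin> U t)
    (\<lambda>_ s. SOME t. t \<ge> s + 1 \<and> (\<exists>f\<in>Fg t. emb a * f \<in> U (t + 1) \<and> f \<notin> U t))"
  have TS: "T (Suc i) \<ge> T i + 1 \<and> (\<exists>f\<in>Fg (T (Suc i)). emb a * f \<in> U (T (Suc i) + 1) \<and> f \<notin> U (T (Suc i)))" for i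
    unfolding T_def nat.rec(2) by (rule someI_ex) (use bad in blast)
  have Tmono: "T i < T (Suc i)" for i using TS[of i] by linarith
  have Tbad: "\<exists>f\<in>Fg (T i). emb a * f \<in> U (T i + 1) \<and> f \<notin> U (T i)" for i
  proof (cases i)
    case 0
    show ?thesis unfolding 0 T_def nat.rec(1) by (rule someI_ex) (use bad in blast)
  qed (use TS in blast)
  have strict: "\<psi> ` tot (Z t') \<subset> \<psi> ` tot (Z t)" if tt: "t < t'" and tb: "\<exists>f\<in>Fg t. emb a * f \<in> U (t + 1) \<and> f \<notin> U t" for t t'
  proof (rule psubsetI)
    show "\<psi> ` tot (Z t') \<subseteq> \<psi> ` tot (Z t)" using tt by (intro image_mono tot_mono) (auto simp: Z_def)
    obtain f where f: "f \<in> Fg t" "emb a * f \<in> U (t + 1)" "f \<notin> U t" using tb by blast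
    have "f \<in> Z t t" using f by (simp add: Z_def A_def)
    then have "f \<in> tot (Z t)" using tot_Fg[OF sZ f(1)] by blast
    moreover have "\<psi> f \<notin> \<psi> ` tot (Z t')"
    proof
      assume "\<psi> f \<in> \<psi> ` tot (Z t')"
      then obtain g where g: "g \<in> tot (Z t')" "\<psi> f = \<psi> g" by blast
      have gF: "g \<in> FF" using g(1) by (simp add: tot_def)
      have "f - g \<in> tot U" using psi_eq[OF Fg_subset_FF[OF f(1)] gF] g(2) by blast
      then have "hc t (f - g) \<in> U t" by (simp add: tot_def)
      then have "f - hc t g \<in> U t" using hc_Fg[OF f(1), of t] by (simp add: hc_diff)
      moreover have "hc t g \<in> U t" using g(1) tt by (auto simp: tot_def Z_def)
      ultimately have "f \<in> U t" using sub_add[OF sub_U, of "f - hc t g" t "hc t g"] by simp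
      then show False using f(3) by blast
    qed
    ultimately show "\<psi> ` tot (Z t') \<noteq> \<psi> ` tot (Z t)" by blast
  qed
  \<comment> \<open>The index is reversed to \<open>r - i\<close> because
    \<open>module_length\<close> counts increasing chains, while later truncations are
    smaller.\<close>
  have "enat r \<le> module_length (poly_ring n) (Q\<lparr>carrier := \<psi> ` KK\<rparr>)" for r
    unfolding module_length_def
  proof (rule Sup_upper, rule CollectI, rule exI[of _ r], rule conjI[OF refl],
      rule exI[of _ "\<lambda>i. \<psi> ` tot (Z (T (r - i)))"], rule conjI)
    show "\<forall>i\<le>r. Module.submodule (\<psi> ` tot (Z (T (r - i)))) (poly_ring n) (Q\<lparr>carrier := \<psi> ` KK\<rparr>)"
      using psi_image_submodule[OF sZ ZK] by (auto simp: KK_def)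
    show "\<forall>i<r. \<psi> ` tot (Z (T (r - i))) \<subset> \<psi> ` tot (Z (T (r - Suc i)))"
    proof (intro allI impI)
      fix i assume "i < r"
      then have "r - i = Suc (r - Suc i)" by simp
      then show "\<psi> ` tot (Z (T (r - i))) \<subset> \<psi> ` tot (Z (T (r - Suc i)))" using strict[OF Tmono Tbad] by simp
    qed
  qed
  moreover obtain N where "module_length (poly_ring n) (Q\<lparr>carrier := \<psi> ` KK\<rparr>) = enat N"
    using fl unfolding finite_length_def ker by auto
  ultimately show False by (metis Suc_n_not_le_n enat_ord_simps(1))
qed

end

context generated_module begin

lemma torsion_eq: "torsion n M = \<phi> ` tot (sat K)"
proof
  show "torsion n M \<subseteq> \<phi> ` tot (sat K)"
  proof
    fix y assume y: "y \<in> torsion n M"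
    then have "y \<in> carrier M" by (simp add: torsion_def)
    then obtain f where f: "f \<in> FF" "y = \<phi> f" using phi_surj by blast
    obtain r where r: "\<And>a. a \<in> (ideal_prod (poly_ring n) (irrelevant_ideal n) ^^ r) (carrier (poly_ring n)) \<Longrightarrow> a \<odot>\<^bsub>M\<^esub> y = \<zero>\<^bsub>M\<^esub>"
      using y unfolding torsion_def by blast
    have "hc t f \<in> sat K t" for t
    proof -
      have "emb (var j) ^ r * hc t f \<in> K (t + int r)" if j: "j < n" for j
      proof -
        note h = homog_var_power[OF j, of r]
        have "\<phi> (emb (var j ^ r) * f) = \<zero>\<^bsub>M\<^esub>"
          using phi_smult[OF homog_carrier[OF h] f(1)] r[OF var_power_irrelevant[OF j]] f(2) by simp
        then have "emb (var j ^ r) * f \<in> tot K" using phi_kernel[OF FF_emb[OF homog_carrier[OF h] f(1)]] by blast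
        then have "hc (t + int r) (emb (var j ^ r) * f) \<in> K (t + int r)" unfolding tot_def by blast
        then show ?thesis using hc_homog[OF h f(1), of t] unfolding emb_simps by simp
      qed
      then show ?thesis unfolding sat_def using hc_in[OF f(1)] by blast
    qed
    then have "f \<in> tot (sat K)" using f(1) by (simp add: tot_def)
    then show "y \<in> \<phi> ` tot (sat K)" using f(2) by blast
  qed
  show "\<phi> ` tot (sat K) \<subseteq> torsion n M"
  proof
    fix y assume "y \<in> \<phi> ` tot (sat K)"
    then obtain f where f: "f \<in> tot (sat K)" "y = \<phi> f" by blast
    have FF: "f \<in> FF" using f by (simp add: tot_def)
    let ?T = "{t. hc t f \<noteq> 0}"
    have "\<exists>e. \<forall>s\<ge>e. \<forall>j<n. emb (var j) ^ s * hc t f \<in> K (t + int s)" for t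
      using sat_pow_ge[OF sub_K, of "hc t f" t] f(1) by (simp add: tot_def)
    then obtain e where e: "\<And>t s j. s \<ge> e t \<Longrightarrow> j < n \<Longrightarrow> emb (var j) ^ s * hc t f \<in> K (t + int s)" by metis
    \<comment> \<open>The sum serves as one exponent for all of the finitely many nonzero
      components.\<close>
    define s where "s = sum e ?T"
    have "emb (var j ^ s) * f \<in> tot K" if j: "j < n" for j
    proof -
      have "hc t (emb (var j ^ s) * f) \<in> K t" for t
      proof -
        have h: "hc (t - int s + int s) (emb (var j ^ s) * f) = emb (var j) ^ s * hc (t - int s) f"
          using hc_homog[OF homog_var_power[OF j] FF, of "t - int s"] unfolding emb_simps .
        show ?thesis
        proof (cases "hc (t - int s) f = 0")
          case True
          then show ?thesis using h sub_zero[OF sub_K] by simp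
        next
          case False
          then have "e (t - int s) \<le> s" unfolding s_def using hc_finite[OF FF] by (intro member_le_sum) auto
          from e[OF this j] show ?thesis using h by simp
        qed
      qed
      then show ?thesis unfolding tot_def using FF_emb[OF homog_carrier[OF homog_var_power[OF j]] FF] by blast
    qed
    then have high: "emb p * f \<in> tot K" if "p \<in> carrier (poly_ring n)" "\<forall>u\<in>Poly_Mapping.keys p. n * s < mon_deg u" for p
      using tot_high[OF sub_K _ that] by blast
    \<comment> \<open>Elements of the power \<open>Suc (n * s)\<close> of the ideal have only
      monomials of degree above \<open>n * s\<close>, each divisible by some
      \<open>var j ^ s\<close>.\<close>
    have "p \<odot>\<^bsub>M\<^esub> y = \<zero>\<^bsub>M\<^esub>" if p: "p \<in> (ideal_prod (poly_ring n) (irrelevant_ideal n) ^^ Suc (n * s)) (carrier (poly_ring n))" for p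
    proof -
      have p1: "p \<in> carrier (poly_ring n)" "\<forall>u\<in>Poly_Mapping.keys p. n * s < mon_deg u"
        using irrelevant_power_degree[OF p] by auto
      show ?thesis using phi_kernel[OF FF_emb[OF p1(1) FF]] high[OF p1] phi_smult[OF p1(1) FF] f(2) by simp
    qed
    then show "y \<in> torsion n M" unfolding torsion_def using phi_closed[OF FF] f(2) by blast
  qed
qed

fun Wc :: "(nat \<Rightarrow> 'k mpoly) \<Rightarrow> nat \<Rightarrow> int \<Rightarrow> ('m \<Rightarrow> 'k mpoly) set" where
  "Wc l 0 = K"
| "Wc l (Suc j) = adj (Wc l j) (emb (l (Suc j)))"

lemma sub_Wc: "(\<And>i. i \<in> {1..k} \<Longrightarrow> l i \<in> homog n 1) \<Longrightarrow> sub (Wc l k)"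
  by (induction k) (auto simp: sub_K intro!: sub_adj linear_form_homog)

lemma Wc_mono: "i \<le> j \<Longrightarrow> Wc l i t \<subseteq> Wc l j t"
  by (rule lift_Suc_mono_le[of "\<lambda>j. Wc l j t"]) (use adj_supset in auto)

text \<open>The forms are homogeneous, so the submodule generated by their multiples is the sum of
  its degree parts, and these arise by adjoining one form at a time.\<close>

lemma ideal_smult_eq:
  assumes l: "\<And>i. i \<in> {1..k} \<Longrightarrow> l i \<in> homog n 1"
  shows "ideal_smult (poly_ring n) (l ` {1..k}) M = \<phi> ` tot (Wc l k)"
proof -
  define X where "X = {a \<odot>\<^bsub>M\<^esub> y | a y. a \<in> l ` {1..k} \<and> y \<in> carrier M}"
  have lc: "l i \<in> carrier (poly_ring n)" if "i \<in> {1..k}" for i using homog_carrier[OF l[OF that]] .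
  have XM: "X \<subseteq> carrier M" unfolding X_def using lc M.smult_closed by auto
  have N: "LinearCombinations.submodule (poly_ring n) (M.span X) M" by (rule M.span_is_submodule[OF XM])
  have Nz: "\<zero>\<^bsub>M\<^esub> \<in> M.span X" and Na: "\<And>y z. y \<in> M.span X \<Longrightarrow> z \<in> M.span X \<Longrightarrow> y \<oplus>\<^bsub>M\<^esub> z \<in> M.span X"
    using N unfolding LinearCombinations.submodule_def by auto
  have NX: "y \<in> M.span X" if y: "y \<in> X" for y
  proof -
    have yM: "y \<in> carrier M" using y XM by blast
    have "M.lincomb (\<lambda>_. 1) {y} = y" unfolding M.lincomb_def using M.finsum_insert[of "{}" y "\<lambda>v. 1 \<odot>\<^bsub>M\<^esub> v"] M.smult_one[OF yM] yM by simp
    then show ?thesis unfolding M.span_def using y poly_ring_one[of n] by (intro CollectI exI[of _ "\<lambda>_. 1"] exI[of _ "{y}"]) auto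
  qed
  have W: "\<phi> f \<in> M.span X" if "j \<le> k" "f \<in> Wc l j t" for j f t
    using that
  proof (induction j arbitrary: f t)
    case 0
    then show ?case using Nz by (simp add: K_def)
  next
    case (Suc j)
    then obtain u g where ug: "f = u + emb (l (Suc j)) * g" "u \<in> Wc l j t" "g \<in> Fg (t - 1)" by (auto simp: adj_def)
    have li: "Suc j \<in> {1..k}" using Suc.prems by simp
    have sW: "sub (Wc l j)" using l Suc.prems by (intro sub_Wc) auto
    have uF: "u \<in> FF" using Fg_subset_FF[OF sub_subset[OF sW ug(2)]] .
    have gF: "g \<in> FF" using Fg_subset_FF[OF ug(3)] .
    have "\<phi> f = \<phi> u \<oplus>\<^bsub>M\<^esub> l (Suc j) \<odot>\<^bsub>M\<^esub> \<phi> g"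
      using phi_add[OF uF FF_emb[OF lc[OF li] gF]] phi_smult[OF lc[OF li] gF] ug(1) by simp
    moreover have "l (Suc j) \<odot>\<^bsub>M\<^esub> \<phi> g \<in> X" unfolding X_def using li phi_closed[OF gF] by blast
    ultimately show ?case using Na[OF Suc.IH[OF _ ug(2)] NX] Suc.prems by simp
  qed
  have sWk: "sub (Wc l k)" using l by (rule sub_Wc)
  have tF: "f \<in> FF" if "f \<in> tot (Wc l k)" for f using that by (simp add: tot_def)
  show ?thesis
    unfolding ideal_smult_def X_def[symmetric]
  proof
    show "\<phi> ` tot (Wc l k) \<subseteq> M.span X"
    proof clarify
      fix f assume f: "f \<in> tot (Wc l k)"
      note FF = tF[OF f]
      have T: "finite {t. hc t f \<noteq> 0}" using hc_finite[OF FF] .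
      have "\<phi> f = finsum M (\<lambda>t. \<phi> (hc t f)) {t. hc t f \<noteq> 0}"
        using phi_sum[OF T, of "\<lambda>t. hc t f"] Fg_subset_FF[OF hc_in[OF FF]] hc_decompose[OF T, of f] by simp
      also have "\<dots> \<in> M.span X"
      proof -
        have "finsum M (\<lambda>t. \<phi> (hc t f)) A \<in> M.span X" if "finite A" for A
          using that
        proof (induction A rule: finite_induct)
          case empty
          then show ?case using Nz by simp
        next
          case (insert t A)
          have "finsum M (\<lambda>t. \<phi> (hc t f)) (insert t A) = \<phi> (hc t f) \<oplus>\<^bsub>M\<^esub> finsum M (\<lambda>t. \<phi> (hc t f)) A"
            using insert phi_closed[OF Fg_subset_FF[OF hc_in[OF FF]]] by (intro M.finsum_insert) auto
          then show ?case using Na[OF W[of k "hc t f" t] insert.IH] f by (simp add: tot_def)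
        qed
        then show ?thesis using T by blast
      qed
      finally show "\<phi> f \<in> M.span X" .
    qed
    show "M.span X \<subseteq> \<phi> ` tot (Wc l k)"
    proof
      fix y assume "y \<in> M.span X"
      then obtain c A where A: "finite A" "A \<subseteq> X" "c \<in> A \<rightarrow> carrier (poly_ring n)" "y = M.lincomb c A"
        unfolding M.span_def by blast
      have "\<exists>f\<in>tot (Wc l k). v = \<phi> f" if v: "v \<in> A" for v
      proof -
        obtain i z where i: "i \<in> {1..k}" "z \<in> carrier M" "v = l i \<odot>\<^bsub>M\<^esub> z" using v A(2) unfolding X_def by blast
        obtain g where g: "g \<in> FF" "z = \<phi> g" using i(2) phi_surj by blast
        obtain h where h: "i = Suc h" using i(1) by (cases i) auto
        have "hc t (emb (l i) * g) \<in> Wc l k t" for t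
        proof -
          have "hc (t - 1 + int 1) (emb (l i) * g) = emb (l i) * hc (t - 1) g" by (rule hc_homog[OF l[OF i(1)] g(1)])
          moreover have "0 + emb (l i) * hc (t - 1) g \<in> Wc l i t"
            unfolding h Wc.simps adj_def
            using sub_zero[OF sub_Wc[of h l], of t] l i(1) hc_in[OF g(1), of "t - 1"] h by fastforce
          ultimately show ?thesis using Wc_mono[of i k l t] i(1) by auto
        qed
        then have "emb (l i) * g \<in> tot (Wc l k)" unfolding tot_def using FF_emb[OF lc[OF i(1)] g(1)] by blast
        then show ?thesis using phi_smult[OF lc[OF i(1)] g(1)] i(3) g(2) by metis
      qed
      then obtain F where F: "\<And>v. v \<in> A \<Longrightarrow> F v \<in> tot (Wc l k)" "\<And>v. v \<in> A \<Longrightarrow> v = \<phi> (F v)" by metis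
      have cv: "c v \<in> carrier (poly_ring n)" if "v \<in> A" for v using A(3) that by blast
      define S where "S = (\<Sum>v\<in>A. emb (c v) * F v)"
      have "y = finsum M (\<lambda>v. \<phi> (emb (c v) * F v)) A"
        unfolding A(4) M.lincomb_def
      proof (rule M.finsum_cong'[OF refl])
        show "(\<lambda>v. \<phi> (emb (c v) * F v)) \<in> A \<rightarrow> carrier M"
          using phi_closed[OF FF_emb[OF cv tF[OF F(1)]]] by blast
        fix v assume v: "v \<in> A"
        show "c v \<odot>\<^bsub>M\<^esub> v = \<phi> (emb (c v) * F v)"
          using phi_smult[OF cv[OF v] tF[OF F(1)[OF v]]] F(2)[OF v] by simp
      qed
      also have "\<dots> = \<phi> S"
        unfolding S_def using FF_emb[OF cv tF[OF F(1)]] by (intro phi_sum[OF A(1), symmetric])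
      finally have "y = \<phi> S" .
      moreover have "S \<in> tot (Wc l k)"
        unfolding S_def using tot_emb[OF sWk F(1) cv] by (intro tot_sum[OF sWk])
      ultimately show "y \<in> \<phi> ` tot (Wc l k)" by blast
    qed
  qed
qed

end

lemma prime_power_in:
  assumes P: "primeideal P (poly_ring n)" and p: "p \<in> carrier (poly_ring n)" and "p ^ k \<in> P"
  shows "p \<in> P"
  using assms(3)
proof (induction k)
  case 0
  have "1 \<notin> P"
    using primeideal.I_notcarr[OF P] ideal.one_imp_carrier[OF primeideal.axioms(1)[OF P]] by auto
  then show ?case using 0 by simp
next
  case (Suc k)
  then have "p * p ^ k \<in> P" by simp
  then show ?case using Suc.IH primeideal.I_prime[OF P p poly_ring_power[OF p]] by auto
qed

lemma prime_one_notin: "primeideal P (poly_ring n) \<Longrightarrow> 1 \<notin> P"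
  using primeideal.I_notcarr[of P "poly_ring n"] ideal.one_imp_carrier[OF primeideal.axioms(1), of P "poly_ring n"] by auto

lemma hcomp_0: "hcomp 0 p = const_poly (Poly_Mapping.lookup p 0)"
  by (rule poly_mapping_eqI) (auto simp: lookup_hcomp const_poly_def lookup_single when_def mon_deg_0_iff)

section \<open>Primes over the annihilators of the quotients\<close>

context free_graded begin

text \<open>Only the constant term of \<open>u\<close> keeps the degree of a homogeneous
  element.\<close>

lemma hc_emb_same:
  assumes u: "u \<in> carrier (poly_ring n)" and f: "f \<in> Fg e"
  shows "hc e (emb u * f) = emb (const_poly (Poly_Mapping.lookup u 0)) * f"
proof -
  let ?T = "insert 0 {j. hcomp j u \<noteq> 0}"
  have T: "finite ?T" using hcomp_finite by simp
  have "emb u * f = emb (\<Sum>j\<in>?T. hcomp j u) * f" using hcomp_sum[OF T, of u] by (simp add: subset_insertI)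
  then have "hc e (emb u * f) = (\<Sum>j\<in>?T. hc e (emb (hcomp j u) * f))" by (simp only: emb_sum sum_distrib_right hc_sum)
  also have "\<dots> = (\<Sum>j\<in>?T. if j = 0 then emb (hcomp j u) * f else 0)"
    using hc_Fg[OF Fg_homog[OF hcomp_in_homog[OF u] f]] by (intro sum.cong refl) auto
  also have "\<dots> = emb (hcomp 0 u) * f" unfolding sum.delta[OF T] by simp
  finally show ?thesis unfolding hcomp_0 .
qed

end

context generated_module begin

context
  fixes l :: "nat \<Rightarrow> 'k mpoly" and d :: nat
  assumes deg_nonneg: "\<And>g. g \<in> G \<Longrightarrow> 0 \<le> deg g" and l_homog: "\<And>i. i \<in> {1..d} \<Longrightarrow> l i \<in> homog n 1"
begin

text \<open>The annihilator of \<open>F / Wc l j\<close>, that is of \<open>M\<close> modulo the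
  first \<open>j\<close> forms.\<close>

definition Ann :: "nat \<Rightarrow> 'k mpoly set" where
  "Ann j = {p \<in> carrier (poly_ring n). \<forall>g\<in>FF. emb p * g \<in> tot (Wc l j)}"

lemma sub_Wd: "j \<le> d \<Longrightarrow> sub (Wc l j)"
  using l_homog by (intro sub_Wc) auto

lemma Ann_ideal:
  assumes "j \<le> d"
  shows "ideal (Ann j) (poly_ring n)"
proof (rule poly_idealI)
  note s = sub_Wd[OF assms]
  show "Ann j \<subseteq> carrier (poly_ring n)" by (auto simp: Ann_def)
  show "0 \<in> Ann j" using tot_zero[OF s] by (simp add: Ann_def poly_ring_zero emb_simps)
  show "p + q \<in> Ann j" if "p \<in> Ann j" "q \<in> Ann j" for p q
    using that tot_add[OF s] poly_ring_add[of p n q] by (simp add: Ann_def emb_simps distrib_right)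
  show "p * q \<in> Ann j" if p: "p \<in> carrier (poly_ring n)" and q: "q \<in> Ann j" for p q
    using q tot_emb[OF s _ p] poly_ring_mult[OF p] by (simp add: Ann_def emb_simps mult.assoc)
qed

lemma Ann_mono: "i \<le> j \<Longrightarrow> Ann i \<subseteq> Ann j"
  unfolding Ann_def using tot_mono[of "Wc l i" "Wc l j"] Wc_mono[of i j l] by blast

lemma Ann_0: "Ann 0 = annihilator (poly_ring n) M"
proof -
  have "emb p * g \<in> tot K \<longleftrightarrow> p \<odot>\<^bsub>M\<^esub> \<phi> g = \<zero>\<^bsub>M\<^esub>" if "p \<in> carrier (poly_ring n)" "g \<in> FF" for p g
    using phi_kernel[OF FF_emb[OF that]] phi_smult[OF that] by simp
  then show ?thesis unfolding Ann_def annihilator_def phi_surj by auto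
qed

lemma l_in_Ann:
  assumes "j < d"
  shows "l (Suc j) \<in> Ann (Suc j)"
proof -
  have h: "l (Suc j) \<in> homog n 1" using l_homog assms by simp
  have "emb (l (Suc j)) * g \<in> tot (Wc l (Suc j))" if g: "g \<in> FF" for g
  proof -
    have "hc t (emb (l (Suc j)) * g) \<in> Wc l (Suc j) t" for t
    proof -
      have "hc (t - 1 + int 1) (emb (l (Suc j)) * g) = emb (l (Suc j)) * hc (t - 1) g" by (rule hc_homog[OF h g])
      moreover have "0 + emb (l (Suc j)) * hc (t - 1) g \<in> Wc l (Suc j) t"
        unfolding Wc.simps adj_def using sub_zero[OF sub_Wd, of j t] assms hc_in[OF g, of "t - 1"] by fastforce
      ultimately show ?thesis by simp
    qed
    then show ?thesis unfolding tot_def using FF_emb[OF homog_carrier[OF h] g] by blast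
  qed
  then show ?thesis unfolding Ann_def using homog_carrier[OF h] by blast
qed

lemma unit_vectors:
  "g \<in> G \<Longrightarrow> (\<lambda>h. if h = g then 1 else 0) \<in> FF"
  "f \<in> FF \<Longrightarrow> f = (\<Sum>g\<in>G. emb (f g) * (\<lambda>h. if h = g then 1 else 0))"
proof -
  show "g \<in> G \<Longrightarrow> (\<lambda>h. if h = g then 1 else 0) \<in> FF" by (auto simp: FF_def poly_ring_one poly_ring_zero)
  assume f: "f \<in> FF"
  show "f = (\<Sum>g\<in>G. emb (f g) * (\<lambda>h. if h = g then 1 else 0))"
  proof
    fix h
    have "(\<Sum>g\<in>G. emb (f g) * (\<lambda>h. if h = g then 1 else 0)) h = (\<Sum>g\<in>G. if h = g then f g else 0)"
      unfolding fun_sum_apply by (intro sum.cong) auto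
    also have "\<dots> = f h" using finite_G f by (auto simp: FF_def dest!: spec[of _ h])
    finally show "f h = (\<Sum>g\<in>G. emb (f g) * (\<lambda>h. if h = g then 1 else 0)) h" by simp
  qed
qed

lemma full_if_powers:
  assumes j: "j \<le> d" and s: "\<And>i. i < n \<Longrightarrow> var i ^ s \<in> Ann j"
  shows "\<exists>t0. \<forall>t\<ge>t0. Wc l j t = Fg t"
proof -
  note sW = sub_Wd[OF j]
  \<comment> \<open>The sum of the nonnegative degrees bounds each of them, so from this degree on
    every coefficient of \<open>f\<close> has degree above \<open>n * s\<close>.\<close>
  define t0 where "t0 = (\<Sum>g\<in>G. deg g) + int (n * s) + 1"
  have "f \<in> Wc l j t" if t: "t \<ge> t0" and f: "f \<in> Fg t" for t f
  proof -
    have FF: "f \<in> FF" using Fg_subset_FF[OF f] .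
    have "emb (f g) * (\<lambda>h. if h = g then 1 else 0) \<in> tot (Wc l j)" if g: "g \<in> G" for g
    proof (rule tot_high[OF sW])
      show "emb (var i ^ s) * (\<lambda>h. if h = g then 1 else 0) \<in> tot (Wc l j)" if "i < n" for i
        using s[OF that] unit_vectors(1)[OF g] unfolding Ann_def by blast
      show "f g \<in> carrier (poly_ring n)" using FF_app[OF FF] .
      have "deg g \<le> (\<Sum>g\<in>G. deg g)" using deg_nonneg finite_G g by (intro member_le_sum) auto
      then have d: "t - deg g > int (n * s)" using t unfolding t0_def by linarith
      have "f g \<in> hz n (t - deg g)" using f g by (auto simp: Fg_def dest: spec[of _ g])
      then have "f g \<in> homog n (nat (t - deg g))" using d by (simp add: hz_def split: if_splits)
      moreover have "n * s < nat (t - deg g)" using d by linarith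
      ultimately show "\<forall>u\<in>Poly_Mapping.keys (f g). n * s < mon_deg u" by (auto simp: homog_def)
    qed
    then have "(\<Sum>g\<in>G. emb (f g) * (\<lambda>h. if h = g then 1 else 0)) \<in> tot (Wc l j)" by (rule tot_sum[OF sW])
    then have "f \<in> tot (Wc l j)" using unit_vectors(2)[OF FF] by argo
    then show ?thesis using tot_Fg[OF sW f] by blast
  qed
  then show ?thesis using sub_subset[OF sW] by blast
qed

text \<open>Avoiding the products of powers of \<open>var i\<close> with polynomials of nonzero constant term keeps the
  prime strictly below the maximal ideal.\<close>

lemma prime_top:
  assumes i: "i < n" and np: "\<And>s. var i ^ s \<notin> Ann d"
  shows "\<exists>P. primeideal P (poly_ring n) \<and> Ann d \<subseteq> P \<and> var i \<notin> P \<and> P \<subseteq> max_ideal n"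
proof -
  note sW = sub_Wd[OF order_refl]
  define S where "S = {(var i :: 'k mpoly) ^ s * u | s u. u \<in> carrier (poly_ring n) \<and> Poly_Mapping.lookup u 0 \<noteq> 0}"
  have vS: "var i ^ s * u \<in> S" if "u \<in> carrier (poly_ring n)" "Poly_Mapping.lookup u 0 \<noteq> 0" for s and u :: "'k mpoly"
    using that unfolding S_def by blast
  have one: "Poly_Mapping.lookup (1 :: 'k mpoly) 0 \<noteq> 0" by (simp add: lookup_one)
  have "1 \<in> S" using vS[OF poly_ring_one one, of 0] by simp
  moreover have "a * b \<in> S" if ab: "a \<in> S" "b \<in> S" for a b
  proof -
    obtain s u s' u' where e: "a = var i ^ s * u" "u \<in> carrier (poly_ring n)" "Poly_Mapping.lookup u 0 \<noteq> 0"
      "b = var i ^ s' * u'" "u' \<in> carrier (poly_ring n)" "Poly_Mapping.lookup u' 0 \<noteq> 0" using ab unfolding S_def by blast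
    have "a * b = var i ^ (s + s') * (u * u')" unfolding e(1,4) power_add by (simp add: algebra_simps)
    then show ?thesis using vS[OF poly_ring_mult[OF e(2,5)]] e(3,6) by (simp add: lookup_mult_0)
  qed
  moreover have "Ann d \<inter> S = {}"
  proof (rule ccontr)
    assume "Ann d \<inter> S \<noteq> {}"
    then obtain s u where u: "var i ^ s * u \<in> Ann d" "u \<in> carrier (poly_ring n)" "Poly_Mapping.lookup u 0 \<noteq> 0"
      unfolding S_def by blast
    define c where "c = Poly_Mapping.lookup u 0"
    note h = homog_var_power[OF i, of s]
    \<comment> \<open>In degree \<open>e + s\<close> only the constant term \<open>c\<close> of
      \<open>u\<close> contributes on a homogeneous \<open>f\<close>; dividing by \<open>c\<close>
      leads to \<open>var i ^ s\<close> in \<open>Ann d\<close>, against the choice of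
      \<open>i\<close>.\<close>
    have W: "emb (var i ^ s) * f \<in> Wc l d (e + int s)" if f: "f \<in> Fg e" for e f
    proof -
      have FF: "f \<in> FF" using Fg_subset_FF[OF f] .
      have "emb (var i ^ s * u) * f \<in> tot (Wc l d)" using u(1) FF unfolding Ann_def by blast
      then have "hc (e + int s) (emb (var i ^ s) * (emb u * f)) \<in> Wc l d (e + int s)"
        unfolding emb_simps mult.assoc tot_def by blast
      then have "emb (var i ^ s) * (emb (const_poly c) * f) \<in> Wc l d (e + int s)"
        unfolding hc_homog[OF h FF_emb[OF u(2) FF]] hc_emb_same[OF u(2) f] c_def .
      from sub_C[OF sW this, of "emb (const_poly (inverse c))"]
      have "emb (const_poly (inverse c)) * (emb (var i ^ s) * (emb (const_poly c) * f)) \<in> Wc l d (e + int s)" by blast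
      moreover have "emb (const_poly (inverse c)) * (emb (var i ^ s) * (emb (const_poly c) * f))
          = emb (const_poly (inverse c * c)) * (emb (var i ^ s) * f)"
        unfolding const_poly_simps emb_simps by (simp only: mult.assoc mult.left_commute)
      moreover have "inverse c * c = 1" using u(3) by (simp add: c_def)
      ultimately show ?thesis by (simp add: const_poly_simps emb_simps)
    qed
    have "emb (var i ^ s) * g \<in> tot (Wc l d)" if g: "g \<in> FF" for g
    proof -
      have "hc t (emb (var i ^ s) * g) \<in> Wc l d t" for t
        using hc_homog[OF h g, of "t - int s"] W[OF hc_in[OF g], of "t - int s"] by simp
      then show ?thesis unfolding tot_def using FF_emb[OF homog_carrier[OF h] g] by blast
    qed
    then have "var i ^ s \<in> Ann d" unfolding Ann_def using homog_carrier[OF h] by blast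
    then show False using np by blast
  qed
  ultimately obtain P where P: "primeideal P (poly_ring n)" "Ann d \<subseteq> P" "P \<inter> S = {}"
    using exists_prime_avoiding[OF Ann_ideal[OF order_refl], of S] by blast
  have "var i \<notin> P" using vS[OF poly_ring_one one, of 1] P(3) by auto
  moreover have "P \<subseteq> max_ideal n"
  proof
    fix u assume uP: "u \<in> P"
    have uc: "u \<in> carrier (poly_ring n)" using poly_ideal_props(1)[OF primeideal.axioms(1)[OF P(1)]] uP by blast
    then show "u \<in> max_ideal n" unfolding max_ideal_def using vS[OF uc, of 0] uP P(3) by auto
  qed
  ultimately show ?thesis using P by blast
qed

text \<open>The set to be avoided is generated by the form \<open>a\<close> and the complement of
  \<open>P\<close>, so the new prime lies inside \<open>P\<close> and misses \<open>a\<close>, which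
  is in \<open>P\<close>. For disjointness from \<open>Ann j\<close>: if \<open>a ^ s * u\<close>
  annihilates, filter regularity cancels \<open>a ^ s\<close> in high degrees, which a power of
  \<open>var i\<close> reaches; since \<open>var i\<close> is not in \<open>P\<close>,
  \<open>u\<close> would be.\<close>

lemma prime_step:
  assumes j: "j < d" and i: "i < n"
    and freg: "\<exists>t0. \<forall>t\<ge>t0. \<forall>f\<in>Fg t. emb (l (Suc j)) * f \<in> Wc l j (t + 1) \<longrightarrow> f \<in> Wc l j t"
    and P: "primeideal P (poly_ring n)" "Ann (Suc j) \<subseteq> P" "var i \<notin> P"
  shows "\<exists>P'. primeideal P' (poly_ring n) \<and> Ann j \<subseteq> P' \<and> P' \<subset> P"
proof -
  have j': "j \<le> d" using j by simp
  note sW = sub_Wd[OF j']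
  define a where "a = l (Suc j)"
  have ah: "a \<in> homog n 1" using l_homog j by (simp add: a_def)
  have ac: "a ^ s \<in> carrier (poly_ring n)" for s using poly_ring_power[OF homog_carrier[OF ah]] .
  have as: "a ^ s \<in> homog n s" for s
  proof (induction s)
    case 0
    show ?case using homog_const[of 1 n] by (simp add: const_poly_simps)
  next
    case (Suc s)
    then show ?case using homog_mult[OF ah Suc] by simp
  qed
  define S where "S = {a ^ s * u | s u. u \<in> carrier (poly_ring n) \<and> u \<notin> P}"
  have vS: "a ^ s * u \<in> S" if "u \<in> carrier (poly_ring n)" "u \<notin> P" for s u
    using that unfolding S_def by blast
  note P1 = prime_one_notin[OF P(1)]
  have "1 \<in> S" using vS[OF poly_ring_one P1, of 0] by simp
  moreover have "b * c \<in> S" if bc: "b \<in> S" "c \<in> S" for b c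
  proof -
    obtain s u s' u' where e: "b = a ^ s * u" "u \<in> carrier (poly_ring n)" "u \<notin> P"
      "c = a ^ s' * u'" "u' \<in> carrier (poly_ring n)" "u' \<notin> P" using bc unfolding S_def by blast
    have "b * c = a ^ (s + s') * (u * u')" unfolding e(1,4) power_add by (simp add: algebra_simps)
    moreover have "u * u' \<notin> P" using primeideal.I_prime[OF P(1) e(2,5)] e(3,6) by auto
    ultimately show ?thesis using vS[OF poly_ring_mult[OF e(2,5)]] by simp
  qed
  moreover have "Ann j \<inter> S = {}"
  proof (rule ccontr)
    assume "Ann j \<inter> S \<noteq> {}"
    then obtain s u where u: "a ^ s * u \<in> Ann j" "u \<in> carrier (poly_ring n)" "u \<notin> P" unfolding S_def by blast
    obtain t0 where t0: "\<And>t f. t \<ge> t0 \<Longrightarrow> f \<in> Fg t \<Longrightarrow> emb a * f \<in> Wc l j (t + 1) \<Longrightarrow> f \<in> Wc l j t"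
      using freg unfolding a_def by blast
    have it: "f \<in> Wc l j t" if "t \<ge> t0" "f \<in> Fg t" "emb (a ^ s) * f \<in> Wc l j (t + int s)" for t f s
      using that
    proof (induction s)
      case 0
      then show ?case by (simp add: emb_simps)
    next
      case (Suc s)
      have "emb a * (emb (a ^ s) * f) = emb (a ^ Suc s) * f" unfolding power_Suc emb_simps(2) mult.assoc ..
      moreover have "t + int (Suc s) = t + int s + 1" by simp
      ultimately have "emb a * (emb (a ^ s) * f) \<in> Wc l j (t + int s + 1)" using Suc.prems(3) by argo
      moreover have "emb (a ^ s) * f \<in> Fg (t + int s)" using Fg_homog[OF as Suc.prems(2)] .
      ultimately have "emb (a ^ s) * f \<in> Wc l j (t + int s)" using t0[of "t + int s"] Suc.prems(1) by simp
      then show ?case using Suc by blast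
    qed
    \<comment> \<open>Multiplication by \<open>var i ^ N\<close> carries every nonnegative degree to
      at least \<open>t0\<close>; in negative degrees the free module is zero.\<close>
    define N where "N = nat t0"
    note h = homog_var_power[OF i, of N, where ?'a = 'k]
    have "emb (var i ^ N * u) * g \<in> tot (Wc l j)" if g: "g \<in> FF" for g
    proof -
      define y where "y = emb u * g"
      have yF: "y \<in> FF" unfolding y_def using FF_emb[OF u(2) g] .
      have ty: "emb (a ^ s) * y \<in> tot (Wc l j)"
        using u(1) g unfolding Ann_def y_def mult.assoc[symmetric] emb_simps(2)[symmetric] by blast
      have "hc t (emb (var i ^ N) * y) \<in> Wc l j t" for t
      proof -
        define e where "e = t - int N"
        define z where "z = hc e y"
        have zF: "z \<in> Fg e" unfolding z_def using hc_in[OF yF] .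
        have hz: "hc t (emb (var i ^ N) * y) = emb (var i ^ N) * z"
          using hc_homog[OF h yF, of e] by (simp add: e_def z_def)
        show ?thesis
        proof (cases "e < 0")
          case True
          then have "z = 0" using zF Fg_neg[OF deg_nonneg True] by blast
          then show ?thesis using hz sub_zero[OF sW] by simp
        next
          case False
          have "hc (e + int s) (emb (a ^ s) * y) \<in> Wc l j (e + int s)" using ty unfolding tot_def by blast
          then have "emb (a ^ s) * z \<in> Wc l j (e + int s)" unfolding hc_homog[OF as yF] z_def .
          from sub_homog[OF sW this h] have "emb (var i ^ N) * (emb (a ^ s) * z) \<in> Wc l j (e + int s + int N)" .
          then have "emb (a ^ s) * (emb (var i ^ N) * z) \<in> Wc l j (e + int N + int s)"
            by (simp only: mult.left_commute add.assoc add.commute add.left_commute)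
          moreover have "emb (var i ^ N) * z \<in> Fg (e + int N)" using Fg_homog[OF h zF] .
          moreover have "e + int N \<ge> t0" using False unfolding N_def by linarith
          ultimately have "emb (var i ^ N) * z \<in> Wc l j (e + int N)" using it by blast
          then show ?thesis using hz by (simp add: e_def)
        qed
      qed
      then have "emb (var i ^ N) * y \<in> tot (Wc l j)" unfolding tot_def using FF_emb[OF homog_carrier[OF h] yF] by blast
      then show ?thesis unfolding y_def emb_simps(2) mult.assoc .
    qed
    then have "var i ^ N * u \<in> Ann j" unfolding Ann_def using poly_ring_mult[OF homog_carrier[OF h] u(2)] by blast
    then have "var i ^ N * u \<in> P" using Ann_mono[of j "Suc j"] P(2) by auto
    then have "var i ^ N \<in> P" using primeideal.I_prime[OF P(1) homog_carrier[OF h] u(2)] u(3) by auto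
    then show False using prime_power_in[OF P(1) poly_ring_var[OF i]] P(3) by blast
  qed
  ultimately obtain P' where P': "primeideal P' (poly_ring n)" "Ann j \<subseteq> P'" "P' \<inter> S = {}"
    using exists_prime_avoiding[OF Ann_ideal[OF j'], of S] by blast
  have "P' \<subseteq> P"
  proof
    fix p assume p: "p \<in> P'"
    have pc: "p \<in> carrier (poly_ring n)" using poly_ideal_props(1)[OF primeideal.axioms(1)[OF P'(1)]] p by blast
    show "p \<in> P" using vS[OF pc, of 0] p P'(3) by auto
  qed
  moreover have "a \<in> P" using l_in_Ann[OF j] P(2) unfolding a_def by blast
  moreover have "a \<notin> P'" using vS[OF poly_ring_one P1, of 1] P'(3) by auto
  ultimately show ?thesis using P' by blast
qed

theorem Wc_full:
  assumes freg: "\<And>j. j < d \<Longrightarrow> \<exists>t0. \<forall>t\<ge>t0. \<forall>f\<in>Fg t. emb (l (Suc j)) * f \<in> Wc l j (t + 1) \<longrightarrow> f \<in> Wc l j t"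
    and dim: "module_dim (poly_ring n) M = enat d"
  shows "\<exists>t0. \<forall>t\<ge>t0. Wc l d t = Fg t"
proof (rule ccontr)
  assume nf: "\<not> ?thesis"
  have "\<exists>i<n. \<forall>s. var i ^ s \<notin> Ann d"
  proof (rule ccontr)
    assume "\<not> ?thesis"
    then obtain e where e: "\<And>i. i < n \<Longrightarrow> var i ^ e i \<in> Ann d" by metis
    define s where "s = (\<Sum>i<n. e i)"
    have "var i ^ s \<in> Ann d" if i: "i < n" for i
    proof -
      have "e i \<le> s" unfolding s_def using i by (intro member_le_sum) auto
      then have "var i ^ s = var i ^ (s - e i) * (var i :: 'k mpoly) ^ e i" by (simp flip: power_add)
      then show ?thesis
        using poly_ideal_props(4)[OF Ann_ideal[OF order_refl] poly_ring_power[OF poly_ring_var[OF i]] e[OF i]] by simp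
    qed
    then show False using full_if_powers[OF order_refl] nf by blast
  qed
  then obtain i where i: "i < n" "\<And>s. var i ^ s \<notin> Ann d" by blast
  \<comment> \<open>The condition is empty beyond \<open>d\<close>, so that dependent choice can run
    over all natural numbers.\<close>
  define Good where "Good = (\<lambda>k X. k \<le> d \<longrightarrow> primeideal X (poly_ring n) \<and> Ann (d - k) \<subseteq> X \<and> (var i :: 'k mpoly) \<notin> X \<and> X \<subseteq> max_ideal n)"
  have "\<exists>f. \<forall>k. Good k (f k) \<and> (k < d \<longrightarrow> f (Suc k) \<subset> f k)"
  proof (rule dependent_nat_choice)
    show "\<exists>X. Good 0 X" unfolding Good_def using prime_top[OF i] by simp
    fix X k assume X: "Good k X"
    show "\<exists>Y. Good (Suc k) Y \<and> (k < d \<longrightarrow> Y \<subset> X)"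
    proof (cases "k < d")
      case True
      then have dk: "Suc (d - Suc k) = d - k" by simp
      have XP: "primeideal X (poly_ring n)" "Ann (Suc (d - Suc k)) \<subseteq> X" "var i \<notin> X" "X \<subseteq> max_ideal n"
        using X True unfolding Good_def dk by auto
      have "d - Suc k < d" using True by simp
      from prime_step[OF this i(1) freg[OF this] XP(1-3)]
      obtain Y where "primeideal Y (poly_ring n)" "Ann (d - Suc k) \<subseteq> Y" "Y \<subset> X" by blast
      then show ?thesis unfolding Good_def using XP by blast
    qed (auto simp: Good_def)
  qed
  then obtain f where f: "\<And>k. Good k (f k)" "\<And>k. k < d \<Longrightarrow> f (Suc k) \<subset> f k" by blast
  \<comment> \<open>Reverses the chain to make it increasing and adds the maximal ideal on top; the
    last inclusion is strict because \<open>var i\<close> lies in that ideal but not in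
    \<open>f 0\<close>.\<close>
  define C where "C = (\<lambda>k. if k \<le> d then f (d - k) else max_ideal n)"
  have fC: "primeideal (f k) (poly_ring n) \<and> annihilator (poly_ring n) M \<subseteq> f k \<and> var i \<notin> f k \<and> f k \<subseteq> max_ideal n" if "k \<le> d" for k
    using f(1)[of k] that Ann_mono[of 0 "d - k"] unfolding Good_def Ann_0 by blast
  have "enat (Suc d) \<le> module_dim (poly_ring n) M"
    unfolding module_dim_def
  proof (rule Sup_upper, rule CollectI, rule exI[of _ "Suc d"], rule conjI[OF refl], rule exI[of _ C], rule conjI)
    show "\<forall>k\<le>Suc d. primeideal (C k) (poly_ring n) \<and> annihilator (poly_ring n) M \<subseteq> C k"
      using fC max_ideal_prime[of n] fC[of 0] unfolding C_def by auto
    show "\<forall>k<Suc d. C k \<subset> C (Suc k)"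
    proof (intro allI impI)
      fix k assume k: "k < Suc d"
      show "C k \<subset> C (Suc k)"
      proof (cases "k = d")
        case True
        have "Poly_Mapping.single i (1::nat) \<noteq> 0" by (metis lookup_single_eq lookup_zero zero_neq_one)
        then have "var i \<in> (max_ideal n :: 'k mpoly set)"
          using poly_ring_var[OF i(1), where ?'a = 'k] unfolding max_ideal_def var_def
          by (simp add: lookup_single when_def)
        then show ?thesis unfolding C_def using True fC[of 0] by auto
      next
        case False
        then have "k < d" "d - k = Suc (d - Suc k)" using k by auto
        then show ?thesis unfolding C_def using f(2)[of "d - Suc k"] by simp
      qed
    qed
  qed
  then show False unfolding dim by simp
qed

text \<open>If \<open>M\<close> vanished in high degrees, powers of all variables would annihilate
  it. Every prime over the annihilator would then be the maximal ideal, and the dimension would be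
  0.\<close>

lemma not_full_K:
  assumes dim: "module_dim (poly_ring n) M = enat d" and d: "d \<ge> 1"
  shows "\<not> (\<exists>t0. \<forall>t\<ge>t0. K t = Fg t)"
proof
  assume "\<exists>t0. \<forall>t\<ge>t0. K t = Fg t"
  then obtain t0 where t0: "\<And>t. t \<ge> t0 \<Longrightarrow> K t = Fg t" by blast
  define N where "N = nat t0"
  have ann: "var i ^ N \<in> annihilator (poly_ring n) M" if i: "i < n" for i
  proof -
    note h = homog_var_power[OF i, of N, where ?'a = 'k]
    have "emb (var i ^ N) * g \<in> tot K" if g: "g \<in> FF" for g
    proof -
      have "hc t (emb (var i ^ N) * g) \<in> K t" for t
      proof (cases "t - int N < 0")
        case True
        have "hc (t - int N) g = 0" using hc_in[OF g, of "t - int N"] Fg_neg[OF deg_nonneg True] by blast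
        then show ?thesis using hc_homog[OF h g, of "t - int N"] sub_zero[OF sub_K] by simp
      next
        case False
        then have "t \<ge> t0" unfolding N_def by linarith
        then show ?thesis using t0 hc_in[OF FF_emb[OF homog_carrier[OF h] g]] by blast
      qed
      then show ?thesis unfolding tot_def using FF_emb[OF homog_carrier[OF h] g] by blast
    qed
    then show ?thesis unfolding Ann_0[symmetric] Ann_def using homog_carrier[OF h] by simp
  qed
  have prime: "P = max_ideal n" if P: "primeideal P (poly_ring n)" "annihilator (poly_ring n) M \<subseteq> P" for P
  proof -
    note PI = poly_ideal_props[OF primeideal.axioms(1)[OF P(1)]]
    have vP: "var i \<in> P" if i: "i < n" for i
      using prime_power_in[OF P(1) poly_ring_var[OF i]] ann[OF i] P(2) by blast
    have mP: "u \<in> P" if u: "u \<in> max_ideal n" for u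
    proof -
      have uc: "u \<in> carrier (poly_ring n)" and u0: "Poly_Mapping.lookup u 0 = 0" using u by (auto simp: max_ideal_def)
      have "Poly_Mapping.single v c \<in> P" if v: "v \<in> Poly_Mapping.keys u" for v c
      proof -
        have vn: "Poly_Mapping.keys v \<subseteq> {..<n}" using uc v by (auto simp: in_poly_ring)
        have "v \<noteq> 0" using v u0 by (auto simp: in_keys_iff)
        then obtain i where iv: "i \<in> Poly_Mapping.keys v" by (metis keys_eq_empty ex_in_conv)
        define v' where "v' = v - Poly_Mapping.single i 1"
        have "v = v' + Poly_Mapping.single i 1"
          by (rule poly_mapping_eqI) (use iv in \<open>auto simp: v'_def lookup_add lookup_minus lookup_single when_def in_keys_iff\<close>)
        then have "Poly_Mapping.single v c = Poly_Mapping.single v' c * var i" by (simp add: var_def mult_single)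
        moreover have "Poly_Mapping.keys v' \<subseteq> {..<n}"
        proof
          fix k assume "k \<in> Poly_Mapping.keys v'"
          then have "k \<in> Poly_Mapping.keys v" by (auto simp: v'_def in_keys_iff lookup_minus)
          then show "k \<in> {..<n}" using vn by blast
        qed
        ultimately show ?thesis using PI(4)[OF poly_ring_single vP] iv vn by auto
      qed
      then have "(\<Sum>v\<in>A. Poly_Mapping.single v (Poly_Mapping.lookup u v)) \<in> P" if "A \<subseteq> Poly_Mapping.keys u" for A
        using that by (induction A rule: infinite_finite_induct) (auto intro: PI(2,3))
      from this[OF order_refl] show ?thesis using poly_mapping_sum_monomials[of u] by argo
    qed
    \<comment> \<open>An element of \<open>P\<close> with nonzero constant term differs from that
      constant by an element of \<open>max_ideal n\<close>, which is already known to lie in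
      \<open>P\<close>; so \<open>P\<close> would contain a unit.\<close>
    have "u \<in> max_ideal n" if u: "u \<in> P" for u
    proof (rule ccontr)
      assume nm: "u \<notin> max_ideal n"
      have uc: "u \<in> carrier (poly_ring n)" using PI(1) u by blast
      define c where "c = Poly_Mapping.lookup u 0"
      have c: "c \<noteq> 0" using nm uc by (simp add: max_ideal_def c_def)
      have "const_poly c - u \<in> max_ideal n"
        using poly_ring_add[OF poly_ring_const poly_ring_uminus[OF uc], of c]
        by (simp add: max_ideal_def lookup_minus c_def const_poly_def)
      from PI(3)[OF mP[OF this] u] have "const_poly c \<in> P" by simp
      from PI(4)[OF poly_ring_const this, of "inverse c"] have "const_poly (inverse c * c) \<in> P" unfolding const_poly_simps .
      then have "1 \<in> P" using c by (simp add: const_poly_simps)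
      then show False using prime_one_notin[OF P(1)] by blast
    qed
    then show ?thesis using mP by blast
  qed
  have "module_dim (poly_ring n) M \<le> 0"
    unfolding module_dim_def
  proof (rule Sup_least)
    fix x assume "x \<in> {enat r | r. \<exists>P. (\<forall>i\<le>r. primeideal (P i) (poly_ring n) \<and> annihilator (poly_ring n) M \<subseteq> P i) \<and> (\<forall>i<r. P i \<subset> P (Suc i))}"
    then obtain r P where r: "x = enat r" "\<And>i. i \<le> r \<Longrightarrow> primeideal (P i) (poly_ring n) \<and> annihilator (poly_ring n) M \<subseteq> P i"
      "\<And>i. i < r \<Longrightarrow> P i \<subset> P (Suc i)" by blast
    have "r = 0"
    proof (rule ccontr)
      assume "r \<noteq> 0"
      then have "P 0 = max_ideal n" "P (Suc 0) = max_ideal n" "P 0 \<subset> P (Suc 0)" using prime r(2)[of 0] r(2)[of "Suc 0"] r(3)[of 0] by auto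
      then show False by blast
    qed
    then show "x \<le> 0" using r(1) by (simp add: zero_enat_def)
  qed
  then show False using dim d by (simp add: zero_enat_def)
qed

end

end

section \<open>Hilbert coefficients of a graded module\<close>

lemma newton_poly: "\<exists>P. \<forall>t. poly P t = newton e k t"
proof
  let ?P = "\<Sum>i<k. Polynomial.smult (of_int (e i) / fact (k - 1 - i)) (\<Prod>j\<in>{0..<k - 1 - i}. [:of_nat (k - 1 - i) - of_nat j, 1:])"
  show "\<forall>t. poly ?P t = newton e k t"
    unfolding newton_def poly_sum
    by (intro allI sum.cong refl)
      (simp add: gbinomial_prod_rev poly_prod algebra_simps del: of_nat_diff)
qed

text \<open>Both definite descriptions need uniqueness: polynomials that agree at infinitely many
  integers are equal, and \<open>newton_inj\<close> separates the coefficients. The signs dropped in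
  \<open>newton\<close> return here.\<close>

lemma hilbert_coeff_newton:
  assumes dim: "module_dim (poly_ring n) M = enat d"
    and h: "\<And>t. t \<ge> t0 \<Longrightarrow> of_nat (hilbert_function M t) = newton e d (of_int t)" and i: "i < d"
  shows "hilbert_coeff n M i = (-1) ^ i * e i"
proof -
  obtain P where P: "\<And>t. poly P t = newton e d t" using newton_poly by blast
  have hp: "hilbert_poly M = P"
    unfolding hilbert_poly_def
  proof (rule the_equality)
    show "\<exists>t0. \<forall>t\<ge>t0. poly P (of_int t) = of_nat (hilbert_function M t)"
      unfolding P using h by (intro exI[of _ t0]) simp
    fix Q :: "rat poly" assume "\<exists>t0. \<forall>t\<ge>t0. poly Q (of_int t) = of_nat (hilbert_function M t)"
    then obtain t1 where t1: "\<And>t. t \<ge> t1 \<Longrightarrow> poly Q (of_int t) = of_nat (hilbert_function M t)" by blast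
    have sub: "of_int ` {max t0 t1..} \<subseteq> {x. poly (Q - P) x = 0}" using t1 h P by auto
    have "infinite (of_int ` {max t0 t1..} :: rat set)"
      by (subst finite_image_iff) (auto simp: inj_on_def infinite_Ici)
    then have "infinite {x. poly (Q - P) x = 0}" using sub finite_subset by blast
    then show "Q = P" using poly_roots_finite[of "Q - P"] by auto
  qed
  let ?e = "\<lambda>i. if i < d then (-1) ^ i * e i else 0"
  have sq: "(-1) ^ j * ((-1) ^ j * x) = x" for j and x :: int by (simp flip: mult.assoc power_mult_distrib)
  have "hilbert_coeff n M = ?e"
    unfolding hilbert_coeff_def dim the_enat.simps Let_def
  proof (rule the_equality)
    have "newton e d t = (\<Sum>i<d. (-1) ^ i * of_int (?e i) * ((t + of_nat (d - 1 - i)) gchoose (d - 1 - i)))" for t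
      unfolding newton_def
    proof (intro sum.cong refl)
      fix j assume "j \<in> {..<d}"
      then have "(-1) ^ j * rat_of_int (?e j) = of_int ((-1) ^ j * ((-1) ^ j * e j))" by simp
      then show "of_int (e j) * ((t + of_nat (d - 1 - j)) gchoose (d - 1 - j))
          = (-1) ^ j * of_int (?e j) * ((t + of_nat (d - 1 - j)) gchoose (d - 1 - j))" unfolding sq by simp
    qed
    then show "(\<forall>i\<ge>d. ?e i = 0) \<and> (\<forall>t. poly (hilbert_poly M) t =
        (\<Sum>i<d. (-1) ^ i * of_int (?e i) * ((t + of_nat (d - 1 - i)) gchoose (d - 1 - i))))"
      unfolding hp P by simp
  next
    fix e' assume e': "(\<forall>i\<ge>d. e' i = 0) \<and> (\<forall>t. poly (hilbert_poly M) t =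
        (\<Sum>i<d. (-1) ^ i * of_int (e' i) * ((t + of_nat (d - 1 - i)) gchoose (d - 1 - i))))"
    have "newton (\<lambda>i. (-1) ^ i * e' i) d t = newton e d t" for t
      using e' unfolding hp P by (simp add: newton_def)
    then have "(-1) ^ j * e' j = e j" if "j < d" for j using newton_inj[of "\<lambda>i. (-1) ^ i * e' i" d e j] that by blast
    then have "e' j = (-1) ^ j * e j" if "j < d" for j using sq[of j "e' j"] that by simp
    then show "e' = ?e" using e' by auto
  qed
  then show ?thesis using i by simp
qed

text \<open>The generators are the nonzero homogeneous components of a finite generating set. Zero
  is left out because it lies in every degree, while the degrees of the generators must not fall
  below the initial degree.\<close>

lemma (in graded_module) exists_homogeneous_generators:
  assumes "fin_gen (poly_ring n) M"
  shows "\<exists>G deg. generated_module n G deg M \<and> \<zero>\<^bsub>M\<^esub> \<notin> G"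
proof -
  obtain A where A: "finite A" "A \<subseteq> carrier M" "span A = carrier M" using assms unfolding fin_gen_def by blast
  have "\<forall>a\<in>carrier M. \<exists>f. (\<forall>t. f t \<in> grade M t) \<and> finite {t. f t \<noteq> \<zero>\<^bsub>M\<^esub>} \<and> a = finsum M f {t. f t \<noteq> \<zero>\<^bsub>M\<^esub>}"
    using ex1_implies_ex[OF grade_direct_sum] by blast
  from bchoice[OF this] obtain e where e: "\<And>a t. a \<in> carrier M \<Longrightarrow> e a t \<in> grade M t"
    "\<And>a. a \<in> carrier M \<Longrightarrow> finite {t. e a t \<noteq> \<zero>\<^bsub>M\<^esub>}"
    "\<And>a. a \<in> carrier M \<Longrightarrow> a = finsum M (e a) {t. e a t \<noteq> \<zero>\<^bsub>M\<^esub>}" by blast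
  define G where "G = (\<Union>a\<in>A. e a ` {t. e a t \<noteq> \<zero>\<^bsub>M\<^esub>})"
  define deg where "deg = (\<lambda>g. SOME t. g \<in> grade M t)"
  have gc: "grade M t \<subseteq> carrier M" for t using subgroup.subset[OF grade_subgroup, of t] by simp
  have ex: "\<exists>t. g \<in> grade M t" if "g \<in> G" for g using that e(1) A(2) unfolding G_def by blast
  have Gc: "G \<subseteq> carrier M" using ex gc by blast
  have fG: "finite G" unfolding G_def using A e(2) by auto
  have S: "LinearCombinations.submodule (poly_ring n) (span G) M" by (rule span_is_submodule[OF Gc])
  then have Sz: "\<zero>\<^bsub>M\<^esub> \<in> span G" and Sa: "\<And>y z. y \<in> span G \<Longrightarrow> z \<in> span G \<Longrightarrow> y \<oplus>\<^bsub>M\<^esub> z \<in> span G"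
    unfolding LinearCombinations.submodule_def by auto
  have "a \<in> span G" if a: "a \<in> A" for a
  proof -
    have ac: "a \<in> carrier M" using a A(2) by blast
    have "finsum M (e a) T \<in> span G" if "finite T" "T \<subseteq> {t. e a t \<noteq> \<zero>\<^bsub>M\<^esub>}" for T
      using that
    proof (induction T rule: finite_induct)
      case empty
      then show ?case using Sz by simp
    next
      case (insert t T)
      have "e a t \<in> G" unfolding G_def using insert.prems a by blast
      then have "e a t \<in> span G" using in_own_span[OF Gc] by blast
      moreover have "finsum M (e a) (insert t T) = e a t \<oplus>\<^bsub>M\<^esub> finsum M (e a) T"
        using insert(1,2) e(1)[OF ac] gc by (intro finsum_insert) blast+
      ultimately show ?case using Sa insert by simp
    qed
    from this[OF e(2)[OF ac] order_refl] show ?thesis using e(3)[OF ac] by simp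
  qed
  then have "A \<subseteq> span G" by blast
  then have sp: "carrier M \<subseteq> span G" using span_is_subset[OF _ S] A(3) by blast
  have "generated_module n G deg M"
  proof (intro generated_module.intro free_graded.intro generated_module_axioms.intro)
    show "graded_module n M" by (rule graded_module_axioms)
    show "finite G" by (rule fG)
    show "g \<in> grade M (deg g)" if "g \<in> G" for g unfolding deg_def using someI_ex[OF ex[OF that]] .
    fix y assume "y \<in> carrier M"
    then have "y \<in> {lincomb a G | a. a \<in> G \<rightarrow> carrier (poly_ring n)}" using sp finite_span[OF fG Gc] by blast
    then show "\<exists>f. f \<in> G \<rightarrow> carrier (poly_ring n) \<and> y = finsum M (\<lambda>g. f g \<odot>\<^bsub>M\<^esub> g) G"
      unfolding lincomb_def by blast
  qed
  moreover have "\<zero>\<^bsub>M\<^esub> \<notin> G" unfolding G_def by force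
  ultimately show ?thesis by blast
qed

context free_graded begin

lemma codim_zero_full:
  assumes U: "sub U" and c: "codim U t = 0"
  shows "U t = Fg t"
proof -
  obtain S where S: "S \<subseteq> U t" "fs.independent S" "U t \<subseteq> fs.span S" "card S = fs.dim (U t)" by (rule fs.basis_exists)
  obtain X where X: "finite X" "Fg t \<subseteq> fs.span X" using Fg_finite_dim by blast
  have SF: "S \<subseteq> Fg t" using S(1) sub_subset[OF U] by (meson subset_iff)
  obtain B where "S \<subseteq> B" "B \<subseteq> Fg t" "fs.independent B" "Fg t \<subseteq> fs.span B" "finite B" "card B = fs.dim (Fg t)"
    by (rule fs.finite_basis_extend[OF SF S(2) X(2,1)])
  note B = this(1,4,5,6)
  have "card S = card B" using c S(4) B(4) unfolding codim_def by simp
  then have "S = B" using B(1,3) card_subset_eq by blast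
  then have "Fg t \<subseteq> U t" using B(2) fs.span_minimal[OF S(1) sub_subspace[OF U]] by blast
  then show ?thesis using sub_subset[OF U] by blast
qed

end

context presentation begin

text \<open>\<open>GREATEST\<close> denotes a maximum here because the set of values is bounded by
  \<open>r\<close> and nonempty: were it empty, the vanishing would hold above -1, against
  \<open>low\<close>.\<close>

lemma reg_vanish_above:
  assumes ex: "vanish_above U r" and low: "\<And>r. vanish_above U r \<Longrightarrow> 0 \<le> r"
  shows "vanish_above U (reg n Q)"
proof -
  define D where "D = {int i + t | i t. \<not> van U i t}"
  have le: "s \<le> r" if "s \<in> D" for s using ex that unfolding vanish_above_def D_def by force
  have "D \<noteq> {}"
  proof
    assume "D = {}"
    then have "vanish_above U (- 1)" unfolding vanish_above_def D_def by blast
    then show False using low by force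
  qed
  then obtain s where s: "s \<in> D" by blast
  define m where "m = Max (D \<inter> {s..r})"
  have m: "m \<in> D \<inter> {s..r}" unfolding m_def using s le by (intro Max_in) auto
  have mle: "s' \<le> m" if "s' \<in> D" for s'
  proof (cases "s \<le> s'")
    case True
    then show ?thesis unfolding m_def using that le by (intro Max_ge) auto
  qed (use m in auto)
  have iff: "(\<exists>i t. q = int i + t \<and> grade (local_cohomology n Q i) t \<noteq> {\<zero>\<^bsub>local_cohomology n Q i\<^esub>}) \<longleftrightarrow> q \<in> D" for q
    unfolding local_cohomology_zero_iff D_def by blast
  have "reg n Q = m" unfolding reg_def iff using m mle by (intro Greatest_equality) auto
  moreover have "vanish_above U m" unfolding vanish_above_def using mle unfolding D_def by force
  ultimately show ?thesis by simp
qed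

text \<open>From degree \<open>T\<close> on everything is killed, so \<open>Q\<close> is already the
  image of the truncated free module, whose dimension is a finite sum over degrees.\<close>

lemma k_dim_presentation:
  assumes deg: "\<And>g. g \<in> G \<Longrightarrow> 0 \<le> deg g" and T: "\<And>t. t \<ge> int T \<Longrightarrow> U t = Fg t"
  shows "int (k_dim Q) = (\<Sum>t<T. codim U (int t))"
proof -
  let ?V = "tot_below Fg T"
  have FFt: "f \<in> tot Fg \<longleftrightarrow> f \<in> FF" for f unfolding tot_def using hc_in by blast
  have VF: "f \<in> FF" if "f \<in> ?V" for f using that FFt unfolding tot_below_def by blast
  obtain X where X: "finite X" "?V \<subseteq> fs.span X" using tot_below_dim[OF deg sub_F] by blast
  have "\<psi> ` FF \<subseteq> \<psi> ` ?V"
  proof (rule image_subsetI)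
    fix f assume f: "f \<in> FF"
    define J where "J = {t. hc t f \<noteq> 0} \<inter> {..<int T}"
    define f1 where "f1 = (\<Sum>t\<in>J. hc t f)"
    have J: "finite J" unfolding J_def using hc_finite[OF f] by blast
    have "hc t f \<in> tot Fg" for t using Fg_subset_FF[OF hc_in[OF f]] FFt by blast
    then have f1t: "f1 \<in> tot Fg" unfolding f1_def by (intro tot_sum[OF sub_F])
    then have f1F: "f1 \<in> FF" using FFt by blast
    have hc1: "hc s f1 = (if s < int T then hc s f else 0)" for s
    proof -
      have "hc s f1 = (\<Sum>t\<in>J. hc s (hc t f))" unfolding f1_def by (rule hc_sum)
      also have "\<dots> = (\<Sum>t\<in>J. if t = s then hc t f else 0)"
        using hc_Fg[OF hc_in[OF f]] by (intro sum.cong refl) auto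
      also have "\<dots> = (if s \<in> J then hc s f else 0)" by (rule sum.delta[OF J])
      finally show ?thesis unfolding J_def by auto
    qed
    have "f1 \<in> ?V" unfolding tot_below_def using f1t hc1 by auto
    moreover have "hc s (f - f1) \<in> U s" for s
    proof (cases "s < int T")
      case True
      then have "hc s (f - f1) = 0" unfolding hc_diff hc1 by simp
      then show ?thesis using sub_zero[OF sub_U] by simp
    next
      case False
      then have "hc s (f - f1) = hc s f" unfolding hc_diff hc1 by simp
      then show ?thesis using T[of s] False hc_in[OF f, of s] by simp
    qed
    then have "f - f1 \<in> tot U" unfolding tot_def using FF_diff[OF f f1F] by blast
    then have "\<psi> f = \<psi> f1" using psi_eq[OF f f1F] by blast
    ultimately show "\<psi> f \<in> \<psi> ` ?V" by blast
  qed
  then have car: "carrier Q = \<psi> ` ?V" unfolding carrier_Q using VF by blast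
  have "k_dim Q = fs.dim ?V - fs.dim {f \<in> ?V. \<psi> f = \<zero>\<^bsub>Q\<^esub>}"
  proof (rule vector_space_k_dim[OF vector_space_fscale tot_below_subspace[OF sub_F] X(2,1) _ _ psi_zero car])
    show "\<psi> (f + g) = \<psi> f \<oplus>\<^bsub>Q\<^esub> \<psi> g" if "f \<in> ?V" "g \<in> ?V" for f g using psi_add VF that by blast
    show "\<psi> (fscale c f) = const_poly c \<odot>\<^bsub>Q\<^esub> \<psi> f" if "f \<in> ?V" for c f
      unfolding fscale_def using psi_smult[OF poly_ring_const VF[OF that]] .
  qed
  also have "{f \<in> ?V. \<psi> f = \<zero>\<^bsub>Q\<^esub>} = tot_below U T"
    using kernel VF tot_mono[of U Fg] sub_subset[OF sub_U] unfolding tot_below_def by blast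
  finally have "k_dim Q = (\<Sum>t<T. fs.dim (Fg (int t))) - (\<Sum>t<T. fs.dim (U (int t)))"
    using tot_below_dim[OF deg sub_F, of T] tot_below_dim[OF deg sub_U, of T] by simp
  moreover have "(\<Sum>t<T. fs.dim (U (int t))) \<le> (\<Sum>t<T. fs.dim (Fg (int t)))"
    using codim_nonneg[OF sub_U] by (intro sum_mono) (simp add: codim_def)
  ultimately show ?thesis by (simp add: codim_def of_nat_diff sum_subtractf)
qed

end

context generated_module begin

text \<open>\<open>LEAST\<close> over the integers yields a minimum only if the degrees with nonzero
  parts are bounded below; the degrees of the generators provide the bound \<open>b\<close>.\<close>

lemma deg_nonneg_if_indeg:
  assumes ind: "indeg M = 0" and z: "\<zero>\<^bsub>M\<^esub> \<notin> G" and g: "g \<in> G"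
  shows "0 \<le> deg g"
proof -
  define D where "D = {t. grade M t \<noteq> {\<zero>\<^bsub>M\<^esub>}}"
  define b where "b = - (\<Sum>g\<in>G. \<bar>deg g\<bar>)"
  have low: "b \<le> t" if t: "t \<in> D" for t
  proof (rule ccontr)
    assume nb: "\<not> b \<le> t"
    have "f = 0" if f: "f \<in> Fg t" for f
    proof
      fix g
      show "f g = 0 g"
      proof (cases "g \<in> G")
        case True
        have "\<bar>deg g\<bar> \<le> (\<Sum>g\<in>G. \<bar>deg g\<bar>)" using True finite_G by (intro member_le_sum) auto
        then have "t - deg g < 0" using nb unfolding b_def by linarith
        moreover have "f g \<in> hz n (t - deg g)" using f True by (auto simp: Fg_def dest: spec[of _ g])
        ultimately show ?thesis by (simp add: hz_def)
      qed (use f in \<open>auto simp: Fg_def dest: spec[of _ g]\<close>)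
    qed
    then have "Fg t = {0}" using F_zero by blast
    then have "grade M t = {\<zero>\<^bsub>M\<^esub>}" unfolding grade_image by (simp add: phi_zero)
    then show False using t unfolding D_def by blast
  qed
  have gD: "deg g \<in> D" unfolding D_def using G_grade[OF g] z g by auto
  define m where "m = Min (D \<inter> {b..deg g})"
  have m: "m \<in> D \<inter> {b..deg g}" unfolding m_def using gD low by (intro Min_in) auto
  have mle: "m \<le> t" if "t \<in> D" for t
  proof (cases "t \<le> deg g")
    case True
    then show ?thesis unfolding m_def using that low by (intro Min_le) auto
  qed (use m in auto)
  have "indeg M = m" unfolding indeg_def using m mle unfolding D_def by (intro Least_equality) auto
  then show ?thesis using m ind by auto
qed

lemma hilbert_function_codim: "int (hilbert_function M t) = codim K t"
proof -
  let ?N = "M\<lparr>carrier := grade M t\<rparr>"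
  obtain X where X: "finite X" "Fg t \<subseteq> fs.span X" using Fg_finite_dim by blast
  have "k_dim ?N = fs.dim (Fg t) - fs.dim {f \<in> Fg t. \<phi> f = \<zero>\<^bsub>?N\<^esub>}"
  proof (rule vector_space_k_dim[OF vector_space_fscale sub_subspace[OF sub_F] X(2,1)])
    show "\<phi> (f + g) = \<phi> f \<oplus>\<^bsub>?N\<^esub> \<phi> g" if "f \<in> Fg t" "g \<in> Fg t" for f g
      using phi_add[OF Fg_subset_FF[OF that(1)] Fg_subset_FF[OF that(2)]] by simp
    show "\<phi> (fscale c f) = const_poly c \<odot>\<^bsub>?N\<^esub> \<phi> f" if "f \<in> Fg t" for c f
      unfolding fscale_def using phi_smult[OF poly_ring_const Fg_subset_FF[OF that]] by simp
    show "\<phi> 0 = \<zero>\<^bsub>?N\<^esub>" using phi_zero by simp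
    show "carrier ?N = \<phi> ` Fg t" using grade_image by simp
  qed
  moreover have "{f \<in> Fg t. \<phi> f = \<zero>\<^bsub>?N\<^esub>} = K t" by (simp add: K_def)
  ultimately have "hilbert_function M t = fs.dim (Fg t) - fs.dim (K t)" unfolding hilbert_function_def by simp
  then show ?thesis using codim_nonneg[OF sub_K, of t] by (simp add: codim_def)
qed

theorem hilbert_coeff_bound:
  assumes deg: "\<And>g. g \<in> G \<Longrightarrow> 0 \<le> deg g"
    and dim: "module_dim (poly_ring n) M = enat d" and d: "d \<ge> 1"
    and l: "\<And>j. j \<in> {1..d} \<Longrightarrow> l j \<in> homog n 1" and fr: "filter_regular n M d l" and i: "i < d"
  shows "\<bar>hilbert_coeff n M i\<bar> \<le>
    int (k_dim (quot_module M (ideal_smult (poly_ring n) (l ` {1..d}) M))) * (reg n (quot_module M (torsion n M)) + 1) ^ i"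
proof -
  have quot: "presentation n G deg (quot_module M (ideal_smult (poly_ring n) (l ` {1..j}) M))
      (\<lambda>f. ideal_smult (poly_ring n) (l ` {1..j}) M +>\<^bsub>M\<^esub> \<phi> f) (Wc l j)" if j: "j \<le> d" for j
  proof -
    have lj: "l i \<in> homog n 1" if "i \<in> {1..j}" for i using l that j by simp
    have KW: "K t \<subseteq> Wc l j t" for t using Wc_mono[of 0 j l t] by simp
    note sub = image_submodule[OF sub_Wc[OF lj] KW ideal_smult_eq[OF lj]]
    show ?thesis by (rule quot_presentation[OF sub_Wc[OF lj] sub])
  qed
  have freg: "\<exists>t0. \<forall>t\<ge>t0. \<forall>f\<in>Fg t. emb (l (Suc j)) * f \<in> Wc l j (t + 1) \<longrightarrow> f \<in> Wc l j t" if j: "j < d" for j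
  proof -
    have jd: "Suc j \<in> {1..d}" using j by simp
    \<comment> \<open>\<open>filter_regular\<close> tests the form with index \<open>Suc j\<close>
      modulo the forms before it, which is the quotient by the first \<open>j\<close> forms.\<close>
    have e: "{1..<Suc j} = {1..j}" by auto
    note fl = bspec[OF fr[unfolded filter_regular_def Let_def] jd, unfolded e]
    show ?thesis by (rule presentation.finite_length_kernel[OF quot[OF less_imp_le[OF j]] l[OF jd] fl])
  qed
  note full = Wc_full[of d l, OF deg l freg dim]
  interpret C: free_chain n G deg ty "Wc l" l d
    using deg sub_K l freg full by unfold_locales auto
  have Usat0: "C.Usat 0 = sat K" by (simp add: C.Usat_def)
  have KU: "K t \<subseteq> sat K t" for t using sat_supset[OF sub_K] by blast
  note tor = image_submodule[OF sub_sat[OF sub_K] KU torsion_eq]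
  interpret T: presentation n G deg ty "quot_module M (torsion n M)" "\<lambda>f. torsion n M +>\<^bsub>M\<^esub> \<phi> f" "sat K"
    by (rule quot_presentation[OF sub_sat[OF sub_K] tor])
  interpret Q: presentation n G deg ty "quot_module M (ideal_smult (poly_ring n) (l ` {1..d}) M)"
      "\<lambda>f. ideal_smult (poly_ring n) (l ` {1..d}) M +>\<^bsub>M\<^esub> \<phi> f" "Wc l d"
    by (rule quot[OF order_refl])
  define B where "B = int (k_dim (quot_module M (ideal_smult (poly_ring n) (l ` {1..d}) M)))"
  obtain t0 where t0: "\<And>t. t \<ge> t0 \<Longrightarrow> Wc l d t = Fg t" using full by blast
  \<comment> \<open>The terms are nonnegative, so a partial sum is at most one that reaches past the
    degree where \<open>Wc l d\<close> is everything; that one is the dimension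
    \<open>B\<close>.\<close>
  have B: "(\<Sum>t<k. codim (Wc l d) (int t)) \<le> B" for k
  proof -
    have "(\<Sum>t<k. codim (Wc l d) (int t)) \<le> (\<Sum>t<max k (nat t0). codim (Wc l d) (int t))"
      using codim_nonneg[OF Q.sub_U] by (intro sum_mono2) auto
    also have "\<dots> = B" unfolding B_def
      using Q.k_dim_presentation[OF deg, of "max k (nat t0)"] t0 by simp
    finally show ?thesis .
  qed
  obtain t1 where t1: "\<And>t. t \<ge> t1 \<Longrightarrow> sat K t = K t" using C.Usat_eventually[of 0] unfolding Usat0 by auto
  have newton: "\<exists>e. (\<forall>k\<le>d. \<forall>t\<ge>max r 0. of_int (codim (C.Usat (d - k)) t) = newton e k (of_int t))"
    if "vanish_above (sat K) r" for r
    using hilbert_data.ex_newton[OF C.hilbert_data[OF _ B] order_refl] that unfolding Usat0 by blast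
  \<comment> \<open>If the cohomology of \<open>F / sat K\<close> vanished above a negative number,
    all coefficients would be zero, the saturation and then \<open>K\<close> would be everything in
    high degrees, and \<open>not_full_K\<close> excludes this.\<close>
  have low: "0 \<le> r" if v: "vanish_above (sat K) r" for r
  proof (rule ccontr)
    assume "\<not> 0 \<le> r"
    then have r: "r < 0" by simp
    obtain e where e: "\<And>k t. k \<le> d \<Longrightarrow> t \<ge> max r 0 \<Longrightarrow> of_int (codim (C.Usat (d - k)) t) = newton e k (of_int t)"
      using newton[OF v] by blast
    have "e j = 0" if "j < d" for j
      using hilbert_data.coefficient_bound(2)[OF C.hilbert_data[OF _ B] e that r] v unfolding Usat0 by blast
    then have "newton e d t = 0" for t unfolding newton_def by simp
    then have "codim (sat K) t = 0" if "t \<ge> 0" for t using e[of d t] that r unfolding Usat0 by (simp add: Usat0)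
    then have "K t = Fg t" if "t \<ge> max t1 0" for t
      using t1[of t] codim_zero_full[OF sub_sat[OF sub_K], of t] that by simp
    then show False using not_full_K[of d l, OF deg l dim d] by blast
  qed
  obtain r0 where "vanish_above (sat K) r0" using C.vanish_above_exists unfolding Usat0 by blast
  from T.reg_vanish_above[OF this low]
  have v: "vanish_above (sat K) (reg n (quot_module M (torsion n M)))" .
  define r where "r = reg n (quot_module M (torsion n M))"
  note v = v[folded r_def]
  obtain e where e: "\<And>k t. k \<le> d \<Longrightarrow> t \<ge> max r 0 \<Longrightarrow> of_int (codim (C.Usat (d - k)) t) = newton e k (of_int t)"
    using newton[OF v] by blast
  have bound: "\<bar>e i\<bar> \<le> B * (r + 1) ^ i"
    using hilbert_data.coefficient_bound(1)[OF C.hilbert_data[OF _ B] e i low[OF v]] v unfolding Usat0 by blast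
  have "of_nat (hilbert_function M t) = newton e d (of_int t)" if "t \<ge> max t1 (max r 0)" for t
  proof -
    have "codim K t = codim (sat K) t" using t1[of t] that by (intro codim_cong) simp
    then have "int (hilbert_function M t) = codim (sat K) t" using hilbert_function_codim[of t] by simp
    moreover have "of_int (codim (sat K) t) = newton e d (of_int t)" using e[of d t] that by (simp add: Usat0)
    ultimately show ?thesis by (metis of_int_of_nat_eq)
  qed
  from hilbert_coeff_newton[of n M d "max t1 (max r 0)" e i, OF dim this i] have "\<bar>hilbert_coeff n M i\<bar> = \<bar>e i\<bar>" by (simp add: abs_mult power_abs)
  then show ?thesis using bound unfolding B_def r_def by simp
qed

end

theorem theorem4p6:
  fixes n d :: nat
    and M :: "('k::field mpoly, 'm) graded_module"
    and l :: "nat \<Rightarrow> 'k mpoly"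
    and B :: nat
    and Mbar :: "('k mpoly, 'm set) graded_module"
  assumes "n \<ge> 2"
    and "graded_module n M"
    and "fin_gen (poly_ring n) M"
    and "module_dim (poly_ring n) M = enat d"
    and "d \<ge> 1"
    and "indeg M = 0"
    and "\<forall>j \<in> {1..d}. l j \<in> homog n 1"
    and "filter_regular n M d l"
    and "B = k_dim (quot_module M (ideal_smult (poly_ring n) (l ` {1..d}) M))"
    and "Mbar = quot_module M (torsion n M)"
  shows "\<forall>i \<in> {0..d - 1}. \<bar>hilbert_coeff n M i\<bar> \<le> int B * (reg n Mbar + 1) ^ i"
proof
  fix i assume "i \<in> {0..d - 1}"
  then have i: "i < d" using assms(5) by auto
  obtain G deg where G: "generated_module n G deg M" "\<zero>\<^bsub>M\<^esub> \<notin> G"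
    using graded_module.exists_homogeneous_generators[OF assms(2,3)] by blast
  interpret generated_module n G deg "TYPE('k)" M by (rule G(1))
  show "\<bar>hilbert_coeff n M i\<bar> \<le> int B * (reg n Mbar + 1) ^ i"
    unfolding assms(9,10)
    using assms(7) by (intro hilbert_coeff_bound deg_nonneg_if_indeg[OF assms(6) G(2)] assms(4,5,8) i) auto
qed

end
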